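(* Let $\mathcal C$ be a tensor category over a field $\Bbbk$, and let $\rho$ be an action of a finite group $G$ on $\mathcal C$ by tensor autoequivalences. Then: (1) The $\Bbbk$-linear exact endofunctor $\mathbb T^\rho=\bigoplus_{g\in G}\rho^g$ admits a canonical structure of Hopf monad on $\mathcal C$. (2) There is a canonical isomorphism of categories $\mathcal C^G\simeq\mathcal C^{\mathbb T^\rho}$ over $\mathcal C$ (that is, compatible with the forgetful functors to $\mathcal C$), where $\mathcal C^G$ denotes the equivariantization of $\mathcal C$ under $G$. (3) The Hopf monad $\mathbb T^\rho$ is faithful, normal, and cocommutative. (4) The induced Hopf algebra of $\mathbb T^\rho$ is $\Bbbk^G$. In particular $\mathbb T^\rho$ is semisimple if and only if $\operatorname{char}(\Bbbk)$ does not divide the order of $G$.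
   Context: A tensor category over $\Bbbk$ is a $\Bbbk$-linear abelian rigid monoidal category with finite-dimensional Hom spaces, all objects of finite length, monoidal product $\Bbbk$-linear in each variable, and $\operatorname{End}(\mathbf 1)=\Bbbk$. A tensor functor is a $\Bbbk$-linear exact strong monoidal functor between tensor categories. An object is trivial if isomorphic to $\mathbf 1^n$ for some $n$. An action of a group $G$ on $\mathcal C$ by tensor autoequivalences is a strong monoidal functor $\rho$ from $\underline G$ (the discrete strict monoidal category with objects the elements of $G$ and tensor product the multiplication of $G$) to the monoidal category of tensor endofunctors of $\mathcal C$ and monoidal natural transformations; it consists of tensor endofunctors $\rho^g$, and monoidal isomorphisms $\rho_2^{g,h}:\rho^g\rho^h\to\rho^{gh}$, $\rho_0:\mathrm{id}_{\mathcal C}\to\rho^1$ satisfying the associativity and unit constraints. The equivariantization $\mathcal C^G$ is the category of pairs $(X,u)$, $u=(u^g:\rho^gX\to X)_{g\in G}$ with $u^g\rho^g(u^h)=u^{gh}(\rho_2^{g,h})_X$ and $u^1(\rho_0)_X=\mathrm{id}_X$; morphisms $(X,u)\to(Y,v)$ are morphisms $f:X\to Y$ with $fu^g=v^g\rho^g(f)$. It is a tensor category. A monad $(T,\mu,\eta)$ on $\mathcal C$ has category of modules $\mathcal C^T$ (pairs $(M,r)$, $r:T(M)\to M$, $rT(r)=r\mu_M$, $r\eta_M=\mathrm{id}$). A bimonad is a monad with a comonoidal structure $T_2(X,Y):T(X\otimes Y)\to T(X)\otimes T(Y)$, $T_0:T(\mathbf 1)\to\mathbf 1$ such that $\mu,\eta$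 are comonoidal; then $\mathcal C^T$ is monoidal with strict monoidal forgetful functor $U$. A bimonad $T$ on a rigid category $\mathcal C$ is a Hopf monad if $\mathcal C^T$ is rigid. The canonical structure on $\mathbb T^\rho$ is given componentwise: multiplication by the $\rho_2^{g,h}$, unit by $\rho_0$, comonoidal structure by the inverses of the monoidal structure isomorphisms of the functors $\rho^g$. A $\Bbbk$-linear right exact Hopf monad $T$ on $\mathcal C$ is normal if $T(\mathbf 1)$ is trivial; faithful if it is faithful as a functor. A normal such $T$ is cocommutative if for every morphism $g:T(\mathbf 1)\to\mathbf 1$ and every object $X$ of $\mathcal C$, $(\mathrm{id}_{T(X)}\otimes g)T_2(X,\mathbf 1)=(g\otimes\mathrm{id}_{T(X)})T_2(\mathbf 1,X)$. The induced Hopf algebra of a normal $T$ is the coend $L(\omega)=\int^{X}\omega(X)\otimes\omega(X)^\vee$ over $X\in\mathfrak{Ker}_U$, where $\mathfrak{Ker}_U\subset\mathcal C^T$ is the full subcategory of objects with trivial image under $U$ and $\omega(X)=\operatorname{Hom}(\mathbf 1,U(X))$; it is a Hopf algebra with $\mathfrak{Ker}_U\simeq\mathrm{comod}\text{-}L(\omega)$ (finite-dimensional right comodules). A monad $T$ is semisimple if every $T$-module is a $T$-linear retract of a free $T$-module $(T(X),\mu_X)$. $\Bbbk^G$ is the Hopf algebra of functions on $G$. *)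

theory Defs
  imports "Jordan_Normal_Form.VS_Connect" "HOL-Algebra.AbelCoset"
begin

hide_const (open) Modules.module_hom

section \<open>Vector spaces over a field\<close>

text \<open>
  The ground field is a type of class \<^class>\<open>field\<close>; vector spaces over it are records
  \<open>V\<close> with \<open>vectorspace class_ring V\<close>. The \<^const>\<open>mult\<close> and \<^const>\<open>one\<close> fields of such a
  record are junk unless it carries an algebra.
\<close>

definition ground_space :: "('k::field, 'k) module" where
  "ground_space = \<lparr>carrier = UNIV, mult = (*), one = 1, zero = 0, add = (+), smult = (*)\<rparr>"

text \<open>Linear maps are made extensional, so that equality of maps is equality in HOL.\<close>

definition lin_maps ::
  "('k::field, 'v, 'm) module_scheme \<Rightarrow> ('k, 'w, 'n) module_scheme \<Rightarrow> ('v \<Rightarrow> 'w) set" where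
  "lin_maps V W = module_hom class_ring V W \<inter> extensional (carrier V)"

definition dual_space :: "('k::field, 'v, 'm) module_scheme \<Rightarrow> ('k, 'v \<Rightarrow> 'k) module" where
  "dual_space V =
    \<lparr>carrier = lin_maps V ground_space, mult = undefined, one = undefined,
     zero = (\<lambda>v\<in>carrier V. 0),
     add = (\<lambda>\<phi> \<psi>. \<lambda>v\<in>carrier V. \<phi> v + \<psi> v),
     smult = (\<lambda>c \<phi>. \<lambda>v\<in>carrier V. c * \<phi> v)\<rparr>"

definition free_space :: "'x set \<Rightarrow> ('k::field, 'x \<Rightarrow> 'k) module" where
  "free_space S =
    \<lparr>carrier = {f. finite {x. f x \<noteq> 0} \<and> {x. f x \<noteq> 0} \<subseteq> S}, mult = undefined, one = undefined,
     zero = (\<lambda>x. 0),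
     add = (\<lambda>f g x. f x + g x),
     smult = (\<lambda>c f x. c * f x)\<rparr>"

definition free_gen :: "'x \<Rightarrow> 'x \<Rightarrow> 'k::field" where
  "free_gen x = (\<lambda>y. if y = x then 1 else 0)"

definition quotient_space ::
  "('k::field, 'v, 'm) module_scheme \<Rightarrow> 'v set \<Rightarrow> ('k, 'v set) module" where
  "quotient_space V N =
    \<lparr>carrier = A_RCOSETS V N, mult = undefined, one = undefined,
     zero = N,
     add = set_add V,
     smult = (\<lambda>c A. \<Union>v\<in>A. a_r_coset V N (c \<odot>\<^bsub>V\<^esub> v))\<rparr>"

definition tensor_relators ::
  "('k::field, 'v, 'm) module_scheme \<Rightarrow> ('k, 'w, 'n) module_scheme \<Rightarrow> ('v \<times> 'w \<Rightarrow> 'k) set" where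
  "tensor_relators V W =
     {(\<lambda>p. free_gen (v \<oplus>\<^bsub>V\<^esub> v', w) p - free_gen (v, w) p - free_gen (v', w) p) | v v' w.
        v \<in> carrier V \<and> v' \<in> carrier V \<and> w \<in> carrier W}
   \<union> {(\<lambda>p. free_gen (v, w \<oplus>\<^bsub>W\<^esub> w') p - free_gen (v, w) p - free_gen (v, w') p) | v w w'.
        v \<in> carrier V \<and> w \<in> carrier W \<and> w' \<in> carrier W}
   \<union> {(\<lambda>p. free_gen (c \<odot>\<^bsub>V\<^esub> v, w) p - c * free_gen (v, w) p) | c v w.
        v \<in> carrier V \<and> w \<in> carrier W}
   \<union> {(\<lambda>p. free_gen (v, c \<odot>\<^bsub>W\<^esub> w) p - c * free_gen (v, w) p) | c v w.
        v \<in> carrier V \<and> w \<in> carrier W}"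

definition tensor_null ::
  "('k::field, 'v, 'm) module_scheme \<Rightarrow> ('k, 'w, 'n) module_scheme \<Rightarrow> ('v \<times> 'w \<Rightarrow> 'k) set" where
  "tensor_null V W =
     LinearCombinations.module.span class_ring (free_space (carrier V \<times> carrier W)) (tensor_relators V W)"

definition tensor_space ::
  "('k::field, 'v, 'm) module_scheme \<Rightarrow> ('k, 'w, 'n) module_scheme \<Rightarrow>
   ('k, ('v \<times> 'w \<Rightarrow> 'k) set) module" where
  "tensor_space V W = quotient_space (free_space (carrier V \<times> carrier W)) (tensor_null V W)"

definition tens ::
  "('k::field, 'v, 'm) module_scheme \<Rightarrow> ('k, 'w, 'n) module_scheme \<Rightarrow>
   'v \<Rightarrow> 'w \<Rightarrow> ('v \<times> 'w \<Rightarrow> 'k) set" where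
  "tens V W v w =
     a_r_coset (free_space (carrier V \<times> carrier W)) (tensor_null V W) (free_gen (v, w))"

text \<open>The linear map on \<open>V \<otimes> W\<close> induced by a bilinear map \<open>B : V \<times> W \<rightarrow> U\<close>.\<close>

definition tensor_lift ::
  "('k::field, 'v, 'm) module_scheme \<Rightarrow> ('k, 'w, 'n) module_scheme \<Rightarrow>
   ('k, 'u, 'r) module_scheme \<Rightarrow> ('v \<Rightarrow> 'w \<Rightarrow> 'u) \<Rightarrow> ('v \<times> 'w \<Rightarrow> 'k) set \<Rightarrow> 'u" where
  "tensor_lift V W U B =
     (THE f. f \<in> lin_maps (tensor_space V W) U \<and>
        (\<forall>v\<in>carrier V. \<forall>w\<in>carrier W. f (tens V W v w) = B v w))"


section \<open>Hopf algebras\<close>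

record ('k, 'l) hopf = "('k, 'l) module" +
  comult :: "'l \<Rightarrow> ('l \<times> 'l \<Rightarrow> 'k) set"
  counit :: "'l \<Rightarrow> 'k"
  antipode :: "'l \<Rightarrow> 'l"

definition tensor_mult ::
  "('k::field, 'l, 'm) module_scheme \<Rightarrow> ('l \<times> 'l \<Rightarrow> 'k) set \<Rightarrow> ('l \<times> 'l \<Rightarrow> 'k) set \<Rightarrow>
   ('l \<times> 'l \<Rightarrow> 'k) set" where
  "tensor_mult L s t =
     tensor_lift L L (tensor_space L L)
       (\<lambda>a b. tensor_lift L L (tensor_space L L)
          (\<lambda>c d. tens L L (a \<otimes>\<^bsub>L\<^esub> c) (b \<otimes>\<^bsub>L\<^esub> d)) t) s"

locale hopf_algebra = vectorspace class_ring L + ring L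
  for L :: "('k::field, 'l, 'm) hopf_scheme" (structure) +
  assumes smult_mult_left:
      "\<lbrakk>a \<in> carrier L; b \<in> carrier L\<rbrakk> \<Longrightarrow> (c \<odot> a) \<otimes> b = c \<odot> (a \<otimes> b)"
    and smult_mult_right:
      "\<lbrakk>a \<in> carrier L; b \<in> carrier L\<rbrakk> \<Longrightarrow> a \<otimes> (c \<odot> b) = c \<odot> (a \<otimes> b)"
    and comult_linear: "comult L \<in> module_hom class_ring L (tensor_space L L)"
    and counit_linear: "counit L \<in> module_hom class_ring L ground_space"
    and antipode_linear: "antipode L \<in> module_hom class_ring L L"
    and comult_coassoc: "a \<in> carrier L \<Longrightarrow>
      tensor_lift (tensor_space L L) L (tensor_space L (tensor_space L L))
        (\<lambda>s z. tensor_lift L L (tensor_space L (tensor_space L L))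
           (\<lambda>x y. tens L (tensor_space L L) x (tens L L y z)) s)
        (tensor_lift L L (tensor_space (tensor_space L L) L)
           (\<lambda>x y. tens (tensor_space L L) L (comult L x) y) (comult L a))
      = tensor_lift L L (tensor_space L (tensor_space L L))
          (\<lambda>x y. tens L (tensor_space L L) x (comult L y)) (comult L a)"
    and counit_left: "a \<in> carrier L \<Longrightarrow>
      tensor_lift L L L (\<lambda>x y. counit L x \<odot> y) (comult L a) = a"
    and counit_right: "a \<in> carrier L \<Longrightarrow>
      tensor_lift L L L (\<lambda>x y. counit L y \<odot> x) (comult L a) = a"
    and comult_mult: "\<lbrakk>a \<in> carrier L; b \<in> carrier L\<rbrakk> \<Longrightarrow>
      comult L (a \<otimes> b) = tensor_mult L (comult L a) (comult L b)"
    and comult_one: "comult L \<one> = tens L L \<one> \<one>"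
    and counit_mult: "\<lbrakk>a \<in> carrier L; b \<in> carrier L\<rbrakk> \<Longrightarrow>
      counit L (a \<otimes> b) = counit L a * counit L b"
    and counit_one: "counit L \<one> = 1"
    and antipode_left: "a \<in> carrier L \<Longrightarrow>
      tensor_lift L L L (\<lambda>x y. antipode L x \<otimes> y) (comult L a) = counit L a \<odot> \<one>"
    and antipode_right: "a \<in> carrier L \<Longrightarrow>
      tensor_lift L L L (\<lambda>x y. x \<otimes> antipode L y) (comult L a) = counit L a \<odot> \<one>"

definition function_algebra :: "('g, 'm) monoid_scheme \<Rightarrow> ('k::field, 'g \<Rightarrow> 'k) module" where
  "function_algebra G =
    \<lparr>carrier = carrier G \<rightarrow>\<^sub>E UNIV,
     mult = (\<lambda>f f'. \<lambda>x\<in>carrier G. f x * f' x),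
     one = (\<lambda>x\<in>carrier G. 1),
     zero = (\<lambda>x\<in>carrier G. 0),
     add = (\<lambda>f f'. \<lambda>x\<in>carrier G. f x + f' x),
     smult = (\<lambda>c f. \<lambda>x\<in>carrier G. c * f x)\<rparr>"

definition point_mass :: "('g, 'm) monoid_scheme \<Rightarrow> 'g \<Rightarrow> 'g \<Rightarrow> 'k::field" where
  "point_mass G g = (\<lambda>x\<in>carrier G. if x = g then 1 else 0)"

text \<open>
  The Hopf algebra of functions on a finite group. Under the identification of
  \<open>\<bbbk>\<^sup>G \<otimes> \<bbbk>\<^sup>G\<close> with the functions on \<open>G \<times> G\<close>, its comultiplication is \<open>f \<mapsto> ((g, h) \<mapsto> f (g h))\<close>.
\<close>

definition function_hopf :: "('g, 'm) monoid_scheme \<Rightarrow> ('k::field, 'g \<Rightarrow> 'k) hopf" where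
  "function_hopf G =
     module.extend (function_algebra G)
       (hopf.fields
         (\<lambda>f. finsum (tensor_space (function_algebra G) (function_algebra G))
            (\<lambda>(g, h). f (g \<otimes>\<^bsub>G\<^esub> h) \<odot>\<^bsub>tensor_space (function_algebra G) (function_algebra G)\<^esub>
               tens (function_algebra G) (function_algebra G) (point_mass G g) (point_mass G h))
            (carrier G \<times> carrier G))
         (\<lambda>f. f \<one>\<^bsub>G\<^esub>)
         (\<lambda>f. \<lambda>g\<in>carrier G. f (inv\<^bsub>G\<^esub> g)))"


section \<open>Linear and monoidal categories\<close>

text \<open>
  A (small) linear category is given by a set of objects and a family of vector spaces
  \<open>HomSp C X Y\<close>. Hom-spaces of different pairs of objects need not be disjoint: this allows the
  morphisms of a category of modules to be literally those of the underlying category.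
\<close>

record ('k, 'o, 'a) lincat =
  Obj :: "'o set"
  HomSp :: "'o \<Rightarrow> 'o \<Rightarrow> ('k, 'a) module"
  Cmp :: "'a \<Rightarrow> 'a \<Rightarrow> 'a" (infixl "\<cdot>\<index>" 70)
  Idn :: "'o \<Rightarrow> 'a"

record ('k, 'o, 'a) moncat = "('k, 'o, 'a) lincat" +
  TensO :: "'o \<Rightarrow> 'o \<Rightarrow> 'o" (infixr "\<boxtimes>\<index>" 75)
  TensM :: "'a \<Rightarrow> 'a \<Rightarrow> 'a" (infixr "\<star>\<index>" 75)
  Unit :: "'o"
  Assoc :: "'o \<Rightarrow> 'o \<Rightarrow> 'o \<Rightarrow> 'a"
  LUnit :: "'o \<Rightarrow> 'a"
  RUnit :: "'o \<Rightarrow> 'a"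

abbreviation Hom :: "('k, 'o, 'a, 'm) lincat_scheme \<Rightarrow> 'o \<Rightarrow> 'o \<Rightarrow> 'a set" where
  "Hom C X Y \<equiv> carrier (HomSp C X Y)"

locale category =
  fixes C :: "('k, 'o, 'a, 'm) lincat_scheme" (structure)
  assumes Idn_in_Hom: "X \<in> Obj C \<Longrightarrow> Idn C X \<in> Hom C X X"
    and Cmp_in_Hom: "\<lbrakk>X \<in> Obj C; Y \<in> Obj C; Z \<in> Obj C; f \<in> Hom C X Y; g \<in> Hom C Y Z\<rbrakk> \<Longrightarrow>
      g \<cdot> f \<in> Hom C X Z"
    and Cmp_assoc: "\<lbrakk>W \<in> Obj C; X \<in> Obj C; Y \<in> Obj C; Z \<in> Obj C;
      f \<in> Hom C W X; g \<in> Hom C X Y; h \<in> Hom C Y Z\<rbrakk> \<Longrightarrow> (h \<cdot> g) \<cdot> f = h \<cdot> (g \<cdot> f)"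
    and Idn_left: "\<lbrakk>X \<in> Obj C; Y \<in> Obj C; f \<in> Hom C X Y\<rbrakk> \<Longrightarrow> Idn C Y \<cdot> f = f"
    and Idn_right: "\<lbrakk>X \<in> Obj C; Y \<in> Obj C; f \<in> Hom C X Y\<rbrakk> \<Longrightarrow> f \<cdot> Idn C X = f"

locale linear_category = category C
  for C :: "('k::field, 'o, 'a, 'm) lincat_scheme" (structure) +
  assumes HomSp_vectorspace:
      "\<lbrakk>X \<in> Obj C; Y \<in> Obj C\<rbrakk> \<Longrightarrow> vectorspace class_ring (HomSp C X Y)"
    and Cmp_linear_left: "\<lbrakk>X \<in> Obj C; Y \<in> Obj C; Z \<in> Obj C; f \<in> Hom C X Y\<rbrakk> \<Longrightarrow>
      (\<lambda>g. g \<cdot> f) \<in> module_hom class_ring (HomSp C Y Z) (HomSp C X Z)"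
    and Cmp_linear_right: "\<lbrakk>X \<in> Obj C; Y \<in> Obj C; Z \<in> Obj C; g \<in> Hom C Y Z\<rbrakk> \<Longrightarrow>
      (\<lambda>f. g \<cdot> f) \<in> module_hom class_ring (HomSp C X Y) (HomSp C X Z)"

definition inverse_arrows ::
  "('k, 'o, 'a, 'm) lincat_scheme \<Rightarrow> 'o \<Rightarrow> 'o \<Rightarrow> 'a \<Rightarrow> 'a \<Rightarrow> bool" where
  "inverse_arrows C X Y f g \<longleftrightarrow> f \<in> Hom C X Y \<and> g \<in> Hom C Y X \<and>
     g \<cdot>\<^bsub>C\<^esub> f = Idn C X \<and> f \<cdot>\<^bsub>C\<^esub> g = Idn C Y"

definition is_iso :: "('k, 'o, 'a, 'm) lincat_scheme \<Rightarrow> 'o \<Rightarrow> 'o \<Rightarrow> 'a \<Rightarrow> bool" where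
  "is_iso C X Y f \<longleftrightarrow> (\<exists>g. inverse_arrows C X Y f g)"

definition inv_arr :: "('k, 'o, 'a, 'm) lincat_scheme \<Rightarrow> 'o \<Rightarrow> 'o \<Rightarrow> 'a \<Rightarrow> 'a" where
  "inv_arr C X Y f = (THE g. inverse_arrows C X Y f g)"

definition isomorphic :: "('k, 'o, 'a, 'm) lincat_scheme \<Rightarrow> 'o \<Rightarrow> 'o \<Rightarrow> bool" where
  "isomorphic C X Y \<longleftrightarrow> (\<exists>f. is_iso C X Y f)"

definition biproduct ::
  "('k, 'o, 'a, 'm) lincat_scheme \<Rightarrow> 'i set \<Rightarrow> ('i \<Rightarrow> 'o) \<Rightarrow> 'o \<Rightarrow> ('i \<Rightarrow> 'a) \<Rightarrow> ('i \<Rightarrow> 'a) \<Rightarrow> bool"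
  where
  "biproduct C I F S \<iota> \<pi> \<longleftrightarrow> finite I \<and> S \<in> Obj C \<and>
     (\<forall>i\<in>I. F i \<in> Obj C \<and> \<iota> i \<in> Hom C (F i) S \<and> \<pi> i \<in> Hom C S (F i)) \<and>
     (\<forall>i\<in>I. \<forall>j\<in>I. \<pi> j \<cdot>\<^bsub>C\<^esub> \<iota> i = (if i = j then Idn C (F i) else \<zero>\<^bsub>HomSp C (F i) (F j)\<^esub>)) \<and>
     finsum (HomSp C S S) (\<lambda>i. \<iota> i \<cdot>\<^bsub>C\<^esub> \<pi> i) I = Idn C S"

definition zero_object :: "('k, 'o, 'a, 'm) lincat_scheme \<Rightarrow> 'o \<Rightarrow> bool" where
  "zero_object C Z \<longleftrightarrow> Z \<in> Obj C \<and>
     (\<forall>X\<in>Obj C. (\<exists>!f. f \<in> Hom C X Z) \<and> (\<exists>!f. f \<in> Hom C Z X))"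

definition monic :: "('k, 'o, 'a, 'm) lincat_scheme \<Rightarrow> 'o \<Rightarrow> 'o \<Rightarrow> 'a \<Rightarrow> bool" where
  "monic C X Y f \<longleftrightarrow> f \<in> Hom C X Y \<and>
     (\<forall>W\<in>Obj C. \<forall>u\<in>Hom C W X. \<forall>v\<in>Hom C W X. f \<cdot>\<^bsub>C\<^esub> u = f \<cdot>\<^bsub>C\<^esub> v \<longrightarrow> u = v)"

definition epic :: "('k, 'o, 'a, 'm) lincat_scheme \<Rightarrow> 'o \<Rightarrow> 'o \<Rightarrow> 'a \<Rightarrow> bool" where
  "epic C X Y f \<longleftrightarrow> f \<in> Hom C X Y \<and>
     (\<forall>Z\<in>Obj C. \<forall>u\<in>Hom C Y Z. \<forall>v\<in>Hom C Y Z. u \<cdot>\<^bsub>C\<^esub> f = v \<cdot>\<^bsub>C\<^esub> f \<longrightarrow> u = v)"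

text \<open>\<open>k : K \<rightarrow> X\<close> is a kernel, respectively \<open>q : Y \<rightarrow> Q\<close> a cokernel, of \<open>f : X \<rightarrow> Y\<close>.\<close>

definition is_kernel ::
  "('k, 'o, 'a, 'm) lincat_scheme \<Rightarrow> 'o \<Rightarrow> 'o \<Rightarrow> 'a \<Rightarrow> 'o \<Rightarrow> 'a \<Rightarrow> bool" where
  "is_kernel C X Y f K k \<longleftrightarrow>
     X \<in> Obj C \<and> Y \<in> Obj C \<and> K \<in> Obj C \<and> f \<in> Hom C X Y \<and> k \<in> Hom C K X \<and>
     f \<cdot>\<^bsub>C\<^esub> k = \<zero>\<^bsub>HomSp C K Y\<^esub> \<and>
     (\<forall>W\<in>Obj C. \<forall>w\<in>Hom C W X. f \<cdot>\<^bsub>C\<^esub> w = \<zero>\<^bsub>HomSp C W Y\<^esub> \<longrightarrow>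
        (\<exists>!v. v \<in> Hom C W K \<and> k \<cdot>\<^bsub>C\<^esub> v = w))"

definition is_cokernel ::
  "('k, 'o, 'a, 'm) lincat_scheme \<Rightarrow> 'o \<Rightarrow> 'o \<Rightarrow> 'a \<Rightarrow> 'o \<Rightarrow> 'a \<Rightarrow> bool" where
  "is_cokernel C X Y f Q q \<longleftrightarrow>
     X \<in> Obj C \<and> Y \<in> Obj C \<and> Q \<in> Obj C \<and> f \<in> Hom C X Y \<and> q \<in> Hom C Y Q \<and>
     q \<cdot>\<^bsub>C\<^esub> f = \<zero>\<^bsub>HomSp C X Q\<^esub> \<and>
     (\<forall>W\<in>Obj C. \<forall>w\<in>Hom C Y W. w \<cdot>\<^bsub>C\<^esub> f = \<zero>\<^bsub>HomSp C X W\<^esub> \<longrightarrow>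
        (\<exists>!v. v \<in> Hom C Q W \<and> v \<cdot>\<^bsub>C\<^esub> q = w))"

locale linear_abelian_category = linear_category C
  for C :: "('k::field, 'o, 'a, 'm) lincat_scheme" (structure) +
  assumes ex_biproduct: "(\<And>i. i < n \<Longrightarrow> F i \<in> Obj C) \<Longrightarrow> \<exists>S \<iota> \<pi>. biproduct C {..<n::nat} F S \<iota> \<pi>"
    and ex_kernel: "\<lbrakk>X \<in> Obj C; Y \<in> Obj C; f \<in> Hom C X Y\<rbrakk> \<Longrightarrow> \<exists>K k. is_kernel C X Y f K k"
    and ex_cokernel: "\<lbrakk>X \<in> Obj C; Y \<in> Obj C; f \<in> Hom C X Y\<rbrakk> \<Longrightarrow> \<exists>Q q. is_cokernel C X Y f Q q"
    and monic_is_kernel: "\<lbrakk>X \<in> Obj C; Y \<in> Obj C; monic C X Y f\<rbrakk> \<Longrightarrow>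
      \<exists>Z g. is_kernel C Y Z g X f"
    and epic_is_cokernel: "\<lbrakk>X \<in> Obj C; Y \<in> Obj C; epic C X Y f\<rbrakk> \<Longrightarrow>
      \<exists>W g. is_cokernel C W X g Y f"

definition simple_object :: "('k, 'o, 'a, 'm) lincat_scheme \<Rightarrow> 'o \<Rightarrow> bool" where
  "simple_object C S \<longleftrightarrow> S \<in> Obj C \<and> \<not> zero_object C S \<and>
     (\<forall>X\<in>Obj C. \<forall>f. monic C X S f \<longrightarrow> zero_object C X \<or> is_iso C X S f)"

text \<open>Existence of a finite composition series, built up along short exact sequences
  \<open>0 \<rightarrow> X' \<rightarrow> X \<rightarrow> S \<rightarrow> 0\<close> with \<open>S\<close> simple.\<close>

inductive finite_length :: "('k, 'o, 'a, 'm) lincat_scheme \<Rightarrow> 'o \<Rightarrow> bool"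
  for C :: "('k, 'o, 'a, 'm) lincat_scheme" where
  "zero_object C X \<Longrightarrow> finite_length C X"
| "\<lbrakk>finite_length C X'; is_kernel C X S p X' i; is_cokernel C X' X i S p; simple_object C S\<rbrakk> \<Longrightarrow>
     finite_length C X"

locale monoidal_category = category C
  for C :: "('k, 'o, 'a, 'm) moncat_scheme" (structure) +
  assumes Unit_Obj: "Unit C \<in> Obj C"
    and TensO_Obj: "\<lbrakk>X \<in> Obj C; Y \<in> Obj C\<rbrakk> \<Longrightarrow> X \<boxtimes> Y \<in> Obj C"
    and TensM_in_Hom: "\<lbrakk>X \<in> Obj C; X' \<in> Obj C; Y \<in> Obj C; Y' \<in> Obj C;
      f \<in> Hom C X X'; g \<in> Hom C Y Y'\<rbrakk> \<Longrightarrow> f \<star> g \<in> Hom C (X \<boxtimes> Y) (X' \<boxtimes> Y')"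
    and TensM_Idn: "\<lbrakk>X \<in> Obj C; Y \<in> Obj C\<rbrakk> \<Longrightarrow> Idn C X \<star> Idn C Y = Idn C (X \<boxtimes> Y)"
    and TensM_Cmp: "\<lbrakk>X \<in> Obj C; X' \<in> Obj C; X'' \<in> Obj C; Y \<in> Obj C; Y' \<in> Obj C; Y'' \<in> Obj C;
      f \<in> Hom C X X'; f' \<in> Hom C X' X''; g \<in> Hom C Y Y'; g' \<in> Hom C Y' Y''\<rbrakk> \<Longrightarrow>
      (f' \<cdot> f) \<star> (g' \<cdot> g) = (f' \<star> g') \<cdot> (f \<star> g)"
    and Assoc_iso: "\<lbrakk>X \<in> Obj C; Y \<in> Obj C; Z \<in> Obj C\<rbrakk> \<Longrightarrow>
      is_iso C ((X \<boxtimes> Y) \<boxtimes> Z) (X \<boxtimes> (Y \<boxtimes> Z)) (Assoc C X Y Z)"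
    and Assoc_natural: "\<lbrakk>X \<in> Obj C; X' \<in> Obj C; Y \<in> Obj C; Y' \<in> Obj C; Z \<in> Obj C; Z' \<in> Obj C;
      f \<in> Hom C X X'; g \<in> Hom C Y Y'; h \<in> Hom C Z Z'\<rbrakk> \<Longrightarrow>
      Assoc C X' Y' Z' \<cdot> ((f \<star> g) \<star> h) = (f \<star> (g \<star> h)) \<cdot> Assoc C X Y Z"
    and LUnit_iso: "X \<in> Obj C \<Longrightarrow> is_iso C (Unit C \<boxtimes> X) X (LUnit C X)"
    and LUnit_natural: "\<lbrakk>X \<in> Obj C; Y \<in> Obj C; f \<in> Hom C X Y\<rbrakk> \<Longrightarrow>
      LUnit C Y \<cdot> (Idn C (Unit C) \<star> f) = f \<cdot> LUnit C X"
    and RUnit_iso: "X \<in> Obj C \<Longrightarrow> is_iso C (X \<boxtimes> Unit C) X (RUnit C X)"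
    and RUnit_natural: "\<lbrakk>X \<in> Obj C; Y \<in> Obj C; f \<in> Hom C X Y\<rbrakk> \<Longrightarrow>
      RUnit C Y \<cdot> (f \<star> Idn C (Unit C)) = f \<cdot> RUnit C X"
    and pentagon: "\<lbrakk>W \<in> Obj C; X \<in> Obj C; Y \<in> Obj C; Z \<in> Obj C\<rbrakk> \<Longrightarrow>
      Assoc C W X (Y \<boxtimes> Z) \<cdot> Assoc C (W \<boxtimes> X) Y Z =
      (Idn C W \<star> Assoc C X Y Z) \<cdot> Assoc C W (X \<boxtimes> Y) Z \<cdot> (Assoc C W X Y \<star> Idn C Z)"
    and triangle: "\<lbrakk>X \<in> Obj C; Y \<in> Obj C\<rbrakk> \<Longrightarrow>
      (Idn C X \<star> LUnit C Y) \<cdot> Assoc C X (Unit C) Y = RUnit C X \<star> Idn C Y"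

text \<open>\<open>Y\<close> is a left dual of \<open>X\<close>, and \<open>X\<close> a right dual of \<open>Y\<close>, with evaluation
  \<open>e : Y \<otimes> X \<rightarrow> 1\<close> and coevaluation \<open>c : 1 \<rightarrow> X \<otimes> Y\<close>.\<close>

definition dual_pair ::
  "('k, 'o, 'a, 'm) moncat_scheme \<Rightarrow> 'o \<Rightarrow> 'o \<Rightarrow> 'a \<Rightarrow> 'a \<Rightarrow> bool" where
  "dual_pair C Y X e c \<longleftrightarrow> X \<in> Obj C \<and> Y \<in> Obj C \<and>
     e \<in> Hom C (Y \<boxtimes>\<^bsub>C\<^esub> X) (Unit C) \<and> c \<in> Hom C (Unit C) (X \<boxtimes>\<^bsub>C\<^esub> Y) \<and>
     RUnit C X \<cdot>\<^bsub>C\<^esub> (Idn C X \<star>\<^bsub>C\<^esub> e) \<cdot>\<^bsub>C\<^esub> Assoc C X Y X \<cdot>\<^bsub>C\<^esub> (c \<star>\<^bsub>C\<^esub> Idn C X) = LUnit C X \<and>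
     LUnit C Y \<cdot>\<^bsub>C\<^esub> (e \<star>\<^bsub>C\<^esub> Idn C Y) \<cdot>\<^bsub>C\<^esub>
       inv_arr C ((Y \<boxtimes>\<^bsub>C\<^esub> X) \<boxtimes>\<^bsub>C\<^esub> Y) (Y \<boxtimes>\<^bsub>C\<^esub> (X \<boxtimes>\<^bsub>C\<^esub> Y)) (Assoc C Y X Y) \<cdot>\<^bsub>C\<^esub>
       (Idn C Y \<star>\<^bsub>C\<^esub> c) = RUnit C Y"

definition rigid :: "('k, 'o, 'a, 'm) moncat_scheme \<Rightarrow> bool" where
  "rigid C \<longleftrightarrow> (\<forall>X\<in>Obj C. (\<exists>Y e c. dual_pair C Y X e c) \<and> (\<exists>Y e c. dual_pair C X Y e c))"

locale tensor_category = linear_abelian_category C + monoidal_category C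
  for C :: "('k::field, 'o, 'a, 'm) moncat_scheme" (structure) +
  assumes rigid: "rigid C"
    and HomSp_fin_dim: "\<lbrakk>X \<in> Obj C; Y \<in> Obj C\<rbrakk> \<Longrightarrow> vectorspace.fin_dim class_ring (HomSp C X Y)"
    and Obj_finite_length: "X \<in> Obj C \<Longrightarrow> finite_length C X"
    and TensM_linear_left: "\<lbrakk>X \<in> Obj C; X' \<in> Obj C; Y \<in> Obj C; Y' \<in> Obj C; g \<in> Hom C Y Y'\<rbrakk> \<Longrightarrow>
      (\<lambda>f. f \<star> g) \<in> module_hom class_ring (HomSp C X X') (HomSp C (X \<boxtimes> Y) (X' \<boxtimes> Y'))"
    and TensM_linear_right: "\<lbrakk>X \<in> Obj C; X' \<in> Obj C; Y \<in> Obj C; Y' \<in> Obj C; f \<in> Hom C X X'\<rbrakk> \<Longrightarrow>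
      (\<lambda>g. f \<star> g) \<in> module_hom class_ring (HomSp C Y Y') (HomSp C (X \<boxtimes> Y) (X' \<boxtimes> Y'))"
    and End_Unit: "bij_betw (\<lambda>c. c \<odot>\<^bsub>HomSp C (Unit C) (Unit C)\<^esub> Idn C (Unit C)) UNIV
      (Hom C (Unit C) (Unit C))"

definition trivial_object :: "('k, 'o, 'a, 'm) moncat_scheme \<Rightarrow> 'o \<Rightarrow> bool" where
  "trivial_object C X \<longleftrightarrow> X \<in> Obj C \<and>
     (\<exists>(n::nat) S \<iota> \<pi>. biproduct C {..<n} (\<lambda>_. Unit C) S \<iota> \<pi> \<and> isomorphic C X S)"


section \<open>Functors\<close>

text \<open>\<open>FM F X Y\<close> is the action of \<open>F\<close> on morphisms from \<open>X\<close> to \<open>Y\<close>.\<close>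

record ('o, 'a, 'p, 'b) func =
  FO :: "'o \<Rightarrow> 'p"
  FM :: "'o \<Rightarrow> 'o \<Rightarrow> 'a \<Rightarrow> 'b"

record ('o, 'a, 'p, 'b) monfunc = "('o, 'a, 'p, 'b) func" +
  F2 :: "'o \<Rightarrow> 'o \<Rightarrow> 'b"
  F0 :: "'b"

definition func_comp ::
  "('p, 'b, 'q, 'c, 'm) func_scheme \<Rightarrow> ('o, 'a, 'p, 'b, 'n) func_scheme \<Rightarrow> ('o, 'a, 'q, 'c) func"
  where
  "func_comp G F = \<lparr>FO = FO G \<circ> FO F, FM = (\<lambda>X Y f. FM G (FO F X) (FO F Y) (FM F X Y f))\<rparr>"

definition is_functor ::
  "('k, 'o, 'a, 'm) lincat_scheme \<Rightarrow> ('l, 'p, 'b, 'n) lincat_scheme \<Rightarrow>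
   ('o, 'a, 'p, 'b, 'r) func_scheme \<Rightarrow> bool" where
  "is_functor A B F \<longleftrightarrow>
     (\<forall>X\<in>Obj A. FO F X \<in> Obj B \<and> FM F X X (Idn A X) = Idn B (FO F X)) \<and>
     (\<forall>X\<in>Obj A. \<forall>Y\<in>Obj A. \<forall>f\<in>Hom A X Y. FM F X Y f \<in> Hom B (FO F X) (FO F Y)) \<and>
     (\<forall>X\<in>Obj A. \<forall>Y\<in>Obj A. \<forall>Z\<in>Obj A. \<forall>f\<in>Hom A X Y. \<forall>g\<in>Hom A Y Z.
        FM F X Z (g \<cdot>\<^bsub>A\<^esub> f) = FM F Y Z g \<cdot>\<^bsub>B\<^esub> FM F X Y f)"

definition linear_functor ::
  "('k::field, 'o, 'a, 'm) lincat_scheme \<Rightarrow> ('k, 'p, 'b, 'n) lincat_scheme \<Rightarrow>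
   ('o, 'a, 'p, 'b, 'r) func_scheme \<Rightarrow> bool" where
  "linear_functor A B F \<longleftrightarrow> is_functor A B F \<and>
     (\<forall>X\<in>Obj A. \<forall>Y\<in>Obj A.
        FM F X Y \<in> module_hom class_ring (HomSp A X Y) (HomSp B (FO F X) (FO F Y)))"

definition faithful_functor ::
  "('k, 'o, 'a, 'm) lincat_scheme \<Rightarrow> ('o, 'a, 'p, 'b, 'r) func_scheme \<Rightarrow> bool" where
  "faithful_functor A F \<longleftrightarrow> (\<forall>X\<in>Obj A. \<forall>Y\<in>Obj A. inj_on (FM F X Y) (Hom A X Y))"

definition left_exact_functor ::
  "('k, 'o, 'a, 'm) lincat_scheme \<Rightarrow> ('k, 'p, 'b, 'n) lincat_scheme \<Rightarrow>
   ('o, 'a, 'p, 'b, 'r) func_scheme \<Rightarrow> bool" where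
  "left_exact_functor A B F \<longleftrightarrow> (\<forall>X Y f K k. is_kernel A X Y f K k \<longrightarrow>
     is_kernel B (FO F X) (FO F Y) (FM F X Y f) (FO F K) (FM F K X k))"

definition right_exact_functor ::
  "('k, 'o, 'a, 'm) lincat_scheme \<Rightarrow> ('k, 'p, 'b, 'n) lincat_scheme \<Rightarrow>
   ('o, 'a, 'p, 'b, 'r) func_scheme \<Rightarrow> bool" where
  "right_exact_functor A B F \<longleftrightarrow> (\<forall>X Y f Q q. is_cokernel A X Y f Q q \<longrightarrow>
     is_cokernel B (FO F X) (FO F Y) (FM F X Y f) (FO F Q) (FM F Y Q q))"

definition exact_functor ::
  "('k, 'o, 'a, 'm) lincat_scheme \<Rightarrow> ('k, 'p, 'b, 'n) lincat_scheme \<Rightarrow>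
   ('o, 'a, 'p, 'b, 'r) func_scheme \<Rightarrow> bool" where
  "exact_functor A B F \<longleftrightarrow> left_exact_functor A B F \<and> right_exact_functor A B F"

definition category_isomorphism ::
  "('k, 'o, 'a, 'm) lincat_scheme \<Rightarrow> ('l, 'p, 'b, 'n) lincat_scheme \<Rightarrow>
   ('o, 'a, 'p, 'b, 'r) func_scheme \<Rightarrow> bool" where
  "category_isomorphism A B F \<longleftrightarrow> is_functor A B F \<and>
     (\<exists>H :: ('p, 'b, 'o, 'a) func. is_functor B A H \<and>
        (\<forall>X\<in>Obj A. FO H (FO F X) = X) \<and> (\<forall>Y\<in>Obj B. FO F (FO H Y) = Y) \<and>
        (\<forall>X\<in>Obj A. \<forall>Y\<in>Obj A. \<forall>f\<in>Hom A X Y. FM H (FO F X) (FO F Y) (FM F X Y f) = f) \<and>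
        (\<forall>X\<in>Obj B. \<forall>Y\<in>Obj B. \<forall>f\<in>Hom B X Y. FM F (FO H X) (FO H Y) (FM H X Y f) = f))"

definition strong_monoidal_functor ::
  "('k, 'o, 'a, 'm) moncat_scheme \<Rightarrow> ('l, 'p, 'b, 'n) moncat_scheme \<Rightarrow>
   ('o, 'a, 'p, 'b, 'r) monfunc_scheme \<Rightarrow> bool" where
  "strong_monoidal_functor A B F \<longleftrightarrow> is_functor A B F \<and>
     (\<forall>X\<in>Obj A. \<forall>Y\<in>Obj A.
        is_iso B (FO F X \<boxtimes>\<^bsub>B\<^esub> FO F Y) (FO F (X \<boxtimes>\<^bsub>A\<^esub> Y)) (F2 F X Y)) \<and>
     is_iso B (Unit B) (FO F (Unit A)) (F0 F) \<and>
     (\<forall>X\<in>Obj A. \<forall>X'\<in>Obj A. \<forall>Y\<in>Obj A. \<forall>Y'\<in>Obj A. \<forall>f\<in>Hom A X X'. \<forall>g\<in>Hom A Y Y'.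
        F2 F X' Y' \<cdot>\<^bsub>B\<^esub> (FM F X X' f \<star>\<^bsub>B\<^esub> FM F Y Y' g) =
        FM F (X \<boxtimes>\<^bsub>A\<^esub> Y) (X' \<boxtimes>\<^bsub>A\<^esub> Y') (f \<star>\<^bsub>A\<^esub> g) \<cdot>\<^bsub>B\<^esub> F2 F X Y) \<and>
     (\<forall>X\<in>Obj A. \<forall>Y\<in>Obj A. \<forall>Z\<in>Obj A.
        FM F ((X \<boxtimes>\<^bsub>A\<^esub> Y) \<boxtimes>\<^bsub>A\<^esub> Z) (X \<boxtimes>\<^bsub>A\<^esub> (Y \<boxtimes>\<^bsub>A\<^esub> Z)) (Assoc A X Y Z) \<cdot>\<^bsub>B\<^esub>
          F2 F (X \<boxtimes>\<^bsub>A\<^esub> Y) Z \<cdot>\<^bsub>B\<^esub> (F2 F X Y \<star>\<^bsub>B\<^esub> Idn B (FO F Z)) =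
        F2 F X (Y \<boxtimes>\<^bsub>A\<^esub> Z) \<cdot>\<^bsub>B\<^esub> (Idn B (FO F X) \<star>\<^bsub>B\<^esub> F2 F Y Z) \<cdot>\<^bsub>B\<^esub>
          Assoc B (FO F X) (FO F Y) (FO F Z)) \<and>
     (\<forall>X\<in>Obj A.
        FM F (Unit A \<boxtimes>\<^bsub>A\<^esub> X) X (LUnit A X) \<cdot>\<^bsub>B\<^esub> F2 F (Unit A) X \<cdot>\<^bsub>B\<^esub>
          (F0 F \<star>\<^bsub>B\<^esub> Idn B (FO F X)) = LUnit B (FO F X) \<and>
        FM F (X \<boxtimes>\<^bsub>A\<^esub> Unit A) X (RUnit A X) \<cdot>\<^bsub>B\<^esub> F2 F X (Unit A) \<cdot>\<^bsub>B\<^esub>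
          (Idn B (FO F X) \<star>\<^bsub>B\<^esub> F0 F) = RUnit B (FO F X))"

definition tensor_functor ::
  "('k::field, 'o, 'a, 'm) moncat_scheme \<Rightarrow> ('k, 'p, 'b, 'n) moncat_scheme \<Rightarrow>
   ('o, 'a, 'p, 'b, 'r) monfunc_scheme \<Rightarrow> bool" where
  "tensor_functor A B F \<longleftrightarrow>
     linear_functor A B F \<and> exact_functor A B F \<and> strong_monoidal_functor A B F"

definition natural_transformation ::
  "('k, 'o, 'a, 'm) lincat_scheme \<Rightarrow> ('l, 'p, 'b, 'n) lincat_scheme \<Rightarrow>
   ('o, 'a, 'p, 'b, 'r) func_scheme \<Rightarrow> ('o, 'a, 'p, 'b, 's) func_scheme \<Rightarrow> ('o \<Rightarrow> 'b) \<Rightarrow> bool" where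
  "natural_transformation A B F H \<alpha> \<longleftrightarrow>
     (\<forall>X\<in>Obj A. \<alpha> X \<in> Hom B (FO F X) (FO H X)) \<and>
     (\<forall>X\<in>Obj A. \<forall>Y\<in>Obj A. \<forall>f\<in>Hom A X Y. \<alpha> Y \<cdot>\<^bsub>B\<^esub> FM F X Y f = FM H X Y f \<cdot>\<^bsub>B\<^esub> \<alpha> X)"

definition monoidal_isomorphism ::
  "('k, 'o, 'a, 'm) moncat_scheme \<Rightarrow> ('l, 'p, 'b, 'n) moncat_scheme \<Rightarrow>
   ('o, 'a, 'p, 'b, 'r) monfunc_scheme \<Rightarrow> ('o, 'a, 'p, 'b, 's) monfunc_scheme \<Rightarrow>
   ('o \<Rightarrow> 'b) \<Rightarrow> bool" where
  "monoidal_isomorphism A B F H \<alpha> \<longleftrightarrow> natural_transformation A B F H \<alpha> \<and>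
     (\<forall>X\<in>Obj A. is_iso B (FO F X) (FO H X) (\<alpha> X)) \<and>
     (\<forall>X\<in>Obj A. \<forall>Y\<in>Obj A.
        \<alpha> (X \<boxtimes>\<^bsub>A\<^esub> Y) \<cdot>\<^bsub>B\<^esub> F2 F X Y = F2 H X Y \<cdot>\<^bsub>B\<^esub> (\<alpha> X \<star>\<^bsub>B\<^esub> \<alpha> Y)) \<and>
     \<alpha> (Unit A) \<cdot>\<^bsub>B\<^esub> F0 F = F0 H"

definition id_func :: "('o, 'a, 'o, 'a) func" where
  "id_func = \<lparr>FO = (\<lambda>X. X), FM = (\<lambda>X Y f. f)\<rparr>"

definition id_endo :: "('k, 'o, 'a, 'm) moncat_scheme \<Rightarrow> ('o, 'a, 'o, 'a) monfunc" where
  "id_endo C = \<lparr>FO = (\<lambda>X. X), FM = (\<lambda>X Y f. f),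
     F2 = (\<lambda>X Y. Idn C (X \<boxtimes>\<^bsub>C\<^esub> Y)), F0 = Idn C (Unit C)\<rparr>"

definition endo_comp ::
  "('k, 'o, 'a, 'm) moncat_scheme \<Rightarrow> ('o, 'a, 'o, 'a) monfunc \<Rightarrow> ('o, 'a, 'o, 'a) monfunc \<Rightarrow>
   ('o, 'a, 'o, 'a) monfunc" where
  "endo_comp C H F =
    \<lparr>FO = FO H \<circ> FO F, FM = (\<lambda>X Y f. FM H (FO F X) (FO F Y) (FM F X Y f)),
     F2 = (\<lambda>X Y. FM H (FO F X \<boxtimes>\<^bsub>C\<^esub> FO F Y) (FO F (X \<boxtimes>\<^bsub>C\<^esub> Y)) (F2 F X Y) \<cdot>\<^bsub>C\<^esub> F2 H (FO F X) (FO F Y)),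
     F0 = FM H (Unit C) (FO F (Unit C)) (F0 F) \<cdot>\<^bsub>C\<^esub> F0 H\<rparr>"


section \<open>Group actions and equivariantization\<close>

locale tensor_action =
  fixes C :: "('k::field, 'o, 'a, 'm) moncat_scheme" (structure)
    and G :: "('g, 'n) monoid_scheme"
    and \<rho> :: "'g \<Rightarrow> ('o, 'a, 'o, 'a) monfunc"
    and \<rho>2 :: "'g \<Rightarrow> 'g \<Rightarrow> 'o \<Rightarrow> 'a"
    and \<rho>0 :: "'o \<Rightarrow> 'a"
  assumes \<rho>_tensor_functor: "g \<in> carrier G \<Longrightarrow> tensor_functor C C (\<rho> g)"
    and \<rho>2_monoidal_iso: "\<lbrakk>g \<in> carrier G; h \<in> carrier G\<rbrakk> \<Longrightarrow>
      monoidal_isomorphism C C (endo_comp C (\<rho> g) (\<rho> h)) (\<rho> (g \<otimes>\<^bsub>G\<^esub> h)) (\<rho>2 g h)"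
    and \<rho>0_monoidal_iso: "monoidal_isomorphism C C (id_endo C) (\<rho> \<one>\<^bsub>G\<^esub>) \<rho>0"
    and \<rho>2_assoc: "\<lbrakk>g \<in> carrier G; h \<in> carrier G; k \<in> carrier G; X \<in> Obj C\<rbrakk> \<Longrightarrow>
      \<rho>2 (g \<otimes>\<^bsub>G\<^esub> h) k X \<cdot> \<rho>2 g h (FO (\<rho> k) X) =
      \<rho>2 g (h \<otimes>\<^bsub>G\<^esub> k) X \<cdot> FM (\<rho> g) (FO (\<rho> h) (FO (\<rho> k) X)) (FO (\<rho> (h \<otimes>\<^bsub>G\<^esub> k)) X) (\<rho>2 h k X)"
    and \<rho>0_left: "\<lbrakk>g \<in> carrier G; X \<in> Obj C\<rbrakk> \<Longrightarrow>
      \<rho>2 \<one>\<^bsub>G\<^esub> g X \<cdot> \<rho>0 (FO (\<rho> g) X) = Idn C (FO (\<rho> g) X)"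
    and \<rho>0_right: "\<lbrakk>g \<in> carrier G; X \<in> Obj C\<rbrakk> \<Longrightarrow>
      \<rho>2 g \<one>\<^bsub>G\<^esub> X \<cdot> FM (\<rho> g) X (FO (\<rho> \<one>\<^bsub>G\<^esub>) X) (\<rho>0 X) = Idn C (FO (\<rho> g) X)"

definition equivariantization ::
  "('k, 'o, 'a, 'm) moncat_scheme \<Rightarrow> ('g, 'n) monoid_scheme \<Rightarrow>
   ('g \<Rightarrow> ('o, 'a, 'o, 'a) monfunc) \<Rightarrow> ('g \<Rightarrow> 'g \<Rightarrow> 'o \<Rightarrow> 'a) \<Rightarrow> ('o \<Rightarrow> 'a) \<Rightarrow>
   ('k, 'o \<times> ('g \<Rightarrow> 'a), 'a) lincat" where
  "equivariantization C G \<rho> \<rho>2 \<rho>0 =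
    \<lparr>Obj = {(X, u). X \<in> Obj C \<and> u \<in> (\<Pi>\<^sub>E g\<in>carrier G. Hom C (FO (\<rho> g) X) X) \<and>
        (\<forall>g\<in>carrier G. \<forall>h\<in>carrier G.
           u g \<cdot>\<^bsub>C\<^esub> FM (\<rho> g) (FO (\<rho> h) X) X (u h) = u (g \<otimes>\<^bsub>G\<^esub> h) \<cdot>\<^bsub>C\<^esub> \<rho>2 g h X) \<and>
        u \<one>\<^bsub>G\<^esub> \<cdot>\<^bsub>C\<^esub> \<rho>0 X = Idn C X},
     HomSp = (\<lambda>(X, u) (Y, v). (HomSp C X Y)\<lparr>carrier :=
        {f \<in> Hom C X Y. \<forall>g\<in>carrier G. f \<cdot>\<^bsub>C\<^esub> u g = v g \<cdot>\<^bsub>C\<^esub> FM (\<rho> g) X Y f}\<rparr>),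
     Cmp = Cmp C,
     Idn = (\<lambda>(X, u). Idn C X)\<rparr>"

text \<open>Forgetful functor, on objects of the form (underlying object, structure).\<close>

definition forgetful :: "('o \<times> 's, 'a, 'o, 'a) func" where
  "forgetful = \<lparr>FO = fst, FM = (\<lambda>X Y f. f)\<rparr>"


section \<open>Hopf monads\<close>

record ('o, 'a) bimonad = "('o, 'a, 'o, 'a) func" +
  Mu :: "'o \<Rightarrow> 'a"
  Eta :: "'o \<Rightarrow> 'a"
  T2 :: "'o \<Rightarrow> 'o \<Rightarrow> 'a"
  T0 :: "'a"

definition monad :: "('k, 'o, 'a, 'm) lincat_scheme \<Rightarrow> ('o, 'a, 'r) bimonad_scheme \<Rightarrow> bool" where
  "monad C T \<longleftrightarrow> is_functor C C T \<and>
     natural_transformation C C (func_comp T T) T (Mu T) \<and>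
     natural_transformation C C id_func T (Eta T) \<and>
     (\<forall>X\<in>Obj C.
        Mu T X \<cdot>\<^bsub>C\<^esub> FM T (FO T (FO T X)) (FO T X) (Mu T X) = Mu T X \<cdot>\<^bsub>C\<^esub> Mu T (FO T X) \<and>
        Mu T X \<cdot>\<^bsub>C\<^esub> Eta T (FO T X) = Idn C (FO T X) \<and>
        Mu T X \<cdot>\<^bsub>C\<^esub> FM T X (FO T X) (Eta T X) = Idn C (FO T X))"

definition comonoidal_functor ::
  "('k, 'o, 'a, 'm) moncat_scheme \<Rightarrow> ('o, 'a, 'r) bimonad_scheme \<Rightarrow> bool" where
  "comonoidal_functor C T \<longleftrightarrow> is_functor C C T \<and>
     (\<forall>X\<in>Obj C. \<forall>Y\<in>Obj C. T2 T X Y \<in> Hom C (FO T (X \<boxtimes>\<^bsub>C\<^esub> Y)) (FO T X \<boxtimes>\<^bsub>C\<^esub> FO T Y)) \<and>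
     T0 T \<in> Hom C (FO T (Unit C)) (Unit C) \<and>
     (\<forall>X\<in>Obj C. \<forall>X'\<in>Obj C. \<forall>Y\<in>Obj C. \<forall>Y'\<in>Obj C. \<forall>f\<in>Hom C X X'. \<forall>g\<in>Hom C Y Y'.
        T2 T X' Y' \<cdot>\<^bsub>C\<^esub> FM T (X \<boxtimes>\<^bsub>C\<^esub> Y) (X' \<boxtimes>\<^bsub>C\<^esub> Y') (f \<star>\<^bsub>C\<^esub> g) =
        (FM T X X' f \<star>\<^bsub>C\<^esub> FM T Y Y' g) \<cdot>\<^bsub>C\<^esub> T2 T X Y) \<and>
     (\<forall>X\<in>Obj C. \<forall>Y\<in>Obj C. \<forall>Z\<in>Obj C.
        Assoc C (FO T X) (FO T Y) (FO T Z) \<cdot>\<^bsub>C\<^esub> (T2 T X Y \<star>\<^bsub>C\<^esub> Idn C (FO T Z)) \<cdot>\<^bsub>C\<^esub>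
          T2 T (X \<boxtimes>\<^bsub>C\<^esub> Y) Z =
        (Idn C (FO T X) \<star>\<^bsub>C\<^esub> T2 T Y Z) \<cdot>\<^bsub>C\<^esub> T2 T X (Y \<boxtimes>\<^bsub>C\<^esub> Z) \<cdot>\<^bsub>C\<^esub>
          FM T ((X \<boxtimes>\<^bsub>C\<^esub> Y) \<boxtimes>\<^bsub>C\<^esub> Z) (X \<boxtimes>\<^bsub>C\<^esub> (Y \<boxtimes>\<^bsub>C\<^esub> Z)) (Assoc C X Y Z)) \<and>
     (\<forall>X\<in>Obj C.
        LUnit C (FO T X) \<cdot>\<^bsub>C\<^esub> (T0 T \<star>\<^bsub>C\<^esub> Idn C (FO T X)) \<cdot>\<^bsub>C\<^esub> T2 T (Unit C) X =
          FM T (Unit C \<boxtimes>\<^bsub>C\<^esub> X) X (LUnit C X) \<and>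
        RUnit C (FO T X) \<cdot>\<^bsub>C\<^esub> (Idn C (FO T X) \<star>\<^bsub>C\<^esub> T0 T) \<cdot>\<^bsub>C\<^esub> T2 T X (Unit C) =
          FM T (X \<boxtimes>\<^bsub>C\<^esub> Unit C) X (RUnit C X))"

text \<open>The last four conditions say that multiplication and unit are comonoidal.\<close>

definition bimonad :: "('k, 'o, 'a, 'm) moncat_scheme \<Rightarrow> ('o, 'a, 'r) bimonad_scheme \<Rightarrow> bool" where
  "bimonad C T \<longleftrightarrow> monad C T \<and> comonoidal_functor C T \<and>
     (\<forall>X\<in>Obj C. \<forall>Y\<in>Obj C. T2 T X Y \<cdot>\<^bsub>C\<^esub> Mu T (X \<boxtimes>\<^bsub>C\<^esub> Y) =
        (Mu T X \<star>\<^bsub>C\<^esub> Mu T Y) \<cdot>\<^bsub>C\<^esub> T2 T (FO T X) (FO T Y) \<cdot>\<^bsub>C\<^esub>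
          FM T (FO T (X \<boxtimes>\<^bsub>C\<^esub> Y)) (FO T X \<boxtimes>\<^bsub>C\<^esub> FO T Y) (T2 T X Y)) \<and>
     T0 T \<cdot>\<^bsub>C\<^esub> Mu T (Unit C) = T0 T \<cdot>\<^bsub>C\<^esub> FM T (FO T (Unit C)) (Unit C) (T0 T) \<and>
     (\<forall>X\<in>Obj C. \<forall>Y\<in>Obj C. T2 T X Y \<cdot>\<^bsub>C\<^esub> Eta T (X \<boxtimes>\<^bsub>C\<^esub> Y) = Eta T X \<star>\<^bsub>C\<^esub> Eta T Y) \<and>
     T0 T \<cdot>\<^bsub>C\<^esub> Eta T (Unit C) = Idn C (Unit C)"

definition module_category ::
  "('k, 'o, 'a, 'm) moncat_scheme \<Rightarrow> ('o, 'a, 'r) bimonad_scheme \<Rightarrow> ('k, 'o \<times> 'a, 'a) moncat"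
  where
  "module_category C T =
    \<lparr>Obj = {(M, r). M \<in> Obj C \<and> r \<in> Hom C (FO T M) M \<and>
        r \<cdot>\<^bsub>C\<^esub> FM T (FO T M) M r = r \<cdot>\<^bsub>C\<^esub> Mu T M \<and> r \<cdot>\<^bsub>C\<^esub> Eta T M = Idn C M},
     HomSp = (\<lambda>(M, r) (N, s). (HomSp C M N)\<lparr>carrier :=
        {f \<in> Hom C M N. f \<cdot>\<^bsub>C\<^esub> r = s \<cdot>\<^bsub>C\<^esub> FM T M N f}\<rparr>),
     Cmp = Cmp C,
     Idn = (\<lambda>(M, r). Idn C M),
     TensO = (\<lambda>(M, r) (N, s). (M \<boxtimes>\<^bsub>C\<^esub> N, (r \<star>\<^bsub>C\<^esub> s) \<cdot>\<^bsub>C\<^esub> T2 T M N)),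
     TensM = TensM C,
     Unit = (Unit C, T0 T),
     Assoc = (\<lambda>(M, r) (N, s) (P, t). Assoc C M N P),
     LUnit = (\<lambda>(M, r). LUnit C M),
     RUnit = (\<lambda>(M, r). RUnit C M)\<rparr>"

definition hopf_monad ::
  "('k, 'o, 'a, 'm) moncat_scheme \<Rightarrow> ('o, 'a, 'r) bimonad_scheme \<Rightarrow> bool" where
  "hopf_monad C T \<longleftrightarrow> bimonad C T \<and> rigid (module_category C T)"

definition normal_hopf_monad ::
  "('k::field, 'o, 'a, 'm) moncat_scheme \<Rightarrow> ('o, 'a, 'r) bimonad_scheme \<Rightarrow> bool" where
  "normal_hopf_monad C T \<longleftrightarrow> linear_functor C C T \<and> right_exact_functor C C T \<and> hopf_monad C T \<and>
     trivial_object C (FO T (Unit C))"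

text \<open>The unitors identify \<open>T(X \<otimes> 1)\<close>, \<open>T(1 \<otimes> X)\<close> with \<open>T X\<close>, and \<open>T X \<otimes> 1\<close>, \<open>1 \<otimes> T X\<close>
  with \<open>T X\<close>.\<close>

definition cocommutative_hopf_monad ::
  "('k::field, 'o, 'a, 'm) moncat_scheme \<Rightarrow> ('o, 'a, 'r) bimonad_scheme \<Rightarrow> bool" where
  "cocommutative_hopf_monad C T \<longleftrightarrow> normal_hopf_monad C T \<and>
     (\<forall>g\<in>Hom C (FO T (Unit C)) (Unit C). \<forall>X\<in>Obj C.
        RUnit C (FO T X) \<cdot>\<^bsub>C\<^esub> (Idn C (FO T X) \<star>\<^bsub>C\<^esub> g) \<cdot>\<^bsub>C\<^esub> T2 T X (Unit C) \<cdot>\<^bsub>C\<^esub>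
          FM T X (X \<boxtimes>\<^bsub>C\<^esub> Unit C) (inv_arr C (X \<boxtimes>\<^bsub>C\<^esub> Unit C) X (RUnit C X)) =
        LUnit C (FO T X) \<cdot>\<^bsub>C\<^esub> (g \<star>\<^bsub>C\<^esub> Idn C (FO T X)) \<cdot>\<^bsub>C\<^esub> T2 T (Unit C) X \<cdot>\<^bsub>C\<^esub>
          FM T X (Unit C \<boxtimes>\<^bsub>C\<^esub> X) (inv_arr C (Unit C \<boxtimes>\<^bsub>C\<^esub> X) X (LUnit C X)))"

definition semisimple_monad ::
  "('k, 'o, 'a, 'm) moncat_scheme \<Rightarrow> ('o, 'a, 'r) bimonad_scheme \<Rightarrow> bool" where
  "semisimple_monad C T \<longleftrightarrow> (\<forall>M\<in>Obj (module_category C T). \<exists>X\<in>Obj C.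
     \<exists>i\<in>Hom (module_category C T) M (FO T X, Mu T X).
     \<exists>p\<in>Hom (module_category C T) (FO T X, Mu T X) M.
       p \<cdot>\<^bsub>module_category C T\<^esub> i = Idn (module_category C T) M)"


section \<open>The induced Hopf algebra of a normal Hopf monad\<close>

definition Ker_U ::
  "('k, 'o, 'a, 'm) moncat_scheme \<Rightarrow> ('o, 'a, 'r) bimonad_scheme \<Rightarrow> ('k, 'o \<times> 'a, 'a) moncat"
  where
  "Ker_U C T = (module_category C T)\<lparr>Obj :=
     {X \<in> Obj (module_category C T). trivial_object C (fst X)}\<rparr>"

text \<open>The fibre functor \<open>\<omega> = Hom(1, U(-))\<close>. On a morphism \<open>f\<close> it acts by \<open>x \<mapsto> f \<cdot> x\<close>.\<close>

definition fibre :: "('k, 'o, 'a, 'm) moncat_scheme \<Rightarrow> 'o \<times> 'a \<Rightarrow> ('k, 'a) module" where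
  "fibre C X = HomSp C (Unit C) (fst X)"

abbreviation fibre_dual ::
  "('k::field, 'o, 'a, 'm) moncat_scheme \<Rightarrow> 'o \<times> 'a \<Rightarrow> ('k, 'a \<Rightarrow> 'k) module" where
  "fibre_dual C X \<equiv> dual_space (fibre C X)"

abbreviation fibre_tens ::
  "('k::field, 'o, 'a, 'm) moncat_scheme \<Rightarrow> 'o \<times> 'a \<Rightarrow> 'a \<Rightarrow> ('a \<Rightarrow> 'k) \<Rightarrow>
   ('a \<times> ('a \<Rightarrow> 'k) \<Rightarrow> 'k) set" where
  "fibre_tens C X x \<phi> \<equiv> tens (fibre C X) (fibre_dual C X) x \<phi>"

text \<open>
  Dinatural families \<open>j\<^sub>X : \<omega>(X) \<otimes> \<omega>(X)\<^sup>\<or> \<rightarrow> D\<close>. For \<open>f : X \<rightarrow> Y\<close>, dinaturality is the equality of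
  the two maps \<open>\<omega>(X) \<otimes> \<omega>(Y)\<^sup>\<or> \<rightarrow> D\<close>, tested on the elementary tensors \<open>x \<otimes> \<psi>\<close>.
\<close>

definition coend_wedge ::
  "('k::field, 'o, 'a, 'm) moncat_scheme \<Rightarrow> ('o, 'a, 'r) bimonad_scheme \<Rightarrow>
   ('k, 'd, 'n) module_scheme \<Rightarrow> ('o \<times> 'a \<Rightarrow> ('a \<times> ('a \<Rightarrow> 'k) \<Rightarrow> 'k) set \<Rightarrow> 'd) \<Rightarrow> bool" where
  "coend_wedge C T D j \<longleftrightarrow>
     (\<forall>X\<in>Obj (Ker_U C T).
        j X \<in> module_hom class_ring (tensor_space (fibre C X) (fibre_dual C X)) D) \<and>
     (\<forall>X\<in>Obj (Ker_U C T). \<forall>Y\<in>Obj (Ker_U C T). \<forall>f\<in>Hom (Ker_U C T) X Y.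
      \<forall>x\<in>carrier (fibre C X). \<forall>\<psi>\<in>carrier (fibre_dual C Y).
        j Y (fibre_tens C Y (f \<cdot>\<^bsub>C\<^esub> x) \<psi>) =
        j X (fibre_tens C X x (\<lambda>x'\<in>carrier (fibre C X). \<psi> (f \<cdot>\<^bsub>C\<^esub> x'))))"

text \<open>
  The universal property of the coend of \<open>\<omega> \<otimes> \<omega>\<^sup>\<or>\<close>. HOL cannot quantify over the type of the test
  spaces inside a formula, so that type is a parameter; a statement about \<open>is_coend\<close> for an
  arbitrary type \<open>'d\<close> covers all test spaces.
\<close>

definition is_coend ::
  "'d itself \<Rightarrow> ('k::field, 'o, 'a, 'm) moncat_scheme \<Rightarrow> ('o, 'a, 'r) bimonad_scheme \<Rightarrow>
   ('k, 'l, 'n) module_scheme \<Rightarrow> ('o \<times> 'a \<Rightarrow> ('a \<times> ('a \<Rightarrow> 'k) \<Rightarrow> 'k) set \<Rightarrow> 'l) \<Rightarrow> bool" where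
  "is_coend TYPE('d) C T L j \<longleftrightarrow> vectorspace class_ring L \<and> coend_wedge C T L j \<and>
     (\<forall>(D :: ('k, 'd) module) i. vectorspace class_ring D \<longrightarrow> coend_wedge C T D i \<longrightarrow>
        (\<exists>!h. h \<in> lin_maps L D \<and>
           (\<forall>X\<in>Obj (Ker_U C T). \<forall>t\<in>carrier (tensor_space (fibre C X) (fibre_dual C X)).
              h (j X t) = i X t)))"

text \<open>
  The Hopf algebra structure of the coend \<open>L(\<omega>)\<close>, given by Tannaka reconstruction. The formulas
  for comultiplication and counit say that \<open>x \<mapsto> \<Sum>\<^sub>i e\<^sub>i \<otimes> j\<^sub>X(x \<otimes> e\<^sup>i)\<close>, for dual bases
  \<open>(e\<^sub>i)\<close>, \<open>(e\<^sup>i)\<close> of \<open>\<omega>(X)\<close>, \<open>\<omega>(X)\<^sup>\<or>\<close>, is a right coaction of \<open>L(\<omega>)\<close> on \<open>\<omega>(X)\<close>; those for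
  product and unit say that these coactions are compatible with the monoidal structure
  \<open>x \<otimes> y \<mapsto> (x \<otimes> y) l\<^sub>1\<^sup>-\<^sup>1\<close> of \<open>\<omega>\<close>. In the product formula, \<open>\<chi>\<close> is \<open>\<phi> \<otimes> \<psi>\<close> seen as a functional on
  \<open>\<omega>(X \<otimes> Y)\<close>; it exists and is unique since \<open>\<omega>\<close> is strong monoidal on \<open>Ker_U\<close>. The antipode is
  determined by the rest of the structure.
\<close>

definition induced_hopf_algebra ::
  "'d itself \<Rightarrow> ('k::field, 'o, 'a, 'm) moncat_scheme \<Rightarrow> ('o, 'a, 'r) bimonad_scheme \<Rightarrow>
   ('k, 'l, 'n) hopf_scheme \<Rightarrow> ('o \<times> 'a \<Rightarrow> ('a \<times> ('a \<Rightarrow> 'k) \<Rightarrow> 'k) set \<Rightarrow> 'l) \<Rightarrow> bool" where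
  "induced_hopf_algebra TYPE('d) C T L j \<longleftrightarrow>
     hopf_algebra L \<and> is_coend TYPE('d) C T L j \<and>
     (\<forall>X\<in>Obj (Ker_U C T). \<forall>(n::nat) e e'.
        (\<forall>i<n. e i \<in> carrier (fibre C X) \<and> e' i \<in> carrier (fibre_dual C X)) \<and>
        (\<forall>x\<in>carrier (fibre C X).
           finsum (fibre C X) (\<lambda>i. e' i x \<odot>\<^bsub>fibre C X\<^esub> e i) {..<n} = x) \<longrightarrow>
        (\<forall>x\<in>carrier (fibre C X). \<forall>\<phi>\<in>carrier (fibre_dual C X).
           comult L (j X (fibre_tens C X x \<phi>)) =
           finsum (tensor_space L L)
             (\<lambda>i. tens L L (j X (fibre_tens C X (e i) \<phi>)) (j X (fibre_tens C X x (e' i)))) {..<n})) \<and>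
     (\<forall>X\<in>Obj (Ker_U C T). \<forall>x\<in>carrier (fibre C X). \<forall>\<phi>\<in>carrier (fibre_dual C X).
        counit L (j X (fibre_tens C X x \<phi>)) = \<phi> x) \<and>
     (\<forall>X\<in>Obj (Ker_U C T). \<forall>Y\<in>Obj (Ker_U C T).
      \<forall>x\<in>carrier (fibre C X). \<forall>\<phi>\<in>carrier (fibre_dual C X).
      \<forall>y\<in>carrier (fibre C Y). \<forall>\<psi>\<in>carrier (fibre_dual C Y).
      \<forall>\<chi>\<in>carrier (fibre_dual C (X \<boxtimes>\<^bsub>Ker_U C T\<^esub> Y)).
        let \<omega>2 = (\<lambda>x' y'. (x' \<star>\<^bsub>C\<^esub> y') \<cdot>\<^bsub>C\<^esub>
          inv_arr C (Unit C \<boxtimes>\<^bsub>C\<^esub> Unit C) (Unit C) (LUnit C (Unit C))) in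
        (\<forall>x'\<in>carrier (fibre C X). \<forall>y'\<in>carrier (fibre C Y). \<chi> (\<omega>2 x' y') = \<phi> x' * \<psi> y') \<longrightarrow>
        j X (fibre_tens C X x \<phi>) \<otimes>\<^bsub>L\<^esub> j Y (fibre_tens C Y y \<psi>) =
        j (X \<boxtimes>\<^bsub>Ker_U C T\<^esub> Y) (fibre_tens C (X \<boxtimes>\<^bsub>Ker_U C T\<^esub> Y) (\<omega>2 x y) \<chi>)) \<and>
     (\<forall>\<phi>\<in>carrier (fibre_dual C (Unit (Ker_U C T))). \<phi> (Idn C (Unit C)) = 1 \<longrightarrow>
        j (Unit (Ker_U C T)) (fibre_tens C (Unit (Ker_U C T)) (Idn C (Unit C)) \<phi>) = \<one>\<^bsub>L\<^esub>)"


section \<open>The Hopf monad of a group action\<close>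

text \<open>
  \<open>S X\<close>, with injections \<open>\<iota> X g\<close> and projections \<open>\<pi> X g\<close>, is a chosen direct sum of the objects
  \<open>\<rho>\<^sup>g X\<close> for \<open>g \<in> G\<close>. In matrix terms, the multiplication has the components
  \<open>\<rho>\<^sub>2\<^sup>g\<^sup>,\<^sup>h : \<rho>\<^sup>g \<rho>\<^sup>h X \<rightarrow> \<rho>\<^sup>g\<^sup>h X\<close>.
\<close>

definition action_monad ::
  "('k, 'o, 'a, 'm) moncat_scheme \<Rightarrow> ('g, 'n) monoid_scheme \<Rightarrow>
   ('g \<Rightarrow> ('o, 'a, 'o, 'a) monfunc) \<Rightarrow> ('g \<Rightarrow> 'g \<Rightarrow> 'o \<Rightarrow> 'a) \<Rightarrow> ('o \<Rightarrow> 'a) \<Rightarrow>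
   ('o \<Rightarrow> 'o) \<Rightarrow> ('o \<Rightarrow> 'g \<Rightarrow> 'a) \<Rightarrow> ('o \<Rightarrow> 'g \<Rightarrow> 'a) \<Rightarrow> ('o, 'a) bimonad" where
  "action_monad C G \<rho> \<rho>2 \<rho>0 S \<iota> \<pi> =
    \<lparr>FO = S,
     FM = (\<lambda>X Y f. finsum (HomSp C (S X) (S Y))
        (\<lambda>g. \<iota> Y g \<cdot>\<^bsub>C\<^esub> FM (\<rho> g) X Y f \<cdot>\<^bsub>C\<^esub> \<pi> X g) (carrier G)),
     Mu = (\<lambda>X. finsum (HomSp C (S (S X)) (S X))
        (\<lambda>(g, h). \<iota> X (g \<otimes>\<^bsub>G\<^esub> h) \<cdot>\<^bsub>C\<^esub> \<rho>2 g h X \<cdot>\<^bsub>C\<^esub>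
           FM (\<rho> g) (S X) (FO (\<rho> h) X) (\<pi> X h) \<cdot>\<^bsub>C\<^esub> \<pi> (S X) g) (carrier G \<times> carrier G)),
     Eta = (\<lambda>X. \<iota> X \<one>\<^bsub>G\<^esub> \<cdot>\<^bsub>C\<^esub> \<rho>0 X),
     T2 = (\<lambda>X Y. finsum (HomSp C (S (X \<boxtimes>\<^bsub>C\<^esub> Y)) (S X \<boxtimes>\<^bsub>C\<^esub> S Y))
        (\<lambda>g. (\<iota> X g \<star>\<^bsub>C\<^esub> \<iota> Y g) \<cdot>\<^bsub>C\<^esub>
           inv_arr C (FO (\<rho> g) X \<boxtimes>\<^bsub>C\<^esub> FO (\<rho> g) Y) (FO (\<rho> g) (X \<boxtimes>\<^bsub>C\<^esub> Y)) (F2 (\<rho> g) X Y) \<cdot>\<^bsub>C\<^esub>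
           \<pi> (X \<boxtimes>\<^bsub>C\<^esub> Y) g) (carrier G)),
     T0 = finsum (HomSp C (S (Unit C)) (Unit C))
        (\<lambda>g. inv_arr C (Unit C) (FO (\<rho> g) (Unit C)) (F0 (\<rho> g)) \<cdot>\<^bsub>C\<^esub> \<pi> (Unit C) g) (carrier G)\<rparr>"

text \<open>The functor from the equivariantization to the modules over \<^const>\<open>action_monad\<close> that takes
  \<open>(X, u)\<close> to \<open>X\<close> with the action \<open>\<Oplus>\<^sub>g \<rho>\<^sup>g X \<rightarrow> X\<close> of components \<open>u\<^sup>g\<close>.\<close>

definition comparison ::
  "('k, 'o, 'a, 'm) moncat_scheme \<Rightarrow> ('g, 'n) monoid_scheme \<Rightarrow>
   ('o \<Rightarrow> 'o) \<Rightarrow> ('o \<Rightarrow> 'g \<Rightarrow> 'a) \<Rightarrow> ('o \<times> ('g \<Rightarrow> 'a), 'a, 'o \<times> 'a, 'a) func" where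
  "comparison C G S \<pi> =
    \<lparr>FO = (\<lambda>(X, u). (X, finsum (HomSp C (S X) X) (\<lambda>g. u g \<cdot>\<^bsub>C\<^esub> \<pi> X g) (carrier G))),
     FM = (\<lambda>X Y f. f)\<rparr>"

text \<open>
  On a trivial module \<open>(M, r)\<close> the group acts linearly on \<open>\<omega>(M, r) = Hom(1, M)\<close> by letting \<open>g\<close> take
  \<open>x\<close> to the composite \<open>1 \<rightarrow> \<rho>\<^sup>g 1 \<rightarrow> \<rho>\<^sup>g M \<rightarrow> M\<close>; the coend structure map of the function algebra
  sends \<open>x \<otimes> \<phi>\<close> to the matrix coefficient \<open>g \<mapsto> \<phi>(g x)\<close>.
\<close>

definition matrix_coefficients ::
  "('k::field, 'o, 'a, 'm) moncat_scheme \<Rightarrow> ('g, 'n) monoid_scheme \<Rightarrow>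
   ('g \<Rightarrow> ('o, 'a, 'o, 'a) monfunc) \<Rightarrow> ('o \<Rightarrow> 'g \<Rightarrow> 'a) \<Rightarrow>
   'o \<times> 'a \<Rightarrow> ('a \<times> ('a \<Rightarrow> 'k) \<Rightarrow> 'k) set \<Rightarrow> 'g \<Rightarrow> 'k" where
  "matrix_coefficients C G \<rho> \<iota> = (\<lambda>(M, r).
     tensor_lift (fibre C (M, r)) (fibre_dual C (M, r)) (function_algebra G)
       (\<lambda>x \<phi>. \<lambda>g\<in>carrier G. \<phi> (r \<cdot>\<^bsub>C\<^esub> \<iota> M g \<cdot>\<^bsub>C\<^esub> FM (\<rho> g) (Unit C) M x \<cdot>\<^bsub>C\<^esub> F0 (\<rho> g))))"

end

theory Submission
  imports Defs
begin

text \<open>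
  An arrow out of \<open>T X = \<Oplus>\<^sub>g \<rho>\<^sup>g X\<close> is a family of arrows out of the \<open>\<rho>\<^sup>g X\<close>, and as the \<open>\<rho>\<^sup>g\<close> are linear
  they preserve direct sums, so that an arrow out of \<open>T (T X)\<close> is a family of arrows out of the
  \<open>\<rho>\<^sup>g (\<rho>\<^sup>h X)\<close>. On such components \<open>T\<close> acts by the \<open>\<rho>\<^sup>g\<close>, its multiplication and unit are \<open>\<rho>\<^sub>2\<close> and \<open>\<rho>\<^sub>0\<close>,
  and its comonoidal structure consists of the inverse structure maps of the \<open>\<rho>\<^sup>g\<close>. Every axiom of a
  bimonad thereby becomes one of the axioms of an action. In the same way kernels and cokernels of
  \<open>T f\<close> are formed componentwise, which gives exactness, and \<open>T\<close> is faithful because its summand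
  \<open>\<rho>\<^sup>1\<close> is isomorphic to the identity.

  A module structure \<open>T M \<rightarrow> M\<close> is a family of arrows \<open>u\<^sup>g : \<rho>\<^sup>g M \<rightarrow> M\<close>, and the axioms of a module
  are those of an equivariant object (\<open>Mod_Obj_act_iff\<close>, \<open>Mod_Hom_iff\<close>). Hence the comparison functor
  is an isomorphism of categories (\<open>Comp_iso\<close>). The \<open>u\<^sup>g\<close> are automatically invertible. This is why
  modules have duals: if \<open>Y\<close> is dual to \<open>M\<close> then \<open>\<rho>\<^sup>g Y\<close> is dual to \<open>\<rho>\<^sup>g M\<close>, and there is a unique
  \<open>v\<^sup>g : \<rho>\<^sup>g Y \<rightarrow> Y\<close> for which evaluation is compatible with \<open>v\<^sup>g\<close> and \<open>u\<^sup>g\<close> (\<open>dual_transport\<close>). By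
  uniqueness the \<open>v\<^sup>g\<close> form an action, and coevaluation is a module map because it is determined by
  evaluation. Right duals are left duals for the reversed tensor product.

  The object \<open>T 1 = \<Oplus>\<^sub>g \<rho>\<^sup>g 1\<close> is a sum of copies of the unit. A morphism \<open>T 1 \<rightarrow> 1\<close> is a family of
  scalars, as \<open>End 1 = \<bbbk>\<close>, and both sides of the cocommutativity condition multiply the component
  \<open>\<rho>\<^sup>g X\<close> by the scalar with index \<open>g\<close>.

  On a trivial module \<open>M\<close> the group acts linearly on \<open>\<omega>(M) = Hom(1, M)\<close>. The fibre of the free module
  \<open>T 1\<close> is the regular representation, with basis \<open>g e\<close> for the unit \<open>e : 1 \<rightarrow> T 1\<close> of the monad, so
  that its dual is the space of functions on \<open>G\<close>; moreover \<open>T 1\<close> represents \<open>\<omega>\<close>, since a module map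
  out of it is given by the image of \<open>e\<close> (\<open>regular_map\<close>). As in the Yoneda lemma, a dinatural family
  is therefore determined by its values on the tensors \<open>e \<otimes> \<phi>\<close>, and the coend is \<open>\<bbbk>\<^sup>G\<close>, the structure
  maps being the matrix coefficients (\<open>coend\<close>). The formulas for the Hopf algebra structure express
  that \<open>(g h) x = g (h x)\<close> and \<open>1 x = x\<close>, and that the action is diagonal on tensor products.

  If \<open>|G|\<close> is invertible in \<open>\<bbbk>\<close>, averaging splits the action map \<open>T M \<rightarrow> M\<close> of every module
  (\<open>semisimple_if\<close>). Conversely an endomorphism of the unit module that factors through a free module
  is a multiple of \<open>|G|\<close> (\<open>semisimple_only_if\<close>).

  Diagrams are chased in terms of arrows that know their source and target, from which the
  simplifier computes the side conditions of associativity and functoriality.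
\<close>

section \<open>Linear maps\<close>

lemma vectorspace_class_ringI:
  fixes V :: "('k::field, 'v, 'm) module_scheme"
  assumes "abelian_group V"
    and "\<And>c x. x \<in> carrier V \<Longrightarrow> c \<odot>\<^bsub>V\<^esub> x \<in> carrier V"
    and "\<And>c d x. x \<in> carrier V \<Longrightarrow> (c + d) \<odot>\<^bsub>V\<^esub> x = c \<odot>\<^bsub>V\<^esub> x \<oplus>\<^bsub>V\<^esub> d \<odot>\<^bsub>V\<^esub> x"
    and "\<And>c x y. \<lbrakk>x \<in> carrier V; y \<in> carrier V\<rbrakk> \<Longrightarrow>
      c \<odot>\<^bsub>V\<^esub> (x \<oplus>\<^bsub>V\<^esub> y) = c \<odot>\<^bsub>V\<^esub> x \<oplus>\<^bsub>V\<^esub> c \<odot>\<^bsub>V\<^esub> y"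
    and "\<And>c d x. x \<in> carrier V \<Longrightarrow> (c * d) \<odot>\<^bsub>V\<^esub> x = c \<odot>\<^bsub>V\<^esub> (d \<odot>\<^bsub>V\<^esub> x)"
    and "\<And>x. x \<in> carrier V \<Longrightarrow> 1 \<odot>\<^bsub>V\<^esub> x = x"
  shows "vectorspace class_ring V"
proof -
  have "module class_ring V"
    by (rule moduleI) (use assms class_cring.is_cring in auto)
  then show ?thesis
    by (simp add: vectorspace_def class_field)
qed

lemma module_homI:
  fixes V :: "('k::field, 'v, 'm) module_scheme"
  assumes "\<And>x. x \<in> carrier V \<Longrightarrow> f x \<in> carrier W"
    and "\<And>x y. \<lbrakk>x \<in> carrier V; y \<in> carrier V\<rbrakk> \<Longrightarrow> f (x \<oplus>\<^bsub>V\<^esub> y) = f x \<oplus>\<^bsub>W\<^esub> f y"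
    and "\<And>c x. x \<in> carrier V \<Longrightarrow> f (c \<odot>\<^bsub>V\<^esub> x) = c \<odot>\<^bsub>W\<^esub> f x"
  shows "f \<in> module_hom class_ring V W"
  using assms by (auto simp: LinearCombinations.module_hom_def)

lemma module_homD:
  fixes V :: "('k::field, 'v, 'm) module_scheme"
  assumes "f \<in> module_hom class_ring V W"
  shows "x \<in> carrier V \<Longrightarrow> f x \<in> carrier W"
    and "\<lbrakk>x \<in> carrier V; y \<in> carrier V\<rbrakk> \<Longrightarrow> f (x \<oplus>\<^bsub>V\<^esub> y) = f x \<oplus>\<^bsub>W\<^esub> f y"
    and "x \<in> carrier V \<Longrightarrow> f (c \<odot>\<^bsub>V\<^esub> x) = c \<odot>\<^bsub>W\<^esub> f x"
  using assms by (auto simp: LinearCombinations.module_hom_def)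

text \<open>The vector space axioms with the operations of the ground field unfolded, which is the form in
  which they occur after simplification.\<close>

locale kspace =
  fixes V :: "('k::field, 'v, 'm) module_scheme" (structure)
  assumes vectorspace: "vectorspace class_ring V"
begin

sublocale abelian_group V
proof -
  interpret V: vectorspace class_ring V by (fact vectorspace)
  show "abelian_group V" by unfold_locales
qed

lemma scale_closed [simp, intro]: "x \<in> carrier V \<Longrightarrow> c \<odot> x \<in> carrier V"
  and scale_add_left: "x \<in> carrier V \<Longrightarrow> (c + d) \<odot> x = c \<odot> x \<oplus> d \<odot> x"
  and scale_add_right: "\<lbrakk>x \<in> carrier V; y \<in> carrier V\<rbrakk> \<Longrightarrow> c \<odot> (x \<oplus> y) = c \<odot> x \<oplus> c \<odot> y"
  and scale_scale: "x \<in> carrier V \<Longrightarrow> c \<odot> (d \<odot> x) = (c * d) \<odot> x"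
  and scale_one [simp]: "x \<in> carrier V \<Longrightarrow> 1 \<odot> x = x"
  and scale_zero_left [simp]: "x \<in> carrier V \<Longrightarrow> 0 \<odot> x = \<zero>"
  and scale_zero_right [simp]: "c \<odot> \<zero> = \<zero>"
proof -
  interpret V: vectorspace class_ring V by (fact vectorspace)
  show "x \<in> carrier V \<Longrightarrow> c \<odot> x \<in> carrier V"
    and "x \<in> carrier V \<Longrightarrow> (c + d) \<odot> x = c \<odot> x \<oplus> d \<odot> x"
    and "\<lbrakk>x \<in> carrier V; y \<in> carrier V\<rbrakk> \<Longrightarrow> c \<odot> (x \<oplus> y) = c \<odot> x \<oplus> c \<odot> y"
    and "x \<in> carrier V \<Longrightarrow> c \<odot> (d \<odot> x) = (c * d) \<odot> x"
    and "x \<in> carrier V \<Longrightarrow> 1 \<odot> x = x"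
    and "x \<in> carrier V \<Longrightarrow> 0 \<odot> x = \<zero>"
    and "c \<odot> \<zero> = \<zero>"
    using V.smult_closed[of c x] V.smult_l_distr[of c d x] V.smult_r_distr[of c x y]
      V.smult_assoc1[of c d x] V.smult_one[of x] V.lmult_0[of x] V.rmult_0[of c]
    by simp_all
qed

lemma scale_finsum:
  assumes "finite A" "\<And>i. i \<in> A \<Longrightarrow> x i \<in> carrier V"
  shows "c \<odot> finsum V x A = finsum V (\<lambda>i. c \<odot> x i) A"
proof -
  interpret V: vectorspace class_ring V by (fact vectorspace)
  show ?thesis
    using V.finsum_smult_ldistr[OF assms(1), of c x] assms(2) by (simp add: Pi_def)
qed

lemma scale_minus_one:
  assumes "x \<in> carrier V"
  shows "(- 1) \<odot> x = \<ominus> x"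
  using assms scale_add_left[of x "-1" 1] by (intro minus_equality[symmetric]) simp_all

end

lemma mod_hom_class_ringI:
  fixes V :: "('k::field, 'v, 'm) module_scheme" and W :: "('k, 'w, 'n) module_scheme"
  assumes "f \<in> module_hom class_ring V W" "vectorspace class_ring V" "vectorspace class_ring W"
  shows "mod_hom class_ring V W f"
  using assms by (simp add: mod_hom_def mod_hom_axioms_def vectorspace_def)

lemma module_hom_zero:
  fixes V :: "('k::field, 'v, 'm) module_scheme" and W :: "('k, 'w, 'n) module_scheme"
  assumes "f \<in> module_hom class_ring V W" "vectorspace class_ring V" "vectorspace class_ring W"
  shows "f \<zero>\<^bsub>V\<^esub> = \<zero>\<^bsub>W\<^esub>"
  using mod_hom.f0_is_0[OF mod_hom_class_ringI[OF assms]] .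

lemma module_hom_finsum:
  fixes V :: "('k::field, 'v, 'm) module_scheme" and W :: "('k, 'w, 'n) module_scheme"
  assumes f: "f \<in> module_hom class_ring V W"
    and V: "vectorspace class_ring V" and W: "vectorspace class_ring W"
    and x: "\<And>i. i \<in> I \<Longrightarrow> x i \<in> carrier V"
  shows "f (finsum V x I) = finsum W (\<lambda>i. f (x i)) I"
proof -
  interpret V: kspace V by (rule kspace.intro[OF V])
  interpret W: kspace W by (rule kspace.intro[OF W])
  show ?thesis
    using x
  proof (induction I rule: infinite_finite_induct)
    case (infinite A)
    then show ?case
      by (simp add: V.add.finprod_infinite W.add.finprod_infinite finsum_def finprod_def
          module_hom_zero[OF f V W])
  next
    case empty
    then show ?case
      by (simp add: module_hom_zero[OF f V W])
  next
    case (insert a A)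
    have "f (finsum V x (insert a A)) = f (x a \<oplus>\<^bsub>V\<^esub> finsum V x A)"
      using insert by (subst V.finsum_insert) auto
    also have "\<dots> = f (x a) \<oplus>\<^bsub>W\<^esub> f (finsum V x A)"
      using insert.prems by (intro module_homD(2)[OF f] V.finsum_closed) auto
    also have "\<dots> = finsum W (\<lambda>i. f (x i)) (insert a A)"
      using insert module_homD(1)[OF f] by (subst W.finsum_insert) auto
    finally show ?case .
  qed
qed

lemma module_hom_comp:
  fixes V :: "('k::field, 'v, 'm) module_scheme"
  assumes "f \<in> module_hom class_ring V W" "g \<in> module_hom class_ring W U"
  shows "(\<lambda>x. g (f x)) \<in> module_hom class_ring V U"
  using assms by (auto simp: LinearCombinations.module_hom_def Pi_iff)

lemma module_hom_cong:
  fixes V :: "('k::field, 'v, 'm) module_scheme"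
  assumes "vectorspace class_ring V" "\<And>x. x \<in> carrier V \<Longrightarrow> f x = g x"
  shows "f \<in> module_hom class_ring V W \<longleftrightarrow> g \<in> module_hom class_ring V W"
proof -
  interpret V: kspace V by (rule kspace.intro[OF assms(1)])
  show ?thesis
    using assms(2) by (auto simp: LinearCombinations.module_hom_def Pi_iff)
qed

lemma ground_space_vectorspace: "vectorspace class_ring (ground_space :: ('k::field, 'k) module)"
  by (rule vectorspace_class_ringI, unfold_locales)
    (auto simp: ground_space_def algebra_simps Units_def intro: exI[of _ "- x" for x])

lemma ground_space_simps [simp]:
  "carrier ground_space = UNIV" "add ground_space = (+)" "zero ground_space = 0"
  "module.smult ground_space = (*)"
  by (simp_all add: ground_space_def)

lemma dual_spaceD:
  fixes V :: "('k::field, 'v, 'm) module_scheme"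
  assumes "\<phi> \<in> carrier (dual_space V)"
  shows "\<phi> \<in> module_hom class_ring V ground_space" "\<phi> \<in> extensional (carrier V)"
    and "\<lbrakk>x \<in> carrier V; y \<in> carrier V\<rbrakk> \<Longrightarrow> \<phi> (x \<oplus>\<^bsub>V\<^esub> y) = \<phi> x + \<phi> y"
    and "x \<in> carrier V \<Longrightarrow> \<phi> (c \<odot>\<^bsub>V\<^esub> x) = c * \<phi> x"
  using assms by (auto simp: dual_space_def lin_maps_def LinearCombinations.module_hom_def)

lemma dual_spaceI:
  fixes V :: "('k::field, 'v, 'm) module_scheme"
  assumes "\<And>x y. \<lbrakk>x \<in> carrier V; y \<in> carrier V\<rbrakk> \<Longrightarrow> \<phi> (x \<oplus>\<^bsub>V\<^esub> y) = \<phi> x + \<phi> y"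
    and "\<And>c x. x \<in> carrier V \<Longrightarrow> \<phi> (c \<odot>\<^bsub>V\<^esub> x) = c * \<phi> x"
    and "\<phi> \<in> extensional (carrier V)"
  shows "\<phi> \<in> carrier (dual_space V)"
  using assms by (auto simp: dual_space_def lin_maps_def LinearCombinations.module_hom_def)

lemma dual_space_vectorspace:
  fixes V :: "('k::field, 'v, 'm) module_scheme"
  assumes "vectorspace class_ring V"
  shows "vectorspace class_ring (dual_space V)"
proof -
  interpret V: kspace V by (rule kspace.intro[OF assms(1)])
  have ext: "\<phi> = (\<lambda>v\<in>carrier V. \<phi> v)" if "\<phi> \<in> carrier (dual_space V)" for \<phi>
    using dual_spaceD(2)[OF that] by (simp add: extensional_restrict)
  have sum: "(\<lambda>v\<in>carrier V. \<phi> v + \<psi> v) \<in> carrier (dual_space V)"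
    if "\<phi> \<in> carrier (dual_space V)" "\<psi> \<in> carrier (dual_space V)" for \<phi> \<psi>
    by (rule dual_spaceI) (simp_all add: that dual_spaceD algebra_simps)
  have scale: "(\<lambda>v\<in>carrier V. c * \<phi> v) \<in> carrier (dual_space V)"
    if "\<phi> \<in> carrier (dual_space V)" for \<phi> c
    by (rule dual_spaceI) (simp_all add: that dual_spaceD algebra_simps)
  have zero: "(\<lambda>v\<in>carrier V. 0) \<in> carrier (dual_space V)"
    by (rule dual_spaceI) simp_all
  have ops: "\<phi> \<oplus>\<^bsub>dual_space V\<^esub> \<psi> = (\<lambda>v\<in>carrier V. \<phi> v + \<psi> v)"
    "c \<odot>\<^bsub>dual_space V\<^esub> \<phi> = (\<lambda>v\<in>carrier V. c * \<phi> v)" "\<zero>\<^bsub>dual_space V\<^esub> = (\<lambda>v\<in>carrier V. 0)" for \<phi> \<psi> c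
    by (simp_all add: dual_space_def)
  have "abelian_group (dual_space V)"
  proof (rule abelian_groupI)
    fix \<phi> assume \<phi>: "\<phi> \<in> carrier (dual_space V)"
    show "\<exists>\<psi>\<in>carrier (dual_space V). \<psi> \<oplus>\<^bsub>dual_space V\<^esub> \<phi> = \<zero>\<^bsub>dual_space V\<^esub>"
      by (rule bexI[OF _ scale[OF \<phi>, of "-1"]]) (simp add: ops restrict_def fun_eq_iff)
    show "\<zero>\<^bsub>dual_space V\<^esub> \<oplus>\<^bsub>dual_space V\<^esub> \<phi> = \<phi>"
      unfolding ops by (subst (2) ext[OF \<phi>]) (simp add: restrict_def fun_eq_iff)
  qed (simp_all add: ops sum zero, simp_all add: restrict_def fun_eq_iff algebra_simps)
  then show ?thesis
  proof (rule vectorspace_class_ringI)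
    fix \<phi> assume \<phi>: "\<phi> \<in> carrier (dual_space V)"
    show "1 \<odot>\<^bsub>dual_space V\<^esub> \<phi> = \<phi>"
      unfolding ops by (subst (2) ext[OF \<phi>]) (simp add: restrict_def fun_eq_iff)
  qed (simp_all add: ops scale, simp_all add: restrict_def fun_eq_iff algebra_simps)
qed

section \<open>Tensor products of vector spaces\<close>

lemma free_space_simps:
  "f \<in> carrier (free_space S) \<longleftrightarrow> finite {x. f x \<noteq> 0} \<and> {x. f x \<noteq> 0} \<subseteq> S"
  "\<zero>\<^bsub>free_space S\<^esub> = (\<lambda>x. 0)"
  "f \<oplus>\<^bsub>free_space S\<^esub> g = (\<lambda>x. f x + g x)"
  "c \<odot>\<^bsub>free_space S\<^esub> f = (\<lambda>x. c * f x)"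
  by (simp_all add: free_space_def)

lemma free_space_vectorspace:
  "vectorspace class_ring (free_space S :: ('k::field, 'x \<Rightarrow> 'k) module)"
proof -
  let ?F = "free_space S :: ('k, 'x \<Rightarrow> 'k) module"
  have sum: "(\<lambda>x. f x + g x) \<in> carrier ?F" if "f \<in> carrier ?F" "g \<in> carrier ?F" for f g
  proof -
    have "{x. f x + g x \<noteq> 0} \<subseteq> {x. f x \<noteq> 0} \<union> {x. g x \<noteq> 0}" by auto
    then show ?thesis
      using that finite_subset[of "{x. f x + g x \<noteq> 0}" "{x. f x \<noteq> 0} \<union> {x. g x \<noteq> 0}"]
      by (auto simp: free_space_simps)
  qed
  have scale: "(\<lambda>x. c * f x) \<in> carrier ?F" if "f \<in> carrier ?F" for f c
    using that finite_subset[of "{x. c * f x \<noteq> 0}" "{x. f x \<noteq> 0}"]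
    by (auto simp: free_space_simps)
  have "abelian_group ?F"
  proof (rule abelian_groupI)
    fix f assume f: "f \<in> carrier ?F"
    show "\<exists>g\<in>carrier ?F. g \<oplus>\<^bsub>?F\<^esub> f = \<zero>\<^bsub>?F\<^esub>"
      by (rule bexI[OF _ scale[OF f, of "-1"]]) (simp add: free_space_simps)
  qed (auto simp: sum free_space_simps(2-) algebra_simps, auto simp: free_space_simps)
  then show ?thesis
    by (rule vectorspace_class_ringI)
      (auto simp: scale free_space_simps(2-) algebra_simps)
qed

lemma free_gen_carrier: "x \<in> S \<Longrightarrow> free_gen x \<in> carrier (free_space S)"
  by (auto simp: free_space_simps free_gen_def)

text \<open>The support is finite, so that the expansion into generators is a finite sum.\<close>

lemma free_space_expand:
  fixes f :: "'x \<Rightarrow> 'k::field"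
  assumes f: "f \<in> carrier (free_space S)"
  shows "f = finsum (free_space S) (\<lambda>x. f x \<odot>\<^bsub>free_space S\<^esub> free_gen x) {x. f x \<noteq> 0}"
proof -
  interpret F: kspace "free_space S :: ('k, 'x \<Rightarrow> 'k) module"
    by (rule kspace.intro[OF free_space_vectorspace])
  have "finsum (free_space S) (\<lambda>x. f x \<odot>\<^bsub>free_space S\<^esub> free_gen x) A =
      (\<lambda>y. if y \<in> A then f y else 0)" if "finite A" "A \<subseteq> S" for A
    using that
  proof (induction A)
    case empty
    then show ?case by (simp add: free_space_simps)
  next
    case (insert a A)
    have "finsum (free_space S) (\<lambda>x. f x \<odot>\<^bsub>free_space S\<^esub> free_gen x) (insert a A) =
        f a \<odot>\<^bsub>free_space S\<^esub> free_gen a \<oplus>\<^bsub>free_space S\<^esub>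
          finsum (free_space S) (\<lambda>x. f x \<odot>\<^bsub>free_space S\<^esub> free_gen x) A"
      using insert free_gen_carrier[of _ S] by (subst F.finsum_insert) auto
    then show ?case
      using insert by (auto simp: free_space_simps(3-) free_gen_def fun_eq_iff)
  qed
  from this[of "{x. f x \<noteq> 0}"] show ?thesis
    using f by (auto simp: free_space_simps(1) fun_eq_iff)
qed

lemma free_space_hom_eq:
  fixes W :: "('k::field, 'w, 'n) module_scheme" and S :: "'x set"
  assumes f: "f \<in> module_hom class_ring (free_space S) W"
    and g: "g \<in> module_hom class_ring (free_space S) W"
    and W: "vectorspace class_ring W"
    and eq: "\<And>x. x \<in> S \<Longrightarrow> f (free_gen x) = g (free_gen x)"
    and a: "a \<in> carrier (free_space S)"
  shows "f a = g a"
proof -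
  interpret F: kspace "free_space S :: ('k, 'x \<Rightarrow> 'k) module"
    by (rule kspace.intro[OF free_space_vectorspace])
  interpret W: kspace W by (rule kspace.intro[OF W])
  have gen: "x \<in> {x. a x \<noteq> 0} \<Longrightarrow> free_gen x \<in> carrier (free_space S :: ('k, 'x \<Rightarrow> 'k) module)" for x
    using a free_gen_carrier[of x S] by (auto simp: free_space_simps(1))
  have expand: "h a = finsum W (\<lambda>x. a x \<odot>\<^bsub>W\<^esub> h (free_gen x)) {x. a x \<noteq> 0}"
    if h: "h \<in> module_hom class_ring (free_space S) W" for h
  proof -
    have "h a = finsum W (\<lambda>x. h (a x \<odot>\<^bsub>free_space S\<^esub> free_gen x)) {x. a x \<noteq> 0}"
      by (subst free_space_expand[OF a], rule module_hom_finsum[OF h free_space_vectorspace W])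
        (use gen in simp)
    also have "\<dots> = finsum W (\<lambda>x. a x \<odot>\<^bsub>W\<^esub> h (free_gen x)) {x. a x \<noteq> 0}"
      using gen module_homD[OF h] by (intro W.finsum_cong') auto
    finally show ?thesis .
  qed
  show ?thesis
    unfolding expand[OF f] expand[OF g]
    using a gen eq module_homD(1)[OF g] by (intro W.finsum_cong') (auto simp: free_space_simps(1))
qed

definition free_extend ::
  "('k::field, 'w, 'n) module_scheme \<Rightarrow> ('x \<Rightarrow> 'w) \<Rightarrow> ('x \<Rightarrow> 'k) \<Rightarrow> 'w" where
  "free_extend W b f = finsum W (\<lambda>x. f x \<odot>\<^bsub>W\<^esub> b x) {x. f x \<noteq> 0}"

text \<open>The support of a sum may be smaller than the union of the supports, which is why linearity is
  proved with sums over a common finite superset.\<close>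

lemma free_extend_superset:
  fixes W :: "('k::field, 'w, 'n) module_scheme"
  assumes W: "vectorspace class_ring W" and b: "\<And>x. x \<in> S \<Longrightarrow> b x \<in> carrier W"
    and A: "finite A" "{x. f x \<noteq> 0} \<subseteq> A" "A \<subseteq> S"
  shows "free_extend W b f = finsum W (\<lambda>x. f x \<odot>\<^bsub>W\<^esub> b x) A"
proof -
  interpret W: kspace W by (rule kspace.intro[OF W])
  show ?thesis
    unfolding free_extend_def
    by (rule W.add.finprod_mono_neutral_cong_left)
       (use A b in \<open>auto simp: subset_iff\<close>)
qed

lemma free_extend_hom:
  fixes W :: "('k::field, 'w, 'n) module_scheme"
  assumes W: "vectorspace class_ring W" and b: "\<And>x. x \<in> S \<Longrightarrow> b x \<in> carrier W"
  shows "free_extend W b \<in> module_hom class_ring (free_space S) W"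
proof (rule module_homI)
  interpret W: kspace W by (rule kspace.intro[OF W])
  fix f g :: "_ \<Rightarrow> 'k" and c
  assume f: "f \<in> carrier (free_space S)"
  then have finf: "finite {x. f x \<noteq> 0}" and f': "{x. f x \<noteq> 0} \<subseteq> S"
    by (auto simp: free_space_simps)
  then show "free_extend W b f \<in> carrier W"
    unfolding free_extend_def by (intro W.finsum_closed) (auto intro: b)
  have "free_extend W b (c \<odot>\<^bsub>free_space S\<^esub> f) = finsum W (\<lambda>x. (c * f x) \<odot>\<^bsub>W\<^esub> b x) {x. f x \<noteq> 0}"
    by (subst free_extend_superset[OF W b finf _ f']) (auto simp: free_space_simps)
  also have "\<dots> = finsum W (\<lambda>x. c \<odot>\<^bsub>W\<^esub> (f x \<odot>\<^bsub>W\<^esub> b x)) {x. f x \<noteq> 0}"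
    using f' b W.scale_scale by (intro W.finsum_cong') (auto simp: subset_iff)
  also have "\<dots> = c \<odot>\<^bsub>W\<^esub> free_extend W b f"
    unfolding free_extend_def
    using f' b by (subst W.scale_finsum[OF finf]) (auto simp: subset_iff)
  finally show "free_extend W b (c \<odot>\<^bsub>free_space S\<^esub> f) = c \<odot>\<^bsub>W\<^esub> free_extend W b f" .
  assume g: "g \<in> carrier (free_space S)"
  define A where "A = {x. f x \<noteq> 0} \<union> {x. g x \<noteq> 0}"
  have A: "finite A" "{x. f x \<noteq> 0} \<subseteq> A" "{x. g x \<noteq> 0} \<subseteq> A" "{x. f x + g x \<noteq> 0} \<subseteq> A" "A \<subseteq> S"
    using f g by (auto simp: A_def free_space_simps)
  have "free_extend W b (f \<oplus>\<^bsub>free_space S\<^esub> g) = finsum W (\<lambda>x. (f x + g x) \<odot>\<^bsub>W\<^esub> b x) A"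
    unfolding free_space_simps by (rule free_extend_superset[OF W b A(1,4,5)])
  also have "\<dots> = finsum W (\<lambda>x. f x \<odot>\<^bsub>W\<^esub> b x \<oplus>\<^bsub>W\<^esub> g x \<odot>\<^bsub>W\<^esub> b x) A"
    using A(5) b W.scale_add_left by (intro W.finsum_cong') (auto simp: subset_iff)
  also have "\<dots> = finsum W (\<lambda>x. f x \<odot>\<^bsub>W\<^esub> b x) A \<oplus>\<^bsub>W\<^esub> finsum W (\<lambda>x. g x \<odot>\<^bsub>W\<^esub> b x) A"
    using A(5) b by (intro W.finsum_addf) (auto simp: subset_iff)
  also have "\<dots> = free_extend W b f \<oplus>\<^bsub>W\<^esub> free_extend W b g"
    using free_extend_superset[OF W b A(1,2,5)] free_extend_superset[OF W b A(1,3,5)] by simp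
  finally show "free_extend W b (f \<oplus>\<^bsub>free_space S\<^esub> g) = free_extend W b f \<oplus>\<^bsub>W\<^esub> free_extend W b g" .
qed

lemma free_extend_gen:
  fixes W :: "('k::field, 'w, 'n) module_scheme"
  assumes W: "vectorspace class_ring W" and "b x \<in> carrier W"
  shows "free_extend W b (free_gen x) = b x"
proof -
  interpret W: kspace W by (rule kspace.intro[OF W])
  have "free_extend W b (free_gen x) = finsum W (\<lambda>y. free_gen x y \<odot>\<^bsub>W\<^esub> b y) {x}"
    unfolding free_extend_def by (rule arg_cong[where f = "finsum W _"]) (auto simp: free_gen_def)
  then show ?thesis
    using assms(2) by (simp add: free_gen_def)
qed

lemma (in kspace) minus_eq_zero_iff:
  assumes "x \<in> carrier V" "y \<in> carrier V"
  shows "x \<ominus> y = \<zero> \<longleftrightarrow> x = y"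
  using assms by (metis a_minus_def a_inv_closed minus_equality minus_minus r_neg)

lemma submodule_of_spaceD:
  fixes V :: "('k::field, 'v, 'm) module_scheme"
  assumes V: "vectorspace class_ring V" and N: "LinearCombinations.submodule class_ring N V"
  shows "abelian_subgroup N V" and "x \<in> N \<Longrightarrow> c \<odot>\<^bsub>V\<^esub> x \<in> N"
proof -
  interpret V: kspace V by (rule kspace.intro[OF V])
  interpret N: LinearCombinations.submodule class_ring N V by (fact N)
  show scale: "c \<odot>\<^bsub>V\<^esub> x \<in> N" if "x \<in> N" for c x
    using N.smult_closed[of c x] that by simp
  have "additive_subgroup N V"
  proof (rule additive_subgroup.intro, rule subgroup.intro)
    fix x assume x: "x \<in> N"
    then have "x \<in> carrier V"
      using N.subset by auto
    then have "\<ominus>\<^bsub>V\<^esub> x \<in> N"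
      using scale[OF x, of "-1"] by (metis V.scale_minus_one)
    then show "inv\<^bsub>add_monoid V\<^esub> x \<in> N"
      by (simp add: a_inv_def)
  qed (use N.subset N.m_closed N.zero_closed in auto)
  then show "abelian_subgroup N V"
    using V.abelian_group_axioms by (intro abelian_subgroupI3)
qed

lemma quotient_space_ops:
  fixes V :: "('k::field, 'v, 'm) module_scheme"
  assumes V: "vectorspace class_ring V" and N: "LinearCombinations.submodule class_ring N V"
  shows "carrier (quotient_space V N) = a_r_coset V N ` carrier V"
    and "\<zero>\<^bsub>quotient_space V N\<^esub> = a_r_coset V N \<zero>\<^bsub>V\<^esub>"
    and "\<lbrakk>x \<in> carrier V; y \<in> carrier V\<rbrakk> \<Longrightarrow>
      a_r_coset V N x \<oplus>\<^bsub>quotient_space V N\<^esub> a_r_coset V N y = a_r_coset V N (x \<oplus>\<^bsub>V\<^esub> y)"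
    and "x \<in> carrier V \<Longrightarrow>
      c \<odot>\<^bsub>quotient_space V N\<^esub> a_r_coset V N x = a_r_coset V N (c \<odot>\<^bsub>V\<^esub> x)"
proof -
  interpret V: kspace V by (rule kspace.intro[OF V])
  interpret N: abelian_subgroup N V by (rule submodule_of_spaceD[OF V N])
  show "carrier (quotient_space V N) = a_r_coset V N ` carrier V"
    by (auto simp: quotient_space_def A_RCOSETS_def')
  show "\<zero>\<^bsub>quotient_space V N\<^esub> = a_r_coset V N \<zero>\<^bsub>V\<^esub>"
    using V.a_coset_add_zero[OF N.a_subset] by (simp add: quotient_space_def)
  show "a_r_coset V N x \<oplus>\<^bsub>quotient_space V N\<^esub> a_r_coset V N y = a_r_coset V N (x \<oplus>\<^bsub>V\<^esub> y)"
    if "x \<in> carrier V" "y \<in> carrier V"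
    using N.a_rcos_sum[OF that] by (simp add: quotient_space_def)
  assume x: "x \<in> carrier V"
  have const: "a_r_coset V N (c \<odot>\<^bsub>V\<^esub> y) = a_r_coset V N (c \<odot>\<^bsub>V\<^esub> x)" if y: "y \<in> a_r_coset V N x" for y
  proof -
    from y obtain n where n: "n \<in> N" "y = n \<oplus>\<^bsub>V\<^esub> x"
      by (auto simp: a_r_coset_def')
    then have "c \<odot>\<^bsub>V\<^esub> y \<in> a_r_coset V N (c \<odot>\<^bsub>V\<^esub> x)"
      using x N.a_subset submodule_of_spaceD(2)[OF V N, of n c]
      by (auto simp: a_r_coset_def' V.scale_add_right subset_iff)
    then show ?thesis
      using N.a_repr_independence'[of "c \<odot>\<^bsub>V\<^esub> y" "c \<odot>\<^bsub>V\<^esub> x"] x by auto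
  qed
  have "a_r_coset V N x \<noteq> {}"
    using N.a_rcos_self[OF x] by blast
  then have "(\<Union>y\<in>a_r_coset V N x. a_r_coset V N (c \<odot>\<^bsub>V\<^esub> y)) = a_r_coset V N (c \<odot>\<^bsub>V\<^esub> x)"
    using const by (rule SUP_eq_const)
  then show "c \<odot>\<^bsub>quotient_space V N\<^esub> a_r_coset V N x = a_r_coset V N (c \<odot>\<^bsub>V\<^esub> x)"
    by (simp add: quotient_space_def)
qed

lemma quotient_space_vectorspace:
  fixes V :: "('k::field, 'v, 'm) module_scheme"
  assumes V: "vectorspace class_ring V" and N: "LinearCombinations.submodule class_ring N V"
  shows "vectorspace class_ring (quotient_space V N)"
proof -
  interpret V: kspace V by (rule kspace.intro[OF V])
  note ops = quotient_space_ops[OF V N]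
  have "abelian_group (quotient_space V N)"
  proof (rule abelian_groupI)
    fix A assume "A \<in> carrier (quotient_space V N)"
    then obtain x where x: "x \<in> carrier V" "A = a_r_coset V N x"
      unfolding ops(1) by blast
    show "\<zero>\<^bsub>quotient_space V N\<^esub> \<oplus>\<^bsub>quotient_space V N\<^esub> A = A"
      by (simp add: x ops(2-))
    show "\<exists>B\<in>carrier (quotient_space V N). B \<oplus>\<^bsub>quotient_space V N\<^esub> A = \<zero>\<^bsub>quotient_space V N\<^esub>"
      by (rule bexI[of _ "a_r_coset V N (\<ominus>\<^bsub>V\<^esub> x)"]) (simp_all add: x ops V.l_neg)
    fix B assume "B \<in> carrier (quotient_space V N)"
    then obtain y where y: "y \<in> carrier V" "B = a_r_coset V N y"
      unfolding ops(1) by blast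
    show "A \<oplus>\<^bsub>quotient_space V N\<^esub> B \<in> carrier (quotient_space V N)"
      by (simp add: x y ops)
    show "A \<oplus>\<^bsub>quotient_space V N\<^esub> B = B \<oplus>\<^bsub>quotient_space V N\<^esub> A"
      by (simp add: x y ops V.a_comm)
    fix D assume "D \<in> carrier (quotient_space V N)"
    then obtain z where z: "z \<in> carrier V" "D = a_r_coset V N z"
      unfolding ops(1) by blast
    show "A \<oplus>\<^bsub>quotient_space V N\<^esub> B \<oplus>\<^bsub>quotient_space V N\<^esub> D =
        A \<oplus>\<^bsub>quotient_space V N\<^esub> (B \<oplus>\<^bsub>quotient_space V N\<^esub> D)"
      by (simp add: x y z ops V.a_assoc)
  qed (simp add: ops)
  then show ?thesis
    by (rule vectorspace_class_ringI; unfold ops(1), (elim imageE)?)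
      (simp_all add: ops V.scale_add_left V.scale_add_right V.scale_scale)
qed

lemma quotient_proj_hom:
  fixes V :: "('k::field, 'v, 'm) module_scheme"
  assumes "vectorspace class_ring V" "LinearCombinations.submodule class_ring N V"
  shows "a_r_coset V N \<in> module_hom class_ring V (quotient_space V N)"
  by (rule module_homI) (auto simp: quotient_space_ops[OF assms])

lemma quotient_lift:
  fixes V :: "('k::field, 'v, 'm) module_scheme" and W :: "('k, 'w, 'n) module_scheme"
  assumes V: "vectorspace class_ring V" and N: "LinearCombinations.submodule class_ring N V"
    and W: "vectorspace class_ring W"
    and f: "f \<in> module_hom class_ring V W" and null: "\<And>n. n \<in> N \<Longrightarrow> f n = \<zero>\<^bsub>W\<^esub>"
  shows "\<exists>h \<in> lin_maps (quotient_space V N) W. \<forall>x\<in>carrier V. h (a_r_coset V N x) = f x"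
proof -
  interpret V: kspace V by (rule kspace.intro[OF V])
  interpret W: kspace W by (rule kspace.intro[OF W])
  interpret N: abelian_subgroup N V by (rule submodule_of_spaceD[OF V N])
  note ops = quotient_space_ops[OF V N]
  \<comment> \<open>The choice of representatives is immaterial because \<open>f\<close> vanishes on \<open>N\<close>.\<close>
  define h where "h = (\<lambda>A\<in>carrier (quotient_space V N). f (SOME x. x \<in> A))"
  have h: "h (a_r_coset V N x) = f x" if x: "x \<in> carrier V" for x
  proof -
    have "(SOME y. y \<in> a_r_coset V N x) \<in> a_r_coset V N x"
      by (rule someI[of "\<lambda>y. y \<in> a_r_coset V N x"]) (rule N.a_rcos_self[OF x])
    then obtain n where n: "n \<in> N" "(SOME y. y \<in> a_r_coset V N x) = n \<oplus>\<^bsub>V\<^esub> x"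
      by (auto simp: a_r_coset_def')
    then show ?thesis
      using x N.a_subset null[of n] module_homD(1)[OF f x] module_homD(2)[OF f, of n x]
      by (auto simp: h_def ops(1))
  qed
  have "h \<in> module_hom class_ring (quotient_space V N) W"
    by (rule module_homI) (auto simp: ops h module_homD[OF f])
  moreover have "h \<in> extensional (carrier (quotient_space V N))"
    by (simp add: h_def)
  ultimately have "h \<in> lin_maps (quotient_space V N) W"
    by (simp add: lin_maps_def)
  with h show ?thesis by blast
qed

definition bilinear ::
  "('k::field, 'v, 'm) module_scheme \<Rightarrow> ('k, 'w, 'n) module_scheme \<Rightarrow>
   ('k, 'u, 'r) module_scheme \<Rightarrow> ('v \<Rightarrow> 'w \<Rightarrow> 'u) \<Rightarrow> bool" where
  "bilinear V W U B \<longleftrightarrow>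
     (\<forall>v\<in>carrier V. B v \<in> module_hom class_ring W U) \<and>
     (\<forall>w\<in>carrier W. (\<lambda>v. B v w) \<in> module_hom class_ring V U)"

lemma bilinearI:
  fixes V :: "('k::field, 'v, 'm) module_scheme"
  assumes "\<And>v w. \<lbrakk>v \<in> carrier V; w \<in> carrier W\<rbrakk> \<Longrightarrow> B v w \<in> carrier U"
    and "\<And>v v' w. \<lbrakk>v \<in> carrier V; v' \<in> carrier V; w \<in> carrier W\<rbrakk> \<Longrightarrow>
      B (v \<oplus>\<^bsub>V\<^esub> v') w = B v w \<oplus>\<^bsub>U\<^esub> B v' w"
    and "\<And>v w w'. \<lbrakk>v \<in> carrier V; w \<in> carrier W; w' \<in> carrier W\<rbrakk> \<Longrightarrow>
      B v (w \<oplus>\<^bsub>W\<^esub> w') = B v w \<oplus>\<^bsub>U\<^esub> B v w'"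
    and "\<And>c v w. \<lbrakk>v \<in> carrier V; w \<in> carrier W\<rbrakk> \<Longrightarrow> B (c \<odot>\<^bsub>V\<^esub> v) w = c \<odot>\<^bsub>U\<^esub> B v w"
    and "\<And>c v w. \<lbrakk>v \<in> carrier V; w \<in> carrier W\<rbrakk> \<Longrightarrow> B v (c \<odot>\<^bsub>W\<^esub> w) = c \<odot>\<^bsub>U\<^esub> B v w"
  shows "bilinear V W U B"
  unfolding bilinear_def by (auto intro!: module_homI assms)

lemma bilinearD:
  fixes V :: "('k::field, 'v, 'm) module_scheme"
  assumes "bilinear V W U B"
  shows "\<And>v. v \<in> carrier V \<Longrightarrow> B v \<in> module_hom class_ring W U"
    and "\<And>w. w \<in> carrier W \<Longrightarrow> (\<lambda>v. B v w) \<in> module_hom class_ring V U"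
    and "\<lbrakk>v \<in> carrier V; w \<in> carrier W\<rbrakk> \<Longrightarrow> B v w \<in> carrier U"
    and "\<lbrakk>v \<in> carrier V; v' \<in> carrier V; w \<in> carrier W\<rbrakk> \<Longrightarrow>
      B (v \<oplus>\<^bsub>V\<^esub> v') w = B v w \<oplus>\<^bsub>U\<^esub> B v' w"
    and "\<lbrakk>v \<in> carrier V; w \<in> carrier W; w' \<in> carrier W\<rbrakk> \<Longrightarrow>
      B v (w \<oplus>\<^bsub>W\<^esub> w') = B v w \<oplus>\<^bsub>U\<^esub> B v w'"
    and "\<lbrakk>v \<in> carrier V; w \<in> carrier W\<rbrakk> \<Longrightarrow> B (c \<odot>\<^bsub>V\<^esub> v) w = c \<odot>\<^bsub>U\<^esub> B v w"
    and "\<lbrakk>v \<in> carrier V; w \<in> carrier W\<rbrakk> \<Longrightarrow> B v (c \<odot>\<^bsub>W\<^esub> w) = c \<odot>\<^bsub>U\<^esub> B v w"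
proof -
  show left: "B v \<in> module_hom class_ring W U" if "v \<in> carrier V" for v
    using assms that by (simp add: bilinear_def)
  show right: "(\<lambda>v. B v w) \<in> module_hom class_ring V U" if "w \<in> carrier W" for w
    using assms that by (simp add: bilinear_def)
  show "\<lbrakk>v \<in> carrier V; w \<in> carrier W\<rbrakk> \<Longrightarrow> B v w \<in> carrier U"
    and "\<lbrakk>v \<in> carrier V; v' \<in> carrier V; w \<in> carrier W\<rbrakk> \<Longrightarrow>
      B (v \<oplus>\<^bsub>V\<^esub> v') w = B v w \<oplus>\<^bsub>U\<^esub> B v' w"
    and "\<lbrakk>v \<in> carrier V; w \<in> carrier W; w' \<in> carrier W\<rbrakk> \<Longrightarrow>
      B v (w \<oplus>\<^bsub>W\<^esub> w') = B v w \<oplus>\<^bsub>U\<^esub> B v w'"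
    and "\<lbrakk>v \<in> carrier V; w \<in> carrier W\<rbrakk> \<Longrightarrow> B (c \<odot>\<^bsub>V\<^esub> v) w = c \<odot>\<^bsub>U\<^esub> B v w"
    and "\<lbrakk>v \<in> carrier V; w \<in> carrier W\<rbrakk> \<Longrightarrow> B v (c \<odot>\<^bsub>W\<^esub> w) = c \<odot>\<^bsub>U\<^esub> B v w"
    using module_homD[OF left] module_homD[OF right] by simp_all
qed

lemma relator_add_null:
  fixes U :: "('k::field, 'u, 'r) module_scheme"
  assumes U: "vectorspace class_ring U" and f: "f \<in> module_hom class_ring (free_space S) U"
    and S: "a \<in> S" "b \<in> S" "c \<in> S"
  shows "(\<lambda>p. free_gen a p - free_gen b p - free_gen c p) \<in> carrier (free_space S :: ('k, 'x \<Rightarrow> 'k) module)"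
    and "f (\<lambda>p. free_gen a p - free_gen b p - free_gen c p) = \<zero>\<^bsub>U\<^esub> \<longleftrightarrow>
      f (free_gen a) = f (free_gen b) \<oplus>\<^bsub>U\<^esub> f (free_gen c)"
proof -
  interpret U: kspace U by (rule kspace.intro[OF U])
  interpret F: kspace "free_space S :: ('k, 'x \<Rightarrow> 'k) module"
    by (rule kspace.intro[OF free_space_vectorspace])
  let ?F = "free_space S :: ('k, 'x \<Rightarrow> 'k) module"
  note gen = S[THEN free_gen_carrier[where 'b = 'k]]
  have r: "(\<lambda>p. free_gen a p - free_gen b p - free_gen c p) =
      free_gen a \<oplus>\<^bsub>?F\<^esub> (-1) \<odot>\<^bsub>?F\<^esub> (free_gen b \<oplus>\<^bsub>?F\<^esub> free_gen c)"
    by (simp add: free_space_simps(2-) fun_eq_iff)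
  show "(\<lambda>p. free_gen a p - free_gen b p - free_gen c p) \<in> carrier ?F"
    unfolding r using gen by simp
  have c: "f (free_gen a) \<in> carrier U" "f (free_gen b) \<in> carrier U" "f (free_gen c) \<in> carrier U"
    using module_homD(1)[OF f] gen by auto
  have "f (\<lambda>p. free_gen a p - free_gen b p - free_gen c p) =
      f (free_gen a) \<ominus>\<^bsub>U\<^esub> (f (free_gen b) \<oplus>\<^bsub>U\<^esub> f (free_gen c))"
    unfolding r a_minus_def
    using gen c module_homD(2,3)[OF f] U.scale_minus_one by simp
  then show "f (\<lambda>p. free_gen a p - free_gen b p - free_gen c p) = \<zero>\<^bsub>U\<^esub> \<longleftrightarrow>
      f (free_gen a) = f (free_gen b) \<oplus>\<^bsub>U\<^esub> f (free_gen c)"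
    using c by (simp add: U.minus_eq_zero_iff)
qed

lemma relator_scale_null:
  fixes U :: "('k::field, 'u, 'r) module_scheme"
  assumes U: "vectorspace class_ring U" and f: "f \<in> module_hom class_ring (free_space S) U"
    and S: "a \<in> S" "b \<in> S"
  shows "(\<lambda>p. free_gen a p - k * free_gen b p) \<in> carrier (free_space S :: ('k, 'x \<Rightarrow> 'k) module)"
    and "f (\<lambda>p. free_gen a p - k * free_gen b p) = \<zero>\<^bsub>U\<^esub> \<longleftrightarrow>
      f (free_gen a) = k \<odot>\<^bsub>U\<^esub> f (free_gen b)"
proof -
  interpret U: kspace U by (rule kspace.intro[OF U])
  interpret F: kspace "free_space S :: ('k, 'x \<Rightarrow> 'k) module"
    by (rule kspace.intro[OF free_space_vectorspace])
  let ?F = "free_space S :: ('k, 'x \<Rightarrow> 'k) module"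
  note gen = S[THEN free_gen_carrier[where 'b = 'k]]
  have r: "(\<lambda>p. free_gen a p - k * free_gen b p) =
      free_gen a \<oplus>\<^bsub>?F\<^esub> (-1) \<odot>\<^bsub>?F\<^esub> (k \<odot>\<^bsub>?F\<^esub> free_gen b)"
    by (simp add: free_space_simps(2-) fun_eq_iff)
  show "(\<lambda>p. free_gen a p - k * free_gen b p) \<in> carrier ?F"
    unfolding r using gen by simp
  have c: "f (free_gen a) \<in> carrier U" "f (free_gen b) \<in> carrier U"
    using module_homD(1)[OF f] gen by auto
  have "f (\<lambda>p. free_gen a p - k * free_gen b p) = f (free_gen a) \<ominus>\<^bsub>U\<^esub> k \<odot>\<^bsub>U\<^esub> f (free_gen b)"
    unfolding r a_minus_def
    using gen c module_homD(2,3)[OF f] U.scale_minus_one by simp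
  then show "f (\<lambda>p. free_gen a p - k * free_gen b p) = \<zero>\<^bsub>U\<^esub> \<longleftrightarrow>
      f (free_gen a) = k \<odot>\<^bsub>U\<^esub> f (free_gen b)"
    using c by (simp add: U.minus_eq_zero_iff)
qed

context
  fixes V :: "('k::field, 'v, 'm) module_scheme" and W :: "('k, 'w, 'n) module_scheme"
  assumes V: "vectorspace class_ring V" and W: "vectorspace class_ring W"
begin

interpretation V: kspace V by (rule kspace.intro[OF V])
interpretation W: kspace W by (rule kspace.intro[OF W])
interpretation F: vectorspace class_ring "free_space (carrier V \<times> carrier W) :: ('k, 'v \<times> 'w \<Rightarrow> 'k) module"
  by (rule free_space_vectorspace)

abbreviation (input) free_pairs :: "('k, 'v \<times> 'w \<Rightarrow> 'k) module" where
  "free_pairs \<equiv> free_space (carrier V \<times> carrier W)"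

text \<open>The four kinds of relators are the four conditions of bilinearity.\<close>

lemma tensor_relators_null_iff:
  assumes U: "vectorspace class_ring U" and f: "f \<in> module_hom class_ring free_pairs U"
  shows "(\<forall>r\<in>tensor_relators V W. f r = \<zero>\<^bsub>U\<^esub>) \<longleftrightarrow> bilinear V W U (\<lambda>v w. f (free_gen (v, w)))"
proof -
  note add = relator_add_null(2)[OF U f] and scale = relator_scale_null(2)[OF U f]
  have "f (free_gen (v, w)) \<in> carrier U" if "v \<in> carrier V" "w \<in> carrier W" for v w
    using that by (intro module_homD(1)[OF f] free_gen_carrier) auto
  note closed = this
  show ?thesis
  proof
    assume null: "\<forall>r\<in>tensor_relators V W. f r = \<zero>\<^bsub>U\<^esub>"
    show "bilinear V W U (\<lambda>v w. f (free_gen (v, w)))"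
    proof (rule bilinearI)
      fix v v' w assume v: "v \<in> carrier V" "v' \<in> carrier V" "w \<in> carrier W"
      then have "f (\<lambda>p. free_gen (v \<oplus>\<^bsub>V\<^esub> v', w) p - free_gen (v, w) p - free_gen (v', w) p) = \<zero>\<^bsub>U\<^esub>"
        by (intro null[rule_format]) (unfold tensor_relators_def, blast)
      with v show "f (free_gen (v \<oplus>\<^bsub>V\<^esub> v', w)) = f (free_gen (v, w)) \<oplus>\<^bsub>U\<^esub> f (free_gen (v', w))"
        by (simp add: add)
    next
      fix v w w' assume v: "v \<in> carrier V" "w \<in> carrier W" "w' \<in> carrier W"
      then have "f (\<lambda>p. free_gen (v, w \<oplus>\<^bsub>W\<^esub> w') p - free_gen (v, w) p - free_gen (v, w') p) = \<zero>\<^bsub>U\<^esub>"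
        by (intro null[rule_format]) (unfold tensor_relators_def, blast)
      with v show "f (free_gen (v, w \<oplus>\<^bsub>W\<^esub> w')) = f (free_gen (v, w)) \<oplus>\<^bsub>U\<^esub> f (free_gen (v, w'))"
        by (simp add: add)
    next
      fix c v w assume v: "v \<in> carrier V" "w \<in> carrier W"
      then have "f (\<lambda>p. free_gen (c \<odot>\<^bsub>V\<^esub> v, w) p - c * free_gen (v, w) p) = \<zero>\<^bsub>U\<^esub>"
        "f (\<lambda>p. free_gen (v, c \<odot>\<^bsub>W\<^esub> w) p - c * free_gen (v, w) p) = \<zero>\<^bsub>U\<^esub>"
        by (intro null[rule_format]; unfold tensor_relators_def, blast)+
      with v show "f (free_gen (c \<odot>\<^bsub>V\<^esub> v, w)) = c \<odot>\<^bsub>U\<^esub> f (free_gen (v, w))"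
        "f (free_gen (v, c \<odot>\<^bsub>W\<^esub> w)) = c \<odot>\<^bsub>U\<^esub> f (free_gen (v, w))"
        by (simp_all add: scale)
    qed (rule closed)
  next
    assume "bilinear V W U (\<lambda>v w. f (free_gen (v, w)))"
    note B = bilinearD(4-)[OF this]
    show "\<forall>r\<in>tensor_relators V W. f r = \<zero>\<^bsub>U\<^esub>"
      unfolding tensor_relators_def by (rule ballI, elim UnE CollectE exE conjE) (simp_all add: add scale B)
  qed
qed

lemma tensor_relators_subset: "tensor_relators V W \<subseteq> carrier free_pairs"
proof -
  have "(\<lambda>_. 0) \<in> module_hom class_ring free_pairs (ground_space :: ('k, 'k) module)"
    by (rule module_homI) auto
  note relators = relator_add_null(1)[OF ground_space_vectorspace this]
    relator_scale_null(1)[OF ground_space_vectorspace this]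
  show ?thesis
    by (auto simp: tensor_relators_def intro!: relators)
qed

lemma tensor_null_submodule: "LinearCombinations.submodule class_ring (tensor_null V W) free_pairs"
  unfolding tensor_null_def by (rule F.span_is_submodule[OF tensor_relators_subset])

lemma tensor_space_vectorspace: "vectorspace class_ring (tensor_space V W)"
  unfolding tensor_space_def
  by (rule quotient_space_vectorspace[OF free_space_vectorspace tensor_null_submodule])

lemma tensor_proj_hom:
  "a_r_coset free_pairs (tensor_null V W) \<in> module_hom class_ring free_pairs (tensor_space V W)"
  unfolding tensor_space_def
  by (rule quotient_proj_hom[OF free_space_vectorspace tensor_null_submodule])

lemma tens_bilinear: "bilinear V W (tensor_space V W) (tens V W)"
proof -
  have "a_r_coset free_pairs (tensor_null V W) r = \<zero>\<^bsub>tensor_space V W\<^esub>" if "r \<in> tensor_relators V W" for r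
  proof -
    interpret N: abelian_subgroup "tensor_null V W" free_pairs
      by (rule submodule_of_spaceD[OF free_space_vectorspace tensor_null_submodule])
    have "r \<in> tensor_null V W"
      unfolding tensor_null_def using F.in_own_span[OF tensor_relators_subset] that by blast
    then show ?thesis
      using N.a_rcos_const by (simp add: tensor_space_def quotient_space_def)
  qed
  then show ?thesis
    using tensor_relators_null_iff[OF tensor_space_vectorspace tensor_proj_hom]
    by (simp add: tens_def[abs_def])
qed

lemma tens_closed: "\<lbrakk>v \<in> carrier V; w \<in> carrier W\<rbrakk> \<Longrightarrow> tens V W v w \<in> carrier (tensor_space V W)"
  using bilinearD(3)[OF tens_bilinear] .

text \<open>The elementary tensors are the images of the generators of the free space.\<close>

lemma tensor_hom_eq:
  assumes U: "vectorspace class_ring U"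
    and f: "f \<in> module_hom class_ring (tensor_space V W) U"
    and g: "g \<in> module_hom class_ring (tensor_space V W) U"
    and eq: "\<And>v w. \<lbrakk>v \<in> carrier V; w \<in> carrier W\<rbrakk> \<Longrightarrow> f (tens V W v w) = g (tens V W v w)"
    and t: "t \<in> carrier (tensor_space V W)"
  shows "f t = g t"
proof -
  obtain a where a: "a \<in> carrier free_pairs" "t = a_r_coset free_pairs (tensor_null V W) a"
    using t by (auto simp: tensor_space_def
        quotient_space_ops(1)[OF free_space_vectorspace tensor_null_submodule])
  have "(\<lambda>a. f (a_r_coset free_pairs (tensor_null V W) a)) a = (\<lambda>a. g (a_r_coset free_pairs (tensor_null V W) a)) a"
    by (rule free_space_hom_eq[OF module_hom_comp[OF tensor_proj_hom f]
          module_hom_comp[OF tensor_proj_hom g] U _ a(1)])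
       (use eq in \<open>auto simp: tens_def\<close>)
  then show ?thesis by (simp add: a(2))
qed

lemma tensor_lift_ex1:
  assumes U: "vectorspace class_ring U" and B: "bilinear V W U B"
  shows "\<exists>!f. f \<in> lin_maps (tensor_space V W) U \<and>
    (\<forall>v\<in>carrier V. \<forall>w\<in>carrier W. f (tens V W v w) = B v w)"
proof (rule ex_ex1I)
  interpret U: kspace U by (rule kspace.intro[OF U])
  let ?f = "free_extend U (case_prod B)"
  have f: "?f \<in> module_hom class_ring free_pairs U"
    using bilinearD(3)[OF B] by (intro free_extend_hom[OF U]) auto
  have gen: "?f (free_gen (v, w)) = B v w" if "v \<in> carrier V" "w \<in> carrier W" for v w
    using bilinearD(3)[OF B that] by (simp add: free_extend_gen[OF U])
  have "bilinear V W U (\<lambda>v w. ?f (free_gen (v, w)))"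
    by (rule bilinearI) (simp_all add: gen bilinearD[OF B])
  then have relators: "?f r = \<zero>\<^bsub>U\<^esub>" if "r \<in> tensor_relators V W" for r
    using tensor_relators_null_iff[OF U f] that by blast
  have null: "?f n = \<zero>\<^bsub>U\<^esub>" if n: "n \<in> tensor_null V W" for n
  proof -
    obtain a A where A: "n = F.lincomb a A" "finite A" "A \<subseteq> tensor_relators V W"
      using n by (auto simp: tensor_null_def F.span_def)
    have sub: "A \<subseteq> carrier free_pairs" using A tensor_relators_subset by blast
    have "?f n = finsum U (\<lambda>r. ?f (a r \<odot>\<^bsub>free_pairs\<^esub> r)) A"
      unfolding A F.lincomb_def
      by (rule module_hom_finsum[OF f free_space_vectorspace U]) (use sub F.smult_closed in auto)
    also have "\<dots> = finsum U (\<lambda>r. \<zero>\<^bsub>U\<^esub>) A"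
      using A sub relators module_homD(3)[OF f] by (intro U.finsum_cong') (auto simp: subset_iff)
    finally show ?thesis by simp
  qed
  obtain h where "h \<in> lin_maps (tensor_space V W) U"
      "\<forall>x\<in>carrier free_pairs. h (a_r_coset free_pairs (tensor_null V W) x) = ?f x"
    using quotient_lift[OF free_space_vectorspace tensor_null_submodule U f null]
    unfolding tensor_space_def by blast
  then show "\<exists>f. f \<in> lin_maps (tensor_space V W) U \<and>
      (\<forall>v\<in>carrier V. \<forall>w\<in>carrier W. f (tens V W v w) = B v w)"
    using free_gen_carrier[where S = "carrier V \<times> carrier W" and 'b = 'k]
    by (intro exI[of _ h]) (auto simp: tens_def gen)
next
  fix f g
  assume f: "f \<in> lin_maps (tensor_space V W) U \<and> (\<forall>v\<in>carrier V. \<forall>w\<in>carrier W. f (tens V W v w) = B v w)"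
    and g: "g \<in> lin_maps (tensor_space V W) U \<and> (\<forall>v\<in>carrier V. \<forall>w\<in>carrier W. g (tens V W v w) = B v w)"
  have "f t = g t" if "t \<in> carrier (tensor_space V W)" for t
    by (rule tensor_hom_eq[OF U _ _ _ that]) (use f g in \<open>simp_all add: lin_maps_def\<close>)
  with f g show "f = g"
    unfolding lin_maps_def by (blast intro: extensionalityI)
qed

lemma tensor_lift:
  assumes U: "vectorspace class_ring U" and B: "bilinear V W U B"
  shows "tensor_lift V W U B \<in> module_hom class_ring (tensor_space V W) U"
    and "tensor_lift V W U B \<in> extensional (carrier (tensor_space V W))"
    and "\<lbrakk>v \<in> carrier V; w \<in> carrier W\<rbrakk> \<Longrightarrow> tensor_lift V W U B (tens V W v w) = B v w"
  using theI'[OF tensor_lift_ex1[OF U B]] by (auto simp: tensor_lift_def lin_maps_def)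

end

lemma module_hom_finsum_hom:
  fixes V :: "('k::field, 'v, 'm) module_scheme" and W :: "('k, 'w, 'n) module_scheme"
  assumes W: "vectorspace class_ring W" and I: "finite I"
    and f: "\<And>i. i \<in> I \<Longrightarrow> f i \<in> module_hom class_ring V W"
  shows "(\<lambda>x. finsum W (\<lambda>i. f i x) I) \<in> module_hom class_ring V W"
proof (rule module_homI)
  interpret W: kspace W by (rule kspace.intro[OF W])
  note f' = module_homD[OF f]
  fix x assume x: "x \<in> carrier V"
  show "finsum W (\<lambda>i. f i x) I \<in> carrier W"
    using x f' by (intro W.finsum_closed) auto
  show "finsum W (\<lambda>i. f i (c \<odot>\<^bsub>V\<^esub> x)) I = c \<odot>\<^bsub>W\<^esub> finsum W (\<lambda>i. f i x) I" for c
    using x f' I by (subst W.scale_finsum) (auto intro!: W.finsum_cong')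
  show "finsum W (\<lambda>i. f i (x \<oplus>\<^bsub>V\<^esub> y)) I = finsum W (\<lambda>i. f i x) I \<oplus>\<^bsub>W\<^esub> finsum W (\<lambda>i. f i y) I"
    if y: "y \<in> carrier V" for y
  proof -
    have "finsum W (\<lambda>i. f i (x \<oplus>\<^bsub>V\<^esub> y)) I = finsum W (\<lambda>i. f i x \<oplus>\<^bsub>W\<^esub> f i y) I"
      using x y f' by (intro W.finsum_cong') auto
    also have "\<dots> = finsum W (\<lambda>i. f i x) I \<oplus>\<^bsub>W\<^esub> finsum W (\<lambda>i. f i y) I"
      using x y f' by (intro W.finsum_addf) auto
    finally show ?thesis .
  qed
qed

lemma module_hom_scale_const:
  fixes V :: "('k::field, 'v, 'm) module_scheme" and W :: "('k, 'w, 'n) module_scheme"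
  assumes W: "vectorspace class_ring W" and f: "f \<in> module_hom class_ring V ground_space"
    and w: "w \<in> carrier W"
  shows "(\<lambda>x. f x \<odot>\<^bsub>W\<^esub> w) \<in> module_hom class_ring V W"
proof -
  interpret W: kspace W by (rule kspace.intro[OF W])
  show ?thesis
    using w module_homD[OF f] by (intro module_homI) (auto simp: W.scale_add_left W.scale_scale)
qed

lemma finsum_ground_space: "finsum ground_space f A = sum f A"
proof -
  interpret K: kspace "ground_space :: ('a, 'a) module"
    by (rule kspace.intro[OF ground_space_vectorspace])
  show ?thesis
    by (induction A rule: infinite_finite_induct) (simp_all add: K.finsum_infinite K.finsum_insert)
qed

section \<open>Coordinates on tensor products\<close>

text \<open>The vectors span the space and the functionals supply coefficients, so that equations between
  vectors can be checked by applying the functionals. The tensor products of two such systems form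
  one again, which makes equations in tensor products checkable.\<close>

definition coordinates ::
  "('k::field, 'v, 'm) module_scheme \<Rightarrow> 'i set \<Rightarrow> ('i \<Rightarrow> 'v) \<Rightarrow> ('i \<Rightarrow> 'v \<Rightarrow> 'k) \<Rightarrow> bool" where
  "coordinates V I e \<epsilon> \<longleftrightarrow> finite I \<and>
     (\<forall>i\<in>I. e i \<in> carrier V \<and> \<epsilon> i \<in> module_hom class_ring V ground_space) \<and>
     (\<forall>v\<in>carrier V. v = finsum V (\<lambda>i. \<epsilon> i v \<odot>\<^bsub>V\<^esub> e i) I)"

lemma coordinates_eqI:
  fixes V :: "('k::field, 'v, 'm) module_scheme"
  assumes V: "vectorspace class_ring V" and c: "coordinates V I e \<epsilon>"
    and "v \<in> carrier V" "w \<in> carrier V" "\<And>i. i \<in> I \<Longrightarrow> \<epsilon> i v = \<epsilon> i w"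
  shows "v = w"
proof -
  interpret V: kspace V by (rule kspace.intro[OF V])
  have "v = finsum V (\<lambda>i. \<epsilon> i v \<odot>\<^bsub>V\<^esub> e i) I"
    using assms by (simp add: coordinates_def)
  also have "\<dots> = finsum V (\<lambda>i. \<epsilon> i w \<odot>\<^bsub>V\<^esub> e i) I"
    using assms by (intro V.finsum_cong') (auto simp: coordinates_def)
  also have "\<dots> = w"
    using assms by (simp add: coordinates_def)
  finally show ?thesis .
qed

definition tensor_functional ::
  "('k::field, 'v, 'm) module_scheme \<Rightarrow> ('k, 'w, 'n) module_scheme \<Rightarrow> ('v \<Rightarrow> 'k) \<Rightarrow> ('w \<Rightarrow> 'k) \<Rightarrow>
   ('v \<times> 'w \<Rightarrow> 'k) set \<Rightarrow> 'k" where
  "tensor_functional V W \<phi> \<psi> = tensor_lift V W ground_space (\<lambda>v w. \<phi> v * \<psi> w)"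

lemma tensor_functional:
  fixes V :: "('k::field, 'v, 'm) module_scheme" and W :: "('k, 'w, 'n) module_scheme"
  assumes V: "vectorspace class_ring V" and W: "vectorspace class_ring W"
    and \<phi>: "\<phi> \<in> module_hom class_ring V ground_space" and \<psi>: "\<psi> \<in> module_hom class_ring W ground_space"
  shows "tensor_functional V W \<phi> \<psi> \<in> module_hom class_ring (tensor_space V W) ground_space"
    and "\<lbrakk>v \<in> carrier V; w \<in> carrier W\<rbrakk> \<Longrightarrow> tensor_functional V W \<phi> \<psi> (tens V W v w) = \<phi> v * \<psi> w"
proof -
  have "bilinear V W ground_space (\<lambda>v w. \<phi> v * \<psi> w)"
    using module_homD(2,3)[OF \<phi>] module_homD(2,3)[OF \<psi>]
    by (intro bilinearI) (auto simp: algebra_simps)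
  note lift = tensor_lift[OF V W ground_space_vectorspace this]
  show "tensor_functional V W \<phi> \<psi> \<in> module_hom class_ring (tensor_space V W) ground_space"
    and "\<lbrakk>v \<in> carrier V; w \<in> carrier W\<rbrakk> \<Longrightarrow> tensor_functional V W \<phi> \<psi> (tens V W v w) = \<phi> v * \<psi> w"
    unfolding tensor_functional_def by (rule lift(1), rule lift(3))
qed

text \<open>The asserted expansion is linear in the tensor, so it suffices to check it on elementary tensors,
  for which it is the product of the expansions of the two factors.\<close>

lemma tensor_coordinates:
  fixes V :: "('k::field, 'v, 'm) module_scheme" and W :: "('k, 'w, 'n) module_scheme"
  assumes V: "vectorspace class_ring V" and W: "vectorspace class_ring W"
    and cV: "coordinates V I e \<epsilon>" and cW: "coordinates W J f \<phi>"
  shows "coordinates (tensor_space V W) (I \<times> J) (\<lambda>(i, j). tens V W (e i) (f j))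
    (\<lambda>(i, j). tensor_functional V W (\<epsilon> i) (\<phi> j))"
proof -
  let ?T = "tensor_space V W"
  let ?F = "\<lambda>i j. tensor_functional V W (\<epsilon> i) (\<phi> j)"
  note T = tensor_space_vectorspace[OF V W]
  interpret V: kspace V by (rule kspace.intro[OF V])
  interpret W: kspace W by (rule kspace.intro[OF W])
  interpret T: kspace ?T by (rule kspace.intro[OF T])
  note B = bilinearD[OF tens_bilinear[OF V W]]
  have I: "finite I" "\<And>i. i \<in> I \<Longrightarrow> e i \<in> carrier V" "\<And>i. i \<in> I \<Longrightarrow> \<epsilon> i \<in> module_hom class_ring V ground_space"
    "\<And>v. v \<in> carrier V \<Longrightarrow> finsum V (\<lambda>i. \<epsilon> i v \<odot>\<^bsub>V\<^esub> e i) I = v"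
    using cV by (auto simp: coordinates_def)
  have J: "finite J" "\<And>i. i \<in> J \<Longrightarrow> f i \<in> carrier W" "\<And>i. i \<in> J \<Longrightarrow> \<phi> i \<in> module_hom class_ring W ground_space"
    "\<And>v. v \<in> carrier W \<Longrightarrow> finsum W (\<lambda>i. \<phi> i v \<odot>\<^bsub>W\<^esub> f i) J = v"
    using cW by (auto simp: coordinates_def)
  note F = tensor_functional[OF V W I(3) J(3)]
  let ?R = "\<lambda>t. finsum ?T (\<lambda>(i, j). ?F i j t \<odot>\<^bsub>?T\<^esub> tens V W (e i) (f j)) (I \<times> J)"
  have hom: "?R \<in> module_hom class_ring ?T ?T"
    unfolding case_prod_beta
    by (rule module_hom_finsum_hom[OF T])
       (use I J F B in \<open>auto intro!: module_hom_scale_const[OF T]\<close>)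
  have "?R (tens V W v w) = tens V W v w" if vw: "v \<in> carrier V" "w \<in> carrier W" for v w
  proof -
    have "tens V W v w = tens V W (finsum V (\<lambda>i. \<epsilon> i v \<odot>\<^bsub>V\<^esub> e i) I) w"
      using I(4) vw by simp
    also have "\<dots> = finsum ?T (\<lambda>i. tens V W (\<epsilon> i v \<odot>\<^bsub>V\<^esub> e i) w) I"
      by (rule module_hom_finsum[OF B(2) V T]) (use vw I in auto)
    also have "\<dots> = finsum ?T (\<lambda>i. finsum ?T (\<lambda>j. ?F i j (tens V W v w) \<odot>\<^bsub>?T\<^esub> tens V W (e i) (f j)) J) I"
    proof (rule T.finsum_cong'[OF refl], intro Pi_I T.finsum_closed)
      fix i assume i: "i \<in> I"
      have "tens V W (\<epsilon> i v \<odot>\<^bsub>V\<^esub> e i) w = \<epsilon> i v \<odot>\<^bsub>?T\<^esub> tens V W (e i) (finsum W (\<lambda>j. \<phi> j w \<odot>\<^bsub>W\<^esub> f j) J)"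
        using B(6)[of "e i" w "\<epsilon> i v"] I i vw J(4) by simp
      also have "tens V W (e i) (finsum W (\<lambda>j. \<phi> j w \<odot>\<^bsub>W\<^esub> f j) J)
          = finsum ?T (\<lambda>j. tens V W (e i) (\<phi> j w \<odot>\<^bsub>W\<^esub> f j)) J"
        by (rule module_hom_finsum[OF B(1) W T]) (use vw I i J in auto)
      also have "\<epsilon> i v \<odot>\<^bsub>?T\<^esub> \<dots> = finsum ?T (\<lambda>j. \<epsilon> i v \<odot>\<^bsub>?T\<^esub> tens V W (e i) (\<phi> j w \<odot>\<^bsub>W\<^esub> f j)) J"
        using i I J B(3) by (intro T.scale_finsum) auto
      also have "\<dots> = finsum ?T (\<lambda>j. ?F i j (tens V W v w) \<odot>\<^bsub>?T\<^esub> tens V W (e i) (f j)) J"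
        using i I J B(3,7) vw F by (intro T.finsum_cong') (auto simp: T.scale_scale)
      finally show "tens V W (\<epsilon> i v \<odot>\<^bsub>V\<^esub> e i) w = finsum ?T (\<lambda>j. ?F i j (tens V W v w) \<odot>\<^bsub>?T\<^esub> tens V W (e i) (f j)) J" .
    next
      fix i j assume "i \<in> I" "j \<in> J"
      then show "?F i j (tens V W v w) \<odot>\<^bsub>?T\<^esub> tens V W (e i) (f j) \<in> carrier ?T"
        using I J B(3) by auto
    qed
    also have "\<dots> = ?R (tens V W v w)"
      using I J B(3) T.add.finprod_finprod[of I J "\<lambda>i j. ?F i j (tens V W v w) \<odot>\<^bsub>?T\<^esub> tens V W (e i) (f j)"]
      by (simp add: finsum_def)
    finally show ?thesis by simp
  qed
  then have "t = ?R t" if "t \<in> carrier ?T" for t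
    using tensor_hom_eq[OF V W T hom _ _ that, of "\<lambda>t. t"]
    by (auto simp: LinearCombinations.module_hom_def)
  then show ?thesis
    using I J B(3) F(1) by (auto simp: coordinates_def case_prod_unfold)
qed

section \<open>The Hopf algebra of functions on a finite group\<close>

lemma function_hopf_simps [simp]:
  "carrier (function_hopf G) = carrier G \<rightarrow>\<^sub>E UNIV"
  "f \<oplus>\<^bsub>function_hopf G\<^esub> f' = (\<lambda>x\<in>carrier G. f x + f' x)"
  "f \<otimes>\<^bsub>function_hopf G\<^esub> f' = (\<lambda>x\<in>carrier G. f x * f' x)"
  "\<zero>\<^bsub>function_hopf G\<^esub> = (\<lambda>x\<in>carrier G. 0)"
  "\<one>\<^bsub>function_hopf G\<^esub> = (\<lambda>x\<in>carrier G. 1)"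
  "c \<odot>\<^bsub>function_hopf G\<^esub> f = (\<lambda>x\<in>carrier G. c * f x)"
  "counit (function_hopf G) f = f \<one>\<^bsub>G\<^esub>"
  "antipode (function_hopf G) f = (\<lambda>g\<in>carrier G. f (inv\<^bsub>G\<^esub> g))"
  by (simp_all add: function_hopf_def function_algebra_def module.defs hopf.defs)

lemma function_algebra_simps:
  "carrier (function_algebra G) = carrier (function_hopf G)"
  "add (function_algebra G) = add (function_hopf G)"
  "module.smult (function_algebra G) = module.smult (function_hopf G)"
  "zero (function_algebra G) = zero (function_hopf G)"
  by (simp_all add: function_hopf_def function_algebra_def module.defs hopf.defs)

lemma function_algebra_tensor:
  "tensor_space (function_algebra G) (function_algebra G) = tensor_space (function_hopf G) (function_hopf G)"
  "tens (function_algebra G) (function_algebra G) = tens (function_hopf G) (function_hopf G)"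
  unfolding tensor_space_def tens_def[abs_def] tensor_null_def tensor_relators_def function_algebra_simps
  by (rule refl)+

lemma module_hom_function_algebra:
  "module_hom class_ring V (function_algebra G) = module_hom class_ring V (function_hopf G)"
  by (simp add: LinearCombinations.module_hom_def function_algebra_simps)

lemma comult_function_hopf:
  "comult (function_hopf G) f = finsum (tensor_space (function_hopf G) (function_hopf G))
     (\<lambda>(g, h). f (g \<otimes>\<^bsub>G\<^esub> h) \<odot>\<^bsub>tensor_space (function_hopf G) (function_hopf G)\<^esub>
        tens (function_hopf G) (function_hopf G) (point_mass G g) (point_mass G h))
     (carrier G \<times> carrier G)"
  unfolding function_algebra_tensor[symmetric]
  by (simp add: function_hopf_def module.defs hopf.defs)

lemma function_hopf_vectorspace:
  "vectorspace class_ring (function_hopf G :: ('k::field, 'g \<Rightarrow> 'k) hopf)"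
proof (rule vectorspace_class_ringI)
  show "abelian_group (function_hopf G :: ('k, 'g \<Rightarrow> 'k) hopf)"
  proof (rule abelian_groupI)
    fix f :: "'g \<Rightarrow> 'k" assume "f \<in> carrier (function_hopf G)"
    then show "\<exists>f'\<in>carrier (function_hopf G). f' \<oplus>\<^bsub>function_hopf G\<^esub> f = \<zero>\<^bsub>function_hopf G\<^esub>"
      by (intro bexI[of _ "\<lambda>x\<in>carrier G. - f x"]) (auto simp: restrict_def)
  qed (auto simp: restrict_def fun_eq_iff PiE_iff extensional_def algebra_simps)
qed (auto simp: restrict_def fun_eq_iff PiE_iff extensional_def algebra_simps)

lemma function_algebra_vectorspace:
  "vectorspace class_ring (function_algebra G :: ('k::field, 'g \<Rightarrow> 'k) module)"
proof (rule vectorspace_class_ringI)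
  show "abelian_group (function_algebra G :: ('k, 'g \<Rightarrow> 'k) module)"
  proof (rule abelian_groupI)
    fix f :: "'g \<Rightarrow> 'k" assume "f \<in> carrier (function_algebra G)"
    then show "\<exists>f'\<in>carrier (function_algebra G). f' \<oplus>\<^bsub>function_algebra G\<^esub> f = \<zero>\<^bsub>function_algebra G\<^esub>"
      by (intro bexI[of _ "\<lambda>x\<in>carrier G. - f x"]) (auto simp: function_algebra_simps restrict_def)
  qed (auto simp: function_algebra_simps restrict_def fun_eq_iff PiE_iff extensional_def algebra_simps)
qed (auto simp: function_algebra_simps restrict_def fun_eq_iff PiE_iff extensional_def algebra_simps)

lemma function_hopf_eval_hom:
  "g \<in> carrier G \<Longrightarrow> (\<lambda>f. f g) \<in> module_hom class_ring (function_hopf G) ground_space"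
  by (rule module_homI) auto

lemma point_mass_carrier [simp]: "point_mass G g \<in> carrier (function_hopf G)"
  by (simp add: point_mass_def)

lemma point_mass_outside [simp]: "x \<notin> carrier G \<Longrightarrow> point_mass G g x = undefined"
  by (simp add: point_mass_def)

lemma function_hopf_finsum_eval:
  fixes F :: "'i \<Rightarrow> 'g \<Rightarrow> 'k::field"
  assumes "\<And>i. i \<in> I \<Longrightarrow> F i \<in> carrier (function_hopf G)" "x \<in> carrier G"
  shows "finsum (function_hopf G) F I x = (\<Sum>i\<in>I. F i x)"
  using module_hom_finsum[OF function_hopf_eval_hom[OF assms(2)] function_hopf_vectorspace
      ground_space_vectorspace assms(1)]
  by (simp add: finsum_ground_space)

lemma function_hopf_coordinates:
  assumes "finite (carrier G)"
  shows "coordinates (function_hopf G) (carrier G) (point_mass G) (\<lambda>g f. f g :: 'k::field)"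
proof -
  let ?L = "function_hopf G :: ('k, 'a \<Rightarrow> 'k) hopf"
  interpret L: kspace ?L by (rule kspace.intro[OF function_hopf_vectorspace])
  have "f = finsum ?L (\<lambda>g. f g \<odot>\<^bsub>?L\<^esub> point_mass G g) (carrier G)" (is "f = ?S")
    if f: "f \<in> carrier ?L" for f
  proof (rule extensionalityI[of _ "carrier G"])
    have "?S \<in> carrier ?L"
      by (intro L.finsum_closed) auto
    then show "?S \<in> extensional (carrier G)" "f \<in> extensional (carrier G)"
      using f by (auto simp: PiE_iff)
    show "f x = ?S x" if "x \<in> carrier G" for x
      using that assms
      by (subst function_hopf_finsum_eval) (auto simp: point_mass_def if_distrib[of "(*) _"] cong: if_cong)
  qed
  then show ?thesis
    using assms function_hopf_eval_hom by (auto simp: coordinates_def)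
qed

locale function_hopf_algebra = group G for G :: "('g, 'm) monoid_scheme" (structure) +
  fixes L :: "('k::field, 'g \<Rightarrow> 'k) hopf"
  assumes finite_group: "finite (carrier G)" and L_def: "L = function_hopf G"
begin

abbreviation (input) "LL \<equiv> tensor_space L L"

lemma L_space: "vectorspace class_ring L"
  unfolding L_def by (rule function_hopf_vectorspace)

sublocale L: kspace L by (rule kspace.intro[OF L_space])

lemmas LL_space = tensor_space_vectorspace[OF L_space L_space]
lemmas L_LL_space = tensor_space_vectorspace[OF L_space LL_space]
lemmas LL_L_space = tensor_space_vectorspace[OF LL_space L_space]

lemma eval_hom: "g \<in> carrier G \<Longrightarrow> (\<lambda>f. f g) \<in> module_hom class_ring L ground_space"
  unfolding L_def by (rule function_hopf_eval_hom)

text \<open>Under the identification of \<open>L \<otimes> L\<close> with the functions on \<open>G \<times> G\<close>, this is evaluation at \<open>(g, h)\<close>.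
  Since these functionals are coordinates, the axioms of a Hopf algebra can be verified pointwise.\<close>

definition ev2 :: "'g \<Rightarrow> 'g \<Rightarrow> (('g \<Rightarrow> 'k) \<times> ('g \<Rightarrow> 'k) \<Rightarrow> 'k) set \<Rightarrow> 'k" where
  "ev2 g h = tensor_functional L L (\<lambda>f. f g) (\<lambda>f. f h)"

lemma ev2_hom: "\<lbrakk>g \<in> carrier G; h \<in> carrier G\<rbrakk> \<Longrightarrow> ev2 g h \<in> module_hom class_ring LL ground_space"
  and ev2_tens: "\<lbrakk>g \<in> carrier G; h \<in> carrier G; a \<in> carrier L; b \<in> carrier L\<rbrakk> \<Longrightarrow>
    ev2 g h (tens L L a b) = a g * b h"
  unfolding ev2_def using tensor_functional[OF L_space L_space eval_hom eval_hom] by auto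

lemma L_coordinates: "coordinates L (carrier G) (point_mass G) (\<lambda>g f. f g)"
  unfolding L_def by (rule function_hopf_coordinates[OF finite_group])

lemma ev2_eqI:
  assumes "s \<in> carrier LL" "t \<in> carrier LL"
    and "\<And>g h. \<lbrakk>g \<in> carrier G; h \<in> carrier G\<rbrakk> \<Longrightarrow> ev2 g h s = ev2 g h t"
  shows "s = t"
  by (rule coordinates_eqI[OF LL_space tensor_coordinates[OF L_space L_space L_coordinates L_coordinates]
        assms(1,2)])
     (use assms(3) in \<open>clarsimp simp: ev2_def\<close>)

lemma ev2_unique:
  assumes "F \<in> module_hom class_ring LL ground_space" "g \<in> carrier G" "h \<in> carrier G"
    and "\<And>a b. \<lbrakk>a \<in> carrier L; b \<in> carrier L\<rbrakk> \<Longrightarrow> F (tens L L a b) = a g * b h"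
    and "t \<in> carrier LL"
  shows "F t = ev2 g h t"
  by (rule tensor_hom_eq[OF L_space L_space ground_space_vectorspace assms(1) ev2_hom[OF assms(2,3)] _ assms(5)])
     (simp add: assms(2-4) ev2_tens)

lemma point_mass_in_L: "point_mass G x \<in> carrier L"
  unfolding L_def by (rule point_mass_carrier)

lemma comult_carrier: "comult L f \<in> carrier LL"
proof -
  interpret LL: kspace LL by (rule kspace.intro[OF LL_space])
  show ?thesis
    unfolding comult_function_hopf[of G f, folded L_def]
    using tens_closed[OF L_space L_space point_mass_in_L point_mass_in_L]
    by (intro LL.finsum_closed) auto
qed

lemma ev2_comult:
  assumes g: "g \<in> carrier G" and h: "h \<in> carrier G"
  shows "ev2 g h (comult L f) = f (g \<otimes> h)"
proof -
  interpret LL: kspace LL by (rule kspace.intro[OF LL_space])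
  note pm = point_mass_in_L
  note tens = tens_closed[OF L_space L_space pm pm]
  have "ev2 g h (comult L f) = (\<Sum>(x, y)\<in>carrier G \<times> carrier G.
      ev2 g h (f (x \<otimes> y) \<odot>\<^bsub>LL\<^esub> tens L L (point_mass G x) (point_mass G y)))"
    unfolding comult_function_hopf[of G f, folded L_def]
    using module_hom_finsum[OF ev2_hom[OF g h] LL_space ground_space_vectorspace,
        of "carrier G \<times> carrier G" "\<lambda>(x, y). f (x \<otimes> y) \<odot>\<^bsub>LL\<^esub> tens L L (point_mass G x) (point_mass G y)"] tens
    by (simp add: finsum_ground_space case_prod_unfold)
  also have "\<dots> = (\<Sum>(x, y)\<in>carrier G \<times> carrier G. f (x \<otimes> y) * (point_mass G x g * point_mass G y h))"
    using tens g h module_homD(3)[OF ev2_hom[OF g h]] ev2_tens[OF g h pm pm]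
    by (intro sum.cong) auto
  also have "\<dots> = (\<Sum>x\<in>carrier G. \<Sum>y\<in>carrier G. if y = h then (if x = g then f (x \<otimes> y) else 0) else 0)"
    unfolding sum.cartesian_product[symmetric]
    using g h by (intro sum.cong refl) (auto simp: point_mass_def)
  also have "\<dots> = f (g \<otimes> h)"
    using finite_group g h by (simp add: sum.delta)
  finally show ?thesis .
qed

lemma ev3_eqI:
  assumes "s \<in> carrier (tensor_space L LL)" "t \<in> carrier (tensor_space L LL)"
    and "\<And>p q r. \<lbrakk>p \<in> carrier G; q \<in> carrier G; r \<in> carrier G\<rbrakk> \<Longrightarrow>
      tensor_functional L LL (\<lambda>f. f p) (ev2 q r) s = tensor_functional L LL (\<lambda>f. f p) (ev2 q r) t"
  shows "s = t"
  by (rule coordinates_eqI[OF L_LL_space tensor_coordinates[OF L_space LL_space L_coordinates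
          tensor_coordinates[OF L_space L_space L_coordinates L_coordinates]] assms(1,2)])
     (use assms(3) in \<open>clarsimp simp: ev2_def\<close>)

definition ev3 :: "'g \<Rightarrow> 'g \<Rightarrow> 'g \<Rightarrow> _ \<Rightarrow> 'k" where
  "ev3 p q r = tensor_functional L LL (\<lambda>f. f p) (ev2 q r)"

lemma ev3_hom: "\<lbrakk>p \<in> carrier G; q \<in> carrier G; r \<in> carrier G\<rbrakk> \<Longrightarrow>
    ev3 p q r \<in> module_hom class_ring (tensor_space L LL) ground_space"
  and ev3_tens: "\<lbrakk>p \<in> carrier G; q \<in> carrier G; r \<in> carrier G; a \<in> carrier L; t \<in> carrier LL\<rbrakk> \<Longrightarrow>
    ev3 p q r (tens L LL a t) = a p * ev2 q r t"
  unfolding ev3_def using tensor_functional[OF L_space LL_space eval_hom ev2_hom] by auto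

lemma L_carrierI: "f \<in> extensional (carrier G) \<Longrightarrow> f \<in> carrier L"
  by (simp add: L_def PiE_iff)

lemma L_eqI: "\<lbrakk>f \<in> carrier L; f' \<in> carrier L; \<And>g. g \<in> carrier G \<Longrightarrow> f g = f' g\<rbrakk> \<Longrightarrow> f = f'"
  by (rule extensionalityI[of _ "carrier G"]) (auto simp: L_def PiE_iff)

lemma comult_hom: "comult L \<in> module_hom class_ring L LL"
proof (rule module_homI)
  interpret LL: kspace LL by (rule kspace.intro[OF LL_space])
  show "comult L (f \<oplus>\<^bsub>L\<^esub> f') = comult L f \<oplus>\<^bsub>LL\<^esub> comult L f'" for f f'
    by (rule ev2_eqI) (simp_all add: comult_carrier module_homD(2)[OF ev2_hom] ev2_comult, simp add: L_def)
  show "comult L (c \<odot>\<^bsub>L\<^esub> f) = c \<odot>\<^bsub>LL\<^esub> comult L f" for c f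
    by (rule ev2_eqI) (simp_all add: comult_carrier module_homD(3)[OF ev2_hom] ev2_comult, simp add: L_def)
qed (rule comult_carrier)

lemma L_ring: "ring L"
proof (rule ringI)
  show "abelian_group L" by (rule L.abelian_group_axioms)
  show "monoid L"
    by (rule monoidI) (auto simp: L_def restrict_def fun_eq_iff PiE_iff extensional_def algebra_simps)
qed (auto simp: L_def restrict_def fun_eq_iff PiE_iff extensional_def algebra_simps)

text \<open>A functional on the values of a lift of a bilinear map out of \<open>L \<otimes> L\<close> is computed on
  \<open>\<Delta> a\<close> by recognising it as one of the coordinate functionals.\<close>

lemma lift_comult:
  assumes U: "vectorspace class_ring U" and B: "bilinear L L U B"
    and \<phi>: "\<phi> \<in> module_hom class_ring U ground_space"
    and g: "g \<in> carrier G" and h: "h \<in> carrier G"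
    and eq: "\<And>a b. \<lbrakk>a \<in> carrier L; b \<in> carrier L\<rbrakk> \<Longrightarrow> \<phi> (B a b) = a g * b h"
  shows "\<phi> (tensor_lift L L U B (comult L f)) = f (g \<otimes> h)"
proof -
  note lift = tensor_lift[OF L_space L_space U B]
  have "(\<lambda>t. \<phi> (tensor_lift L L U B t)) (comult L f) = ev2 g h (comult L f)"
    by (rule ev2_unique[OF module_hom_comp[OF lift(1) \<phi>] g h _ comult_carrier])
       (simp add: lift(3) eq)
  then show ?thesis
    by (simp add: ev2_comult g h)
qed

lemma lift_comult_in_L:
  assumes B: "bilinear L L L B" and "r \<in> carrier L"
    and "\<And>x. x \<in> carrier G \<Longrightarrow> g x \<in> carrier G \<and> h x \<in> carrier G \<and> f (g x \<otimes> h x) = r x"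
    and "\<And>x a b. \<lbrakk>x \<in> carrier G; a \<in> carrier L; b \<in> carrier L\<rbrakk> \<Longrightarrow> B a b x = a (g x) * b (h x)"
  shows "tensor_lift L L L B (comult L f) = r"
proof (rule L_eqI)
  show "tensor_lift L L L B (comult L f) \<in> carrier L"
    by (rule module_homD(1)[OF tensor_lift(1)[OF L_space L_space L_space B] comult_carrier])
  show "tensor_lift L L L B (comult L f) x = r x" if "x \<in> carrier G" for x
    using lift_comult[OF L_space B eval_hom[OF that], of "g x" "h x" f] assms(3,4) that by simp
qed fact

lemma L_bilinear:
  assumes "\<And>a b. \<lbrakk>a \<in> carrier L; b \<in> carrier L\<rbrakk> \<Longrightarrow> B a b \<in> carrier L"
    and "\<And>x a b. \<lbrakk>x \<in> carrier G; a \<in> carrier L; b \<in> carrier L\<rbrakk> \<Longrightarrow> B a b x = a (g x) * b (h x)"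
    and "\<And>x. x \<in> carrier G \<Longrightarrow> g x \<in> carrier G \<and> h x \<in> carrier G"
  shows "bilinear L L L B"
proof (rule bilinearI)
  have ops: "f \<oplus>\<^bsub>L\<^esub> f' = (\<lambda>x\<in>carrier G. f x + f' x)" "c \<odot>\<^bsub>L\<^esub> f = (\<lambda>x\<in>carrier G. c * f x)" for f f' c
    by (simp_all add: L_def)
  fix v v' w c assume [simp]: "v \<in> carrier L" "v' \<in> carrier L" "w \<in> carrier L"
  note [simp] = assms
  show "B (v \<oplus>\<^bsub>L\<^esub> v') w = B v w \<oplus>\<^bsub>L\<^esub> B v' w"
    by (rule L_eqI) (simp_all, simp_all add: ops algebra_simps)
  show "B w (v \<oplus>\<^bsub>L\<^esub> v') = B w v \<oplus>\<^bsub>L\<^esub> B w v'"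
    by (rule L_eqI) (simp_all, simp_all add: ops algebra_simps)
  show "B (c \<odot>\<^bsub>L\<^esub> v) w = c \<odot>\<^bsub>L\<^esub> B v w"
    by (rule L_eqI) (simp_all, simp_all add: ops algebra_simps)
  show "B w (c \<odot>\<^bsub>L\<^esub> v) = c \<odot>\<^bsub>L\<^esub> B w v"
    by (rule L_eqI) (simp_all, simp_all add: ops algebra_simps)
qed (rule assms)

lemma L_ops: "f \<oplus>\<^bsub>L\<^esub> f' = (\<lambda>x\<in>carrier G. f x + f' x)" "c \<odot>\<^bsub>L\<^esub> f = (\<lambda>x\<in>carrier G. c * f x)"
  "f \<otimes>\<^bsub>L\<^esub> f' = (\<lambda>x\<in>carrier G. f x * f' x)" "\<one>\<^bsub>L\<^esub> = (\<lambda>x\<in>carrier G. 1)"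
  "counit L f = f \<one>" "antipode L f = (\<lambda>g\<in>carrier G. f (inv g))"
  by (simp_all add: L_def)

lemma L_lambda [simp]: "(\<lambda>x\<in>carrier G. F x) \<in> carrier L"
  by (simp add: L_carrierI)

lemma tens_mult_bilinear:
  assumes a: "a \<in> carrier L" and b: "b \<in> carrier L"
  shows "bilinear L L LL (\<lambda>c d. tens L L (a \<otimes>\<^bsub>L\<^esub> c) (b \<otimes>\<^bsub>L\<^esub> d))"
proof -
  interpret LL: kspace LL by (rule kspace.intro[OF LL_space])
  have mult: "a \<otimes>\<^bsub>L\<^esub> c \<in> carrier L" for a c by (simp add: L_ops)
  note B = bilinearD[OF tens_bilinear[OF L_space L_space]]
  have "x \<otimes>\<^bsub>L\<^esub> (c \<oplus>\<^bsub>L\<^esub> d) = x \<otimes>\<^bsub>L\<^esub> c \<oplus>\<^bsub>L\<^esub> x \<otimes>\<^bsub>L\<^esub> d"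
    "x \<otimes>\<^bsub>L\<^esub> (k \<odot>\<^bsub>L\<^esub> c) = k \<odot>\<^bsub>L\<^esub> (x \<otimes>\<^bsub>L\<^esub> c)" for x c d k
    by (auto simp: L_ops restrict_def fun_eq_iff algebra_simps)
  then show ?thesis
    by (intro bilinearI) (simp_all add: B mult)
qed

text \<open>In terms of functions of two variables, the product of \<open>L \<otimes> L\<close> is pointwise. This describes
  also the inner lift of its definition, whence the bilinearity that the outer lift needs.\<close>

lemma ev2_tensor_mult:
  assumes g: "g \<in> carrier G" and h: "h \<in> carrier G" and s: "s \<in> carrier LL" and t: "t \<in> carrier LL"
  shows "tensor_mult L s t \<in> carrier LL" and "ev2 g h (tensor_mult L s t) = ev2 g h s * ev2 g h t"
proof -
  interpret LL: kspace LL by (rule kspace.intro[OF LL_space])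
  let ?I = "\<lambda>a b. tensor_lift L L LL (\<lambda>c d. tens L L (a \<otimes>\<^bsub>L\<^esub> c) (b \<otimes>\<^bsub>L\<^esub> d))"
  have mult: "a \<otimes>\<^bsub>L\<^esub> c \<in> carrier L" for a c by (simp add: L_ops)
  note inner = tensor_lift[OF L_space L_space LL_space tens_mult_bilinear]
  have closed: "?I a b t \<in> carrier LL" if "a \<in> carrier L" "b \<in> carrier L" for a b
    using module_homD(1)[OF inner(1)[OF that] t] .
  have ev: "ev2 x y (?I a b t) = a x * b y * ev2 x y t"
    if xy: "x \<in> carrier G" "y \<in> carrier G" and ab: "a \<in> carrier L" "b \<in> carrier L" for x y a b
  proof -
    have scaled: "(\<lambda>t. a x * b y * ev2 x y t) \<in> module_hom class_ring LL ground_space"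
      using module_homD(2,3)[OF ev2_hom[OF xy]] by (intro module_homI) (auto simp: algebra_simps)
    show ?thesis
      by (rule tensor_hom_eq[OF L_space L_space ground_space_vectorspace
            module_hom_comp[OF inner(1)[OF ab] ev2_hom[OF xy]] scaled _ t])
         (simp add: inner(3)[OF ab] ev2_tens xy ab mult, simp add: L_ops xy)
  qed
  have "bilinear L L LL (\<lambda>a b. ?I a b t)"
  proof (rule bilinearI)
    fix a a' b c assume [simp]: "a \<in> carrier L" "a' \<in> carrier L" "b \<in> carrier L"
    note [simp] = closed ev module_homD(2,3)[OF ev2_hom]
    show "?I (a \<oplus>\<^bsub>L\<^esub> a') b t = ?I a b t \<oplus>\<^bsub>LL\<^esub> ?I a' b t"
      by (rule ev2_eqI) (simp_all, simp add: L_ops algebra_simps)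
    show "?I b (a \<oplus>\<^bsub>L\<^esub> a') t = ?I b a t \<oplus>\<^bsub>LL\<^esub> ?I b a' t"
      by (rule ev2_eqI) (simp_all, simp add: L_ops algebra_simps)
    show "?I (c \<odot>\<^bsub>L\<^esub> a) b t = c \<odot>\<^bsub>LL\<^esub> ?I a b t"
      by (rule ev2_eqI) (simp_all, simp add: L_ops algebra_simps)
    show "?I b (c \<odot>\<^bsub>L\<^esub> a) t = c \<odot>\<^bsub>LL\<^esub> ?I b a t"
      by (rule ev2_eqI) (simp_all, simp add: L_ops algebra_simps)
  qed (rule closed)
  note outer = tensor_lift[OF L_space L_space LL_space this]
  show "tensor_mult L s t \<in> carrier LL"
    unfolding tensor_mult_def by (rule module_homD(1)[OF outer(1) s])
  have scaled: "(\<lambda>s. ev2 g h s * ev2 g h t) \<in> module_hom class_ring LL ground_space"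
    using module_homD(2,3)[OF ev2_hom[OF g h]] by (intro module_homI) (auto simp: algebra_simps)
  show "ev2 g h (tensor_mult L s t) = ev2 g h s * ev2 g h t"
    unfolding tensor_mult_def
    by (rule tensor_hom_eq[OF L_space L_space ground_space_vectorspace
          module_hom_comp[OF outer(1) ev2_hom[OF g h]] scaled _ s])
       (simp add: outer(3) ev ev2_tens g h)
qed

text \<open>Read as functions of three variables, the two sides take the values \<open>a ((p q) r)\<close> and \<open>a (p (q r))\<close>
  at \<open>(p, q, r)\<close>.\<close>

lemma comult_coassoc:
  "tensor_lift LL L (tensor_space L LL)
     (\<lambda>s z. tensor_lift L L (tensor_space L LL) (\<lambda>x y. tens L LL x (tens L L y z)) s)
     (tensor_lift L L (tensor_space LL L) (\<lambda>x y. tens LL L (comult L x) y) (comult L a))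
   = tensor_lift L L (tensor_space L LL) (\<lambda>x y. tens L LL x (comult L y)) (comult L a)"
  (is "tensor_lift LL L ?LLL (\<lambda>s z. ?A z s) (?B (comult L a)) = ?C (comult L a)")
proof (rule ev3_eqI[folded ev3_def])
  interpret LL: kspace LL by (rule kspace.intro[OF LL_space])
  interpret LLL: kspace ?LLL by (rule kspace.intro[OF L_LL_space])
  note b = bilinearD[OF tens_bilinear[OF L_space L_space]]
  note b' = bilinearD[OF tens_bilinear[OF L_space LL_space]]
  note b'' = bilinearD[OF tens_bilinear[OF LL_space L_space]]
  note \<Delta> = module_homD[OF comult_hom]
  have "bilinear L L (tensor_space LL L) (\<lambda>x y. tens LL L (comult L x) y)"
    by (rule bilinearI) (simp_all add: b'' comult_carrier \<Delta>)
  note B = tensor_lift[OF L_space L_space LL_L_space this]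
  have "bilinear L L ?LLL (\<lambda>x y. tens L LL x (comult L y))"
    by (rule bilinearI) (simp_all add: b' comult_carrier \<Delta>)
  note C = tensor_lift[OF L_space L_space L_LL_space this]
  have "bilinear L L ?LLL (\<lambda>x y. tens L LL x (tens L L y z))" if "z \<in> carrier L" for z
    by (rule bilinearI) (simp_all add: b' b that)
  note A = tensor_lift[OF L_space L_space L_LL_space this]
  have evA: "ev3 p q r (?A z s) = ev2 p q s * z r"
    if pqr: "p \<in> carrier G" "q \<in> carrier G" "r \<in> carrier G" and z: "z \<in> carrier L"
      and s: "s \<in> carrier LL" for p q r z s
  proof -
    have scaled: "(\<lambda>s. ev2 p q s * z r) \<in> module_hom class_ring LL ground_space"
      using module_homD(2,3)[OF ev2_hom] pqr by (intro module_homI) (auto simp: algebra_simps)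
    show ?thesis
      by (rule tensor_hom_eq[OF L_space L_space ground_space_vectorspace
            module_hom_comp[OF A(1)[OF z] ev3_hom[OF pqr]] scaled _ s])
         (simp add: A(3) z ev3_tens ev2_tens pqr b)
  qed
  have A_closed: "?A z s \<in> carrier ?LLL" if "z \<in> carrier L" "s \<in> carrier LL" for z s
    using module_homD(1)[OF A(1)] that .
  have "bilinear LL L ?LLL (\<lambda>s z. ?A z s)"
  proof (rule bilinearI)
    fix s s' z z' c
    assume [simp]: "s \<in> carrier LL" "s' \<in> carrier LL" "z \<in> carrier L" "z' \<in> carrier L"
    note [simp] = A_closed
    show "?A z (s \<oplus>\<^bsub>LL\<^esub> s') = ?A z s \<oplus>\<^bsub>?LLL\<^esub> ?A z s'" "?A z (c \<odot>\<^bsub>LL\<^esub> s) = c \<odot>\<^bsub>?LLL\<^esub> ?A z s"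
      by (simp_all add: module_homD[OF A(1)])
    note [simp] = evA module_homD(2,3)[OF ev3_hom]
    show "?A (z \<oplus>\<^bsub>L\<^esub> z') s = ?A z s \<oplus>\<^bsub>?LLL\<^esub> ?A z' s"
      by (rule ev3_eqI[folded ev3_def]) (simp_all, simp add: L_ops algebra_simps)
    show "?A (c \<odot>\<^bsub>L\<^esub> z) s = c \<odot>\<^bsub>?LLL\<^esub> ?A z s"
      by (rule ev3_eqI[folded ev3_def]) (simp_all, simp add: L_ops algebra_simps)
  qed (rule A_closed)
  note D = tensor_lift[OF LL_space L_space L_LL_space this]
  have \<Delta>a: "?B (comult L a) \<in> carrier (tensor_space LL L)"
    by (rule module_homD(1)[OF B(1) comult_carrier])
  show "tensor_lift LL L ?LLL (\<lambda>s z. ?A z s) (?B (comult L a)) \<in> carrier ?LLL"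
    by (rule module_homD(1)[OF D(1) \<Delta>a])
  show "?C (comult L a) \<in> carrier ?LLL"
    by (rule module_homD(1)[OF C(1) comult_carrier])
  fix p q r assume pqr: "p \<in> carrier G" "q \<in> carrier G" "r \<in> carrier G"
  have "(\<lambda>t. ev3 p q r (tensor_lift LL L ?LLL (\<lambda>s z. ?A z s) (?B t))) (comult L a)
      = ev2 (p \<otimes> q) r (comult L a)"
    by (rule ev2_unique[OF module_hom_comp[OF module_hom_comp[OF B(1) D(1)] ev3_hom[OF pqr]]])
       (simp_all add: B(3) D(3) comult_carrier evA ev2_comult pqr)
  then have l: "ev3 p q r (tensor_lift LL L ?LLL (\<lambda>s z. ?A z s) (?B (comult L a))) = a (p \<otimes> q \<otimes> r)"
    by (simp add: ev2_comult pqr)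
  have "(\<lambda>t. ev3 p q r (?C t)) (comult L a) = ev2 p (q \<otimes> r) (comult L a)"
    by (rule ev2_unique[OF module_hom_comp[OF C(1) ev3_hom[OF pqr]]])
       (simp_all add: C(3) comult_carrier ev3_tens ev2_comult pqr)
  then have r: "ev3 p q r (?C (comult L a)) = a (p \<otimes> (q \<otimes> r))"
    by (simp add: ev2_comult pqr)
  show "ev3 p q r (tensor_lift LL L ?LLL (\<lambda>s z. ?A z s) (?B (comult L a))) = ev3 p q r (?C (comult L a))"
    unfolding l r using pqr by (simp add: m_assoc)
qed

lemma hopf_algebra_L: "hopf_algebra L"
proof (rule hopf_algebra.intro)
  show "vectorspace class_ring L" by (rule L_space)
  show "ring L" by (rule L_ring)
  show "hopf_algebra_axioms L"
  proof
    fix a b c assume a: "a \<in> carrier L" and b: "b \<in> carrier L"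
    show "(c \<odot>\<^bsub>L\<^esub> a) \<otimes>\<^bsub>L\<^esub> b = c \<odot>\<^bsub>L\<^esub> (a \<otimes>\<^bsub>L\<^esub> b)" "a \<otimes>\<^bsub>L\<^esub> (c \<odot>\<^bsub>L\<^esub> b) = c \<odot>\<^bsub>L\<^esub> (a \<otimes>\<^bsub>L\<^esub> b)"
      by (auto simp: L_ops restrict_def fun_eq_iff)
    show "comult L (a \<otimes>\<^bsub>L\<^esub> b) = tensor_mult L (comult L a) (comult L b)"
      by (rule ev2_eqI) (simp_all add: comult_carrier ev2_tensor_mult[OF one_closed one_closed]
          ev2_tensor_mult(2) ev2_comult, simp add: L_ops)
    show "counit L (a \<otimes>\<^bsub>L\<^esub> b) = counit L a * counit L b"
      by (simp add: L_ops)
  next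
    show "comult L \<in> module_hom class_ring L LL" by (rule comult_hom)
    show "counit L \<in> module_hom class_ring L ground_space"
      using eval_hom[OF one_closed] by (simp add: L_ops[abs_def])
    show "antipode L \<in> module_hom class_ring L L"
      by (rule module_homI) (simp_all add: L_ops, auto simp: restrict_def fun_eq_iff)
    show "comult L \<one>\<^bsub>L\<^esub> = tens L L \<one>\<^bsub>L\<^esub> \<one>\<^bsub>L\<^esub>"
      by (rule ev2_eqI) (simp_all add: comult_carrier tens_closed[OF L_space L_space] L_ops ev2_comult ev2_tens)
    show "counit L \<one>\<^bsub>L\<^esub> = 1" by (simp add: L_ops)
  next
    fix a assume a: "a \<in> carrier L"
    show "tensor_lift LL L (tensor_space L LL)
        (\<lambda>s z. tensor_lift L L (tensor_space L LL) (\<lambda>x y. tens L LL x (tens L L y z)) s)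
        (tensor_lift L L (tensor_space LL L) (\<lambda>x y. tens LL L (comult L x) y) (comult L a))
      = tensor_lift L L (tensor_space L LL) (\<lambda>x y. tens L LL x (comult L y)) (comult L a)"
      by (rule comult_coassoc)
    show "tensor_lift L L L (\<lambda>x y. counit L x \<odot>\<^bsub>L\<^esub> y) (comult L a) = a"
      by (rule lift_comult_in_L[where g = "\<lambda>_. \<one>" and h = "\<lambda>x. x"],
          rule L_bilinear[where g = "\<lambda>_. \<one>" and h = "\<lambda>x. x"]) (simp_all add: a, simp_all add: L_ops)
    show "tensor_lift L L L (\<lambda>x y. counit L y \<odot>\<^bsub>L\<^esub> x) (comult L a) = a"
      by (rule lift_comult_in_L[where h = "\<lambda>_. \<one>" and g = "\<lambda>x. x"],
          rule L_bilinear[where h = "\<lambda>_. \<one>" and g = "\<lambda>x. x"]) (simp_all add: a, simp_all add: L_ops)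
    show "tensor_lift L L L (\<lambda>x y. antipode L x \<otimes>\<^bsub>L\<^esub> y) (comult L a) = counit L a \<odot>\<^bsub>L\<^esub> \<one>\<^bsub>L\<^esub>"
      by (rule lift_comult_in_L[where g = "\<lambda>x. inv x" and h = "\<lambda>x. x"],
          rule L_bilinear[where g = "\<lambda>x. inv x" and h = "\<lambda>x. x"]) (simp_all add: L_ops)
    show "tensor_lift L L L (\<lambda>x y. x \<otimes>\<^bsub>L\<^esub> antipode L y) (comult L a) = counit L a \<odot>\<^bsub>L\<^esub> \<one>\<^bsub>L\<^esub>"
      by (rule lift_comult_in_L[where h = "\<lambda>x. inv x" and g = "\<lambda>x. x"],
          rule L_bilinear[where h = "\<lambda>x. inv x" and g = "\<lambda>x. x"]) (simp_all add: L_ops)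
  qed
qed

end

section \<open>Typed arrows\<close>

text \<open>Composition in a linear category does not know the source and target of its arguments, so
  its associativity law is useless for rewriting: the objects in its premises do not occur in the
  equation. Diagrams are therefore chased with triples that carry their source and target, for
  which all side conditions can be computed.\<close>

datatype ('o, 'a) arrow = Arrow (src: 'o) (mor: 'a) (tgt: 'o)

context category
begin

definition ok :: "('o, 'a) arrow \<Rightarrow> bool" where
  "ok t \<longleftrightarrow> src t \<in> Obj C \<and> tgt t \<in> Obj C \<and> mor t \<in> Hom C (src t) (tgt t)"

definition comp :: "('o, 'a) arrow \<Rightarrow> ('o, 'a) arrow \<Rightarrow> ('o, 'a) arrow" (infixr "\<diamond>" 70) where
  "t \<diamond> s = Arrow (src s) (mor t \<cdot> mor s) (tgt t)"

definition one :: "'o \<Rightarrow> ('o, 'a) arrow" where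
  "one X = Arrow X (Idn C X) X"

lemma src_tgt_comp [simp]: "src (t \<diamond> s) = src s" "tgt (t \<diamond> s) = tgt t" "mor (t \<diamond> s) = mor t \<cdot> mor s"
  by (simp_all add: comp_def)

lemma src_tgt_one [simp]: "src (one X) = X" "tgt (one X) = X" "mor (one X) = Idn C X"
  by (simp_all add: one_def)

lemma ok_Arrow [simp]: "ok (Arrow X f Y) \<longleftrightarrow> X \<in> Obj C \<and> Y \<in> Obj C \<and> f \<in> Hom C X Y"
  by (simp add: ok_def)

lemma okD: "ok t \<Longrightarrow> src t \<in> Obj C" "ok t \<Longrightarrow> tgt t \<in> Obj C" "ok t \<Longrightarrow> mor t \<in> Hom C (src t) (tgt t)"
  by (simp_all add: ok_def)

lemma ok_one [simp]: "ok (one X) \<longleftrightarrow> X \<in> Obj C"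
  using Idn_in_Hom by (auto simp: ok_def)

lemma ok_comp [simp]: "\<lbrakk>ok t; ok s; src t = tgt s\<rbrakk> \<Longrightarrow> ok (t \<diamond> s)"
  using Cmp_in_Hom[of "src s" "tgt s" "tgt t"] by (auto simp: ok_def)

lemma comp_assoc [simp]: "\<lbrakk>ok t; ok s; ok r; src t = tgt s; src s = tgt r\<rbrakk> \<Longrightarrow> (t \<diamond> s) \<diamond> r = t \<diamond> s \<diamond> r"
  using Cmp_assoc[of "src r" "tgt r" "tgt s" "tgt t"] by (auto simp: ok_def comp_def)

lemma comp_one_left [simp]: "\<lbrakk>ok t; tgt t = X\<rbrakk> \<Longrightarrow> one X \<diamond> t = t"
  using Idn_left by (cases t) (auto simp: ok_def comp_def one_def)

lemma comp_one_right [simp]: "\<lbrakk>ok t; src t = X\<rbrakk> \<Longrightarrow> t \<diamond> one X = t"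
  using Idn_right by (cases t) (auto simp: ok_def comp_def one_def)

text \<open>Composites are normalised to nest to the right, where an equation for a composite of two arrows
  does not apply literally inside a longer one; this is its form for that position.\<close>

lemma comp_reduce:
  assumes "a \<diamond> b = c" "ok a" "ok b" "ok r" "src a = tgt b" "src b = tgt r"
  shows "a \<diamond> b \<diamond> r = c \<diamond> r"
  using comp_assoc[OF assms(2-6)] assms(1) by simp

lemma inverse_arrows_unique:
  assumes "X \<in> Obj C" "Y \<in> Obj C" "inverse_arrows C X Y f g" "inverse_arrows C X Y f h"
  shows "g = h"
proof -
  have "g = (h \<cdot> f) \<cdot> g"
    using assms Idn_left[of Y X g] by (simp add: inverse_arrows_def)
  also have "\<dots> = h \<cdot> (f \<cdot> g)"
    using assms by (intro Cmp_assoc[of Y X Y X]) (auto simp: inverse_arrows_def)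
  also have "\<dots> = h"
    using assms Idn_right[of Y X h] by (simp add: inverse_arrows_def)
  finally show ?thesis .
qed

lemma inv_arr_eqI:
  assumes "X \<in> Obj C" "Y \<in> Obj C" "inverse_arrows C X Y f g"
  shows "inv_arr C X Y f = g"
  unfolding inv_arr_def using assms inverse_arrows_unique by blast

lemma inverse_inv_arr:
  assumes "X \<in> Obj C" "Y \<in> Obj C" "is_iso C X Y f"
  shows "inverse_arrows C X Y f (inv_arr C X Y f)"
  using assms inv_arr_eqI unfolding is_iso_def by metis

definition inverse_pair :: "('o, 'a) arrow \<Rightarrow> ('o, 'a) arrow \<Rightarrow> bool" where
  "inverse_pair t s \<longleftrightarrow> ok t \<and> ok s \<and> src s = tgt t \<and> tgt s = src t \<and>
     s \<diamond> t = one (src t) \<and> t \<diamond> s = one (tgt t)"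

lemma inverse_pair_Arrow:
  "inverse_pair (Arrow X f Y) (Arrow Y g X) \<longleftrightarrow> X \<in> Obj C \<and> Y \<in> Obj C \<and> inverse_arrows C X Y f g"
  by (auto simp: inverse_pair_def inverse_arrows_def comp_def one_def)

lemma inverse_pair_sym: "inverse_pair t s \<Longrightarrow> inverse_pair s t"
  by (auto simp: inverse_pair_def)

lemma inverse_pair_cancel:
  assumes "inverse_pair t s"
  shows "s \<diamond> t = one (src t)" "t \<diamond> s = one (tgt t)"
    and "\<lbrakk>ok r; tgt r = src t\<rbrakk> \<Longrightarrow> s \<diamond> t \<diamond> r = r"
    and "\<lbrakk>ok r; tgt r = tgt t\<rbrakk> \<Longrightarrow> t \<diamond> s \<diamond> r = r"
  using assms comp_assoc[of s t r] comp_assoc[of t s r] by (auto simp: inverse_pair_def)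

lemma inverse_pair_left_move:
  assumes "inverse_pair t s" "ok a" "tgt a = src t" "t \<diamond> a = b"
  shows "a = s \<diamond> b"
  using assms inverse_pair_cancel(3)[OF assms(1)] by auto

lemma inverse_pair_left_eq:
  assumes "inverse_pair t s" "ok a" "ok b" "tgt a = src t" "tgt b = src t" "t \<diamond> a = t \<diamond> b"
  shows "a = b"
  using assms inverse_pair_cancel(3)[OF assms(1)] by metis

lemma inverse_pair_right_eq:
  assumes p: "inverse_pair t s" and a: "ok a" "ok b" "src a = tgt t" "src b = tgt t"
    and eq: "a \<diamond> t = b \<diamond> t"
  shows "a = b"
proof -
  have "(a \<diamond> t) \<diamond> s = (b \<diamond> t) \<diamond> s" by (simp add: eq)
  then show ?thesis
    using p a by (simp add: inverse_pair_def)
qed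

lemma inverse_pair_comp:
  assumes "inverse_pair t s" "inverse_pair t' s'" "src t' = tgt t"
  shows "inverse_pair (t' \<diamond> t) (s \<diamond> s')"
  using assms inverse_pair_cancel[OF assms(1)] inverse_pair_cancel[OF assms(2)]
  by (auto simp: inverse_pair_def)

lemma inverse_pair_unique:
  assumes "inverse_pair t s" "inverse_pair t s'"
  shows "s = s'"
  using assms inverse_pair_cancel(3)[OF assms(1), of s'] by (auto simp: inverse_pair_def)

lemma is_isoD:
  assumes "is_iso C X Y f" "X \<in> Obj C" "Y \<in> Obj C"
  shows "inverse_pair (Arrow X f Y) (Arrow Y (inv_arr C X Y f) X)"
  using inverse_inv_arr assms by (simp add: inverse_pair_Arrow)

text \<open>The arrow in the middle has a left inverse because of \<open>p \<diamond> a\<close> and a right inverse because of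
  \<open>a \<diamond> b\<close>; so it is invertible, and with it \<open>p\<close>.\<close>

lemma iso_of_composites:
  assumes i: "inverse_pair i i'" and j: "inverse_pair j j'"
    and ok: "ok p" "ok a" "ok b" "src p = tgt a" "src a = tgt b"
    and pa: "p \<diamond> a = i" and ab: "a \<diamond> b = j"
  shows "\<exists>v. inverse_pair p v"
proof -
  have I: "ok i'" "src i' = tgt p" "tgt i' = src a" "i' \<diamond> i = one (src a)" "i \<diamond> i' = one (tgt p)"
    using i pa by (auto simp: inverse_pair_def)
  have J: "ok j'" "src j' = tgt a" "tgt j' = src b" "j \<diamond> j' = one (tgt a)"
    using j ab by (auto simp: inverse_pair_def)
  have right: "a \<diamond> b \<diamond> j' = one (tgt a)"
    using J ok ab comp_assoc[of a b j'] by simp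
  have "i' \<diamond> p = (i' \<diamond> p) \<diamond> (a \<diamond> b \<diamond> j')"
    unfolding right using I ok by simp
  also have "\<dots> = (i' \<diamond> (p \<diamond> a)) \<diamond> b \<diamond> j'"
    using I J ok by simp
  also have "\<dots> = b \<diamond> j'"
    unfolding pa I(4) using J ok by simp
  finally have "(a \<diamond> i') \<diamond> p = one (src p)"
    using right I ok by simp
  moreover have "p \<diamond> a \<diamond> i' = one (tgt p)"
    using I ok pa comp_assoc[of p a i'] by simp
  ultimately show ?thesis
    using I ok by (intro exI[of _ "a \<diamond> i'"]) (simp add: inverse_pair_def)
qed

end

section \<open>Coherence in monoidal categories\<close>

context monoidal_category
begin

definition ten :: "('o, 'a) arrow \<Rightarrow> ('o, 'a) arrow \<Rightarrow> ('o, 'a) arrow" (infixr "\<parallel>" 75) where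
  "t \<parallel> s = Arrow (src t \<boxtimes> src s) (mor t \<star> mor s) (tgt t \<boxtimes> tgt s)"

lemma src_tgt_ten [simp]: "src (t \<parallel> s) = src t \<boxtimes> src s" "tgt (t \<parallel> s) = tgt t \<boxtimes> tgt s"
  "mor (t \<parallel> s) = mor t \<star> mor s"
  by (simp_all add: ten_def)

lemmas [simp] = Unit_Obj TensO_Obj okD(1,2)

lemma ok_ten [simp]: "\<lbrakk>ok t; ok s\<rbrakk> \<Longrightarrow> ok (t \<parallel> s)"
  unfolding ok_def by (simp add: TensM_in_Hom)

lemma ten_one [simp]: "\<lbrakk>X \<in> Obj C; Y \<in> Obj C\<rbrakk> \<Longrightarrow> one X \<parallel> one Y = one (X \<boxtimes> Y)"
  by (simp add: ten_def one_def TensM_Idn)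

lemma ten_comp [simp]: "\<lbrakk>ok t; ok t'; ok s; ok s'; src t' = tgt t; src s' = tgt s\<rbrakk> \<Longrightarrow>
    (t' \<parallel> s') \<diamond> (t \<parallel> s) = (t' \<diamond> t) \<parallel> (s' \<diamond> s)"
  using TensM_Cmp[of "src t" "tgt t" "tgt t'" "src s" "tgt s" "tgt s'" "mor t" "mor t'" "mor s" "mor s'"]
    okD(3)[of t] okD(3)[of t'] okD(3)[of s] okD(3)[of s']
  by (simp add: ten_def comp_def)

lemma ten_comp_assoc [simp]: "\<lbrakk>ok t; ok t'; ok s; ok s'; ok r; src t' = tgt t; src s' = tgt s;
    tgt r = src t \<boxtimes> src s\<rbrakk> \<Longrightarrow> (t' \<parallel> s') \<diamond> (t \<parallel> s) \<diamond> r = ((t' \<diamond> t) \<parallel> (s' \<diamond> s)) \<diamond> r"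
  by (rule comp_reduce[OF ten_comp]) simp_all

lemma inverse_pair_ten:
  assumes "inverse_pair t s" "inverse_pair t' s'"
  shows "inverse_pair (t \<parallel> t') (s \<parallel> s')"
  using assms by (auto simp: inverse_pair_def)

text \<open>The structural arrows with their sources and targets; a prime marks the inverse.\<close>

definition asc where "asc X Y Z = Arrow ((X \<boxtimes> Y) \<boxtimes> Z) (Assoc C X Y Z) (X \<boxtimes> (Y \<boxtimes> Z))"
definition asc' where "asc' X Y Z =
  Arrow (X \<boxtimes> (Y \<boxtimes> Z)) (inv_arr C ((X \<boxtimes> Y) \<boxtimes> Z) (X \<boxtimes> (Y \<boxtimes> Z)) (Assoc C X Y Z)) ((X \<boxtimes> Y) \<boxtimes> Z)"
definition lu where "lu X = Arrow (Unit C \<boxtimes> X) (LUnit C X) X"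
definition lu' where "lu' X = Arrow X (inv_arr C (Unit C \<boxtimes> X) X (LUnit C X)) (Unit C \<boxtimes> X)"
definition ru where "ru X = Arrow (X \<boxtimes> Unit C) (RUnit C X) X"
definition ru' where "ru' X = Arrow X (inv_arr C (X \<boxtimes> Unit C) X (RUnit C X)) (X \<boxtimes> Unit C)"

lemma src_tgt_structural [simp]:
  "src (asc X Y Z) = (X \<boxtimes> Y) \<boxtimes> Z" "tgt (asc X Y Z) = X \<boxtimes> (Y \<boxtimes> Z)"
  "src (asc' X Y Z) = X \<boxtimes> (Y \<boxtimes> Z)" "tgt (asc' X Y Z) = (X \<boxtimes> Y) \<boxtimes> Z"
  "src (lu X) = Unit C \<boxtimes> X" "tgt (lu X) = X" "src (lu' X) = X" "tgt (lu' X) = Unit C \<boxtimes> X"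
  "src (ru X) = X \<boxtimes> Unit C" "tgt (ru X) = X" "src (ru' X) = X" "tgt (ru' X) = X \<boxtimes> Unit C"
  by (simp_all add: asc_def asc'_def lu_def lu'_def ru_def ru'_def)

lemma mor_structural:
  "mor (asc X Y Z) = Assoc C X Y Z"
  "mor (asc' X Y Z) = inv_arr C ((X \<boxtimes> Y) \<boxtimes> Z) (X \<boxtimes> (Y \<boxtimes> Z)) (Assoc C X Y Z)"
  "mor (lu X) = LUnit C X" "mor (lu' X) = inv_arr C (Unit C \<boxtimes> X) X (LUnit C X)"
  "mor (ru X) = RUnit C X" "mor (ru' X) = inv_arr C (X \<boxtimes> Unit C) X (RUnit C X)"
  by (simp_all add: asc_def asc'_def lu_def lu'_def ru_def ru'_def)

lemma inverse_structural:
  "\<lbrakk>X \<in> Obj C; Y \<in> Obj C; Z \<in> Obj C\<rbrakk> \<Longrightarrow> inverse_pair (asc X Y Z) (asc' X Y Z)"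
  "X \<in> Obj C \<Longrightarrow> inverse_pair (lu X) (lu' X)"
  "X \<in> Obj C \<Longrightarrow> inverse_pair (ru X) (ru' X)"
  unfolding asc_def asc'_def lu_def lu'_def ru_def ru'_def
  by (intro is_isoD Assoc_iso LUnit_iso RUnit_iso; simp)+

lemma ok_structural [simp]:
  "\<lbrakk>X \<in> Obj C; Y \<in> Obj C; Z \<in> Obj C\<rbrakk> \<Longrightarrow> ok (asc X Y Z)"
  "\<lbrakk>X \<in> Obj C; Y \<in> Obj C; Z \<in> Obj C\<rbrakk> \<Longrightarrow> ok (asc' X Y Z)"
  "X \<in> Obj C \<Longrightarrow> ok (lu X)" "X \<in> Obj C \<Longrightarrow> ok (lu' X)"
  "X \<in> Obj C \<Longrightarrow> ok (ru X)" "X \<in> Obj C \<Longrightarrow> ok (ru' X)"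
  using inverse_structural by (auto simp: inverse_pair_def)

lemmas asc_cancel [simp] = inverse_pair_cancel[OF inverse_structural(1), simplified]
lemmas lu_cancel [simp] = inverse_pair_cancel[OF inverse_structural(2), simplified]
lemmas ru_cancel [simp] = inverse_pair_cancel[OF inverse_structural(3), simplified]

lemma asc_natural: "\<lbrakk>ok t; ok s; ok r\<rbrakk> \<Longrightarrow>
    asc (tgt t) (tgt s) (tgt r) \<diamond> ((t \<parallel> s) \<parallel> r) = (t \<parallel> (s \<parallel> r)) \<diamond> asc (src t) (src s) (src r)"
  using Assoc_natural[of "src t" "tgt t" "src s" "tgt s" "src r" "tgt r" "mor t" "mor s" "mor r"]
  by (auto simp: okD ten_def comp_def asc_def)

lemma asc'_natural:
  assumes "ok t" "ok s" "ok r"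
  shows "asc' (tgt t) (tgt s) (tgt r) \<diamond> (t \<parallel> (s \<parallel> r)) = ((t \<parallel> s) \<parallel> r) \<diamond> asc' (src t) (src s) (src r)"
proof (rule inverse_pair_left_eq[OF inverse_structural(1)[of "tgt t" "tgt s" "tgt r"]])
  show "asc (tgt t) (tgt s) (tgt r) \<diamond> asc' (tgt t) (tgt s) (tgt r) \<diamond> (t \<parallel> (s \<parallel> r)) =
      asc (tgt t) (tgt s) (tgt r) \<diamond> ((t \<parallel> s) \<parallel> r) \<diamond> asc' (src t) (src s) (src r)"
    using assms comp_reduce[OF asc_natural[OF assms], of "asc' (src t) (src s) (src r)"] by simp
qed (use assms in simp_all)

lemma lu_natural: "ok t \<Longrightarrow> lu (tgt t) \<diamond> (one (Unit C) \<parallel> t) = t \<diamond> lu (src t)"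
  using LUnit_natural[of "src t" "tgt t" "mor t"]
  by (cases t) (auto simp: okD ten_def comp_def lu_def)

lemma ru_natural: "ok t \<Longrightarrow> ru (tgt t) \<diamond> (t \<parallel> one (Unit C)) = t \<diamond> ru (src t)"
  using RUnit_natural[of "src t" "tgt t" "mor t"]
  by (cases t) (auto simp: okD ten_def comp_def ru_def)

lemma ru'_natural:
  assumes "ok t"
  shows "ru' (tgt t) \<diamond> t = (t \<parallel> one (Unit C)) \<diamond> ru' (src t)"
  by (rule inverse_pair_left_eq[OF inverse_structural(3)[of "tgt t"]])
     (use assms comp_reduce[OF ru_natural[OF assms], of "ru' (src t)"] in simp_all)

lemma pentagon_arrow:
  assumes "W \<in> Obj C" "X \<in> Obj C" "Y \<in> Obj C" "Z \<in> Obj C"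
  shows "asc W X (Y \<boxtimes> Z) \<diamond> asc (W \<boxtimes> X) Y Z =
    (one W \<parallel> asc X Y Z) \<diamond> asc W (X \<boxtimes> Y) Z \<diamond> (asc W X Y \<parallel> one Z)"
proof -
  have "asc W X (Y \<boxtimes> Z) \<diamond> asc (W \<boxtimes> X) Y Z =
      ((one W \<parallel> asc X Y Z) \<diamond> asc W (X \<boxtimes> Y) Z) \<diamond> (asc W X Y \<parallel> one Z)"
    using pentagon[OF assms] by (simp add: ten_def comp_def asc_def one_def del: comp_assoc)
  then show ?thesis using assms by simp
qed

lemma triangle_arrow: "\<lbrakk>X \<in> Obj C; Y \<in> Obj C\<rbrakk> \<Longrightarrow>
    (one X \<parallel> lu Y) \<diamond> asc X (Unit C) Y = ru X \<parallel> one Y"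
  using triangle[of X Y] by (simp add: ten_def comp_def asc_def one_def lu_def ru_def)

lemma unit_ten_faithful:
  assumes "ok t" "ok s" "src t = src s" "tgt t = tgt s" "one (Unit C) \<parallel> t = one (Unit C) \<parallel> s"
  shows "t = s"
  by (rule inverse_pair_right_eq[OF inverse_structural(2)[of "src t"]])
     (use assms lu_natural[of t] lu_natural[of s] in simp_all)

lemma ten_unit_faithful:
  assumes "ok t" "ok s" "src t = src s" "tgt t = tgt s" "t \<parallel> one (Unit C) = s \<parallel> one (Unit C)"
  shows "t = s"
  by (rule inverse_pair_right_eq[OF inverse_structural(3)[of "src t"]])
     (use assms ru_natural[of t] ru_natural[of s] in simp_all)

text \<open>Kelly: the pentagon for \<open>(1, 1, X, Y)\<close> and two triangles give the equation after tensoring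
  with the unit object, which is a faithful operation.\<close>

lemma lu_ten:
  assumes X: "X \<in> Obj C" and Y: "Y \<in> Obj C"
  shows "lu (X \<boxtimes> Y) \<diamond> asc (Unit C) X Y = lu X \<parallel> one Y"
proof (rule unit_ten_faithful)
  let ?I = "Unit C"
  let ?r = "asc ?I (?I \<boxtimes> X) Y \<diamond> (asc ?I ?I X \<parallel> one Y)"
  have inv: "inverse_pair ?r ((asc' ?I ?I X \<parallel> one Y) \<diamond> asc' ?I (?I \<boxtimes> X) Y)"
    using X Y by (intro inverse_pair_comp inverse_pair_ten inverse_structural)
      (simp_all add: inverse_pair_def)
  show "one ?I \<parallel> (lu (X \<boxtimes> Y) \<diamond> asc ?I X Y) = one ?I \<parallel> (lu X \<parallel> one Y)"
  proof (rule inverse_pair_right_eq[OF inv])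
    have "(one ?I \<parallel> (lu (X \<boxtimes> Y) \<diamond> asc ?I X Y)) \<diamond> ?r =
        (one ?I \<parallel> lu (X \<boxtimes> Y)) \<diamond> (one ?I \<parallel> asc ?I X Y) \<diamond> ?r"
      using X Y by simp
    also have "(one ?I \<parallel> asc ?I X Y) \<diamond> ?r = asc ?I ?I (X \<boxtimes> Y) \<diamond> asc (?I \<boxtimes> ?I) X Y"
      using X Y by (simp add: pentagon_arrow)
    also have "(one ?I \<parallel> lu (X \<boxtimes> Y)) \<diamond> \<dots> = (ru ?I \<parallel> one (X \<boxtimes> Y)) \<diamond> asc (?I \<boxtimes> ?I) X Y"
      using X Y by (intro comp_reduce triangle_arrow) simp_all
    also have "\<dots> = asc ?I X Y \<diamond> ((ru ?I \<parallel> one X) \<parallel> one Y)"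
      using asc_natural[of "ru ?I" "one X" "one Y"] X Y by simp
    also have "\<dots> = asc ?I X Y \<diamond> ((one ?I \<parallel> lu X) \<parallel> one Y) \<diamond> (asc ?I ?I X \<parallel> one Y)"
      using X Y by (simp add: triangle_arrow)
    also have "\<dots> = (one ?I \<parallel> (lu X \<parallel> one Y)) \<diamond> ?r"
      using comp_reduce[OF asc_natural[of "one ?I" "lu X" "one Y"], of "asc ?I ?I X \<parallel> one Y"] X Y by simp
    finally show "(one ?I \<parallel> (lu (X \<boxtimes> Y) \<diamond> asc ?I X Y)) \<diamond> ?r = (one ?I \<parallel> (lu X \<parallel> one Y)) \<diamond> ?r" .
  qed (use X Y in simp_all)
qed (use X Y in simp_all)

text \<open>By naturality \<open>lu\<close> at \<open>1 \<otimes> 1\<close> is \<open>1 \<otimes> lu\<close>. The triangle relates this to \<open>ru \<otimes> 1\<close>, the previous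
  lemma relates it to \<open>lu \<otimes> 1\<close>.\<close>

lemma lu_unit_eq_ru_unit: "lu (Unit C) = ru (Unit C)"
proof (rule ten_unit_faithful)
  let ?I = "Unit C"
  have "lu (?I \<boxtimes> ?I) = one ?I \<parallel> lu ?I"
    by (rule inverse_pair_left_eq[OF inverse_structural(2)[of ?I]])
       (use lu_natural[of "lu ?I"] in simp_all)
  then show "lu ?I \<parallel> one ?I = ru ?I \<parallel> one ?I"
    using lu_ten[of ?I ?I] triangle_arrow[of ?I ?I] by simp
qed simp_all

end

text \<open>Reversing the tensor product exchanges left and right, so that only one of each pair of
  mirror-image statements needs a proof.\<close>

definition reversed :: "('k, 'o, 'a, 'm) moncat_scheme \<Rightarrow> ('k, 'o, 'a, 'm) moncat_scheme" where
  "reversed C = C\<lparr>TensO := (\<lambda>X Y. TensO C Y X), TensM := (\<lambda>f g. TensM C g f),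
     Assoc := (\<lambda>X Y Z. inv_arr C (TensO C (TensO C Z Y) X) (TensO C Z (TensO C Y X)) (Assoc C Z Y X)),
     LUnit := RUnit C, RUnit := LUnit C\<rparr>"

lemma reversed_simps [simp]:
  "Obj (reversed C) = Obj C" "HomSp (reversed C) = HomSp C" "Cmp (reversed C) = Cmp C"
  "Idn (reversed C) = Idn C" "TensO (reversed C) X Y = TensO C Y X"
  "TensM (reversed C) f g = TensM C g f" "Unit (reversed C) = Unit C"
  "Assoc (reversed C) X Y Z =
     inv_arr C (TensO C (TensO C Z Y) X) (TensO C Z (TensO C Y X)) (Assoc C Z Y X)"
  "LUnit (reversed C) = RUnit C" "RUnit (reversed C) = LUnit C"
  by (simp_all add: reversed_def)

lemma reversed_iso [simp]:
  "inverse_arrows (reversed C) = inverse_arrows C"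
  "is_iso (reversed C) = is_iso C" "inv_arr (reversed C) = inv_arr C"
proof -
  show inv: "inverse_arrows (reversed C) = inverse_arrows C"
    by (simp add: fun_eq_iff inverse_arrows_def)
  show "is_iso (reversed C) = is_iso C" "inv_arr (reversed C) = inv_arr C"
    by (simp_all add: fun_eq_iff is_iso_def inv_arr_def inv)
qed

context monoidal_category
begin

lemma inverse_pentagon_arrow:
  assumes "W \<in> Obj C" "X \<in> Obj C" "Y \<in> Obj C" "Z \<in> Obj C"
  shows "asc' (W \<boxtimes> X) Y Z \<diamond> asc' W X (Y \<boxtimes> Z) =
    (asc' W X Y \<parallel> one Z) \<diamond> asc' W (X \<boxtimes> Y) Z \<diamond> (one W \<parallel> asc' X Y Z)"
proof (rule inverse_pair_unique)
  have one: "inverse_pair (one A) (one A)" if "A \<in> Obj C" for A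
    using that by (simp add: inverse_pair_def)
  show "inverse_pair (asc W X (Y \<boxtimes> Z) \<diamond> asc (W \<boxtimes> X) Y Z) (asc' (W \<boxtimes> X) Y Z \<diamond> asc' W X (Y \<boxtimes> Z))"
    using assms by (intro inverse_pair_comp inverse_structural) simp_all
  have "inverse_pair ((one W \<parallel> asc X Y Z) \<diamond> asc W (X \<boxtimes> Y) Z \<diamond> (asc W X Y \<parallel> one Z))
      (((asc' W X Y \<parallel> one Z) \<diamond> asc' W (X \<boxtimes> Y) Z) \<diamond> (one W \<parallel> asc' X Y Z))"
    using assms by (intro inverse_pair_comp inverse_pair_ten inverse_structural one) simp_all
  then show "inverse_pair (asc W X (Y \<boxtimes> Z) \<diamond> asc (W \<boxtimes> X) Y Z)
      ((asc' W X Y \<parallel> one Z) \<diamond> asc' W (X \<boxtimes> Y) Z \<diamond> (one W \<parallel> asc' X Y Z))"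
    using assms by (simp add: pentagon_arrow)
qed

lemma inverse_triangle_arrow:
  assumes "X \<in> Obj C" "Y \<in> Obj C"
  shows "(ru X \<parallel> one Y) \<diamond> asc' X (Unit C) Y = one X \<parallel> lu Y"
  using assms by (simp add: triangle_arrow[symmetric])

lemma inv_arr_inv_arr:
  assumes "is_iso C X Y f" "X \<in> Obj C" "Y \<in> Obj C"
  shows "inv_arr C Y X (inv_arr C X Y f) = f" and "is_iso C Y X (inv_arr C X Y f)"
proof -
  have "inverse_arrows C Y X (inv_arr C X Y f) f"
    using inverse_inv_arr[OF assms(2,3,1)] by (auto simp: inverse_arrows_def)
  then show "inv_arr C Y X (inv_arr C X Y f) = f" "is_iso C Y X (inv_arr C X Y f)"
    using assms inv_arr_eqI by (auto simp: is_iso_def)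
qed

lemma reversed_monoidal: "monoidal_category (reversed C)"
proof
  show "is_iso (reversed C) (TensO (reversed C) (TensO (reversed C) X Y) Z)
     (TensO (reversed C) X (TensO (reversed C) Y Z)) (Assoc (reversed C) X Y Z)"
    if "X \<in> Obj (reversed C)" "Y \<in> Obj (reversed C)" "Z \<in> Obj (reversed C)" for X Y Z
    using that by (simp add: inv_arr_inv_arr Assoc_iso)
  fix W X Y Z assume "W \<in> Obj (reversed C)" "X \<in> Obj (reversed C)" "Y \<in> Obj (reversed C)" "Z \<in> Obj (reversed C)"
  then have o: "W \<in> Obj C" "X \<in> Obj C" "Y \<in> Obj C" "Z \<in> Obj C" by simp_all
  have "mor (asc' (Z \<boxtimes> Y) X W \<diamond> asc' Z Y (X \<boxtimes> W)) =
      mor (((asc' Z Y X \<parallel> one W) \<diamond> asc' Z (Y \<boxtimes> X) W) \<diamond> (one Z \<parallel> asc' Y X W))"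
    using inverse_pentagon_arrow[OF o(4,3,2,1)] o by simp
  then show "Assoc (reversed C) W X (TensO (reversed C) Y Z) \<cdot>\<^bsub>reversed C\<^esub> Assoc (reversed C) (TensO (reversed C) W X) Y Z
      = TensM (reversed C) (Idn (reversed C) W) (Assoc (reversed C) X Y Z) \<cdot>\<^bsub>reversed C\<^esub>
        Assoc (reversed C) W (TensO (reversed C) X Y) Z \<cdot>\<^bsub>reversed C\<^esub>
        TensM (reversed C) (Assoc (reversed C) W X Y) (Idn (reversed C) Z)"
    by (simp add: mor_structural)
next
  fix X Y assume "X \<in> Obj (reversed C)" "Y \<in> Obj (reversed C)"
  then have o: "X \<in> Obj C" "Y \<in> Obj C" by simp_all
  have "mor ((ru Y \<parallel> one X) \<diamond> asc' Y (Unit C) X) = mor (one Y \<parallel> lu X)"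
    using inverse_triangle_arrow[OF o(2,1)] by simp
  then show "TensM (reversed C) (Idn (reversed C) X) (LUnit (reversed C) Y) \<cdot>\<^bsub>reversed C\<^esub>
      Assoc (reversed C) X (Unit (reversed C)) Y = TensM (reversed C) (RUnit (reversed C) X) (Idn (reversed C) Y)"
    by (simp add: mor_structural)
next
  fix X X' Y Y' Z Z' f g h
  assume "X \<in> Obj (reversed C)" "X' \<in> Obj (reversed C)" "Y \<in> Obj (reversed C)" "Y' \<in> Obj (reversed C)"
    "Z \<in> Obj (reversed C)" "Z' \<in> Obj (reversed C)"
    "f \<in> Hom (reversed C) X X'" "g \<in> Hom (reversed C) Y Y'" "h \<in> Hom (reversed C) Z Z'"
  then have "asc' Z' Y' X' \<diamond> (Arrow Z h Z' \<parallel> Arrow Y g Y' \<parallel> Arrow X f X') =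
      ((Arrow Z h Z' \<parallel> Arrow Y g Y') \<parallel> Arrow X f X') \<diamond> asc' Z Y X"
    using asc'_natural[of "Arrow Z h Z'" "Arrow Y g Y'" "Arrow X f X'"] by simp
  then have "mor (asc' Z' Y' X' \<diamond> (Arrow Z h Z' \<parallel> Arrow Y g Y' \<parallel> Arrow X f X')) =
      mor (((Arrow Z h Z' \<parallel> Arrow Y g Y') \<parallel> Arrow X f X') \<diamond> asc' Z Y X)" by simp
  then show "Assoc (reversed C) X' Y' Z' \<cdot>\<^bsub>reversed C\<^esub> TensM (reversed C) (TensM (reversed C) f g) h =
      TensM (reversed C) f (TensM (reversed C) g h) \<cdot>\<^bsub>reversed C\<^esub> Assoc (reversed C) X Y Z"
    by (simp add: mor_structural)
qed (simp_all add: Idn_in_Hom Cmp_in_Hom Cmp_assoc Idn_left Idn_right TensM_in_Hom TensM_Idn TensM_Cmp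
    LUnit_iso RUnit_iso LUnit_natural RUnit_natural)

lemma ru_ten:
  assumes X: "X \<in> Obj C" and Y: "Y \<in> Obj C"
  shows "(one X \<parallel> ru Y) \<diamond> asc X Y (Unit C) = ru (X \<boxtimes> Y)"
proof -
  interpret R: monoidal_category "reversed C" by (rule reversed_monoidal)
  have "ru (X \<boxtimes> Y) \<diamond> asc' X Y (Unit C) = one X \<parallel> ru Y"
    using R.lu_ten[of Y X] X Y
    by (simp add: R.lu_def R.asc_def R.one_def R.comp_def R.ten_def
        comp_def ten_def one_def ru_def asc'_def)
  then have "(one X \<parallel> ru Y) \<diamond> asc X Y (Unit C) = (ru (X \<boxtimes> Y) \<diamond> asc' X Y (Unit C)) \<diamond> asc X Y (Unit C)"
    by simp
  also have "\<dots> = ru (X \<boxtimes> Y)"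
    using X Y by simp
  finally show ?thesis .
qed

section \<open>Dual objects\<close>

definition dual_arrows :: "'o \<Rightarrow> 'o \<Rightarrow> ('o, 'a) arrow \<Rightarrow> ('o, 'a) arrow \<Rightarrow> bool" where
  "dual_arrows Y M E K \<longleftrightarrow> M \<in> Obj C \<and> Y \<in> Obj C \<and>
     ok E \<and> src E = Y \<boxtimes> M \<and> tgt E = Unit C \<and> ok K \<and> src K = Unit C \<and> tgt K = M \<boxtimes> Y \<and>
     ru M \<diamond> (one M \<parallel> E) \<diamond> asc M Y M \<diamond> (K \<parallel> one M) = lu M \<and>
     lu Y \<diamond> (E \<parallel> one Y) \<diamond> asc' Y M Y \<diamond> (one Y \<parallel> K) = ru Y"

lemma dual_arrowsD:
  assumes "dual_arrows Y M E K"
  shows "M \<in> Obj C" "Y \<in> Obj C" "ok E" "src E = Y \<boxtimes> M" "tgt E = Unit C"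
    "ok K" "src K = Unit C" "tgt K = M \<boxtimes> Y"
    "ru M \<diamond> (one M \<parallel> E) \<diamond> asc M Y M \<diamond> (K \<parallel> one M) = lu M"
    "lu Y \<diamond> (E \<parallel> one Y) \<diamond> asc' Y M Y \<diamond> (one Y \<parallel> K) = ru Y"
  using assms by (simp_all add: dual_arrows_def)

lemma dual_pair_iff:
  "dual_pair C Y M e c \<longleftrightarrow>
     dual_arrows Y M (Arrow (Y \<boxtimes> M) e (Unit C)) (Arrow (Unit C) c (M \<boxtimes> Y))" (is "_ \<longleftrightarrow> dual_arrows Y M ?E ?K")
proof (cases "M \<in> Obj C \<and> Y \<in> Obj C \<and> ok ?E \<and> ok ?K")
  case True
  have "ru M \<diamond> (one M \<parallel> ?E) \<diamond> asc M Y M \<diamond> (?K \<parallel> one M) = ((ru M \<diamond> (one M \<parallel> ?E)) \<diamond> asc M Y M) \<diamond> (?K \<parallel> one M)"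
    "lu Y \<diamond> (?E \<parallel> one Y) \<diamond> asc' Y M Y \<diamond> (one Y \<parallel> ?K) = ((lu Y \<diamond> (?E \<parallel> one Y)) \<diamond> asc' Y M Y) \<diamond> (one Y \<parallel> ?K)"
    using True by simp_all
  then show ?thesis
    unfolding dual_pair_def dual_arrows_def
    using True by (simp add: comp_def ten_def one_def ru_def lu_def asc_def asc'_def)
next
  case False
  then show ?thesis by (auto simp: dual_pair_def dual_arrows_def)
qed

definition mate :: "'o \<Rightarrow> 'o \<Rightarrow> ('o, 'a) arrow \<Rightarrow> 'o \<Rightarrow> ('o, 'a) arrow \<Rightarrow> ('o, 'a) arrow" where
  "mate Y M K Z h = lu Y \<diamond> (h \<parallel> one Y) \<diamond> asc' Z M Y \<diamond> (one Z \<parallel> K) \<diamond> ru' Z"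

lemma mate_arrow:
  assumes "dual_arrows Y M E K" "ok h" "src h = Z \<boxtimes> M" "tgt h = Unit C" "Z \<in> Obj C"
  shows "ok (mate Y M K Z h)" "src (mate Y M K Z h) = Z" "tgt (mate Y M K Z h) = Y"
  using assms dual_arrowsD[OF assms(1)] by (simp_all add: mate_def)

text \<open>Arrows \<open>Z \<rightarrow> Y\<close> into a left dual of \<open>M\<close> correspond to arrows \<open>Z \<otimes> M \<rightarrow> 1\<close>, by evaluation in one
  direction and \<open>mate\<close> in the other; the next two lemmas say that these are mutually inverse.\<close>

lemma mate_eval:
  assumes d: "dual_arrows Y M E K" and f: "ok f" "src f = Z" "tgt f = Y"
  shows "mate Y M K Z (E \<diamond> (f \<parallel> one M)) = f"
proof -
  note D = dual_arrowsD[OF d]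
  have Z: "Z \<in> Obj C" using f okD by blast
  note typed = D f Z
  have 1: "((f \<parallel> one M) \<parallel> one Y) \<diamond> asc' Z M Y = asc' Y M Y \<diamond> (f \<parallel> one (M \<boxtimes> Y))"
    using asc'_natural[of f "one M" "one Y"] typed by simp
  have 2: "(f \<parallel> one (M \<boxtimes> Y)) \<diamond> (one Z \<parallel> K) = (one Y \<parallel> K) \<diamond> (f \<parallel> one (Unit C))"
    using typed by simp
  have 3: "(f \<parallel> one (Unit C)) \<diamond> ru' Z = ru' Y \<diamond> f"
    using ru'_natural[of f] typed by simp
  have "mate Y M K Z (E \<diamond> (f \<parallel> one M)) =
      lu Y \<diamond> (E \<parallel> one Y) \<diamond> ((f \<parallel> one M) \<parallel> one Y) \<diamond> asc' Z M Y \<diamond> (one Z \<parallel> K) \<diamond> ru' Z"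
    using typed by (simp add: mate_def)
  also have "\<dots> = lu Y \<diamond> (E \<parallel> one Y) \<diamond> asc' Y M Y \<diamond> (one Y \<parallel> K) \<diamond> ru' Y \<diamond> f"
    using typed 1 2 3 by (simp add: comp_reduce[OF 1] comp_reduce[OF 2] del: ten_comp ten_comp_assoc)
  also have "\<dots> = (lu Y \<diamond> (E \<parallel> one Y) \<diamond> asc' Y M Y \<diamond> (one Y \<parallel> K)) \<diamond> ru' Y \<diamond> f"
    using D(1-8) f Z by (simp del: ten_comp ten_comp_assoc)
  also have "\<dots> = f"
    unfolding D(10) using D(1-8) f Z by simp
  finally show ?thesis .
qed

text \<open>Naturality moves \<open>h\<close> to the left end of the composite. What remains on its right is \<open>Z\<close> tensored
  with one side of the triangle identity of \<open>M\<close>, together with unit constraints that cancel.\<close>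

lemma eval_mate:
  assumes d: "dual_arrows Y M E K" and h: "ok h" "src h = Z \<boxtimes> M" "tgt h = Unit C" and Z: "Z \<in> Obj C"
  shows "E \<diamond> (mate Y M K Z h \<parallel> one M) = h"
proof -
  let ?I = "Unit C"
  note D = dual_arrowsD[OF d]
  note typed = D(1-8) h Z
  have 1: "lu Y \<parallel> one M = lu (Y \<boxtimes> M) \<diamond> asc ?I Y M"
    using typed by (simp add: lu_ten)
  have 2: "E \<diamond> lu (Y \<boxtimes> M) = lu ?I \<diamond> (one ?I \<parallel> E)"
    using lu_natural[of E] typed by simp
  have 3: "asc ?I Y M \<diamond> ((h \<parallel> one Y) \<parallel> one M) = (h \<parallel> one (Y \<boxtimes> M)) \<diamond> asc (Z \<boxtimes> M) Y M"
    using asc_natural[of h "one Y" "one M"] typed by simp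
  have 4: "(one ?I \<parallel> E) \<diamond> (h \<parallel> one (Y \<boxtimes> M)) = (h \<parallel> one ?I) \<diamond> (one (Z \<boxtimes> M) \<parallel> E)"
    using typed by simp
  have 5: "asc (Z \<boxtimes> M) Y M \<diamond> (asc' Z M Y \<parallel> one M) =
      asc' Z M (Y \<boxtimes> M) \<diamond> (one Z \<parallel> asc M Y M) \<diamond> asc Z (M \<boxtimes> Y) M"
  proof (rule inverse_pair_left_eq[OF inverse_structural(1)])
    have "asc Z M (Y \<boxtimes> M) \<diamond> asc (Z \<boxtimes> M) Y M \<diamond> (asc' Z M Y \<parallel> one M) =
        (asc Z M (Y \<boxtimes> M) \<diamond> asc (Z \<boxtimes> M) Y M) \<diamond> (asc' Z M Y \<parallel> one M)"
      using typed by simp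
    also have "\<dots> = (one Z \<parallel> asc M Y M) \<diamond> asc Z (M \<boxtimes> Y) M"
      using typed by (simp add: pentagon_arrow)
    finally show "asc Z M (Y \<boxtimes> M) \<diamond> asc (Z \<boxtimes> M) Y M \<diamond> (asc' Z M Y \<parallel> one M) =
        asc Z M (Y \<boxtimes> M) \<diamond> asc' Z M (Y \<boxtimes> M) \<diamond> (one Z \<parallel> asc M Y M) \<diamond> asc Z (M \<boxtimes> Y) M"
      using typed by simp
  qed (use typed in simp_all)
  have 6: "asc Z (M \<boxtimes> Y) M \<diamond> ((one Z \<parallel> K) \<parallel> one M) = (one Z \<parallel> (K \<parallel> one M)) \<diamond> asc Z ?I M"
    using asc_natural[of "one Z" K "one M"] typed by simp
  have 7: "asc Z ?I M \<diamond> (ru' Z \<parallel> one M) = one Z \<parallel> lu' M"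
    by (rule inverse_pair_left_eq[where t = "one Z \<parallel> lu M" and s = "one Z \<parallel> lu' M"])
       (use typed comp_reduce[OF triangle_arrow, of Z M "ru' Z \<parallel> one M"] in
         \<open>simp_all add: inverse_pair_def\<close>)
  have 8: "(one (Z \<boxtimes> M) \<parallel> E) \<diamond> asc' Z M (Y \<boxtimes> M) = asc' Z M ?I \<diamond> (one Z \<parallel> (one M \<parallel> E))"
    using asc'_natural[of "one Z" "one M" E] typed by simp
  have "(one M \<parallel> E) \<diamond> asc M Y M \<diamond> (K \<parallel> one M) = ru' M \<diamond> lu M"
    by (rule inverse_pair_left_move[OF inverse_structural(3)]) (use typed D(9) in simp_all)
  then have "((one M \<parallel> E) \<diamond> asc M Y M \<diamond> (K \<parallel> one M)) \<diamond> lu' M = ru' M"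
    using typed by simp
  then have 9: "(one Z \<parallel> (one M \<parallel> E)) \<diamond> (one Z \<parallel> asc M Y M) \<diamond> (one Z \<parallel> (K \<parallel> one M)) \<diamond> (one Z \<parallel> lu' M)
      = one Z \<parallel> ru' M"
    using typed by simp
  have 10: "asc' Z M ?I \<diamond> (one Z \<parallel> ru' M) = ru' (Z \<boxtimes> M)"
    by (rule inverse_pair_unique[where t = "(one Z \<parallel> ru M) \<diamond> asc Z M ?I"])
       (use typed inverse_structural(3)[of "Z \<boxtimes> M"] in \<open>simp add: inverse_pair_def, simp add: ru_ten\<close>)
  have 11: "(h \<parallel> one ?I) \<diamond> ru' (Z \<boxtimes> M) = ru' ?I \<diamond> h"
    using ru'_natural[of h] typed by simp
  have "E \<diamond> (mate Y M K Z h \<parallel> one M) = E \<diamond> (lu Y \<parallel> one M) \<diamond> ((h \<parallel> one Y) \<parallel> one M) \<diamond>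
      (asc' Z M Y \<parallel> one M) \<diamond> ((one Z \<parallel> K) \<parallel> one M) \<diamond> (ru' Z \<parallel> one M)"
    using typed by (simp add: mate_def)
  also have "\<dots> = lu ?I \<diamond> (h \<parallel> one ?I) \<diamond> asc' Z M ?I \<diamond>
      (one Z \<parallel> (one M \<parallel> E)) \<diamond> (one Z \<parallel> asc M Y M) \<diamond> (one Z \<parallel> (K \<parallel> one M)) \<diamond> (one Z \<parallel> lu' M)"
    unfolding 1 using typed
    by (simp add: 7 comp_reduce[OF 2] comp_reduce[OF 3] comp_reduce[OF 4] comp_reduce[OF 5]
        comp_reduce[OF 6] comp_reduce[OF 8] del: ten_comp ten_comp_assoc)
  also have "\<dots> = h"
    unfolding 9 10 11 using typed by (simp add: lu_unit_eq_ru_unit)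
  finally show ?thesis .
qed

text \<open>Since evaluation determines coevaluation, an isomorphism of evaluations along \<open>u\<close> and \<open>v\<close> is
  automatically one of coevaluations. This is what makes duals of modules again modules.\<close>

lemma dual_transport:
  assumes d: "dual_arrows Y M E K" and d': "dual_arrows Y' M' E' K'"
    and u: "inverse_pair u u'" "src u = M'" "tgt u = M"
  shows "\<exists>v. ok v \<and> src v = Y' \<and> tgt v = Y \<and> E \<diamond> (v \<parallel> u) = E' \<and> (u \<parallel> v) \<diamond> K' = K"
proof -
  let ?I = "Unit C"
  note D = dual_arrowsD[OF d] and D' = dual_arrowsD[OF d']
  have u': "ok u" "ok u'" "src u' = M" "tgt u' = M'" "u' \<diamond> u = one M'" "u \<diamond> u' = one M"
    using u by (auto simp: inverse_pair_def)
  note typed = D(1-8) D'(1-8) u(2,3) u'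
  \<comment> \<open>The condition on \<open>E\<close> says that \<open>v\<close> evaluates to \<open>E' (1 \<otimes> u\<inverse>)\<close>, which determines it as a mate.\<close>
  define h where "h = E' \<diamond> (one Y' \<parallel> u')"
  have h: "ok h" "src h = Y' \<boxtimes> M" "tgt h = ?I"
    using typed by (simp_all add: h_def)
  define v where "v = mate Y M K Y' h"
  have v: "ok v" "src v = Y'" "tgt v = Y"
    using mate_arrow[OF d h D'(2)] by (simp_all add: v_def)
  have "E \<diamond> (v \<parallel> u) = (E \<diamond> (v \<parallel> one M)) \<diamond> (one Y' \<parallel> u)"
    using typed v by simp
  also have "\<dots> = E'"
    unfolding v_def eval_mate[OF d h D'(2)] using typed by (simp add: h_def)
  finally have eval: "E \<diamond> (v \<parallel> u) = E'" .
  note typed = typed h v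
  \<comment> \<open>For coevaluation, the mate is expanded and \<open>K'\<close> is moved to the left until the triangle identity of \<open>M'\<close> applies in step 9.\<close>
  have 1: "one M' \<parallel> ru' Y' = asc M' Y' ?I \<diamond> ru' (M' \<boxtimes> Y')"
    by (rule inverse_pair_left_eq[where t = "one M' \<parallel> ru Y'" and s = "one M' \<parallel> ru' Y'"])
       (use typed comp_reduce[OF ru_ten, of M' Y' "ru' (M' \<boxtimes> Y')"] in \<open>simp_all add: inverse_pair_def\<close>)
  have 2: "ru' (M' \<boxtimes> Y') \<diamond> K' = (K' \<parallel> one ?I) \<diamond> ru' ?I"
    using ru'_natural[of K'] typed by simp
  have 3: "(one M' \<parallel> (one Y' \<parallel> K)) \<diamond> asc M' Y' ?I = asc M' Y' (M \<boxtimes> Y) \<diamond> (one (M' \<boxtimes> Y') \<parallel> K)"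
    using asc_natural[of "one M'" "one Y'" K] typed by simp
  have 4: "(one (M' \<boxtimes> Y') \<parallel> K) \<diamond> (K' \<parallel> one ?I) = (K' \<parallel> one (M \<boxtimes> Y)) \<diamond> (one ?I \<parallel> K)"
    using typed by simp
  have 5: "(one M' \<parallel> asc' Y' M Y) \<diamond> asc M' Y' (M \<boxtimes> Y) =
      asc M' (Y' \<boxtimes> M) Y \<diamond> (asc M' Y' M \<parallel> one Y) \<diamond> asc' (M' \<boxtimes> Y') M Y"
  proof (rule inverse_pair_right_eq[OF inverse_structural(1)[of "M' \<boxtimes> Y'" M Y]])
    have "((one M' \<parallel> asc' Y' M Y) \<diamond> asc M' Y' (M \<boxtimes> Y)) \<diamond> asc (M' \<boxtimes> Y') M Y =
        (one M' \<parallel> asc' Y' M Y) \<diamond> asc M' Y' (M \<boxtimes> Y) \<diamond> asc (M' \<boxtimes> Y') M Y"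
      using typed by simp
    also have "\<dots> = asc M' (Y' \<boxtimes> M) Y \<diamond> (asc M' Y' M \<parallel> one Y)"
      unfolding pentagon_arrow[OF D'(1,2) D(1,2)] using typed by simp
    finally show "((one M' \<parallel> asc' Y' M Y) \<diamond> asc M' Y' (M \<boxtimes> Y)) \<diamond> asc (M' \<boxtimes> Y') M Y =
        (asc M' (Y' \<boxtimes> M) Y \<diamond> (asc M' Y' M \<parallel> one Y) \<diamond> asc' (M' \<boxtimes> Y') M Y) \<diamond> asc (M' \<boxtimes> Y') M Y"
      using typed by simp
  qed (use typed in simp_all)
  have 6: "asc' (M' \<boxtimes> Y') M Y \<diamond> (K' \<parallel> one (M \<boxtimes> Y)) = ((K' \<parallel> one M) \<parallel> one Y) \<diamond> asc' ?I M Y"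
    using asc'_natural[of K' "one M" "one Y"] typed by simp
  have 7: "(one M' \<parallel> (h \<parallel> one Y)) \<diamond> asc M' (Y' \<boxtimes> M) Y = asc M' ?I Y \<diamond> ((one M' \<parallel> h) \<parallel> one Y)"
    using asc_natural[of "one M'" h "one Y"] typed by simp
  have 8: "(one M' \<parallel> lu Y) \<diamond> asc M' ?I Y = ru M' \<parallel> one Y"
    using typed by (simp add: triangle_arrow)
  have 9: "ru M' \<diamond> (one M' \<parallel> h) \<diamond> asc M' Y' M \<diamond> (K' \<parallel> one M) = u' \<diamond> lu M"
  proof -
    have a: "(one M' \<parallel> (one Y' \<parallel> u')) \<diamond> asc M' Y' M = asc M' Y' M' \<diamond> (one (M' \<boxtimes> Y') \<parallel> u')"
      using asc_natural[of "one M'" "one Y'" u'] typed by simp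
    have b: "(one (M' \<boxtimes> Y') \<parallel> u') \<diamond> (K' \<parallel> one M) = (K' \<parallel> one M') \<diamond> (one ?I \<parallel> u')"
      using typed by simp
    have "ru M' \<diamond> (one M' \<parallel> h) \<diamond> asc M' Y' M \<diamond> (K' \<parallel> one M) =
        ru M' \<diamond> (one M' \<parallel> E') \<diamond> (one M' \<parallel> (one Y' \<parallel> u')) \<diamond> asc M' Y' M \<diamond> (K' \<parallel> one M)"
      using typed by (simp add: h_def)
    also have "\<dots> = (ru M' \<diamond> (one M' \<parallel> E') \<diamond> asc M' Y' M' \<diamond> (K' \<parallel> one M')) \<diamond> (one ?I \<parallel> u')"
      using typed b by (simp add: comp_reduce[OF a] del: ten_comp ten_comp_assoc)
    also have "\<dots> = u' \<diamond> lu M"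
      unfolding D'(9) using lu_natural[of u'] typed by simp
    finally show ?thesis .
  qed
  have 10: "(lu M \<parallel> one Y) \<diamond> asc' ?I M Y = lu (M \<boxtimes> Y)"
    using typed by (simp add: lu_ten[symmetric])
  have 11: "lu (M \<boxtimes> Y) \<diamond> (one ?I \<parallel> K) = K \<diamond> lu ?I"
    using lu_natural[of K] typed by simp
  have "(one M' \<parallel> v) \<diamond> K' = (one M' \<parallel> lu Y) \<diamond> (one M' \<parallel> (h \<parallel> one Y)) \<diamond> (one M' \<parallel> asc' Y' M Y) \<diamond>
      (one M' \<parallel> (one Y' \<parallel> K)) \<diamond> (one M' \<parallel> ru' Y') \<diamond> K'"
    using typed by (simp add: v_def mate_def)
  also have "\<dots> = (ru M' \<parallel> one Y) \<diamond> ((one M' \<parallel> h) \<parallel> one Y) \<diamond> (asc M' Y' M \<parallel> one Y) \<diamond>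
      ((K' \<parallel> one M) \<parallel> one Y) \<diamond> asc' ?I M Y \<diamond> (one ?I \<parallel> K) \<diamond> ru' ?I"
    unfolding 1 using typed
    by (simp add: 2 comp_reduce[OF 3] comp_reduce[OF 4] comp_reduce[OF 5]
        comp_reduce[OF 6] comp_reduce[OF 7] comp_reduce[OF 8] del: ten_comp ten_comp_assoc)
  also have "\<dots> = ((ru M' \<diamond> (one M' \<parallel> h) \<diamond> asc M' Y' M \<diamond> (K' \<parallel> one M)) \<parallel> one Y) \<diamond>
      asc' ?I M Y \<diamond> (one ?I \<parallel> K) \<diamond> ru' ?I"
    using typed by simp
  also have "\<dots> = (u' \<parallel> one Y) \<diamond> (lu M \<parallel> one Y) \<diamond> asc' ?I M Y \<diamond> (one ?I \<parallel> K) \<diamond> ru' ?I"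
    unfolding 9 using typed by simp
  also have "\<dots> = (u' \<parallel> one Y) \<diamond> K \<diamond> lu ?I \<diamond> ru' ?I"
    using typed by (simp add: comp_reduce[OF 10] comp_reduce[OF 11] del: ten_comp ten_comp_assoc)
  also have "\<dots> = (u' \<parallel> one Y) \<diamond> K"
    using typed by (simp add: lu_unit_eq_ru_unit)
  finally have "(u \<parallel> one Y) \<diamond> (one M' \<parallel> v) \<diamond> K' = (u \<parallel> one Y) \<diamond> (u' \<parallel> one Y) \<diamond> K" by simp
  then have "(u \<parallel> v) \<diamond> K' = K"
    using typed by simp
  with eval v show ?thesis by blast
qed

text \<open>By \<open>mate_eval\<close>, an arrow into a dual object can be recovered from its evaluation.\<close>

lemma eval_cancel:
  assumes d: "dual_arrows Y M E K" and u: "inverse_pair u u'" "tgt u = M"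
    and f: "ok f" "tgt f = Y" and g: "ok g" "tgt g = Y" "src g = src f"
    and eq: "E \<diamond> (f \<parallel> u) = E \<diamond> (g \<parallel> u)"
  shows "f = g"
proof -
  note D = dual_arrowsD[OF d]
  have u': "ok u" "ok u'" "src u' = tgt u" "tgt u' = src u" "u \<diamond> u' = one M"
    using u by (auto simp: inverse_pair_def)
  have "E \<diamond> (k \<parallel> one M) = (E \<diamond> (k \<parallel> u)) \<diamond> (one (src k) \<parallel> u')" if "ok k" "tgt k = Y" for k
    using D(3,4) u(2) u' that by simp
  then have "E \<diamond> (f \<parallel> one M) = E \<diamond> (g \<parallel> one M)"
    using eq f g by metis
  then show ?thesis
    using mate_eval[OF d f(1) refl f(2)] mate_eval[OF d g(1,3,2)] by metis
qed

text \<open>The mirror images of the last lemmas, with the roles of the two dual objects exchanged.\<close>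

text \<open>Typed arrows of the reversed category are those of the original one, so that its theorems can be
  read back.\<close>

lemma reversed_arrows:
  "category.ok (reversed C) = ok" "category.comp (reversed C) = comp"
  "category.inverse_pair (reversed C) = inverse_pair" "category.one (reversed C) = one"
  "monoidal_category.ten (reversed C) s t = t \<parallel> s"
proof -
  interpret R: monoidal_category "reversed C" by (rule reversed_monoidal)
  show ok: "R.ok = ok" and comp: "R.comp = comp" and one: "R.one = one"
    by (simp_all add: fun_eq_iff R.ok_def[abs_def] ok_def[abs_def] R.comp_def comp_def R.one_def one_def
        del: okD R.okD)
  show "R.inverse_pair = inverse_pair"
    by (simp add: R.inverse_pair_def inverse_pair_def ok comp one fun_eq_iff)
  show "R.ten s t = t \<parallel> s"
    by (simp add: R.ten_def ten_def)
qed

lemma reversed_dual_arrows: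
  assumes "dual_arrows Y M E K"
  shows "monoidal_category.dual_arrows (reversed C) M Y E K"
proof -
  interpret R: monoidal_category "reversed C" by (rule reversed_monoidal)
  note D = dual_arrowsD[OF assms]
  have "R.asc' M Y M = asc M Y M"
    using D by (simp add: R.asc'_def asc_def inv_arr_inv_arr Assoc_iso)
  then show ?thesis
    using D
    by (simp add: R.dual_arrows_def dual_arrows_def reversed_arrows)
       (simp add: R.ru_def R.lu_def R.asc_def ru_def lu_def asc'_def)
qed

lemma dual_transport_right:
  assumes d: "dual_arrows Y M E K" and d': "dual_arrows Y' M' E' K'"
    and v: "inverse_pair v v'" "src v = Y'" "tgt v = Y"
  shows "\<exists>u. ok u \<and> src u = M' \<and> tgt u = M \<and> E \<diamond> (v \<parallel> u) = E' \<and> (u \<parallel> v) \<diamond> K' = K"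
proof -
  interpret R: monoidal_category "reversed C" by (rule reversed_monoidal)
  show ?thesis
    using R.dual_transport[OF reversed_dual_arrows[OF d] reversed_dual_arrows[OF d'], of v v'] v
    by (simp add: reversed_arrows)
qed

lemma eval_cancel_right:
  assumes d: "dual_arrows Y M E K" and v: "inverse_pair v v'" "tgt v = Y"
    and f: "ok f" "tgt f = M" and g: "ok g" "tgt g = M" "src g = src f"
    and eq: "E \<diamond> (v \<parallel> f) = E \<diamond> (v \<parallel> g)"
  shows "f = g"
proof -
  interpret R: monoidal_category "reversed C" by (rule reversed_monoidal)
  show ?thesis
    using R.eval_cancel[OF reversed_dual_arrows[OF d], of v v' f g] v f g eq
    by (simp add: reversed_arrows)
qed

section \<open>Strong monoidal functors on typed arrows\<close>

abbreviation "smf F \<equiv> strong_monoidal_functor C C F"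

definition fm :: "('o, 'a, 'o, 'a) monfunc \<Rightarrow> ('o, 'a) arrow \<Rightarrow> ('o, 'a) arrow" where
  "fm F t = Arrow (FO F (src t)) (FM F (src t) (tgt t) (mor t)) (FO F (tgt t))"

text \<open>The structure maps of \<open>F\<close> with their sources and targets; a prime marks the inverse.\<close>

definition f2 where "f2 F X Y = Arrow (FO F X \<boxtimes> FO F Y) (F2 F X Y) (FO F (X \<boxtimes> Y))"
definition f2' where "f2' F X Y =
  Arrow (FO F (X \<boxtimes> Y)) (inv_arr C (FO F X \<boxtimes> FO F Y) (FO F (X \<boxtimes> Y)) (F2 F X Y)) (FO F X \<boxtimes> FO F Y)"
definition f0 where "f0 F = Arrow (Unit C) (F0 F) (FO F (Unit C))"
definition f0' where "f0' F = Arrow (FO F (Unit C)) (inv_arr C (Unit C) (FO F (Unit C)) (F0 F)) (Unit C)"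

lemma src_tgt_fm [simp]: "src (fm F t) = FO F (src t)" "tgt (fm F t) = FO F (tgt t)"
  "mor (fm F t) = FM F (src t) (tgt t) (mor t)"
  by (simp_all add: fm_def)

lemma src_tgt_f2 [simp]:
  "src (f2 F X Y) = FO F X \<boxtimes> FO F Y" "tgt (f2 F X Y) = FO F (X \<boxtimes> Y)"
  "src (f2' F X Y) = FO F (X \<boxtimes> Y)" "tgt (f2' F X Y) = FO F X \<boxtimes> FO F Y"
  "src (f0 F) = Unit C" "tgt (f0 F) = FO F (Unit C)"
  "src (f0' F) = FO F (Unit C)" "tgt (f0' F) = Unit C"
  by (simp_all add: f2_def f2'_def f0_def f0'_def)

lemma mor_f2:
  "mor (f2 F X Y) = F2 F X Y"
  "mor (f2' F X Y) = inv_arr C (FO F X \<boxtimes> FO F Y) (FO F (X \<boxtimes> Y)) (F2 F X Y)"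
  "mor (f0 F) = F0 F" "mor (f0' F) = inv_arr C (Unit C) (FO F (Unit C)) (F0 F)"
  by (simp_all add: f2_def f2'_def f0_def f0'_def)

lemma smfD:
  assumes "smf F"
  shows FO_Obj [simp]: "X \<in> Obj C \<Longrightarrow> FO F X \<in> Obj C"
    and fm_one [simp]: "X \<in> Obj C \<Longrightarrow> fm F (one X) = one (FO F X)"
    and ok_fm [simp]: "ok t \<Longrightarrow> ok (fm F t)"
    and fm_comp [simp]: "\<lbrakk>ok t; ok s; src t = tgt s\<rbrakk> \<Longrightarrow> fm F (t \<diamond> s) = fm F t \<diamond> fm F s"
proof -
  have F: "is_functor C C F" using assms by (simp add: strong_monoidal_functor_def)
  show o: "X \<in> Obj C \<Longrightarrow> FO F X \<in> Obj C" for X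
    using F by (simp add: is_functor_def)
  show "X \<in> Obj C \<Longrightarrow> fm F (one X) = one (FO F X)"
    using F by (simp add: is_functor_def fm_def one_def)
  show "ok t \<Longrightarrow> ok (fm F t)"
    using F okD(3)[of t] by (simp add: is_functor_def fm_def)
  show "\<lbrakk>ok t; ok s; src t = tgt s\<rbrakk> \<Longrightarrow> fm F (t \<diamond> s) = fm F t \<diamond> fm F s"
    using F okD(3)[of t] okD(3)[of s] by (simp add: is_functor_def fm_def comp_def)
qed

lemma inverse_f2: "\<lbrakk>smf F; X \<in> Obj C; Y \<in> Obj C\<rbrakk> \<Longrightarrow> inverse_pair (f2 F X Y) (f2' F X Y)"
  and inverse_f0: "smf F \<Longrightarrow> inverse_pair (f0 F) (f0' F)"
  unfolding f2_def f2'_def f0_def f0'_def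
  by (intro is_isoD; simp add: strong_monoidal_functor_def is_functor_def)+

lemma ok_f2 [simp]:
  "\<lbrakk>smf F; X \<in> Obj C; Y \<in> Obj C\<rbrakk> \<Longrightarrow> ok (f2 F X Y)"
  "\<lbrakk>smf F; X \<in> Obj C; Y \<in> Obj C\<rbrakk> \<Longrightarrow> ok (f2' F X Y)"
  "smf F \<Longrightarrow> ok (f0 F)" "smf F \<Longrightarrow> ok (f0' F)"
  using inverse_f2 inverse_f0 by (auto simp: inverse_pair_def)

lemmas f2_cancel [simp] = inverse_pair_cancel[OF inverse_f2, simplified]
lemmas f0_cancel [simp] = inverse_pair_cancel[OF inverse_f0, simplified]

lemma inverse_fm: "\<lbrakk>smf F; inverse_pair t s\<rbrakk> \<Longrightarrow> inverse_pair (fm F t) (fm F s)"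
  unfolding inverse_pair_def using fm_comp[of F] by (auto simp flip: fm_comp)

lemma f2_natural: "\<lbrakk>smf F; ok t; ok s\<rbrakk> \<Longrightarrow>
    f2 F (tgt t) (tgt s) \<diamond> (fm F t \<parallel> fm F s) = fm F (t \<parallel> s) \<diamond> f2 F (src t) (src s)"
  unfolding strong_monoidal_functor_def
  using okD(3)[of t] okD(3)[of s] by (simp add: f2_def fm_def ten_def comp_def)

lemma f2'_natural:
  assumes "smf F" "ok t" "ok s"
  shows "f2' F (tgt t) (tgt s) \<diamond> fm F (t \<parallel> s) = (fm F t \<parallel> fm F s) \<diamond> f2' F (src t) (src s)"
  by (rule inverse_pair_left_eq[OF inverse_f2[of F "tgt t" "tgt s"]])
     (use assms comp_reduce[OF f2_natural[OF assms], of "f2' F (src t) (src s)"] in simp_all)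

lemma f2_asc:
  assumes F: "smf F" and "X \<in> Obj C" "Y \<in> Obj C" "Z \<in> Obj C"
  shows "fm F (asc X Y Z) \<diamond> f2 F (X \<boxtimes> Y) Z \<diamond> (f2 F X Y \<parallel> one (FO F Z)) =
    f2 F X (Y \<boxtimes> Z) \<diamond> (one (FO F X) \<parallel> f2 F Y Z) \<diamond> asc (FO F X) (FO F Y) (FO F Z)"
proof -
  have "(fm F (asc X Y Z) \<diamond> f2 F (X \<boxtimes> Y) Z) \<diamond> (f2 F X Y \<parallel> one (FO F Z)) =
      (f2 F X (Y \<boxtimes> Z) \<diamond> (one (FO F X) \<parallel> f2 F Y Z)) \<diamond> asc (FO F X) (FO F Y) (FO F Z)"
    using assms unfolding strong_monoidal_functor_def
    by (simp add: f2_def fm_def ten_def comp_def asc_def one_def)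
  then show ?thesis using assms by simp
qed

lemma f2_lu:
  assumes F: "smf F" and "X \<in> Obj C"
  shows "fm F (lu X) \<diamond> f2 F (Unit C) X \<diamond> (f0 F \<parallel> one (FO F X)) = lu (FO F X)"
proof -
  have "(fm F (lu X) \<diamond> f2 F (Unit C) X) \<diamond> (f0 F \<parallel> one (FO F X)) = lu (FO F X)"
    using assms unfolding strong_monoidal_functor_def
    by (simp add: f2_def f0_def fm_def ten_def comp_def lu_def one_def)
  then show ?thesis using assms by simp
qed

lemma f2_ru:
  assumes F: "smf F" and "X \<in> Obj C"
  shows "fm F (ru X) \<diamond> f2 F X (Unit C) \<diamond> (one (FO F X) \<parallel> f0 F) = ru (FO F X)"
proof -
  have "(fm F (ru X) \<diamond> f2 F X (Unit C)) \<diamond> (one (FO F X) \<parallel> f0 F) = ru (FO F X)"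
    using assms unfolding strong_monoidal_functor_def
    by (simp add: f2_def f0_def fm_def ten_def comp_def ru_def one_def)
  then show ?thesis using assms by simp
qed

lemma lu_f0': "\<lbrakk>smf F; X \<in> Obj C\<rbrakk> \<Longrightarrow>
    lu (FO F X) \<diamond> (f0' F \<parallel> one (FO F X)) = fm F (lu X) \<diamond> f2 F (Unit C) X"
  by (simp add: f2_lu[symmetric])

lemma ru_f0': "\<lbrakk>smf F; X \<in> Obj C\<rbrakk> \<Longrightarrow>
    ru (FO F X) \<diamond> (one (FO F X) \<parallel> f0' F) = fm F (ru X) \<diamond> f2 F X (Unit C)"
  by (simp add: f2_ru[symmetric])

lemma f2_asc':
  assumes F: "smf F" and "X \<in> Obj C" "Y \<in> Obj C" "Z \<in> Obj C"
  shows "f2 F (X \<boxtimes> Y) Z \<diamond> (f2 F X Y \<parallel> one (FO F Z)) \<diamond> asc' (FO F X) (FO F Y) (FO F Z) =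
    fm F (asc' X Y Z) \<diamond> f2 F X (Y \<boxtimes> Z) \<diamond> (one (FO F X) \<parallel> f2 F Y Z)" (is "?l = ?r")
proof (rule inverse_pair_left_eq[OF inverse_fm[OF F inverse_structural(1)]])
  have "fm F (asc X Y Z) \<diamond> ?l =
      (fm F (asc X Y Z) \<diamond> f2 F (X \<boxtimes> Y) Z \<diamond> (f2 F X Y \<parallel> one (FO F Z))) \<diamond> asc' (FO F X) (FO F Y) (FO F Z)"
    using assms by simp
  also have "\<dots> = f2 F X (Y \<boxtimes> Z) \<diamond> (one (FO F X) \<parallel> f2 F Y Z)"
    unfolding f2_asc[OF assms] using assms by simp
  also have "\<dots> = fm F (asc X Y Z) \<diamond> ?r"
    using inverse_pair_cancel(4)[OF inverse_fm[OF F inverse_structural(1)[OF assms(2-4)]]] assms by simp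
  finally show "fm F (asc X Y Z) \<diamond> ?l = fm F (asc X Y Z) \<diamond> ?r" .
qed (use assms in simp_all)

lemma f2'_asc:
  assumes F: "smf F" and "X \<in> Obj C" "Y \<in> Obj C" "Z \<in> Obj C"
  shows "asc (FO F X) (FO F Y) (FO F Z) \<diamond> (f2' F X Y \<parallel> one (FO F Z)) \<diamond> f2' F (X \<boxtimes> Y) Z =
    (one (FO F X) \<parallel> f2' F Y Z) \<diamond> f2' F X (Y \<boxtimes> Z) \<diamond> fm F (asc X Y Z)" (is "?l = ?r")
proof -
  have one: "inverse_pair (one A) (one A)" if "A \<in> Obj C" for A
    using that by (simp add: inverse_pair_def)
  have B: "inverse_pair (f2 F X (Y \<boxtimes> Z) \<diamond> (one (FO F X) \<parallel> f2 F Y Z)) ((one (FO F X) \<parallel> f2' F Y Z) \<diamond> f2' F X (Y \<boxtimes> Z))"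
    using assms by (intro inverse_pair_comp inverse_pair_ten inverse_f2 one) simp_all
  show ?thesis
  proof (rule inverse_pair_left_eq[OF B])
    have "(f2 F X (Y \<boxtimes> Z) \<diamond> (one (FO F X) \<parallel> f2 F Y Z)) \<diamond> ?l =
        (f2 F X (Y \<boxtimes> Z) \<diamond> (one (FO F X) \<parallel> f2 F Y Z) \<diamond> asc (FO F X) (FO F Y) (FO F Z)) \<diamond>
          (f2' F X Y \<parallel> one (FO F Z)) \<diamond> f2' F (X \<boxtimes> Y) Z"
      using assms by simp
    also have "\<dots> = fm F (asc X Y Z)"
      unfolding f2_asc[OF assms, symmetric] using assms by simp
    also have "\<dots> = (f2 F X (Y \<boxtimes> Z) \<diamond> (one (FO F X) \<parallel> f2 F Y Z)) \<diamond> ?r"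
      using assms by simp
    finally show "(f2 F X (Y \<boxtimes> Z) \<diamond> (one (FO F X) \<parallel> f2 F Y Z)) \<diamond> ?l =
        (f2 F X (Y \<boxtimes> Z) \<diamond> (one (FO F X) \<parallel> f2 F Y Z)) \<diamond> ?r" .
  qed (use assms in simp_all)
qed

text \<open>By naturality and coherence of the structure maps of \<open>F\<close>, each triangle identity for the images
  is the image of the corresponding triangle identity under \<open>F\<close>.\<close>

lemma functor_dual_arrows:
  assumes F: "smf F" and d: "dual_arrows Y M E K"
  shows "dual_arrows (FO F Y) (FO F M) (f0' F \<diamond> fm F E \<diamond> f2 F Y M) (f2' F M Y \<diamond> fm F K \<diamond> f0 F)"
proof -
  let ?I = "Unit C" and ?M = "FO F M" and ?Y = "FO F Y"
  note D = dual_arrowsD[OF d]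
  note typed = F D(1-8)
  have 1: "f2 F M ?I \<diamond> (one ?M \<parallel> fm F E) = fm F (one M \<parallel> E) \<diamond> f2 F M (Y \<boxtimes> M)"
    using f2_natural[of F "one M" E] typed by simp
  have 2: "f2 F M (Y \<boxtimes> M) \<diamond> (one ?M \<parallel> f2 F Y M) \<diamond> asc ?M ?Y ?M =
      fm F (asc M Y M) \<diamond> f2 F (M \<boxtimes> Y) M \<diamond> (f2 F M Y \<parallel> one ?M)"
    using f2_asc typed by simp
  have 3: "f2 F (M \<boxtimes> Y) M \<diamond> (fm F K \<parallel> one ?M) = fm F (K \<parallel> one M) \<diamond> f2 F ?I M"
    using f2_natural[of F K "one M"] typed by simp
  have "ru ?M \<diamond> (one ?M \<parallel> (f0' F \<diamond> fm F E \<diamond> f2 F Y M)) \<diamond> asc ?M ?Y ?M \<diamond>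
      ((f2' F M Y \<diamond> fm F K \<diamond> f0 F) \<parallel> one ?M) =
      (ru ?M \<diamond> (one ?M \<parallel> f0' F)) \<diamond> (one ?M \<parallel> fm F E) \<diamond> (one ?M \<parallel> f2 F Y M) \<diamond> asc ?M ?Y ?M \<diamond>
      ((f2' F M Y \<diamond> fm F K \<diamond> f0 F) \<parallel> one ?M)"
    using typed by simp
  also have "\<dots> = fm F (ru M) \<diamond> (f2 F M ?I \<diamond> (one ?M \<parallel> fm F E)) \<diamond> (one ?M \<parallel> f2 F Y M) \<diamond> asc ?M ?Y ?M \<diamond>
      ((f2' F M Y \<diamond> fm F K \<diamond> f0 F) \<parallel> one ?M)"
    unfolding ru_f0'[OF F D(1)] using typed by (simp del: ten_comp ten_comp_assoc)
  also have "\<dots> = fm F (ru M) \<diamond> fm F (one M \<parallel> E) \<diamond> (f2 F M (Y \<boxtimes> M) \<diamond> (one ?M \<parallel> f2 F Y M) \<diamond> asc ?M ?Y ?M) \<diamond>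
      ((f2' F M Y \<diamond> fm F K \<diamond> f0 F) \<parallel> one ?M)"
    unfolding 1 using typed by (simp del: ten_comp ten_comp_assoc)
  also have "\<dots> = fm F (ru M) \<diamond> fm F (one M \<parallel> E) \<diamond> fm F (asc M Y M) \<diamond>
      (f2 F (M \<boxtimes> Y) M \<diamond> (fm F K \<parallel> one ?M)) \<diamond> (f0 F \<parallel> one ?M)"
    unfolding 2 using typed by simp
  also have "\<dots> = fm F (ru M \<diamond> (one M \<parallel> E) \<diamond> asc M Y M \<diamond> (K \<parallel> one M)) \<diamond> f2 F ?I M \<diamond> (f0 F \<parallel> one ?M)"
    unfolding 3 using typed by simp
  also have "\<dots> = lu ?M"
    unfolding D(9) by (rule f2_lu[OF F D(1)])
  finally have l: "ru ?M \<diamond> (one ?M \<parallel> (f0' F \<diamond> fm F E \<diamond> f2 F Y M)) \<diamond> asc ?M ?Y ?M \<diamond>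
      ((f2' F M Y \<diamond> fm F K \<diamond> f0 F) \<parallel> one ?M) = lu ?M" .
  have 4: "f2 F ?I Y \<diamond> (fm F E \<parallel> one ?Y) = fm F (E \<parallel> one Y) \<diamond> f2 F (Y \<boxtimes> M) Y"
    using f2_natural[of F E "one Y"] typed by simp
  have 5: "f2 F Y (M \<boxtimes> Y) \<diamond> (one ?Y \<parallel> fm F K) = fm F (one Y \<parallel> K) \<diamond> f2 F Y ?I"
    using f2_natural[of F "one Y" K] typed by simp
  have "lu ?Y \<diamond> ((f0' F \<diamond> fm F E \<diamond> f2 F Y M) \<parallel> one ?Y) \<diamond> asc' ?Y ?M ?Y \<diamond>
      (one ?Y \<parallel> (f2' F M Y \<diamond> fm F K \<diamond> f0 F)) =
      (lu ?Y \<diamond> (f0' F \<parallel> one ?Y)) \<diamond> (fm F E \<parallel> one ?Y) \<diamond> (f2 F Y M \<parallel> one ?Y) \<diamond> asc' ?Y ?M ?Y \<diamond>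
      (one ?Y \<parallel> (f2' F M Y \<diamond> fm F K \<diamond> f0 F))"
    using typed by simp
  also have "\<dots> = fm F (lu Y) \<diamond> (f2 F ?I Y \<diamond> (fm F E \<parallel> one ?Y)) \<diamond> (f2 F Y M \<parallel> one ?Y) \<diamond> asc' ?Y ?M ?Y \<diamond>
      (one ?Y \<parallel> (f2' F M Y \<diamond> fm F K \<diamond> f0 F))"
    unfolding lu_f0'[OF F D(2)] using typed by (simp del: ten_comp ten_comp_assoc)
  also have "\<dots> = fm F (lu Y) \<diamond> fm F (E \<parallel> one Y) \<diamond> (f2 F (Y \<boxtimes> M) Y \<diamond> (f2 F Y M \<parallel> one ?Y) \<diamond> asc' ?Y ?M ?Y) \<diamond>
      (one ?Y \<parallel> (f2' F M Y \<diamond> fm F K \<diamond> f0 F))"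
    unfolding 4 using typed by (simp del: ten_comp ten_comp_assoc)
  also have "\<dots> = fm F (lu Y) \<diamond> fm F (E \<parallel> one Y) \<diamond> fm F (asc' Y M Y) \<diamond>
      (f2 F Y (M \<boxtimes> Y) \<diamond> (one ?Y \<parallel> fm F K)) \<diamond> (one ?Y \<parallel> f0 F)"
    unfolding f2_asc'[OF F D(2,1,2)] using typed by simp
  also have "\<dots> = fm F (lu Y \<diamond> (E \<parallel> one Y) \<diamond> asc' Y M Y \<diamond> (one Y \<parallel> K)) \<diamond> f2 F Y ?I \<diamond> (one ?Y \<parallel> f0 F)"
    unfolding 5 using typed by simp
  also have "\<dots> = ru ?Y"
    unfolding D(10) by (rule f2_ru[OF F D(2)])
  finally have "lu ?Y \<diamond> ((f0' F \<diamond> fm F E \<diamond> f2 F Y M) \<parallel> one ?Y) \<diamond> asc' ?Y ?M ?Y \<diamond>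
      (one ?Y \<parallel> (f2' F M Y \<diamond> fm F K \<diamond> f0 F)) = ru ?Y" .
  with l show ?thesis
    using typed by (simp add: dual_arrows_def)
qed

end

section \<open>Direct sums and kernels\<close>

context linear_category
begin

abbreviation (input) zr :: "'o \<Rightarrow> 'o \<Rightarrow> ('o, 'a) arrow" where
  "zr X Y \<equiv> Arrow X \<zero>\<^bsub>HomSp C X Y\<^esub> Y"

lemma HomSp_kspace: "\<lbrakk>X \<in> Obj C; Y \<in> Obj C\<rbrakk> \<Longrightarrow> kspace (HomSp C X Y)"
  by (rule kspace.intro[OF HomSp_vectorspace])

lemma zero_in_Hom [simp]: "\<lbrakk>X \<in> Obj C; Y \<in> Obj C\<rbrakk> \<Longrightarrow> \<zero>\<^bsub>HomSp C X Y\<^esub> \<in> Hom C X Y"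
proof -
  assume "X \<in> Obj C" "Y \<in> Obj C"
  then interpret H: kspace "HomSp C X Y" by (rule HomSp_kspace)
  show ?thesis by (rule H.zero_closed)
qed

lemma comp_zero [simp]:
  "\<lbrakk>ok t; src t = Y; X \<in> Obj C\<rbrakk> \<Longrightarrow> t \<diamond> zr X Y = zr X (tgt t)"
  "\<lbrakk>ok t; tgt t = X; Y \<in> Obj C\<rbrakk> \<Longrightarrow> zr X Y \<diamond> t = zr (src t) Y"
  using module_hom_zero[OF Cmp_linear_right[of X Y "tgt t" "mor t"] HomSp_vectorspace HomSp_vectorspace]
    module_hom_zero[OF Cmp_linear_left[of "src t" X Y "mor t"] HomSp_vectorspace HomSp_vectorspace]
  by (auto simp: comp_def ok_def)

lemma comp_finsum_left:
  assumes "X \<in> Obj C" "Y \<in> Obj C" "Z \<in> Obj C" "f \<in> Hom C Y Z" "\<And>i. i \<in> I \<Longrightarrow> g i \<in> Hom C X Y"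
  shows "f \<cdot> finsum (HomSp C X Y) g I = finsum (HomSp C X Z) (\<lambda>i. f \<cdot> g i) I"
  using assms by (intro module_hom_finsum[OF Cmp_linear_right HomSp_vectorspace HomSp_vectorspace])

lemma comp_finsum_right:
  assumes "X \<in> Obj C" "Y \<in> Obj C" "Z \<in> Obj C" "f \<in> Hom C X Y" "\<And>i. i \<in> I \<Longrightarrow> g i \<in> Hom C Y Z"
  shows "finsum (HomSp C Y Z) g I \<cdot> f = finsum (HomSp C X Z) (\<lambda>i. g i \<cdot> f) I"
  using assms by (intro module_hom_finsum[OF Cmp_linear_left HomSp_vectorspace HomSp_vectorspace])

lemma finsum_Hom:
  assumes "X \<in> Obj C" "Y \<in> Obj C" "\<And>i. i \<in> I \<Longrightarrow> g i \<in> Hom C X Y"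
  shows "finsum (HomSp C X Y) g I \<in> Hom C X Y"
proof -
  interpret H: kspace "HomSp C X Y" using assms by (intro HomSp_kspace)
  show ?thesis using assms by (intro H.finsum_closed) auto
qed

lemma finsum_Hom_single:
  assumes "X \<in> Obj C" "Y \<in> Obj C" "i \<in> I" "finite I" "f \<in> Hom C X Y"
    and "\<And>j. \<lbrakk>j \<in> I; j \<noteq> i\<rbrakk> \<Longrightarrow> g j = \<zero>\<^bsub>HomSp C X Y\<^esub>" "g i = f"
  shows "finsum (HomSp C X Y) g I = f"
proof -
  interpret H: kspace "HomSp C X Y" using assms by (intro HomSp_kspace)
  have "finsum (HomSp C X Y) g I = finsum (HomSp C X Y) (\<lambda>j. if i = j then f else \<zero>\<^bsub>HomSp C X Y\<^esub>) I"
    using assms by (intro H.finsum_cong') auto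
  also have "\<dots> = f"
    using assms by (intro H.add.finprod_singleton[folded finsum_def]) auto
  finally show ?thesis .
qed

lemma biproductD:
  assumes "biproduct C I F B \<iota> \<pi>"
  shows "finite I" "B \<in> Obj C" "i \<in> I \<Longrightarrow> F i \<in> Obj C"
    "i \<in> I \<Longrightarrow> \<iota> i \<in> Hom C (F i) B" "i \<in> I \<Longrightarrow> \<pi> i \<in> Hom C B (F i)"
    "\<lbrakk>i \<in> I; j \<in> I\<rbrakk> \<Longrightarrow> \<pi> j \<cdot> \<iota> i = (if i = j then Idn C (F i) else \<zero>\<^bsub>HomSp C (F i) (F j)\<^esub>)"
    "finsum (HomSp C B B) (\<lambda>i. \<iota> i \<cdot> \<pi> i) I = Idn C B"
  using assms unfolding biproduct_def by auto

lemma finsum_Hom_cong: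
  assumes "X \<in> Obj C" "Y \<in> Obj C" "\<And>i. i \<in> I \<Longrightarrow> g i \<in> Hom C X Y" "\<And>i. i \<in> I \<Longrightarrow> f i = g i"
  shows "finsum (HomSp C X Y) f I = finsum (HomSp C X Y) g I"
proof -
  interpret H: kspace "HomSp C X Y" using assms(1,2) by (rule HomSp_kspace)
  show ?thesis using assms(3,4) by (intro H.finsum_cong') auto
qed

text \<open>The identity of a direct sum is the sum of the \<open>\<iota> i \<cdot> \<pi> i\<close>.\<close>

lemma biproduct_epi:
  assumes b: "biproduct C I F B \<iota> \<pi>" and Z: "Z \<in> Obj C" and f: "f \<in> Hom C B Z" and g: "g \<in> Hom C B Z"
    and eq: "\<And>i. i \<in> I \<Longrightarrow> f \<cdot> \<iota> i = g \<cdot> \<iota> i"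
  shows "f = g"
proof -
  note B = biproductD[OF b]
  have hom: "(h \<cdot> \<iota> i) \<cdot> \<pi> i \<in> Hom C B Z" if "h \<in> Hom C B Z" "i \<in> I" for h i
    using B(2-5) that Z by (intro Cmp_in_Hom[of B "F i" Z] Cmp_in_Hom[of "F i" B Z])
  have expand: "h = finsum (HomSp C B Z) (\<lambda>i. (h \<cdot> \<iota> i) \<cdot> \<pi> i) I" if h: "h \<in> Hom C B Z" for h
  proof -
    have "h = h \<cdot> finsum (HomSp C B B) (\<lambda>i. \<iota> i \<cdot> \<pi> i) I"
      using Idn_right[OF B(2) Z h] B(7) by simp
    also have "\<dots> = finsum (HomSp C B Z) (\<lambda>i. h \<cdot> (\<iota> i \<cdot> \<pi> i)) I"
      by (intro comp_finsum_left B(2) Z h Cmp_in_Hom[OF B(2,3,2,5,4)])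
    also have "\<dots> = finsum (HomSp C B Z) (\<lambda>i. (h \<cdot> \<iota> i) \<cdot> \<pi> i) I"
      by (intro finsum_Hom_cong B(2) Z hom[OF h] Cmp_assoc[OF B(2,3,2) Z B(5,4) h, symmetric])
    finally show ?thesis .
  qed
  have "finsum (HomSp C B Z) (\<lambda>i. (f \<cdot> \<iota> i) \<cdot> \<pi> i) I = finsum (HomSp C B Z) (\<lambda>i. (g \<cdot> \<iota> i) \<cdot> \<pi> i) I"
    by (intro finsum_Hom_cong B(2) Z hom[OF g]) (simp_all add: eq)
  then show ?thesis
    using expand[OF f] expand[OF g] by simp
qed

lemma biproduct_mono:
  assumes b: "biproduct C I F B \<iota> \<pi>" and Z: "Z \<in> Obj C" and f: "f \<in> Hom C Z B" and g: "g \<in> Hom C Z B"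
    and eq: "\<And>i. i \<in> I \<Longrightarrow> \<pi> i \<cdot> f = \<pi> i \<cdot> g"
  shows "f = g"
proof -
  note B = biproductD[OF b]
  have hom: "\<iota> i \<cdot> (\<pi> i \<cdot> h) \<in> Hom C Z B" if "h \<in> Hom C Z B" "i \<in> I" for h i
    using B(2-5) that Z by (intro Cmp_in_Hom[of Z "F i" B] Cmp_in_Hom[of Z B "F i"])
  have expand: "h = finsum (HomSp C Z B) (\<lambda>i. \<iota> i \<cdot> (\<pi> i \<cdot> h)) I" if h: "h \<in> Hom C Z B" for h
  proof -
    have "h = finsum (HomSp C B B) (\<lambda>i. \<iota> i \<cdot> \<pi> i) I \<cdot> h"
      using Idn_left[OF Z B(2) h] B(7) by simp
    also have "\<dots> = finsum (HomSp C Z B) (\<lambda>i. (\<iota> i \<cdot> \<pi> i) \<cdot> h) I"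
      by (intro comp_finsum_right B(2) Z h Cmp_in_Hom[OF B(2,3,2,5,4)])
    also have "\<dots> = finsum (HomSp C Z B) (\<lambda>i. \<iota> i \<cdot> (\<pi> i \<cdot> h)) I"
      by (intro finsum_Hom_cong B(2) Z hom[OF h] Cmp_assoc[OF Z B(2,3,2) h B(5,4)])
    finally show ?thesis .
  qed
  have "finsum (HomSp C Z B) (\<lambda>i. \<iota> i \<cdot> (\<pi> i \<cdot> f)) I = finsum (HomSp C Z B) (\<lambda>i. \<iota> i \<cdot> (\<pi> i \<cdot> g)) I"
    by (intro finsum_Hom_cong B(2) Z hom[OF g]) (simp_all add: eq)
  then show ?thesis
    using expand[OF f] expand[OF g] by simp
qed

lemma biproduct_copair:
  assumes b: "biproduct C I F B \<iota> \<pi>" and Z: "Z \<in> Obj C" and u: "\<And>i. i \<in> I \<Longrightarrow> u i \<in> Hom C (F i) Z"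
  shows "finsum (HomSp C B Z) (\<lambda>i. u i \<cdot> \<pi> i) I \<in> Hom C B Z"
    and "j \<in> I \<Longrightarrow> finsum (HomSp C B Z) (\<lambda>i. u i \<cdot> \<pi> i) I \<cdot> \<iota> j = u j"
proof -
  note B = biproductD[OF b]
  note Cu = Cmp_in_Hom[OF B(2,3) Z B(5) u]
  show "finsum (HomSp C B Z) (\<lambda>i. u i \<cdot> \<pi> i) I \<in> Hom C B Z"
    by (intro finsum_Hom B(2) Z Cu)
  assume j: "j \<in> I"
  have "finsum (HomSp C B Z) (\<lambda>i. u i \<cdot> \<pi> i) I \<cdot> \<iota> j = finsum (HomSp C (F j) Z) (\<lambda>i. (u i \<cdot> \<pi> i) \<cdot> \<iota> j) I"
    by (intro comp_finsum_right B(2,3,4) Z j Cu)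
  also have "\<dots> = u j"
  proof (rule finsum_Hom_single[OF _ Z j])
    have summand: "(u i \<cdot> \<pi> i) \<cdot> \<iota> j = u i \<cdot> (\<pi> i \<cdot> \<iota> j)" if "i \<in> I" for i
      by (rule Cmp_assoc[OF B(3)[OF j] B(2) B(3)[OF that] Z B(4)[OF j] B(5)[OF that] u[OF that]])
    show "(u i \<cdot> \<pi> i) \<cdot> \<iota> j = \<zero>\<^bsub>HomSp C (F j) Z\<^esub>" if i: "i \<in> I" "i \<noteq> j" for i
      using comp_zero(1)[of "Arrow (F i) (u i) Z" "F i" "F j"] B(3,6) u i j Z
      by (simp add: summand comp_def)
    show "(u j \<cdot> \<pi> j) \<cdot> \<iota> j = u j"
      using B j Z u by (simp add: summand Idn_right[of "F j" Z])
  qed (simp_all add: B j u)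
  finally show "finsum (HomSp C B Z) (\<lambda>i. u i \<cdot> \<pi> i) I \<cdot> \<iota> j = u j" .
qed

lemma biproduct_pair:
  assumes b: "biproduct C I F B \<iota> \<pi>" and Z: "Z \<in> Obj C" and u: "\<And>i. i \<in> I \<Longrightarrow> u i \<in> Hom C Z (F i)"
  shows "\<exists>v\<in>Hom C Z B. \<forall>j\<in>I. \<pi> j \<cdot> v = u j"
proof (intro bexI ballI)
  note B = biproductD[OF b]
  note Cu = Cmp_in_Hom[OF Z B(3,2) u B(4)]
  show "finsum (HomSp C Z B) (\<lambda>i. \<iota> i \<cdot> u i) I \<in> Hom C Z B"
    by (intro finsum_Hom B(2) Z Cu)
  fix j assume j: "j \<in> I"
  have "\<pi> j \<cdot> finsum (HomSp C Z B) (\<lambda>i. \<iota> i \<cdot> u i) I = finsum (HomSp C Z (F j)) (\<lambda>i. \<pi> j \<cdot> (\<iota> i \<cdot> u i)) I"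
    by (intro comp_finsum_left B(2,3,5) Z j Cu)
  also have "\<dots> = u j"
  proof (rule finsum_Hom_single[OF Z _ j])
    have summand: "\<pi> j \<cdot> (\<iota> i \<cdot> u i) = (\<pi> j \<cdot> \<iota> i) \<cdot> u i" if "i \<in> I" for i
      by (rule Cmp_assoc[OF Z B(3)[OF that] B(2) B(3)[OF j] u[OF that] B(4)[OF that] B(5)[OF j], symmetric])
    show "\<pi> j \<cdot> (\<iota> i \<cdot> u i) = \<zero>\<^bsub>HomSp C Z (F j)\<^esub>" if i: "i \<in> I" "i \<noteq> j" for i
      using comp_zero(2)[of "Arrow Z (u i) (F i)" "F i" "F j"] B(3,6) u i j Z
      by (simp add: summand comp_def)
    show "\<pi> j \<cdot> (\<iota> j \<cdot> u j) = u j"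
      using B j Z u by (simp add: summand Idn_left[of Z "F j"])
  qed (simp_all add: B j u)
  finally show "\<pi> j \<cdot> finsum (HomSp C Z B) (\<lambda>i. \<iota> i \<cdot> u i) I = u j" .
qed

lemma linear_functor_biproduct:
  assumes \<Phi>: "linear_functor C C \<Phi>" and b: "biproduct C I F B \<iota> \<pi>"
  shows "biproduct C I (\<lambda>i. FO \<Phi> (F i)) (FO \<Phi> B) (\<lambda>i. FM \<Phi> (F i) B (\<iota> i)) (\<lambda>i. FM \<Phi> B (F i) (\<pi> i))"
proof -
  note B = biproductD[OF b]
  have ftor: "is_functor C C \<Phi>" and
    lin: "\<lbrakk>X \<in> Obj C; Y \<in> Obj C\<rbrakk> \<Longrightarrow> FM \<Phi> X Y \<in> module_hom class_ring (HomSp C X Y) (HomSp C (FO \<Phi> X) (FO \<Phi> Y))" for X Y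
    using \<Phi> by (auto simp: linear_functor_def)
  have o: "X \<in> Obj C \<Longrightarrow> FO \<Phi> X \<in> Obj C" for X using ftor by (simp add: is_functor_def)
  have hom: "FM \<Phi> X Y f \<in> Hom C (FO \<Phi> X) (FO \<Phi> Y)" if "X \<in> Obj C" "Y \<in> Obj C" "f \<in> Hom C X Y" for X Y f
    using ftor that by (simp add: is_functor_def)
  have cmp: "FM \<Phi> Y Z g \<cdot> FM \<Phi> X Y f = FM \<Phi> X Z (g \<cdot> f)"
    if "X \<in> Obj C" "Y \<in> Obj C" "Z \<in> Obj C" "f \<in> Hom C X Y" "g \<in> Hom C Y Z" for X Y Z f g
    using ftor that by (simp add: is_functor_def)
  have "finsum (HomSp C (FO \<Phi> B) (FO \<Phi> B)) (\<lambda>i. FM \<Phi> (F i) B (\<iota> i) \<cdot> FM \<Phi> B (F i) (\<pi> i)) I =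
      finsum (HomSp C (FO \<Phi> B) (FO \<Phi> B)) (\<lambda>i. FM \<Phi> B B (\<iota> i \<cdot> \<pi> i)) I"
    by (intro finsum_Hom_cong o B(2) hom[OF B(2,2)] cmp B(3-5) Cmp_in_Hom[OF B(2,3,2,5,4)])
  also have "\<dots> = FM \<Phi> B B (finsum (HomSp C B B) (\<lambda>i. \<iota> i \<cdot> \<pi> i) I)"
    by (intro module_hom_finsum[OF lin HomSp_vectorspace HomSp_vectorspace, symmetric] o B(2)
        Cmp_in_Hom[OF B(2,3,2,5,4)])
  also have "\<dots> = Idn C (FO \<Phi> B)"
    using ftor B(2) by (simp add: B(7) is_functor_def)
  finally have "finsum (HomSp C (FO \<Phi> B) (FO \<Phi> B)) (\<lambda>i. FM \<Phi> (F i) B (\<iota> i) \<cdot> FM \<Phi> B (F i) (\<pi> i)) I = Idn C (FO \<Phi> B)" .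
  moreover have "FM \<Phi> B (F j) (\<pi> j) \<cdot> FM \<Phi> (F i) B (\<iota> i) =
      (if i = j then Idn C (FO \<Phi> (F i)) else \<zero>\<^bsub>HomSp C (FO \<Phi> (F i)) (FO \<Phi> (F j))\<^esub>)" if "i \<in> I" "j \<in> I" for i j
  proof -
    have "FM \<Phi> B (F j) (\<pi> j) \<cdot> FM \<Phi> (F i) B (\<iota> i) = FM \<Phi> (F i) (F j) (\<pi> j \<cdot> \<iota> i)"
      by (rule cmp[OF B(3)[OF that(1)] B(2) B(3)[OF that(2)] B(4)[OF that(1)] B(5)[OF that(2)]])
    moreover have "FM \<Phi> (F i) (F i) (Idn C (F i)) = Idn C (FO \<Phi> (F i))"
      using ftor B(3)[OF that(1)] by (simp add: is_functor_def)
    moreover have "FM \<Phi> (F i) (F j) \<zero>\<^bsub>HomSp C (F i) (F j)\<^esub> = \<zero>\<^bsub>HomSp C (FO \<Phi> (F i)) (FO \<Phi> (F j))\<^esub>"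
      by (intro module_hom_zero[OF lin HomSp_vectorspace HomSp_vectorspace] o B(3) that)
    ultimately show ?thesis
      using B(6)[OF that] by auto
  qed
  ultimately show ?thesis
    using B o hom by (simp add: biproduct_def)
qed

lemma is_kernelI:
  assumes "ok f" "ok k" "src f = tgt k" "f \<diamond> k = zr (src k) (tgt f)"
    and ex: "\<And>w. \<lbrakk>ok w; tgt w = src f; f \<diamond> w = zr (src w) (tgt f)\<rbrakk> \<Longrightarrow>
      \<exists>v. ok v \<and> src v = src w \<and> tgt v = src k \<and> k \<diamond> v = w"
    and uniq: "\<And>v v'. \<lbrakk>ok v; ok v'; src v = src v'; tgt v = src k; tgt v' = src k; k \<diamond> v = k \<diamond> v'\<rbrakk> \<Longrightarrow> v = v'"
  shows "is_kernel C (src f) (tgt f) (mor f) (src k) (mor k)"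
  unfolding is_kernel_def
proof (intro conjI ballI impI)
  show "mor f \<cdot> mor k = \<zero>\<^bsub>HomSp C (src k) (tgt f)\<^esub>"
    using arg_cong[OF assms(4), of mor] by simp
  fix W w assume W: "W \<in> Obj C" "w \<in> Hom C W (src f)" "mor f \<cdot> w = \<zero>\<^bsub>HomSp C W (tgt f)\<^esub>"
  then obtain v where v: "ok v" "src v = W" "tgt v = src k" "k \<diamond> v = Arrow W w (src f)"
    using ex[of "Arrow W w (src f)"] assms(1) by (auto simp: comp_def okD)
  show "\<exists>!v. v \<in> Hom C W (src k) \<and> mor k \<cdot> v = w"
  proof (rule ex1I[of _ "mor v"])
    show "mor v \<in> Hom C W (src k) \<and> mor k \<cdot> mor v = w"
      using v okD(3)[of v] by (simp add: comp_def)
    fix v' assume v': "v' \<in> Hom C W (src k) \<and> mor k \<cdot> v' = w"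
    have "Arrow W v' (src k) = v"
      by (rule uniq) (use v v' W assms okD in \<open>auto simp: comp_def\<close>)
    then show "v' = mor v" by auto
  qed
qed (use assms(3) okD(1,2)[OF assms(1)] okD(1,2)[OF assms(2)] okD(3)[OF assms(1)] okD(3)[OF assms(2)] in simp_all)

lemma is_kernelD:
  assumes "is_kernel C X Y f K k"
  shows "X \<in> Obj C" "Y \<in> Obj C" "K \<in> Obj C" "f \<in> Hom C X Y" "k \<in> Hom C K X"
    and "Arrow X f Y \<diamond> Arrow K k X = zr K Y"
    and "\<lbrakk>ok w; tgt w = X; Arrow X f Y \<diamond> w = zr (src w) Y\<rbrakk> \<Longrightarrow>
      \<exists>v. ok v \<and> src v = src w \<and> tgt v = K \<and> Arrow K k X \<diamond> v = w"
    and "\<lbrakk>ok v; ok v'; src v = src v'; tgt v = K; tgt v' = K; Arrow K k X \<diamond> v = Arrow K k X \<diamond> v'\<rbrakk> \<Longrightarrow> v = v'"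
proof -
  show o: "X \<in> Obj C" "Y \<in> Obj C" "K \<in> Obj C" "f \<in> Hom C X Y" "k \<in> Hom C K X"
    using assms by (simp_all add: is_kernel_def)
  show z: "Arrow X f Y \<diamond> Arrow K k X = zr K Y"
    using assms by (simp add: is_kernel_def comp_def)
  have ex1: "\<exists>!v. v \<in> Hom C W K \<and> k \<cdot> v = w"
    if "W \<in> Obj C" "w \<in> Hom C W X" "f \<cdot> w = \<zero>\<^bsub>HomSp C W Y\<^esub>" for W w
    using assms that by (simp add: is_kernel_def)
  show "\<exists>v. ok v \<and> src v = src w \<and> tgt v = K \<and> Arrow K k X \<diamond> v = w"
    if w: "ok w" "tgt w = X" "Arrow X f Y \<diamond> w = zr (src w) Y"
  proof -
    have "f \<cdot> mor w = \<zero>\<^bsub>HomSp C (src w) Y\<^esub>"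
      using arg_cong[OF w(3), of mor] by simp
    then obtain v where "v \<in> Hom C (src w) K" "k \<cdot> v = mor w"
      using ex1[of "src w" "mor w"] w(2) okD[OF w(1)] by blast
    then show ?thesis
      using o w okD[OF w(1)] by (intro exI[of _ "Arrow (src w) v K"]) (cases w, simp add: comp_def)
  qed
  show "v = v'" if v: "ok v" "ok v'" "src v = src v'" "tgt v = K" "tgt v' = K"
      "Arrow K k X \<diamond> v = Arrow K k X \<diamond> v'"
  proof -
    have "Arrow X f Y \<diamond> Arrow K k X \<diamond> v = zr (src v) Y"
      using comp_reduce[OF z, of v] o v okD by simp
    then have "f \<cdot> (k \<cdot> mor v) = \<zero>\<^bsub>HomSp C (src v) Y\<^esub>"
      by (simp add: comp_def)
    then have "\<exists>!u. u \<in> Hom C (src v) K \<and> k \<cdot> u = k \<cdot> mor v"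
      using o okD[OF v(1)] v(4) Cmp_in_Hom[of "src v" K X "mor v" k] by (intro ex1) auto
    then have "mor v = mor v'"
      using v okD(3)[OF v(1)] okD(3)[OF v(2)] arg_cong[OF v(6), of mor] by (metis arrow.sel(2) src_tgt_comp(3))
    then show ?thesis using v by (cases v, cases v') simp
  qed
qed

lemma is_cokernelI:
  assumes "ok f" "ok q" "src q = tgt f" "q \<diamond> f = zr (src f) (tgt q)"
    and ex: "\<And>w. \<lbrakk>ok w; src w = tgt f; w \<diamond> f = zr (src f) (tgt w)\<rbrakk> \<Longrightarrow>
      \<exists>v. ok v \<and> src v = tgt q \<and> tgt v = tgt w \<and> v \<diamond> q = w"
    and uniq: "\<And>v v'. \<lbrakk>ok v; ok v'; tgt v = tgt v'; src v = tgt q; src v' = tgt q; v \<diamond> q = v' \<diamond> q\<rbrakk> \<Longrightarrow> v = v'"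
  shows "is_cokernel C (src f) (tgt f) (mor f) (tgt q) (mor q)"
  unfolding is_cokernel_def
proof (intro conjI ballI impI)
  show "mor q \<cdot> mor f = \<zero>\<^bsub>HomSp C (src f) (tgt q)\<^esub>"
    using arg_cong[OF assms(4), of mor] by simp
  fix W w assume W: "W \<in> Obj C" "w \<in> Hom C (tgt f) W" "w \<cdot> mor f = \<zero>\<^bsub>HomSp C (src f) W\<^esub>"
  then obtain v where v: "ok v" "src v = tgt q" "tgt v = W" "v \<diamond> q = Arrow (tgt f) w W"
    using ex[of "Arrow (tgt f) w W"] assms(1) by (auto simp: comp_def okD)
  show "\<exists>!v. v \<in> Hom C (tgt q) W \<and> v \<cdot> mor q = w"
  proof (rule ex1I[of _ "mor v"])
    show "mor v \<in> Hom C (tgt q) W \<and> mor v \<cdot> mor q = w"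
      using v okD(3)[of v] by (simp add: comp_def)
    fix v' assume v': "v' \<in> Hom C (tgt q) W \<and> v' \<cdot> mor q = w"
    have "Arrow (tgt q) v' W = v"
      by (rule uniq) (use v v' W assms okD in \<open>auto simp: comp_def\<close>)
    then show "v' = mor v" by auto
  qed
qed (use assms(3) okD(1,2)[OF assms(1)] okD(1,2)[OF assms(2)] okD(3)[OF assms(1)] okD(3)[OF assms(2)] in simp_all)

lemma is_cokernelD:
  assumes "is_cokernel C X Y f Q q"
  shows "X \<in> Obj C" "Y \<in> Obj C" "Q \<in> Obj C" "f \<in> Hom C X Y" "q \<in> Hom C Y Q"
    and "Arrow Y q Q \<diamond> Arrow X f Y = zr X Q"
    and "\<lbrakk>ok w; src w = Y; w \<diamond> Arrow X f Y = zr X (tgt w)\<rbrakk> \<Longrightarrow>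
      \<exists>v. ok v \<and> src v = Q \<and> tgt v = tgt w \<and> v \<diamond> Arrow Y q Q = w"
    and "\<lbrakk>ok v; ok v'; tgt v = tgt v'; src v = Q; src v' = Q; v \<diamond> Arrow Y q Q = v' \<diamond> Arrow Y q Q\<rbrakk> \<Longrightarrow> v = v'"
proof -
  show o: "X \<in> Obj C" "Y \<in> Obj C" "Q \<in> Obj C" "f \<in> Hom C X Y" "q \<in> Hom C Y Q"
    using assms by (simp_all add: is_cokernel_def)
  show z: "Arrow Y q Q \<diamond> Arrow X f Y = zr X Q"
    using assms by (simp add: is_cokernel_def comp_def)
  have ex1: "\<exists>!v. v \<in> Hom C Q W \<and> v \<cdot> q = w"
    if "W \<in> Obj C" "w \<in> Hom C Y W" "w \<cdot> f = \<zero>\<^bsub>HomSp C X W\<^esub>" for W w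
    using assms that by (simp add: is_cokernel_def)
  show "\<exists>v. ok v \<and> src v = Q \<and> tgt v = tgt w \<and> v \<diamond> Arrow Y q Q = w"
    if w: "ok w" "src w = Y" "w \<diamond> Arrow X f Y = zr X (tgt w)"
  proof -
    have "mor w \<cdot> f = \<zero>\<^bsub>HomSp C X (tgt w)\<^esub>"
      using arg_cong[OF w(3), of mor] by simp
    then obtain v where "v \<in> Hom C Q (tgt w)" "v \<cdot> q = mor w"
      using ex1[of "tgt w" "mor w"] w(2) okD[OF w(1)] by blast
    then show ?thesis
      using o w okD[OF w(1)] by (intro exI[of _ "Arrow Q v (tgt w)"]) (cases w, simp add: comp_def)
  qed
  show "v = v'" if v: "ok v" "ok v'" "tgt v = tgt v'" "src v = Q" "src v' = Q"
      "v \<diamond> Arrow Y q Q = v' \<diamond> Arrow Y q Q"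
  proof -
    have "(v \<diamond> Arrow Y q Q) \<diamond> Arrow X f Y = v \<diamond> zr X Q"
      using z o v okD by simp
    also have "\<dots> = zr X (tgt v)"
      using o v by simp
    finally have "(mor v \<cdot> q) \<cdot> f = \<zero>\<^bsub>HomSp C X (tgt v)\<^esub>"
      by (simp add: comp_def)
    then have "\<exists>!u. u \<in> Hom C Q (tgt v) \<and> u \<cdot> q = mor v \<cdot> q"
      using o okD[OF v(1)] v(4) Cmp_in_Hom[of Y Q "tgt v" q "mor v"] by (intro ex1) auto
    then have "mor v = mor v'"
      using v okD(3)[OF v(1)] okD(3)[OF v(2)] arg_cong[OF v(6), of mor] by (metis arrow.sel(2) src_tgt_comp(3))
    then show ?thesis using v by (cases v, cases v') simp
  qed
qed

end

section \<open>Scalar multiples of arrows\<close>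

context tensor_category
begin

definition scl :: "'k \<Rightarrow> ('o, 'a) arrow \<Rightarrow> ('o, 'a) arrow" where
  "scl c t = Arrow (src t) (c \<odot>\<^bsub>HomSp C (src t) (tgt t)\<^esub> mor t) (tgt t)"

lemma scl_simps [simp]: "src (scl c t) = src t" "tgt (scl c t) = tgt t"
  by (simp_all add: scl_def)

lemma ok_scl [simp]:
  assumes "ok t"
  shows "ok (scl c t)"
proof -
  interpret H: kspace "HomSp C (src t) (tgt t)" using assms by (intro HomSp_kspace) simp_all
  show ?thesis using assms okD(3)[OF assms] by (simp add: scl_def)
qed

lemma scl_comp [simp]:
  "\<lbrakk>ok t; ok s; src t = tgt s\<rbrakk> \<Longrightarrow> t \<diamond> scl c s = scl c (t \<diamond> s)"
  "\<lbrakk>ok t; ok s; src t = tgt s\<rbrakk> \<Longrightarrow> scl c t \<diamond> s = scl c (t \<diamond> s)"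
  using module_homD(3)[OF Cmp_linear_right[of "src s" "tgt s" "tgt t" "mor t"], of "mor s" c]
    module_homD(3)[OF Cmp_linear_left[of "src s" "tgt s" "tgt t" "mor s"], of "mor t" c] okD(3)[of t] okD(3)[of s]
  by (auto simp: scl_def comp_def)

lemma scl_ten [simp]:
  "\<lbrakk>ok t; ok s\<rbrakk> \<Longrightarrow> t \<parallel> scl c s = scl c (t \<parallel> s)"
  "\<lbrakk>ok t; ok s\<rbrakk> \<Longrightarrow> scl c t \<parallel> s = scl c (t \<parallel> s)"
  using module_homD(3)[OF TensM_linear_right[of "src t" "tgt t" "src s" "tgt s" "mor t"], of "mor s" c]
    module_homD(3)[OF TensM_linear_left[of "src t" "tgt t" "src s" "tgt s" "mor s"], of "mor t" c] okD(3)[of t] okD(3)[of s]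
  by (auto simp: scl_def ten_def)

lemma End_Unit_scl:
  assumes "ok t" "src t = Unit C" "tgt t = Unit C"
  obtains c where "t = scl c (one (Unit C))"
  using End_Unit okD(3)[OF assms(1)] assms
  by (cases t) (auto simp: bij_betw_def scl_def)

end

section \<open>The Hopf monad of a group action\<close>

locale action_sums =
  tensor_category C + tensor_action C G \<rho> \<rho>2 \<rho>0 + group G
  for C :: "('k::field, 'o, 'a, 'm) moncat_scheme" (structure)
    and G :: "('g, 'n) monoid_scheme"
    and \<rho> :: "'g \<Rightarrow> ('o, 'a, 'o, 'a) monfunc"
    and \<rho>2 :: "'g \<Rightarrow> 'g \<Rightarrow> 'o \<Rightarrow> 'a"
    and \<rho>0 :: "'o \<Rightarrow> 'a" +
  fixes S :: "'o \<Rightarrow> 'o"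
    and \<iota> \<pi> :: "'o \<Rightarrow> 'g \<Rightarrow> 'a"
    and T :: "('o, 'a) bimonad"
  assumes finite_group: "finite (carrier G)"
    and direct_sums: "X \<in> Obj C \<Longrightarrow>
      biproduct C (carrier G) (\<lambda>g. FO (\<rho> g) X) (S X) (\<iota> X) (\<pi> X)"
    and T_def: "T = action_monad C G \<rho> \<rho>2 \<rho>0 S \<iota> \<pi>"
begin

abbreviation E :: "'g" where "E \<equiv> \<one>\<^bsub>G\<^esub>"
abbreviation gmult :: "'g \<Rightarrow> 'g \<Rightarrow> 'g" (infixl "\<ast>" 80) where "g \<ast> h \<equiv> g \<otimes>\<^bsub>G\<^esub> h"

lemma smf_\<rho> [simp]: "g \<in> carrier G \<Longrightarrow> smf (\<rho> g)"
  using \<rho>_tensor_functor by (simp add: tensor_functor_def)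

lemma linear_\<rho>: "g \<in> carrier G \<Longrightarrow> linear_functor C C (\<rho> g)"
  using \<rho>_tensor_functor by (simp add: tensor_functor_def)

lemma S_Obj [simp]: "X \<in> Obj C \<Longrightarrow> S X \<in> Obj C"
  using biproductD(2)[OF direct_sums] .

subsection \<open>The structure of the action on typed arrows\<close>

text \<open>The data of the direct sums and of the action with their sources and targets; a prime marks the
  inverse.\<close>

definition inj where "inj X g = Arrow (FO (\<rho> g) X) (\<iota> X g) (S X)"
definition prj where "prj X g = Arrow (S X) (\<pi> X g) (FO (\<rho> g) X)"
definition r2 where "r2 g h X = Arrow (FO (\<rho> g) (FO (\<rho> h) X)) (\<rho>2 g h X) (FO (\<rho> (g \<ast> h)) X)"
definition r0 where "r0 X = Arrow X (\<rho>0 X) (FO (\<rho> E) X)"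
definition r2' where "r2' g h X = Arrow (FO (\<rho> (g \<ast> h)) X)
  (inv_arr C (FO (\<rho> g) (FO (\<rho> h) X)) (FO (\<rho> (g \<ast> h)) X) (\<rho>2 g h X)) (FO (\<rho> g) (FO (\<rho> h) X))"
definition r0' where "r0' X = Arrow (FO (\<rho> E) X) (inv_arr C X (FO (\<rho> E) X) (\<rho>0 X)) X"

lemma src_tgt_action [simp]:
  "src (inj X g) = FO (\<rho> g) X" "tgt (inj X g) = S X" "src (prj X g) = S X" "tgt (prj X g) = FO (\<rho> g) X"
  "src (r2 g h X) = FO (\<rho> g) (FO (\<rho> h) X)" "tgt (r2 g h X) = FO (\<rho> (g \<ast> h)) X"
  "src (r2' g h X) = FO (\<rho> (g \<ast> h)) X" "tgt (r2' g h X) = FO (\<rho> g) (FO (\<rho> h) X)"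
  "src (r0 X) = X" "tgt (r0 X) = FO (\<rho> E) X" "src (r0' X) = FO (\<rho> E) X" "tgt (r0' X) = X"
  by (simp_all add: inj_def prj_def r2_def r2'_def r0_def r0'_def)

lemma mor_action:
  "mor (inj X g) = \<iota> X g" "mor (prj X g) = \<pi> X g" "mor (r2 g h X) = \<rho>2 g h X" "mor (r0 X) = \<rho>0 X"
  by (simp_all add: inj_def prj_def r2_def r0_def)

lemma ok_inj [simp]: "\<lbrakk>X \<in> Obj C; g \<in> carrier G\<rbrakk> \<Longrightarrow> ok (inj X g)"
  and ok_prj [simp]: "\<lbrakk>X \<in> Obj C; g \<in> carrier G\<rbrakk> \<Longrightarrow> ok (prj X g)"
  using biproductD[OF direct_sums[of X]] by (simp_all add: inj_def prj_def)

lemma prj_inj: "\<lbrakk>X \<in> Obj C; g \<in> carrier G; h \<in> carrier G\<rbrakk> \<Longrightarrow>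
    prj X h \<diamond> inj X g = (if g = h then one (FO (\<rho> g) X) else zr (FO (\<rho> g) X) (FO (\<rho> h) X))"
  using biproductD(6)[OF direct_sums[of X]] by (simp add: inj_def prj_def comp_def one_def)

lemma inj_epi:
  assumes "ok t" "ok s" "src t = S X" "src s = S X" "tgt s = tgt t" "X \<in> Obj C"
    and "\<And>g. g \<in> carrier G \<Longrightarrow> t \<diamond> inj X g = s \<diamond> inj X g"
  shows "t = s"
  using biproduct_epi[OF direct_sums[of X], of "tgt t" "mor t" "mor s"] assms okD(3)[of t] okD(3)[of s]
  by (cases t, cases s) (auto simp: comp_def inj_def)

lemma prj_mono:
  assumes "ok t" "ok s" "tgt t = S X" "tgt s = S X" "src s = src t" "X \<in> Obj C"
    and "\<And>g. g \<in> carrier G \<Longrightarrow> prj X g \<diamond> t = prj X g \<diamond> s"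
  shows "t = s"
  using biproduct_mono[OF direct_sums[of X], of "src t" "mor t" "mor s"] assms okD(3)[of t] okD(3)[of s]
  by (cases t, cases s) (auto simp: comp_def prj_def)

text \<open>The functors \<open>\<rho>\<^sup>g\<close> are linear and hence preserve direct sums, so that arrows out of iterated
  direct sums can be compared on components.\<close>

lemma fm_inj_epi:
  assumes "ok t" "ok s" "src t = FO (\<rho> g) (S X)" "src s = src t" "tgt s = tgt t" "X \<in> Obj C" "g \<in> carrier G"
    and "\<And>h. h \<in> carrier G \<Longrightarrow> t \<diamond> fm (\<rho> g) (inj X h) = s \<diamond> fm (\<rho> g) (inj X h)"
  shows "t = s"
  using biproduct_epi[OF linear_functor_biproduct[OF linear_\<rho>[of g] direct_sums[of X]], of "tgt t" "mor t" "mor s"]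
    assms okD(3)[of t] okD(3)[of s]
  by (cases t, cases s) (auto simp: comp_def inj_def fm_def)

lemma fm_fm_inj_epi:
  assumes "ok t" "ok s" "src t = FO (\<rho> g) (FO (\<rho> h) (S X))" "src s = src t" "tgt s = tgt t"
    "X \<in> Obj C" "g \<in> carrier G" "h \<in> carrier G"
    and "\<And>k. k \<in> carrier G \<Longrightarrow> t \<diamond> fm (\<rho> g) (fm (\<rho> h) (inj X k)) = s \<diamond> fm (\<rho> g) (fm (\<rho> h) (inj X k))"
  shows "t = s"
  using biproduct_epi[OF linear_functor_biproduct[OF linear_\<rho>[of g]
        linear_functor_biproduct[OF linear_\<rho>[of h] direct_sums[of X]]], of "tgt t" "mor t" "mor s"]
    assms okD(3)[of t] okD(3)[of s]
  by (cases t, cases s) (auto simp: comp_def inj_def fm_def)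

definition copair :: "'o \<Rightarrow> 'o \<Rightarrow> ('g \<Rightarrow> ('o, 'a) arrow) \<Rightarrow> ('o, 'a) arrow" where
  "copair X Z u = Arrow (S X) (finsum (HomSp C (S X) Z) (\<lambda>g. mor (u g) \<cdot> \<pi> X g) (carrier G)) Z"

lemma copair:
  assumes "X \<in> Obj C" "Z \<in> Obj C"
    and u: "\<And>g. g \<in> carrier G \<Longrightarrow> ok (u g) \<and> src (u g) = FO (\<rho> g) X \<and> tgt (u g) = Z"
  shows "ok (copair X Z u)" and "g \<in> carrier G \<Longrightarrow> copair X Z u \<diamond> inj X g = u g"
proof -
  have u': "g \<in> carrier G \<Longrightarrow> mor (u g) \<in> Hom C (FO (\<rho> g) X) Z" for g
    using u[of g] okD(3)[of "u g"] by simp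
  note c = biproduct_copair[OF direct_sums[OF assms(1)] assms(2), of "\<lambda>g. mor (u g)", OF u']
  show "ok (copair X Z u)"
    using c(1) assms by (simp add: copair_def)
  show "g \<in> carrier G \<Longrightarrow> copair X Z u \<diamond> inj X g = u g"
    using c(2)[of g] u[of g] by (cases "u g") (simp add: copair_def comp_def inj_def)
qed

lemma src_tgt_copair [simp]: "src (copair X Z u) = S X" "tgt (copair X Z u) = Z"
  by (simp_all add: copair_def)

lemma inverse_r2: "\<lbrakk>g \<in> carrier G; h \<in> carrier G; X \<in> Obj C\<rbrakk> \<Longrightarrow> inverse_pair (r2 g h X) (r2' g h X)"
  and inverse_r0: "X \<in> Obj C \<Longrightarrow> inverse_pair (r0 X) (r0' X)"
  using \<rho>2_monoidal_iso[of g h] \<rho>0_monoidal_iso unfolding r2_def r2'_def r0_def r0'_def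
  by (intro is_isoD; simp add: monoidal_isomorphism_def endo_comp_def id_endo_def)+

lemma ok_r2 [simp]:
  "\<lbrakk>g \<in> carrier G; h \<in> carrier G; X \<in> Obj C\<rbrakk> \<Longrightarrow> ok (r2 g h X)"
  "\<lbrakk>g \<in> carrier G; h \<in> carrier G; X \<in> Obj C\<rbrakk> \<Longrightarrow> ok (r2' g h X)"
  "X \<in> Obj C \<Longrightarrow> ok (r0 X)" "X \<in> Obj C \<Longrightarrow> ok (r0' X)"
  using inverse_r2 inverse_r0 by (auto simp: inverse_pair_def)

lemmas r2_cancel [simp] = inverse_pair_cancel[OF inverse_r2, simplified]
lemmas r0_cancel [simp] = inverse_pair_cancel[OF inverse_r0, simplified]

lemma r2_natural: "\<lbrakk>g \<in> carrier G; h \<in> carrier G; ok t\<rbrakk> \<Longrightarrow>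
    r2 g h (tgt t) \<diamond> fm (\<rho> g) (fm (\<rho> h) t) = fm (\<rho> (g \<ast> h)) t \<diamond> r2 g h (src t)"
  using \<rho>2_monoidal_iso[of g h] okD(3)[of t]
  by (simp add: monoidal_isomorphism_def natural_transformation_def endo_comp_def r2_def fm_def comp_def)

lemma r0_natural: "ok t \<Longrightarrow> r0 (tgt t) \<diamond> t = fm (\<rho> E) t \<diamond> r0 (src t)"
  using \<rho>0_monoidal_iso okD(3)[of t]
  by (simp add: monoidal_isomorphism_def natural_transformation_def id_endo_def r0_def fm_def comp_def)

lemma r2_f2:
  assumes "g \<in> carrier G" "h \<in> carrier G" "X \<in> Obj C" "Y \<in> Obj C"
  shows "r2 g h (X \<boxtimes> Y) \<diamond> fm (\<rho> g) (f2 (\<rho> h) X Y) \<diamond> f2 (\<rho> g) (FO (\<rho> h) X) (FO (\<rho> h) Y) =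
    f2 (\<rho> (g \<ast> h)) X Y \<diamond> (r2 g h X \<parallel> r2 g h Y)"
  using \<rho>2_monoidal_iso[OF assms(1,2)] assms(3,4)
  by (simp add: monoidal_isomorphism_def endo_comp_def r2_def f2_def fm_def comp_def ten_def)

lemma r2_f0:
  assumes "g \<in> carrier G" "h \<in> carrier G"
  shows "r2 g h (Unit C) \<diamond> fm (\<rho> g) (f0 (\<rho> h)) \<diamond> f0 (\<rho> g) = f0 (\<rho> (g \<ast> h))"
  using \<rho>2_monoidal_iso[OF assms]
  by (simp add: monoidal_isomorphism_def endo_comp_def r2_def f0_def fm_def comp_def)

lemma r0_f2:
  assumes "X \<in> Obj C" "Y \<in> Obj C"
  shows "r0 (X \<boxtimes> Y) = f2 (\<rho> E) X Y \<diamond> (r0 X \<parallel> r0 Y)"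
proof -
  have "r0 (X \<boxtimes> Y) \<diamond> one (X \<boxtimes> Y) = f2 (\<rho> E) X Y \<diamond> (r0 X \<parallel> r0 Y)"
    using \<rho>0_monoidal_iso assms
    by (simp add: monoidal_isomorphism_def id_endo_def r0_def f2_def fm_def comp_def ten_def one_def)
  then show ?thesis using assms by simp
qed

lemma r0_f0: "r0 (Unit C) = f0 (\<rho> E)"
proof -
  have "r0 (Unit C) \<diamond> one (Unit C) = f0 (\<rho> E)"
    using \<rho>0_monoidal_iso
    by (simp add: monoidal_isomorphism_def id_endo_def r0_def f0_def fm_def comp_def one_def)
  then show ?thesis by simp
qed

lemma r2_assoc: "\<lbrakk>g \<in> carrier G; h \<in> carrier G; k \<in> carrier G; X \<in> Obj C\<rbrakk> \<Longrightarrow>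
    r2 (g \<ast> h) k X \<diamond> r2 g h (FO (\<rho> k) X) = r2 g (h \<ast> k) X \<diamond> fm (\<rho> g) (r2 h k X)"
  using \<rho>2_assoc[of g h k X] by (simp add: r2_def comp_def fm_def m_assoc)

lemma r2_r0: "\<lbrakk>g \<in> carrier G; X \<in> Obj C\<rbrakk> \<Longrightarrow> r2 E g X \<diamond> r0 (FO (\<rho> g) X) = one (FO (\<rho> g) X)"
  "\<lbrakk>g \<in> carrier G; X \<in> Obj C\<rbrakk> \<Longrightarrow> r2 g E X \<diamond> fm (\<rho> g) (r0 X) = one (FO (\<rho> g) X)"
  using \<rho>0_left[of g X] \<rho>0_right[of g X] by (simp_all add: r2_def r0_def comp_def fm_def one_def)

text \<open>The monoidality of \<open>\<rho>\<^sub>2\<close> and \<open>\<rho>\<^sub>0\<close> in terms of the inverse structure maps, which are the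
  components of the comonoidal structure of the monad.\<close>

lemma f2'_r2:
  assumes "g \<in> carrier G" "h \<in> carrier G" "X \<in> Obj C" "Y \<in> Obj C"
  shows "f2' (\<rho> (g \<ast> h)) X Y \<diamond> r2 g h (X \<boxtimes> Y) =
    (r2 g h X \<parallel> r2 g h Y) \<diamond> f2' (\<rho> g) (FO (\<rho> h) X) (FO (\<rho> h) Y) \<diamond> fm (\<rho> g) (f2' (\<rho> h) X Y)" (is "?l = ?r")
proof (rule inverse_pair_left_eq[OF inverse_f2[of "\<rho> (g \<ast> h)" X Y]])
  let ?i = "f2' (\<rho> g) (FO (\<rho> h) X) (FO (\<rho> h) Y) \<diamond> fm (\<rho> g) (f2' (\<rho> h) X Y)"
  have "f2 (\<rho> (g \<ast> h)) X Y \<diamond> ?r = (f2 (\<rho> (g \<ast> h)) X Y \<diamond> (r2 g h X \<parallel> r2 g h Y)) \<diamond> ?i"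
    using assms by simp
  also have "\<dots> = r2 g h (X \<boxtimes> Y)"
    unfolding r2_f2[OF assms, symmetric] using assms
    by (simp add: inverse_pair_cancel(2)[OF inverse_fm[OF _ inverse_f2]])
  also have "\<dots> = f2 (\<rho> (g \<ast> h)) X Y \<diamond> ?l"
    using assms by simp
  finally show "f2 (\<rho> (g \<ast> h)) X Y \<diamond> ?l = f2 (\<rho> (g \<ast> h)) X Y \<diamond> ?r" by simp
qed (use assms in simp_all)

lemma f0'_r2:
  assumes "g \<in> carrier G" "h \<in> carrier G"
  shows "f0' (\<rho> (g \<ast> h)) \<diamond> r2 g h (Unit C) = f0' (\<rho> g) \<diamond> fm (\<rho> g) (f0' (\<rho> h))" (is "?l = ?r")
proof (rule inverse_pair_left_eq[OF inverse_f0[of "\<rho> (g \<ast> h)"]])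
  have "f0 (\<rho> (g \<ast> h)) \<diamond> ?r = r2 g h (Unit C)"
    unfolding r2_f0[OF assms, symmetric] using assms
    by (simp add: inverse_pair_cancel(2)[OF inverse_fm[OF _ inverse_f0]])
  then show "f0 (\<rho> (g \<ast> h)) \<diamond> ?l = f0 (\<rho> (g \<ast> h)) \<diamond> ?r"
    using assms by simp
qed (use assms in simp_all)

lemma f2'_r0: "\<lbrakk>X \<in> Obj C; Y \<in> Obj C\<rbrakk> \<Longrightarrow> f2' (\<rho> E) X Y \<diamond> r0 (X \<boxtimes> Y) = r0 X \<parallel> r0 Y"
  by (simp add: r0_f2)

lemma f0'_r0: "f0' (\<rho> E) \<diamond> r0 (Unit C) = one (Unit C)"
  by (simp add: r0_f0)

subsection \<open>The monad on typed arrows\<close>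

definition tT where "tT t = Arrow (S (src t)) (FM T (src t) (tgt t) (mor t)) (S (tgt t))"
definition tmu where "tmu X = Arrow (S (S X)) (Mu T X) (S X)"
definition teta where "teta X = Arrow X (Eta T X) (S X)"
definition tt2 where "tt2 X Y = Arrow (S (X \<boxtimes> Y)) (T2 T X Y) (S X \<boxtimes> S Y)"
definition tt0 where "tt0 = Arrow (S (Unit C)) (T0 T) (Unit C)"

lemma src_tgt_monad [simp]:
  "src (tT t) = S (src t)" "tgt (tT t) = S (tgt t)" "src (tmu X) = S (S X)" "tgt (tmu X) = S X"
  "src (teta X) = X" "tgt (teta X) = S X" "src (tt2 X Y) = S (X \<boxtimes> Y)" "tgt (tt2 X Y) = S X \<boxtimes> S Y"
  "src tt0 = S (Unit C)" "tgt tt0 = Unit C"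
  by (simp_all add: tT_def tmu_def teta_def tt2_def tt0_def)

lemma FO_T [simp]: "FO T = S"
  by (simp add: T_def action_monad_def)

lemmas T_fields = arg_cong[OF T_def, of FM] arg_cong[OF T_def, of Mu] arg_cong[OF T_def, of Eta]
  arg_cong[OF T_def, of T2] arg_cong[OF T_def, of T0]

lemma tT_copair: "tT t = copair (src t) (S (tgt t)) (\<lambda>g. inj (tgt t) g \<diamond> fm (\<rho> g) t)"
  by (simp add: tT_def copair_def T_fields action_monad_def inj_def fm_def comp_def)

lemma teta_eq: "teta X = inj X E \<diamond> r0 X"
  by (simp add: teta_def T_fields action_monad_def inj_def r0_def comp_def)

lemma tt2_copair: "tt2 X Y = copair (X \<boxtimes> Y) (S X \<boxtimes> S Y) (\<lambda>g. (inj X g \<parallel> inj Y g) \<diamond> f2' (\<rho> g) X Y)"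
  by (simp add: tt2_def copair_def T_fields action_monad_def inj_def f2'_def comp_def ten_def)

lemma tt0_copair: "tt0 = copair (Unit C) (Unit C) (\<lambda>g. f0' (\<rho> g))"
  by (simp add: tt0_def copair_def T_fields action_monad_def f0'_def)

lemma ok_tT [simp]: "ok t \<Longrightarrow> ok (tT t)"
  and tT_inj: "\<lbrakk>ok t; g \<in> carrier G\<rbrakk> \<Longrightarrow> tT t \<diamond> inj (src t) g = inj (tgt t) g \<diamond> fm (\<rho> g) t"
  unfolding tT_copair by (rule copair; simp)+

lemma ok_teta [simp]: "X \<in> Obj C \<Longrightarrow> ok (teta X)"
  by (simp add: teta_eq)

lemma ok_tt2 [simp]: "\<lbrakk>X \<in> Obj C; Y \<in> Obj C\<rbrakk> \<Longrightarrow> ok (tt2 X Y)"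
  and tt2_inj: "\<lbrakk>X \<in> Obj C; Y \<in> Obj C; g \<in> carrier G\<rbrakk> \<Longrightarrow>
    tt2 X Y \<diamond> inj (X \<boxtimes> Y) g = (inj X g \<parallel> inj Y g) \<diamond> f2' (\<rho> g) X Y"
  unfolding tt2_copair by (rule copair; simp)+

lemma ok_tt0 [simp]: "ok tt0"
  and tt0_inj: "g \<in> carrier G \<Longrightarrow> tt0 \<diamond> inj (Unit C) g = f0' (\<rho> g)"
  unfolding tt0_copair by (rule copair; simp)+

lemma fm_zero: "\<lbrakk>g \<in> carrier G; X \<in> Obj C; Y \<in> Obj C\<rbrakk> \<Longrightarrow>
    fm (\<rho> g) (zr X Y) = zr (FO (\<rho> g) X) (FO (\<rho> g) Y)"
  using linear_\<rho>[of g] module_hom_zero[OF _ HomSp_vectorspace HomSp_vectorspace, of "FM (\<rho> g) X Y" X Y]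
  by (simp add: linear_functor_def fm_def)

text \<open>By orthogonality of injections and projections, a single summand of the double sum that defines
  the multiplication survives.\<close>

lemma tmu_component:
  assumes X: "X \<in> Obj C" and g: "g \<in> carrier G" "h \<in> carrier G"
  shows "ok (tmu X)" and "tmu X \<diamond> inj (S X) g \<diamond> fm (\<rho> g) (inj X h) = inj X (g \<ast> h) \<diamond> r2 g h X"
proof -
  define c where "c = (\<lambda>(g, h). ((inj X (g \<ast> h) \<diamond> r2 g h X) \<diamond> fm (\<rho> g) (prj X h)) \<diamond> prj (S X) g)"
  have Mu: "Mu T X = finsum (HomSp C (S (S X)) (S X)) (\<lambda>p. mor (c p)) (carrier G \<times> carrier G)"
    unfolding c_def
    by (simp add: T_fields action_monad_def inj_def prj_def r2_def fm_def comp_def case_prod_unfold)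
  have c: "ok (c p)" "src (c p) = S (S X)" "tgt (c p) = S X" if "p \<in> carrier G \<times> carrier G" for p
    using that X by (auto simp: c_def)
  have c': "mor (c p) \<in> Hom C (S (S X)) (S X)" if "p \<in> carrier G \<times> carrier G" for p
    using okD(3)[OF c(1)[OF that]] c[OF that] by simp
  show "ok (tmu X)"
    using X finsum_Hom[of "S (S X)" "S X", OF _ _ c'] by (simp add: tmu_def Mu)
  define k where "k = inj (S X) g \<diamond> fm (\<rho> g) (inj X h)"
  have k: "ok k" "src k = FO (\<rho> g) (FO (\<rho> h) X)" "tgt k = S (S X)"
    using X g by (simp_all add: k_def)
  have k': "mor k \<in> Hom C (FO (\<rho> g) (FO (\<rho> h) X)) (S (S X))"
    using okD(3)[OF k(1)] k by simp
  have comp: "c p \<diamond> k = (if p = (g, h) then inj X (g \<ast> h) \<diamond> r2 g h X else zr (FO (\<rho> g) (FO (\<rho> h) X)) (S X))"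
    if p_in: "p \<in> carrier G \<times> carrier G" for p
  proof -
    obtain g' h' where p: "p = (g', h')" "g' \<in> carrier G" "h' \<in> carrier G" using p_in by auto
    have "c p \<diamond> k = inj X (g' \<ast> h') \<diamond> r2 g' h' X \<diamond> fm (\<rho> g') (prj X h') \<diamond>
        (prj (S X) g' \<diamond> inj (S X) g) \<diamond> fm (\<rho> g) (inj X h)"
      using p X g by (simp add: c_def k_def)
    also have "\<dots> = (if p = (g, h) then inj X (g \<ast> h) \<diamond> r2 g h X else zr (FO (\<rho> g) (FO (\<rho> h) X)) (S X))"
    proof (cases "g' = g")
      case True
      have "fm (\<rho> g) (prj X h') \<diamond> fm (\<rho> g) (inj X h) = fm (\<rho> g) (prj X h' \<diamond> inj X h)"
        using p X g by simp
      then show ?thesis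
        using True p X g by (auto simp: prj_inj fm_zero)
    next
      case False
      then show ?thesis
        using p X g by (simp add: prj_inj)
    qed
    finally show ?thesis .
  qed
  have "Mu T X \<cdot> mor k = finsum (HomSp C (FO (\<rho> g) (FO (\<rho> h) X)) (S X)) (\<lambda>p. mor (c p) \<cdot> mor k) (carrier G \<times> carrier G)"
    unfolding Mu using X g k' c' by (intro comp_finsum_right) auto
  also have "\<dots> = mor (inj X (g \<ast> h) \<diamond> r2 g h X)"
  proof (rule finsum_Hom_single[of _ _ "(g, h)"])
    show "mor (c p) \<cdot> mor k = \<zero>\<^bsub>HomSp C (FO (\<rho> g) (FO (\<rho> h) X)) (S X)\<^esub>"
      if "p \<in> carrier G \<times> carrier G" "p \<noteq> (g, h)" for p
      using arg_cong[OF comp[OF that(1)], of mor] that(2) by simp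
    show "mor (c (g, h)) \<cdot> mor k = mor (inj X (g \<ast> h) \<diamond> r2 g h X)"
      using arg_cong[OF comp[of "(g, h)"], of mor] g by simp
    show "mor (inj X (g \<ast> h) \<diamond> r2 g h X) \<in> Hom C (FO (\<rho> g) (FO (\<rho> h) X)) (S X)"
      using okD(3)[of "inj X (g \<ast> h) \<diamond> r2 g h X"] X g by simp
  qed (use X g finite_group in auto)
  finally have "tmu X \<diamond> k = inj X (g \<ast> h) \<diamond> r2 g h X"
    using k by (simp add: comp_def[of "tmu X"] tmu_def) (simp add: comp_def)
  then show "tmu X \<diamond> inj (S X) g \<diamond> fm (\<rho> g) (inj X h) = inj X (g \<ast> h) \<diamond> r2 g h X"
    by (simp add: k_def)
qed

lemma ok_tmu [simp]: "X \<in> Obj C \<Longrightarrow> ok (tmu X)"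
  using tmu_component(1)[of X E E] by simp

lemma prj_tT:
  assumes "ok t" "g \<in> carrier G"
  shows "prj (tgt t) g \<diamond> tT t = fm (\<rho> g) t \<diamond> prj (src t) g"
proof (rule inj_epi[of _ _ "src t"])
  fix h assume h: "h \<in> carrier G"
  have "(prj (tgt t) g \<diamond> tT t) \<diamond> inj (src t) h = (prj (tgt t) g \<diamond> inj (tgt t) h) \<diamond> fm (\<rho> h) t"
    using assms h by (simp add: tT_inj)
  also have "\<dots> = fm (\<rho> g) t \<diamond> (prj (src t) g \<diamond> inj (src t) h)"
    using assms h by (simp add: prj_inj)
  finally show "(prj (tgt t) g \<diamond> tT t) \<diamond> inj (src t) h = (fm (\<rho> g) t \<diamond> prj (src t) g) \<diamond> inj (src t) h"
    using assms h by simp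
qed (use assms in simp_all)

lemma tT_one: "X \<in> Obj C \<Longrightarrow> tT (one X) = one (S X)"
  by (rule inj_epi[of _ _ X]) (use tT_inj[of "one X"] in simp_all)

lemma tT_comp:
  assumes "ok t" "ok s" "src t = tgt s"
  shows "tT (t \<diamond> s) = tT t \<diamond> tT s"
proof (rule inj_epi[of _ _ "src s"])
  fix g assume g: "g \<in> carrier G"
  have "tT t \<diamond> tT s \<diamond> inj (src s) g = (tT t \<diamond> inj (src t) g) \<diamond> fm (\<rho> g) s"
    using assms g tT_inj[of s g] by simp
  also have "\<dots> = tT (t \<diamond> s) \<diamond> inj (src s) g"
    using assms g tT_inj[of t g] tT_inj[of "t \<diamond> s" g] by simp
  finally show "tT (t \<diamond> s) \<diamond> inj (src s) g = (tT t \<diamond> tT s) \<diamond> inj (src s) g"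
    using assms g by simp
qed (use assms in simp_all)

lemma tmu_inj:
  assumes "X \<in> Obj C" "g \<in> carrier G" "h \<in> carrier G" "ok r" "tgt r = FO (\<rho> g) (FO (\<rho> h) X)"
  shows "tmu X \<diamond> inj (S X) g \<diamond> fm (\<rho> g) (inj X h) \<diamond> r = inj X (g \<ast> h) \<diamond> r2 g h X \<diamond> r"
proof -
  have "tmu X \<diamond> inj (S X) g \<diamond> fm (\<rho> g) (inj X h) \<diamond> r = (tmu X \<diamond> inj (S X) g \<diamond> fm (\<rho> g) (inj X h)) \<diamond> r"
    using assms by simp
  then show ?thesis
    unfolding tmu_component(2)[OF assms(1-3)] using assms by simp
qed

text \<open>As the \<open>\<rho>\<^sup>g\<close> preserve direct sums, \<open>S (S X)\<close> is the direct sum of the \<open>\<rho>\<^sup>g (\<rho>\<^sup>h X)\<close>.\<close>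

lemma inj_inj_epi:
  assumes "ok t" "ok s" "src t = S (S X)" "src s = S (S X)" "tgt s = tgt t" "X \<in> Obj C"
    and "\<And>g h. \<lbrakk>g \<in> carrier G; h \<in> carrier G\<rbrakk> \<Longrightarrow>
      t \<diamond> inj (S X) g \<diamond> fm (\<rho> g) (inj X h) = s \<diamond> inj (S X) g \<diamond> fm (\<rho> g) (inj X h)"
  shows "t = s"
proof (rule inj_epi[of _ _ "S X"])
  fix g assume g: "g \<in> carrier G"
  show "t \<diamond> inj (S X) g = s \<diamond> inj (S X) g"
    by (rule fm_inj_epi[of _ _ g X]) (use assms g in simp_all)
qed (use assms in simp_all)

subsection \<open>The axioms of a bimonad\<close>

lemma tmu_natural:
  assumes t: "ok t"
  shows "tmu (tgt t) \<diamond> tT (tT t) = tT t \<diamond> tmu (src t)"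
proof (rule inj_inj_epi[of _ _ "src t"])
  fix g h assume g: "g \<in> carrier G" "h \<in> carrier G"
  have 1: "tT (tT t) \<diamond> inj (S (src t)) g = inj (S (tgt t)) g \<diamond> fm (\<rho> g) (tT t)"
    using tT_inj[of "tT t" g] t g by simp
  have 2: "fm (\<rho> g) (tT t) \<diamond> fm (\<rho> g) (inj (src t) h) = fm (\<rho> g) (inj (tgt t) h) \<diamond> fm (\<rho> g) (fm (\<rho> h) t)"
    using t g tT_inj[of t h] by (simp flip: fm_comp)
  have "(tmu (tgt t) \<diamond> tT (tT t)) \<diamond> inj (S (src t)) g \<diamond> fm (\<rho> g) (inj (src t) h) =
      tmu (tgt t) \<diamond> inj (S (tgt t)) g \<diamond> fm (\<rho> g) (inj (tgt t) h) \<diamond> fm (\<rho> g) (fm (\<rho> h) t)"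
    using t g by (simp add: comp_reduce[OF 1] 2)
  also have "\<dots> = inj (tgt t) (g \<ast> h) \<diamond> r2 g h (tgt t) \<diamond> fm (\<rho> g) (fm (\<rho> h) t)"
    using t g by (simp add: tmu_inj)
  also have "\<dots> = (inj (tgt t) (g \<ast> h) \<diamond> fm (\<rho> (g \<ast> h)) t) \<diamond> r2 g h (src t)"
    using t g by (simp add: r2_natural)
  also have "\<dots> = tT t \<diamond> inj (src t) (g \<ast> h) \<diamond> r2 g h (src t)"
    using t g by (simp flip: tT_inj)
  also have "\<dots> = (tT t \<diamond> tmu (src t)) \<diamond> inj (S (src t)) g \<diamond> fm (\<rho> g) (inj (src t) h)"
    using t g tmu_component(2)[of "src t" g h] by simp
  finally show "(tmu (tgt t) \<diamond> tT (tT t)) \<diamond> inj (S (src t)) g \<diamond> fm (\<rho> g) (inj (src t) h) =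
      (tT t \<diamond> tmu (src t)) \<diamond> inj (S (src t)) g \<diamond> fm (\<rho> g) (inj (src t) h)" .
qed (use t in simp_all)

lemma teta_natural:
  assumes t: "ok t"
  shows "teta (tgt t) \<diamond> t = tT t \<diamond> teta (src t)"
proof -
  have "tT t \<diamond> teta (src t) = (tT t \<diamond> inj (src t) E) \<diamond> r0 (src t)"
    using t by (simp add: teta_eq)
  also have "\<dots> = inj (tgt t) E \<diamond> r0 (tgt t) \<diamond> t"
    using t by (simp add: tT_inj r0_natural)
  finally show ?thesis using t by (simp add: teta_eq)
qed

text \<open>On the component \<open>\<rho>\<^sup>g \<rho>\<^sup>h \<rho>\<^sup>k X\<close> this is the associativity constraint of the action.\<close>

lemma tmu_assoc:
  assumes X: "X \<in> Obj C"
  shows "tmu X \<diamond> tT (tmu X) = tmu X \<diamond> tmu (S X)"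
proof (rule inj_inj_epi[of _ _ "S X"])
  fix g h assume g: "g \<in> carrier G" "h \<in> carrier G"
  show "(tmu X \<diamond> tT (tmu X)) \<diamond> inj (S (S X)) g \<diamond> fm (\<rho> g) (inj (S X) h) =
      (tmu X \<diamond> tmu (S X)) \<diamond> inj (S (S X)) g \<diamond> fm (\<rho> g) (inj (S X) h)" (is "?l = ?r")
  proof (rule fm_fm_inj_epi[of _ _ g h X])
    fix k assume k: "k \<in> carrier G"
    have 1: "tT (tmu X) \<diamond> inj (S (S X)) g = inj (S X) g \<diamond> fm (\<rho> g) (tmu X)"
      using tT_inj[of "tmu X" g] X g by simp
    have 2: "fm (\<rho> g) (tmu X) \<diamond> fm (\<rho> g) (inj (S X) h) \<diamond> fm (\<rho> g) (fm (\<rho> h) (inj X k)) =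
        fm (\<rho> g) (inj X (h \<ast> k)) \<diamond> fm (\<rho> g) (r2 h k X)"
      using arg_cong[OF tmu_component(2)[OF X g(2) k], of "fm (\<rho> g)"] X g k by simp
    have "?l \<diamond> fm (\<rho> g) (fm (\<rho> h) (inj X k)) =
        tmu X \<diamond> inj (S X) g \<diamond> fm (\<rho> g) (inj X (h \<ast> k)) \<diamond> fm (\<rho> g) (r2 h k X)"
      using X g k by (simp add: comp_reduce[OF 1] 2)
    also have "\<dots> = inj X (g \<ast> (h \<ast> k)) \<diamond> r2 g (h \<ast> k) X \<diamond> fm (\<rho> g) (r2 h k X)"
      using X g k by (simp add: tmu_inj)
    also have "\<dots> = inj X (g \<ast> h \<ast> k) \<diamond> r2 (g \<ast> h) k X \<diamond> r2 g h (FO (\<rho> k) X)"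
      using X g k by (simp add: r2_assoc m_assoc)
    also have "\<dots> = tmu X \<diamond> inj (S X) (g \<ast> h) \<diamond> fm (\<rho> (g \<ast> h)) (inj X k) \<diamond> r2 g h (FO (\<rho> k) X)"
      using X g k by (simp add: tmu_inj)
    also have "\<dots> = tmu X \<diamond> inj (S X) (g \<ast> h) \<diamond> r2 g h (S X) \<diamond> fm (\<rho> g) (fm (\<rho> h) (inj X k))"
      using X g k r2_natural[of g h "inj X k"] by simp
    also have "\<dots> = tmu X \<diamond> tmu (S X) \<diamond> inj (S (S X)) g \<diamond> fm (\<rho> g) (inj (S X) h) \<diamond> fm (\<rho> g) (fm (\<rho> h) (inj X k))"
      using X g k by (simp add: tmu_inj)
    also have "\<dots> = ?r \<diamond> fm (\<rho> g) (fm (\<rho> h) (inj X k))"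
      using X g k by simp
    finally show "?l \<diamond> fm (\<rho> g) (fm (\<rho> h) (inj X k)) = ?r \<diamond> fm (\<rho> g) (fm (\<rho> h) (inj X k))" .
  qed (use X g in simp_all)
qed (use X in simp_all)

text \<open>On the component \<open>\<rho>\<^sup>g X\<close> these are the two unit constraints of the action.\<close>

lemma tmu_teta:
  assumes X: "X \<in> Obj C"
  shows "tmu X \<diamond> teta (S X) = one (S X)" and "tmu X \<diamond> tT (teta X) = one (S X)"
proof -
  show "tmu X \<diamond> teta (S X) = one (S X)"
  proof (rule inj_epi[of _ _ X])
    fix g assume g: "g \<in> carrier G"
    have "(tmu X \<diamond> teta (S X)) \<diamond> inj X g = tmu X \<diamond> inj (S X) E \<diamond> fm (\<rho> E) (inj X g) \<diamond> r0 (FO (\<rho> g) X)"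
      using X g r0_natural[of "inj X g"] by (simp add: teta_eq)
    also have "\<dots> = inj X g"
      using X g by (simp add: tmu_inj r2_r0)
    finally show "(tmu X \<diamond> teta (S X)) \<diamond> inj X g = one (S X) \<diamond> inj X g"
      using X g by simp
  qed (use X in simp_all)
  show "tmu X \<diamond> tT (teta X) = one (S X)"
  proof (rule inj_epi[of _ _ X])
    fix g assume g: "g \<in> carrier G"
    have "(tmu X \<diamond> tT (teta X)) \<diamond> inj X g = tmu X \<diamond> inj (S X) g \<diamond> fm (\<rho> g) (inj X E) \<diamond> fm (\<rho> g) (r0 X)"
      using X g tT_inj[of "teta X" g] by (simp add: teta_eq)
    also have "\<dots> = inj X g"
      using X g by (simp add: tmu_inj r2_r0)
    finally show "(tmu X \<diamond> tT (teta X)) \<diamond> inj X g = one (S X) \<diamond> inj X g"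
      using X g by simp
  qed (use X in simp_all)
qed

lemma tt2_natural:
  assumes t: "ok t" and s: "ok s"
  shows "tt2 (tgt t) (tgt s) \<diamond> tT (t \<parallel> s) = (tT t \<parallel> tT s) \<diamond> tt2 (src t) (src s)"
proof (rule inj_epi[of _ _ "src t \<boxtimes> src s"])
  fix g assume g: "g \<in> carrier G"
  have "(tt2 (tgt t) (tgt s) \<diamond> tT (t \<parallel> s)) \<diamond> inj (src t \<boxtimes> src s) g =
      (tt2 (tgt t) (tgt s) \<diamond> inj (tgt t \<boxtimes> tgt s) g) \<diamond> fm (\<rho> g) (t \<parallel> s)"
    using t s g tT_inj[of "t \<parallel> s" g] by simp
  also have "\<dots> = (inj (tgt t) g \<parallel> inj (tgt s) g) \<diamond> f2' (\<rho> g) (tgt t) (tgt s) \<diamond> fm (\<rho> g) (t \<parallel> s)"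
    using t s g by (simp add: tt2_inj)
  also have "\<dots> = (tT t \<parallel> tT s) \<diamond> (inj (src t) g \<parallel> inj (src s) g) \<diamond> f2' (\<rho> g) (src t) (src s)"
    using t s g by (simp add: f2'_natural tT_inj)
  also have "\<dots> = ((tT t \<parallel> tT s) \<diamond> tt2 (src t) (src s)) \<diamond> inj (src t \<boxtimes> src s) g"
    using t s g by (simp add: tt2_inj)
  finally show "(tt2 (tgt t) (tgt s) \<diamond> tT (t \<parallel> s)) \<diamond> inj (src t \<boxtimes> src s) g =
      ((tT t \<parallel> tT s) \<diamond> tt2 (src t) (src s)) \<diamond> inj (src t \<boxtimes> src s) g" .
qed (use t s in simp_all)

text \<open>On each component, coassociativity is the coherence of the structure maps of one monoidal functor
  \<open>\<rho>\<^sup>g\<close>; the same holds for the counit laws below.\<close>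

lemma tt2_asc:
  assumes "X \<in> Obj C" "Y \<in> Obj C" "Z \<in> Obj C"
  shows "asc (S X) (S Y) (S Z) \<diamond> (tt2 X Y \<parallel> one (S Z)) \<diamond> tt2 (X \<boxtimes> Y) Z =
    (one (S X) \<parallel> tt2 Y Z) \<diamond> tt2 X (Y \<boxtimes> Z) \<diamond> tT (asc X Y Z)" (is "?l = ?r")
proof (rule inj_epi[of _ _ "(X \<boxtimes> Y) \<boxtimes> Z"])
  fix g assume g: "g \<in> carrier G"
  let ?i = "\<lambda>X. inj X g" and ?f = "f2' (\<rho> g)" and ?F = "FO (\<rho> g)"
  have "?l \<diamond> ?i ((X \<boxtimes> Y) \<boxtimes> Z) = asc (S X) (S Y) (S Z) \<diamond> (tt2 X Y \<parallel> one (S Z)) \<diamond> (?i (X \<boxtimes> Y) \<parallel> ?i Z) \<diamond> ?f (X \<boxtimes> Y) Z"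
    using assms g by (simp add: tt2_inj del: ten_comp ten_comp_assoc)
  also have "\<dots> = asc (S X) (S Y) (S Z) \<diamond> (((?i X \<parallel> ?i Y) \<diamond> ?f X Y) \<parallel> ?i Z) \<diamond> ?f (X \<boxtimes> Y) Z"
    using assms g by (simp add: tt2_inj)
  also have "\<dots> = (asc (S X) (S Y) (S Z) \<diamond> ((?i X \<parallel> ?i Y) \<parallel> ?i Z)) \<diamond> (?f X Y \<parallel> one (?F Z)) \<diamond> ?f (X \<boxtimes> Y) Z"
    using assms g by simp
  also have "asc (S X) (S Y) (S Z) \<diamond> ((?i X \<parallel> ?i Y) \<parallel> ?i Z) = (?i X \<parallel> (?i Y \<parallel> ?i Z)) \<diamond> asc (?F X) (?F Y) (?F Z)"
    using asc_natural[of "?i X" "?i Y" "?i Z"] assms g by simp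
  also have "((?i X \<parallel> (?i Y \<parallel> ?i Z)) \<diamond> asc (?F X) (?F Y) (?F Z)) \<diamond> (?f X Y \<parallel> one (?F Z)) \<diamond> ?f (X \<boxtimes> Y) Z =
      (?i X \<parallel> (?i Y \<parallel> ?i Z)) \<diamond> (one (?F X) \<parallel> ?f Y Z) \<diamond> ?f X (Y \<boxtimes> Z) \<diamond> fm (\<rho> g) (asc X Y Z)"
    using assms g by (simp add: f2'_asc del: ten_comp ten_comp_assoc)
  also have "\<dots> = (one (S X) \<parallel> tt2 Y Z) \<diamond> (?i X \<parallel> ?i (Y \<boxtimes> Z)) \<diamond> ?f X (Y \<boxtimes> Z) \<diamond> fm (\<rho> g) (asc X Y Z)"
    using assms g by (simp add: tt2_inj)
  also have "\<dots> = (one (S X) \<parallel> tt2 Y Z) \<diamond> (tt2 X (Y \<boxtimes> Z) \<diamond> ?i (X \<boxtimes> (Y \<boxtimes> Z))) \<diamond> fm (\<rho> g) (asc X Y Z)"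
    using assms g by (simp add: tt2_inj del: ten_comp ten_comp_assoc)
  also have "\<dots> = ?r \<diamond> ?i ((X \<boxtimes> Y) \<boxtimes> Z)"
    using assms g tT_inj[of "asc X Y Z" g] by simp
  finally show "?l \<diamond> ?i ((X \<boxtimes> Y) \<boxtimes> Z) = ?r \<diamond> ?i ((X \<boxtimes> Y) \<boxtimes> Z)" .
qed (use assms in simp_all)

lemma tt2_unit:
  assumes X: "X \<in> Obj C"
  shows "lu (S X) \<diamond> (tt0 \<parallel> one (S X)) \<diamond> tt2 (Unit C) X = tT (lu X)"
    and "ru (S X) \<diamond> (one (S X) \<parallel> tt0) \<diamond> tt2 X (Unit C) = tT (ru X)"
proof -
  show "lu (S X) \<diamond> (tt0 \<parallel> one (S X)) \<diamond> tt2 (Unit C) X = tT (lu X)"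
  proof (rule inj_epi[of _ _ "Unit C \<boxtimes> X"])
    fix g assume g: "g \<in> carrier G"
    let ?F = "FO (\<rho> g)"
    have n: "lu (S X) \<diamond> (one (Unit C) \<parallel> inj X g) = inj X g \<diamond> lu (?F X)"
      using lu_natural[of "inj X g"] X g by simp
    have "(lu (S X) \<diamond> (tt0 \<parallel> one (S X)) \<diamond> tt2 (Unit C) X) \<diamond> inj (Unit C \<boxtimes> X) g =
        (lu (S X) \<diamond> (one (Unit C) \<parallel> inj X g)) \<diamond> (f0' (\<rho> g) \<parallel> one (?F X)) \<diamond> f2' (\<rho> g) (Unit C) X"
      using X g by (simp add: tt2_inj tt0_inj)
    also have "\<dots> = inj X g \<diamond> (lu (?F X) \<diamond> (f0' (\<rho> g) \<parallel> one (?F X))) \<diamond> f2' (\<rho> g) (Unit C) X"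
      unfolding n using X g by simp
    also have "\<dots> = tT (lu X) \<diamond> inj (Unit C \<boxtimes> X) g"
      using X g tT_inj[of "lu X" g] by (simp add: lu_f0')
    finally show "(lu (S X) \<diamond> (tt0 \<parallel> one (S X)) \<diamond> tt2 (Unit C) X) \<diamond> inj (Unit C \<boxtimes> X) g =
        tT (lu X) \<diamond> inj (Unit C \<boxtimes> X) g" .
  qed (use X in simp_all)
  show "ru (S X) \<diamond> (one (S X) \<parallel> tt0) \<diamond> tt2 X (Unit C) = tT (ru X)"
  proof (rule inj_epi[of _ _ "X \<boxtimes> Unit C"])
    fix g assume g: "g \<in> carrier G"
    let ?F = "FO (\<rho> g)"
    have n: "ru (S X) \<diamond> (inj X g \<parallel> one (Unit C)) = inj X g \<diamond> ru (?F X)"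
      using ru_natural[of "inj X g"] X g by simp
    have "(ru (S X) \<diamond> (one (S X) \<parallel> tt0) \<diamond> tt2 X (Unit C)) \<diamond> inj (X \<boxtimes> Unit C) g =
        (ru (S X) \<diamond> (inj X g \<parallel> one (Unit C))) \<diamond> (one (?F X) \<parallel> f0' (\<rho> g)) \<diamond> f2' (\<rho> g) X (Unit C)"
      using X g by (simp add: tt2_inj tt0_inj)
    also have "\<dots> = inj X g \<diamond> (ru (?F X) \<diamond> (one (?F X) \<parallel> f0' (\<rho> g))) \<diamond> f2' (\<rho> g) X (Unit C)"
      unfolding n using X g by simp
    also have "\<dots> = tT (ru X) \<diamond> inj (X \<boxtimes> Unit C) g"
      using X g tT_inj[of "ru X" g] by (simp add: ru_f0')
    finally show "(ru (S X) \<diamond> (one (S X) \<parallel> tt0) \<diamond> tt2 X (Unit C)) \<diamond> inj (X \<boxtimes> Unit C) g =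
        tT (ru X) \<diamond> inj (X \<boxtimes> Unit C) g" .
  qed (use X in simp_all)
qed

text \<open>The multiplication is comonoidal because \<open>\<rho>\<^sub>2\<close> is a monoidal transformation.\<close>

lemma tt2_tmu:
  assumes "X \<in> Obj C" "Y \<in> Obj C"
  shows "tt2 X Y \<diamond> tmu (X \<boxtimes> Y) = (tmu X \<parallel> tmu Y) \<diamond> tt2 (S X) (S Y) \<diamond> tT (tt2 X Y)" (is "?l = ?r")
proof (rule inj_inj_epi[of _ _ "X \<boxtimes> Y"])
  fix g h assume g: "g \<in> carrier G" "h \<in> carrier G"
  let ?c = "inj (S (X \<boxtimes> Y)) g \<diamond> fm (\<rho> g) (inj (X \<boxtimes> Y) h)"
  have 1: "tT (tt2 X Y) \<diamond> inj (S (X \<boxtimes> Y)) g = inj (S X \<boxtimes> S Y) g \<diamond> fm (\<rho> g) (tt2 X Y)"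
    using tT_inj[of "tt2 X Y" g] assms g by simp
  have 2: "fm (\<rho> g) (tt2 X Y) \<diamond> fm (\<rho> g) (inj (X \<boxtimes> Y) h) =
      fm (\<rho> g) (inj X h \<parallel> inj Y h) \<diamond> fm (\<rho> g) (f2' (\<rho> h) X Y)"
    using arg_cong[OF tt2_inj[OF assms g(2)], of "fm (\<rho> g)"] assms g by simp
  have 3: "f2' (\<rho> g) (S X) (S Y) \<diamond> fm (\<rho> g) (inj X h \<parallel> inj Y h) =
      (fm (\<rho> g) (inj X h) \<parallel> fm (\<rho> g) (inj Y h)) \<diamond> f2' (\<rho> g) (FO (\<rho> h) X) (FO (\<rho> h) Y)"
    using f2'_natural[of "\<rho> g" "inj X h" "inj Y h"] assms g by simp
  have "?l \<diamond> ?c = (tt2 X Y \<diamond> inj (X \<boxtimes> Y) (g \<ast> h)) \<diamond> r2 g h (X \<boxtimes> Y)"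
    using assms g by (simp add: tmu_component)
  also have "\<dots> = (inj X (g \<ast> h) \<parallel> inj Y (g \<ast> h)) \<diamond> f2' (\<rho> (g \<ast> h)) X Y \<diamond> r2 g h (X \<boxtimes> Y)"
    using assms g by (simp add: tt2_inj)
  also have "\<dots> = ((inj X (g \<ast> h) \<diamond> r2 g h X) \<parallel> (inj Y (g \<ast> h) \<diamond> r2 g h Y)) \<diamond>
      f2' (\<rho> g) (FO (\<rho> h) X) (FO (\<rho> h) Y) \<diamond> fm (\<rho> g) (f2' (\<rho> h) X Y)"
    using assms g by (simp add: f2'_r2)
  also have "\<dots> = (tmu X \<parallel> tmu Y) \<diamond> (inj (S X) g \<parallel> inj (S Y) g) \<diamond>
      (fm (\<rho> g) (inj X h) \<parallel> fm (\<rho> g) (inj Y h)) \<diamond>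
      f2' (\<rho> g) (FO (\<rho> h) X) (FO (\<rho> h) Y) \<diamond> fm (\<rho> g) (f2' (\<rho> h) X Y)"
    using assms g by (simp add: tmu_component)
  also have "\<dots> = (tmu X \<parallel> tmu Y) \<diamond> ((inj (S X) g \<parallel> inj (S Y) g) \<diamond> f2' (\<rho> g) (S X) (S Y)) \<diamond>
      fm (\<rho> g) (inj X h \<parallel> inj Y h) \<diamond> fm (\<rho> g) (f2' (\<rho> h) X Y)"
    using assms g by (simp add: comp_reduce[OF 3] del: ten_comp ten_comp_assoc)
  also have "\<dots> = (tmu X \<parallel> tmu Y) \<diamond> tt2 (S X) (S Y) \<diamond> (tT (tt2 X Y) \<diamond> inj (S (X \<boxtimes> Y)) g) \<diamond> fm (\<rho> g) (inj (X \<boxtimes> Y) h)"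
    unfolding 1 using assms g by (simp add: tt2_inj[symmetric] 2 del: ten_comp ten_comp_assoc)
  also have "\<dots> = ?r \<diamond> ?c"
    using assms g by simp
  finally show "?l \<diamond> ?c = ?r \<diamond> ?c" .
qed (use assms in simp_all)

lemma tt0_tmu: "tt0 \<diamond> tmu (Unit C) = tt0 \<diamond> tT tt0"
proof (rule inj_inj_epi[of _ _ "Unit C"])
  fix g h assume g: "g \<in> carrier G" "h \<in> carrier G"
  let ?c = "inj (S (Unit C)) g \<diamond> fm (\<rho> g) (inj (Unit C) h)"
  have 1: "tT tt0 \<diamond> inj (S (Unit C)) g = inj (Unit C) g \<diamond> fm (\<rho> g) tt0"
    using tT_inj[of tt0 g] g by simp
  have 2: "fm (\<rho> g) tt0 \<diamond> fm (\<rho> g) (inj (Unit C) h) = fm (\<rho> g) (f0' (\<rho> h))"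
    using arg_cong[OF tt0_inj[OF g(2)], of "fm (\<rho> g)"] g by simp
  have "(tt0 \<diamond> tmu (Unit C)) \<diamond> ?c = (tt0 \<diamond> inj (Unit C) (g \<ast> h)) \<diamond> r2 g h (Unit C)"
    using g by (simp add: tmu_component)
  also have "\<dots> = (tt0 \<diamond> inj (Unit C) g) \<diamond> fm (\<rho> g) (f0' (\<rho> h))"
    using g by (simp add: tt0_inj f0'_r2)
  also have "\<dots> = (tt0 \<diamond> tT tt0) \<diamond> ?c"
    using g by (simp add: comp_reduce[OF 1] 2)
  finally show "(tt0 \<diamond> tmu (Unit C)) \<diamond> ?c = (tt0 \<diamond> tT tt0) \<diamond> ?c" .
qed simp_all

lemma tt2_teta:
  assumes "X \<in> Obj C" "Y \<in> Obj C"
  shows "tt2 X Y \<diamond> teta (X \<boxtimes> Y) = teta X \<parallel> teta Y"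
proof -
  have "tt2 X Y \<diamond> teta (X \<boxtimes> Y) = (tt2 X Y \<diamond> inj (X \<boxtimes> Y) E) \<diamond> r0 (X \<boxtimes> Y)"
    using assms by (simp add: teta_eq)
  also have "\<dots> = teta X \<parallel> teta Y"
    using assms by (simp add: tt2_inj f2'_r0 teta_eq)
  finally show ?thesis .
qed

lemma tt0_teta: "tt0 \<diamond> teta (Unit C) = one (Unit C)"
proof -
  have "tt0 \<diamond> teta (Unit C) = (tt0 \<diamond> inj (Unit C) E) \<diamond> r0 (Unit C)"
    by (simp add: teta_eq)
  then show ?thesis by (simp add: tt0_inj f0'_r0)
qed

text \<open>The component of \<open>T t\<close> at the neutral element is conjugate to \<open>t\<close> under \<open>\<rho>\<^sub>0\<close>.\<close>

lemma tT_faithful: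
  assumes t: "ok t" "ok s" "src t = src s" "tgt t = tgt s" and eq: "tT t = tT s"
  shows "t = s"
proof -
  have "(fm (\<rho> E) t \<diamond> prj (src t) E) \<diamond> inj (src t) E = (fm (\<rho> E) s \<diamond> prj (src s) E) \<diamond> inj (src t) E"
    using prj_tT[of t E] prj_tT[of s E] t eq by simp
  then have "fm (\<rho> E) t = fm (\<rho> E) s"
    using t by (simp add: prj_inj)
  then have "r0 (tgt t) \<diamond> t = r0 (tgt t) \<diamond> s"
    using r0_natural[of t] r0_natural[of s] t by simp
  then show ?thesis
    by (rule inverse_pair_left_eq[OF inverse_r0[of "tgt t"], rotated -1]) (use t in simp_all)
qed

subsection \<open>The bimonad as a linear and exact functor\<close>

lemma mor_monad: "mor (tT t) = FM T (src t) (tgt t) (mor t)" "mor (tmu X) = Mu T X" "mor (teta X) = Eta T X"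
  "mor (tt2 X Y) = T2 T X Y" "mor tt0 = T0 T"
  by (simp_all add: tT_def tmu_def teta_def tt2_def tt0_def)

lemma functor_T: "is_functor C C T"
  unfolding is_functor_def
proof (intro conjI ballI)
  fix X assume X: "X \<in> Obj C"
  then show "FO T X \<in> Obj C" by simp
  show "FM T X X (Idn C X) = Idn C (FO T X)"
    using arg_cong[OF tT_one[OF X], of mor] by (simp add: mor_monad)
next
  fix X Y f assume "X \<in> Obj C" "Y \<in> Obj C" "f \<in> Hom C X Y"
  then show "FM T X Y f \<in> Hom C (FO T X) (FO T Y)"
    using okD(3)[OF ok_tT[of "Arrow X f Y"]] by (simp add: mor_monad)
next
  fix X Y Z f g assume "X \<in> Obj C" "Y \<in> Obj C" "Z \<in> Obj C" "f \<in> Hom C X Y" "g \<in> Hom C Y Z"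
  then have "tT (Arrow Y g Z \<diamond> Arrow X f Y) = tT (Arrow Y g Z) \<diamond> tT (Arrow X f Y)"
    by (intro tT_comp) simp_all
  then show "FM T X Z (g \<cdot> f) = FM T Y Z g \<cdot> FM T X Y f"
    by (simp add: tT_def comp_def)
qed

lemma linear_T: "linear_functor C C T"
  unfolding linear_functor_def
proof (intro conjI ballI)
  show "is_functor C C T" by (rule functor_T)
  fix X Y assume X: "X \<in> Obj C" and Y: "Y \<in> Obj C"
  have "(\<lambda>f. finsum (HomSp C (S X) (S Y)) (\<lambda>g. \<iota> Y g \<cdot> FM (\<rho> g) X Y f \<cdot> \<pi> X g) (carrier G))
      \<in> module_hom class_ring (HomSp C X Y) (HomSp C (S X) (S Y))"
  proof (rule module_hom_finsum_hom[OF HomSp_vectorspace finite_group])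
    fix g assume g: "g \<in> carrier G"
    have lin: "FM (\<rho> g) X Y \<in> module_hom class_ring (HomSp C X Y) (HomSp C (FO (\<rho> g) X) (FO (\<rho> g) Y))"
      using linear_\<rho>[OF g] X Y by (simp add: linear_functor_def)
    have hom: "\<iota> Y g \<in> Hom C (FO (\<rho> g) Y) (S Y)" "\<pi> X g \<in> Hom C (S X) (FO (\<rho> g) X)"
      using biproductD(4,5)[OF direct_sums] X Y g by blast+
    have "(\<lambda>k. \<iota> Y g \<cdot> k) \<in> module_hom class_ring (HomSp C (FO (\<rho> g) X) (FO (\<rho> g) Y)) (HomSp C (FO (\<rho> g) X) (S Y))"
      using X Y g hom by (intro Cmp_linear_right) simp_all
    moreover have "(\<lambda>k. k \<cdot> \<pi> X g) \<in> module_hom class_ring (HomSp C (FO (\<rho> g) X) (S Y)) (HomSp C (S X) (S Y))"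
      using X Y g hom by (intro Cmp_linear_left) simp_all
    ultimately show "(\<lambda>f. \<iota> Y g \<cdot> FM (\<rho> g) X Y f \<cdot> \<pi> X g) \<in> module_hom class_ring (HomSp C X Y) (HomSp C (S X) (S Y))"
      using module_hom_comp[OF module_hom_comp[OF lin]] by blast
  qed (use X Y in simp_all)
  then show "FM T X Y \<in> module_hom class_ring (HomSp C X Y) (HomSp C (FO T X) (FO T Y))"
    by (simp add: T_fields(1) action_monad_def)
qed

lemma monad_T: "monad C T"
proof -
  have mu: "natural_transformation C C (func_comp T T) T (Mu T)"
    unfolding natural_transformation_def
  proof (intro conjI ballI)
    fix X assume "X \<in> Obj C"
    then show "Mu T X \<in> Hom C (FO (func_comp T T) X) (FO T X)"
      using okD(3)[OF ok_tmu[of X]] by (simp add: mor_monad func_comp_def)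
  next
    fix X Y f assume "X \<in> Obj C" "Y \<in> Obj C" "f \<in> Hom C X Y"
    then show "Mu T Y \<cdot> FM (func_comp T T) X Y f = FM T X Y f \<cdot> Mu T X"
      using arg_cong[OF tmu_natural[of "Arrow X f Y"], of mor] by (simp add: mor_monad func_comp_def)
  qed
  have eta: "natural_transformation C C id_func T (Eta T)"
    unfolding natural_transformation_def
  proof (intro conjI ballI)
    fix X assume "X \<in> Obj C"
    then show "Eta T X \<in> Hom C (FO id_func X) (FO T X)"
      using okD(3)[OF ok_teta[of X]] by (simp add: mor_monad id_func_def)
  next
    fix X Y f assume "X \<in> Obj C" "Y \<in> Obj C" "f \<in> Hom C X Y"
    then show "Eta T Y \<cdot> FM id_func X Y f = FM T X Y f \<cdot> Eta T X"
      using arg_cong[OF teta_natural[of "Arrow X f Y"], of mor] by (simp add: mor_monad id_func_def)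
  qed
  show ?thesis
    unfolding monad_def
    using functor_T mu eta
      arg_cong[OF tmu_assoc, of _ mor] arg_cong[OF tmu_teta(1), of _ mor] arg_cong[OF tmu_teta(2), of _ mor]
    by (simp add: mor_monad)
qed

lemma comonoidal_T: "comonoidal_functor C T"
  unfolding comonoidal_functor_def
proof (intro conjI ballI)
  show "is_functor C C T" by (rule functor_T)
  show "T0 T \<in> Hom C (FO T (Unit C)) (Unit C)"
    using okD(3)[OF ok_tt0] by (simp add: mor_monad)
next
  fix X Y assume X: "X \<in> Obj C" and Y: "Y \<in> Obj C"
  show "T2 T X Y \<in> Hom C (FO T (X \<boxtimes> Y)) (FO T X \<boxtimes> FO T Y)"
    using okD(3)[OF ok_tt2[OF X Y]] by (simp add: mor_monad)
next
  fix X X' Y Y' f g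
  assume "X \<in> Obj C" "X' \<in> Obj C" "Y \<in> Obj C" "Y' \<in> Obj C" "f \<in> Hom C X X'" "g \<in> Hom C Y Y'"
  then show "T2 T X' Y' \<cdot> FM T (X \<boxtimes> Y) (X' \<boxtimes> Y') (f \<star> g) = FM T X X' f \<star> FM T Y Y' g \<cdot> T2 T X Y"
    using arg_cong[OF tt2_natural[of "Arrow X f X'" "Arrow Y g Y'"], of mor] by (simp add: mor_monad)
next
  fix X Y Z assume o: "X \<in> Obj C" "Y \<in> Obj C" "Z \<in> Obj C"
  have "(asc (S X) (S Y) (S Z) \<diamond> (tt2 X Y \<parallel> one (S Z))) \<diamond> tt2 (X \<boxtimes> Y) Z =
      ((one (S X) \<parallel> tt2 Y Z) \<diamond> tt2 X (Y \<boxtimes> Z)) \<diamond> tT (asc X Y Z)"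
    using tt2_asc[OF o] o by simp
  from arg_cong[OF this, of mor]
  show "Assoc C (FO T X) (FO T Y) (FO T Z) \<cdot> T2 T X Y \<star> Idn C (FO T Z) \<cdot> T2 T (X \<boxtimes> Y) Z =
      Idn C (FO T X) \<star> T2 T Y Z \<cdot> T2 T X (Y \<boxtimes> Z) \<cdot> FM T ((X \<boxtimes> Y) \<boxtimes> Z) (X \<boxtimes> Y \<boxtimes> Z) (Assoc C X Y Z)"
    by (simp add: mor_monad mor_structural del: comp_assoc)
next
  fix X assume o: "X \<in> Obj C"
  have "(lu (S X) \<diamond> (tt0 \<parallel> one (S X))) \<diamond> tt2 (Unit C) X = tT (lu X)"
    "(ru (S X) \<diamond> (one (S X) \<parallel> tt0)) \<diamond> tt2 X (Unit C) = tT (ru X)"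
    using tt2_unit[OF o] o by simp_all
  from arg_cong[OF this(1), of mor] arg_cong[OF this(2), of mor]
  show "LUnit C (FO T X) \<cdot> T0 T \<star> Idn C (FO T X) \<cdot> T2 T (Unit C) X = FM T (Unit C \<boxtimes> X) X (LUnit C X)"
    "RUnit C (FO T X) \<cdot> Idn C (FO T X) \<star> T0 T \<cdot> T2 T X (Unit C) = FM T (X \<boxtimes> Unit C) X (RUnit C X)"
    by (simp_all add: mor_monad mor_structural del: comp_assoc)
qed

lemma bimonad_T: "bimonad C T"
  unfolding bimonad_def
proof (intro conjI ballI)
  show "monad C T" by (rule monad_T)
  show "comonoidal_functor C T" by (rule comonoidal_T)
  show "T0 T \<cdot> Mu T (Unit C) = T0 T \<cdot> FM T (FO T (Unit C)) (Unit C) (T0 T)"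
    using arg_cong[OF tt0_tmu, of mor] by (simp add: mor_monad)
  show "T0 T \<cdot> Eta T (Unit C) = Idn C (Unit C)"
    using arg_cong[OF tt0_teta, of mor] by (simp add: mor_monad)
  fix X Y assume o: "X \<in> Obj C" "Y \<in> Obj C"
  have "tt2 X Y \<diamond> tmu (X \<boxtimes> Y) = ((tmu X \<parallel> tmu Y) \<diamond> tt2 (S X) (S Y)) \<diamond> tT (tt2 X Y)"
    using tt2_tmu[OF o] o by simp
  from arg_cong[OF this, of mor]
  show "T2 T X Y \<cdot> Mu T (X \<boxtimes> Y) = Mu T X \<star> Mu T Y \<cdot> T2 T (FO T X) (FO T Y) \<cdot>
      FM T (FO T (X \<boxtimes> Y)) (FO T X \<boxtimes> FO T Y) (T2 T X Y)"
    by (simp add: mor_monad del: comp_assoc)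
  show "T2 T X Y \<cdot> Eta T (X \<boxtimes> Y) = Eta T X \<star> Eta T Y"
    using arg_cong[OF tt2_teta[OF o], of mor] by (simp add: mor_monad)
qed

lemma faithful_T: "faithful_functor C T"
  unfolding faithful_functor_def
proof (intro ballI inj_onI)
  fix X Y f g assume "X \<in> Obj C" "Y \<in> Obj C" "f \<in> Hom C X Y" "g \<in> Hom C X Y" "FM T X Y f = FM T X Y g"
  then show "f = g"
    using tT_faithful[of "Arrow X f Y" "Arrow X g Y"] by (simp add: tT_def)
qed

lemma prj_pair:
  assumes "X \<in> Obj C" "Z \<in> Obj C"
    and u: "\<And>g. g \<in> carrier G \<Longrightarrow> ok (u g) \<and> src (u g) = Z \<and> tgt (u g) = FO (\<rho> g) X"
  shows "\<exists>v. ok v \<and> src v = Z \<and> tgt v = S X \<and> (\<forall>g\<in>carrier G. prj X g \<diamond> v = u g)"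
proof -
  have "mor (u g) \<in> Hom C Z (FO (\<rho> g) X)" if "g \<in> carrier G" for g
    using u[OF that] okD(3)[of "u g"] by simp
  then obtain v where v: "v \<in> Hom C Z (S X)" "\<forall>g\<in>carrier G. \<pi> X g \<cdot> v = mor (u g)"
    using biproduct_pair[OF direct_sums[OF assms(1)] assms(2), of "\<lambda>g. mor (u g)"] by auto
  have "prj X g \<diamond> Arrow Z v (S X) = u g" if "g \<in> carrier G" for g
    using u[OF that] v(2) that by (cases "u g") (simp add: comp_def prj_def)
  then show ?thesis
    using v(1) assms by (intro exI[of _ "Arrow Z v (S X)"]) simp
qed

text \<open>The exact functors \<open>\<rho>\<^sup>g\<close> preserve the kernel in each component, and an arrow into a direct sum
  is a family of arrows into its summands.\<close>

lemma left_exact_T: "left_exact_functor C C T"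
  unfolding left_exact_functor_def
proof (intro allI impI)
  fix X Y f K k assume ker: "is_kernel C X Y f K k"
  note o = is_kernelD(1-5)[OF ker]
  let ?f = "Arrow X f Y" and ?k = "Arrow K k X"
  have kg: "is_kernel C (FO (\<rho> g) X) (FO (\<rho> g) Y) (FM (\<rho> g) X Y f) (FO (\<rho> g) K) (FM (\<rho> g) K X k)"
    if "g \<in> carrier G" for g
    using \<rho>_tensor_functor[OF that] ker
    by (simp add: tensor_functor_def exact_functor_def left_exact_functor_def)
  have fm: "Arrow (FO (\<rho> g) X) (FM (\<rho> g) X Y f) (FO (\<rho> g) Y) = fm (\<rho> g) ?f"
    "Arrow (FO (\<rho> g) K) (FM (\<rho> g) K X k) (FO (\<rho> g) X) = fm (\<rho> g) ?k" for g
    by (simp_all add: fm_def)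
  note D = is_kernelD(6-)[OF kg, unfolded fm]
  note pf = prj_tT[of ?f, simplified] and pk = prj_tT[of ?k, simplified]
  have "is_kernel C (src (tT ?f)) (tgt (tT ?f)) (mor (tT ?f)) (src (tT ?k)) (mor (tT ?k))"
  proof (rule is_kernelI)
    show "tT ?f \<diamond> tT ?k = zr (src (tT ?k)) (tgt (tT ?f))"
    proof (rule prj_mono[of _ _ Y])
      fix g assume g: "g \<in> carrier G"
      have "prj Y g \<diamond> tT ?f \<diamond> tT ?k = (prj Y g \<diamond> tT ?f) \<diamond> tT ?k"
        using o g by simp
      also have "\<dots> = (fm (\<rho> g) ?f \<diamond> fm (\<rho> g) ?k) \<diamond> prj K g"
        using o g by (simp add: pf pk del: fm_comp)
      also have "\<dots> = prj Y g \<diamond> zr (src (tT ?k)) (tgt (tT ?f))"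
        using o g D(1)[OF g] by simp
      finally show "prj Y g \<diamond> tT ?f \<diamond> tT ?k = prj Y g \<diamond> zr (src (tT ?k)) (tgt (tT ?f))" .
    qed (use o in simp_all)
  next
    fix w assume w: "ok w" "tgt w = src (tT ?f)" "tT ?f \<diamond> w = zr (src w) (tgt (tT ?f))"
    have "\<exists>v. ok v \<and> src v = src w \<and> tgt v = FO (\<rho> g) K \<and> fm (\<rho> g) ?k \<diamond> v = prj X g \<diamond> w" if g: "g \<in> carrier G" for g
    proof -
      have "fm (\<rho> g) ?f \<diamond> prj X g \<diamond> w = (fm (\<rho> g) ?f \<diamond> prj X g) \<diamond> w"
        using o g w by simp
      also have "\<dots> = prj Y g \<diamond> tT ?f \<diamond> w"
        using o g w by (simp flip: pf)
      also have "\<dots> = zr (src w) (FO (\<rho> g) Y)"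
        unfolding w(3) using o g w(1) by simp
      finally show ?thesis
        using D(2)[OF g, of "prj X g \<diamond> w"] o g w by simp
    qed
    then obtain v where v: "\<And>g. g \<in> carrier G \<Longrightarrow>
        ok (v g) \<and> src (v g) = src w \<and> tgt (v g) = FO (\<rho> g) K \<and> fm (\<rho> g) ?k \<diamond> v g = prj X g \<diamond> w"
      by metis
    obtain V where V: "ok V" "src V = src w" "tgt V = S K" "\<And>g. g \<in> carrier G \<Longrightarrow> prj K g \<diamond> V = v g"
      using prj_pair[of K "src w" v] v o w by auto
    have "tT ?k \<diamond> V = w"
    proof (rule prj_mono[of _ _ X])
      fix g assume g: "g \<in> carrier G"
      have "prj X g \<diamond> tT ?k \<diamond> V = (prj X g \<diamond> tT ?k) \<diamond> V"
        using o g V by simp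
      also have "\<dots> = prj X g \<diamond> w"
        using o g V v[OF g] by (simp add: pk)
      finally show "prj X g \<diamond> tT ?k \<diamond> V = prj X g \<diamond> w" .
    qed (use o V w in simp_all)
    with V show "\<exists>v. ok v \<and> src v = src w \<and> tgt v = src (tT ?k) \<and> tT ?k \<diamond> v = w" by auto
  next
    fix v v' assume v: "ok v" "ok v'" "src v = src v'" "tgt v = src (tT ?k)" "tgt v' = src (tT ?k)"
      "tT ?k \<diamond> v = tT ?k \<diamond> v'"
    show "v = v'"
    proof (rule prj_mono[of _ _ K])
      fix g assume g: "g \<in> carrier G"
      have "fm (\<rho> g) ?k \<diamond> prj K g \<diamond> u = prj X g \<diamond> tT ?k \<diamond> u" if "ok u" "tgt u = S K" for u
      proof -
        have "fm (\<rho> g) ?k \<diamond> prj K g \<diamond> u = (fm (\<rho> g) ?k \<diamond> prj K g) \<diamond> u"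
          using o g that by simp
        also have "\<dots> = prj X g \<diamond> tT ?k \<diamond> u"
          using o g that by (simp flip: pk)
        finally show ?thesis .
      qed
      then have "fm (\<rho> g) ?k \<diamond> prj K g \<diamond> v = fm (\<rho> g) ?k \<diamond> prj K g \<diamond> v'"
        using v by simp
      then show "prj K g \<diamond> v = prj K g \<diamond> v'"
        by (rule D(3)[OF g, rotated -1]) (use o g v in simp_all)
    qed (use o v in simp_all)
  qed (use o in simp_all)
  then show "is_kernel C (FO T X) (FO T Y) (FM T X Y f) (FO T K) (FM T K X k)"
    by (simp add: mor_monad)
qed

lemma right_exact_T: "right_exact_functor C C T"
  unfolding right_exact_functor_def
proof (intro allI impI)
  fix X Y f Q q assume ker: "is_cokernel C X Y f Q q"
  note o = is_cokernelD(1-5)[OF ker]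
  let ?f = "Arrow X f Y" and ?q = "Arrow Y q Q"
  have kg: "is_cokernel C (FO (\<rho> g) X) (FO (\<rho> g) Y) (FM (\<rho> g) X Y f) (FO (\<rho> g) Q) (FM (\<rho> g) Y Q q)"
    if "g \<in> carrier G" for g
    using \<rho>_tensor_functor[OF that] ker
    by (simp add: tensor_functor_def exact_functor_def right_exact_functor_def)
  have fm: "Arrow (FO (\<rho> g) X) (FM (\<rho> g) X Y f) (FO (\<rho> g) Y) = fm (\<rho> g) ?f"
    "Arrow (FO (\<rho> g) Y) (FM (\<rho> g) Y Q q) (FO (\<rho> g) Q) = fm (\<rho> g) ?q" for g
    by (simp_all add: fm_def)
  note D = is_cokernelD(6-)[OF kg, unfolded fm]
  note pf = tT_inj[of ?f, simplified] and pq = tT_inj[of ?q, simplified]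
  have "is_cokernel C (src (tT ?f)) (tgt (tT ?f)) (mor (tT ?f)) (tgt (tT ?q)) (mor (tT ?q))"
  proof (rule is_cokernelI)
    show "tT ?q \<diamond> tT ?f = zr (src (tT ?f)) (tgt (tT ?q))"
    proof (rule inj_epi[of _ _ X])
      fix g assume g: "g \<in> carrier G"
      have "(tT ?q \<diamond> tT ?f) \<diamond> inj X g = (tT ?q \<diamond> inj Y g) \<diamond> fm (\<rho> g) ?f"
        using o g by (simp add: pf)
      also have "\<dots> = inj Q g \<diamond> (fm (\<rho> g) ?q \<diamond> fm (\<rho> g) ?f)"
        using o g by (simp add: pq del: fm_comp)
      also have "\<dots> = zr (src (tT ?f)) (tgt (tT ?q)) \<diamond> inj X g"
        using o g D(1)[OF g] by simp
      finally show "(tT ?q \<diamond> tT ?f) \<diamond> inj X g = zr (src (tT ?f)) (tgt (tT ?q)) \<diamond> inj X g" .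
    qed (use o in simp_all)
  next
    fix w assume w: "ok w" "src w = tgt (tT ?f)" "w \<diamond> tT ?f = zr (src (tT ?f)) (tgt w)"
    have "\<exists>v. ok v \<and> src v = FO (\<rho> g) Q \<and> tgt v = tgt w \<and> v \<diamond> fm (\<rho> g) ?q = w \<diamond> inj Y g" if g: "g \<in> carrier G" for g
    proof -
      have "(w \<diamond> inj Y g) \<diamond> fm (\<rho> g) ?f = (w \<diamond> tT ?f) \<diamond> inj X g"
        using o g w(1,2) by (simp add: pf)
      also have "\<dots> = zr (FO (\<rho> g) X) (tgt w)"
        unfolding w(3) using o g w(1) by simp
      finally show ?thesis
        using D(2)[OF g, of "w \<diamond> inj Y g"] o g w by simp
    qed
    then obtain v where v: "\<And>g. g \<in> carrier G \<Longrightarrow>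
        ok (v g) \<and> src (v g) = FO (\<rho> g) Q \<and> tgt (v g) = tgt w \<and> v g \<diamond> fm (\<rho> g) ?q = w \<diamond> inj Y g"
      by metis
    define V where "V = copair Q (tgt w) v"
    have V: "ok V" "src V = S Q" "tgt V = tgt w" "\<And>g. g \<in> carrier G \<Longrightarrow> V \<diamond> inj Q g = v g"
      using copair[of Q "tgt w" v] v o w by (simp_all add: V_def)
    have "V \<diamond> tT ?q = w"
    proof (rule inj_epi[of _ _ Y])
      fix g assume g: "g \<in> carrier G"
      have "(V \<diamond> tT ?q) \<diamond> inj Y g = (V \<diamond> inj Q g) \<diamond> fm (\<rho> g) ?q"
        using o g V(1-3) by (simp add: pq)
      also have "\<dots> = w \<diamond> inj Y g"
        unfolding V(4)[OF g] using v[OF g] by simp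
      finally show "(V \<diamond> tT ?q) \<diamond> inj Y g = w \<diamond> inj Y g" .
    qed (use o V w in simp_all)
    with V show "\<exists>v. ok v \<and> src v = tgt (tT ?q) \<and> tgt v = tgt w \<and> v \<diamond> tT ?q = w" by auto
  next
    fix v v' assume v: "ok v" "ok v'" "tgt v = tgt v'" "src v = tgt (tT ?q)" "src v' = tgt (tT ?q)"
      "v \<diamond> tT ?q = v' \<diamond> tT ?q"
    show "v = v'"
    proof (rule inj_epi[of _ _ Q])
      fix g assume g: "g \<in> carrier G"
      have "(u \<diamond> inj Q g) \<diamond> fm (\<rho> g) ?q = (u \<diamond> tT ?q) \<diamond> inj Y g" if "ok u" "src u = S Q" for u
        using o g that by (simp add: pq)
      then have "(v \<diamond> inj Q g) \<diamond> fm (\<rho> g) ?q = (v' \<diamond> inj Q g) \<diamond> fm (\<rho> g) ?q"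
        using v by simp
      then show "v \<diamond> inj Q g = v' \<diamond> inj Q g"
        by (rule D(3)[OF g, rotated -1]) (use o g v in simp_all)
    qed (use o v in simp_all)
  qed (use o in simp_all)
  then show "is_cokernel C (FO T X) (FO T Y) (FM T X Y f) (FO T Q) (FM T Y Q q)"
    by (simp add: mor_monad)
qed

lemma exact_T: "exact_functor C C T"
  by (simp add: exact_functor_def left_exact_T right_exact_T)

subsection \<open>Normality and cocommutativity\<close>

text \<open>The unit constraints identify the summands \<open>\<rho>\<^sup>g 1\<close> with \<open>1\<close>. An enumeration of the group turns this
  into a direct sum over an initial segment of the natural numbers.\<close>

lemma trivial_T_Unit: "trivial_object C (FO T (Unit C))"
proof -
  let ?I = "Unit C"
  obtain e where e: "bij_betw e {..<card (carrier G)} (carrier G)"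
    using ex_bij_betw_nat_finite[OF finite_group] by (auto simp: atLeast0LessThan)
  have eG: "e i \<in> carrier G" if "i < card (carrier G)" for i
    using bij_betwE[OF e] that by simp
  define i' where "i' = (\<lambda>g. inj ?I g \<diamond> f0 (\<rho> g))"
  define p' where "p' = (\<lambda>g. f0' (\<rho> g) \<diamond> prj ?I g)"
  have ok: "ok (i' g)" "src (i' g) = ?I" "tgt (i' g) = S ?I" "ok (p' g)" "src (p' g) = S ?I" "tgt (p' g) = ?I"
    if "g \<in> carrier G" for g
    using that by (simp_all add: i'_def p'_def)
  have pi: "p' h \<diamond> i' g = (if g = h then one ?I else zr ?I ?I)" if gh: "g \<in> carrier G" "h \<in> carrier G" for g h
  proof -
    have "p' h \<diamond> i' g = f0' (\<rho> h) \<diamond> (prj ?I h \<diamond> inj ?I g) \<diamond> f0 (\<rho> g)"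
      using gh by (simp add: i'_def p'_def)
    then show ?thesis
      using gh by (simp add: prj_inj)
  qed
  have ip: "i' g \<diamond> p' g = inj ?I g \<diamond> prj ?I g" if "g \<in> carrier G" for g
    using that by (simp add: i'_def p'_def)
  have hom: "mor (i' g) \<in> Hom C ?I (S ?I)" "mor (p' g) \<in> Hom C (S ?I) ?I" if "g \<in> carrier G" for g
    using ok[OF that] okD(3)[of "i' g"] okD(3)[of "p' g"] by simp_all
  interpret H: kspace "HomSp C (S ?I) (S ?I)" by (intro HomSp_kspace) simp_all
  have comp: "mor (i' g) \<cdot> mor (p' g) \<in> Hom C (S ?I) (S ?I)" if "g \<in> carrier G" for g
    using hom[OF that] by (intro Cmp_in_Hom) simp_all
  have "finsum (HomSp C (S ?I) (S ?I)) (\<lambda>i. mor (i' (e i)) \<cdot> mor (p' (e i))) {..<card (carrier G)} =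
      finsum (HomSp C (S ?I) (S ?I)) (\<lambda>g. mor (i' g) \<cdot> mor (p' g)) (e ` {..<card (carrier G)})"
    using e comp eG by (intro H.add.finprod_reindex[folded finsum_def, symmetric]) (auto simp: bij_betw_def)
  also have "e ` {..<card (carrier G)} = carrier G"
    using e by (simp add: bij_betw_def)
  also have "finsum (HomSp C (S ?I) (S ?I)) (\<lambda>g. mor (i' g) \<cdot> mor (p' g)) (carrier G) =
      finsum (HomSp C (S ?I) (S ?I)) (\<lambda>g. \<iota> ?I g \<cdot> \<pi> ?I g) (carrier G)"
  proof (rule finsum_Hom_cong)
    fix g assume g: "g \<in> carrier G"
    show "mor (i' g) \<cdot> mor (p' g) = \<iota> ?I g \<cdot> \<pi> ?I g"
      using arg_cong[OF ip[OF g], of mor] by (simp add: mor_action)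
    then show "\<iota> ?I g \<cdot> \<pi> ?I g \<in> Hom C (S ?I) (S ?I)"
      using comp[OF g] by simp
  qed simp_all
  also have "\<dots> = Idn C (S ?I)"
    using biproductD(7)[OF direct_sums[of ?I]] by simp
  finally have sum: "finsum (HomSp C (S ?I) (S ?I)) (\<lambda>i. mor (i' (e i)) \<cdot> mor (p' (e i))) {..<card (carrier G)} = Idn C (S ?I)" .
  have orth: "mor (p' (e j)) \<cdot> mor (i' (e i)) = (if i = j then Idn C ?I else \<zero>\<^bsub>HomSp C ?I ?I\<^esub>)"
    if "i < card (carrier G)" "j < card (carrier G)" for i j
    using arg_cong[OF pi[OF eG[OF that(1)] eG[OF that(2)]], of mor] that inj_onD[OF bij_betw_imp_inj_on[OF e], of i j]
    by auto
  have "biproduct C {..<card (carrier G)} (\<lambda>_. ?I) (S ?I) (\<lambda>i. mor (i' (e i))) (\<lambda>i. mor (p' (e i)))"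
    unfolding biproduct_def using sum orth hom eG by simp
  moreover have "isomorphic C (S ?I) (S ?I)"
    unfolding isomorphic_def is_iso_def inverse_arrows_def
    using Idn_in_Hom[of "S ?I"] Idn_left[of "S ?I" "S ?I"] by (auto intro!: exI[of _ "Idn C (S ?I)"])
  ultimately show ?thesis
    unfolding trivial_object_def by auto
qed

text \<open>On the component with index \<open>h\<close> both sides are the multiple of the injection by the scalar
  \<open>\<gamma> \<diamond> inj 1 h \<diamond> f0\<close>.\<close>

lemma cocommutative_T:
  assumes \<gamma>: "ok \<gamma>" "src \<gamma> = S (Unit C)" "tgt \<gamma> = Unit C" and X: "X \<in> Obj C"
  shows "ru (S X) \<diamond> (one (S X) \<parallel> \<gamma>) \<diamond> tt2 X (Unit C) \<diamond> tT (ru' X) =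
    lu (S X) \<diamond> (\<gamma> \<parallel> one (S X)) \<diamond> tt2 (Unit C) X \<diamond> tT (lu' X)" (is "?l = ?r")
proof (rule inj_epi[of _ _ X])
  fix h assume h: "h \<in> carrier G"
  let ?I = "Unit C" and ?F = "FO (\<rho> h)" and ?R = "\<rho> h"
  obtain c where c: "\<gamma> \<diamond> inj ?I h \<diamond> f0 ?R = scl c (one ?I)"
    using End_Unit_scl[of "\<gamma> \<diamond> inj ?I h \<diamond> f0 ?R"] \<gamma> h by auto
  have r: "f2' ?R X ?I \<diamond> fm ?R (ru' X) = (one (?F X) \<parallel> f0 ?R) \<diamond> ru' (?F X)"
  proof (rule inverse_pair_unique)
    show "inverse_pair (fm ?R (ru X) \<diamond> f2 ?R X ?I) (f2' ?R X ?I \<diamond> fm ?R (ru' X))"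
      using X h by (intro inverse_pair_comp inverse_f2 inverse_fm inverse_structural) simp_all
    have "inverse_pair (ru (?F X) \<diamond> (one (?F X) \<parallel> f0' ?R)) ((one (?F X) \<parallel> f0 ?R) \<diamond> ru' (?F X))"
      using X h inverse_pair_sym[OF inverse_f0]
      by (intro inverse_pair_comp inverse_pair_ten inverse_structural) (simp_all add: inverse_pair_def)
    then show "inverse_pair (fm ?R (ru X) \<diamond> f2 ?R X ?I) ((one (?F X) \<parallel> f0 ?R) \<diamond> ru' (?F X))"
      using X h by (simp add: ru_f0')
  qed
  have l: "f2' ?R ?I X \<diamond> fm ?R (lu' X) = (f0 ?R \<parallel> one (?F X)) \<diamond> lu' (?F X)"
  proof (rule inverse_pair_unique)
    show "inverse_pair (fm ?R (lu X) \<diamond> f2 ?R ?I X) (f2' ?R ?I X \<diamond> fm ?R (lu' X))"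
      using X h by (intro inverse_pair_comp inverse_f2 inverse_fm inverse_structural) simp_all
    have "inverse_pair (lu (?F X) \<diamond> (f0' ?R \<parallel> one (?F X))) ((f0 ?R \<parallel> one (?F X)) \<diamond> lu' (?F X))"
      using X h inverse_pair_sym[OF inverse_f0]
      by (intro inverse_pair_comp inverse_pair_ten inverse_structural) (simp_all add: inverse_pair_def)
    then show "inverse_pair (fm ?R (lu X) \<diamond> f2 ?R ?I X) ((f0 ?R \<parallel> one (?F X)) \<diamond> lu' (?F X))"
      using X h by (simp add: lu_f0')
  qed
  have "?l \<diamond> inj X h = ru (S X) \<diamond> (one (S X) \<parallel> \<gamma>) \<diamond> (tt2 X ?I \<diamond> inj (X \<boxtimes> ?I) h) \<diamond> fm ?R (ru' X)"
    using X h \<gamma> tT_inj[of "ru' X" h] by simp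
  also have "\<dots> = ru (S X) \<diamond> (inj X h \<parallel> (\<gamma> \<diamond> inj ?I h \<diamond> f0 ?R)) \<diamond> ru' (?F X)"
    using X h \<gamma> by (simp add: tt2_inj r)
  also have "\<dots> = scl c ((ru (S X) \<diamond> (inj X h \<parallel> one ?I)) \<diamond> ru' (?F X))"
    unfolding c using X h by simp
  also have "\<dots> = scl c (inj X h)"
    using X h ru_natural[of "inj X h"] by (simp del: comp_assoc) simp
  finally have l': "?l \<diamond> inj X h = scl c (inj X h)" .
  have "?r \<diamond> inj X h = lu (S X) \<diamond> (\<gamma> \<parallel> one (S X)) \<diamond> (tt2 ?I X \<diamond> inj (?I \<boxtimes> X) h) \<diamond> fm ?R (lu' X)"
    using X h \<gamma> tT_inj[of "lu' X" h] by simp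
  also have "\<dots> = lu (S X) \<diamond> ((\<gamma> \<diamond> inj ?I h \<diamond> f0 ?R) \<parallel> inj X h) \<diamond> lu' (?F X)"
    using X h \<gamma> by (simp add: tt2_inj l)
  also have "\<dots> = scl c ((lu (S X) \<diamond> (one ?I \<parallel> inj X h)) \<diamond> lu' (?F X))"
    unfolding c using X h by simp
  also have "\<dots> = scl c (inj X h)"
    using X h lu_natural[of "inj X h"] by (simp del: comp_assoc) simp
  finally show "?l \<diamond> inj X h = ?r \<diamond> inj X h"
    using l' by simp
qed (use X \<gamma> in simp_all)

section \<open>Modules as objects with a group action\<close>

abbreviation "TMod \<equiv> module_category C T"

definition str where "str X = Arrow (S (fst X)) (snd X) (fst X)"
definition act where "act X g = str X \<diamond> inj (fst X) g"

lemma src_tgt_act [simp]: "src (str X) = S (fst X)" "tgt (str X) = fst X" "mor (str X) = snd X"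
  "src (act X g) = FO (\<rho> g) (fst X)" "tgt (act X g) = fst X"
  by (simp_all add: str_def act_def)

lemma ok_act [simp]: "\<lbrakk>ok (str X); g \<in> carrier G\<rbrakk> \<Longrightarrow> ok (act X g)"
  using okD(2)[of "str X"] by (simp add: act_def)

lemma Mod_Obj_iff: "X \<in> Obj TMod \<longleftrightarrow>
    ok (str X) \<and> str X \<diamond> tT (str X) = str X \<diamond> tmu (fst X) \<and> str X \<diamond> teta (fst X) = one (fst X)"
  by (cases X) (auto simp: module_category_def str_def tT_def tmu_def teta_def comp_def one_def)

lemma Mod_ok [simp]: "X \<in> Obj TMod \<Longrightarrow> ok (str X)"
  and Mod_Obj [simp]: "X \<in> Obj TMod \<Longrightarrow> fst X \<in> Obj C"
proof -
  show *: "ok (str X)" if "X \<in> Obj TMod"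
    using that Mod_Obj_iff by blast
  show "fst X \<in> Obj C" if "X \<in> Obj TMod"
    using okD(2)[OF *[OF that]] by simp
qed

lemma Mod_simps [simp]:
  "Cmp TMod = Cmp C" "Idn TMod X = Idn C (fst X)" "TensM TMod = TensM C"
  "TensO TMod X Y = (fst X \<boxtimes> fst Y, snd X \<star> snd Y \<cdot> T2 T (fst X) (fst Y))"
  "Unit TMod = (Unit C, T0 T)" "Assoc TMod X Y Z = Assoc C (fst X) (fst Y) (fst Z)"
  "LUnit TMod X = LUnit C (fst X)" "RUnit TMod X = RUnit C (fst X)"
  unfolding module_category_def by (simp_all add: case_prod_beta)

lemma Mod_Hom: "Hom TMod X Y = {f \<in> Hom C (fst X) (fst Y). f \<cdot> snd X = snd Y \<cdot> FM T (fst X) (fst Y) f}"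
  unfolding module_category_def by (simp add: case_prod_beta)

text \<open>By the universal property of the direct sum, a \<open>T\<close>-module is an object with a compatible
  family of arrows \<open>\<rho>\<^sup>g M \<rightarrow> M\<close>, and module maps are the arrows that commute with these families.\<close>

lemma Mod_Hom_iff:
  assumes X: "ok (str X)" and Y: "ok (str Y)" and t: "ok t" "src t = fst X" "tgt t = fst Y"
  shows "mor t \<in> Hom TMod X Y \<longleftrightarrow> (\<forall>g\<in>carrier G. t \<diamond> act X g = act Y g \<diamond> fm (\<rho> g) t)"
proof -
  have o: "fst X \<in> Obj C" "fst Y \<in> Obj C"
    using okD(2)[OF X] okD(2)[OF Y] by simp_all
  have "mor t \<in> Hom TMod X Y \<longleftrightarrow> t \<diamond> str X = str Y \<diamond> tT t"
    using okD(3)[OF t(1)] t by (simp add: Mod_Hom comp_def mor_monad)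
  also have "\<dots> \<longleftrightarrow> (\<forall>g\<in>carrier G. (t \<diamond> str X) \<diamond> inj (fst X) g = (str Y \<diamond> tT t) \<diamond> inj (fst X) g)"
  proof
    assume eq: "t \<diamond> str X = str Y \<diamond> tT t"
    show "\<forall>g\<in>carrier G. (t \<diamond> str X) \<diamond> inj (fst X) g = (str Y \<diamond> tT t) \<diamond> inj (fst X) g"
      by (simp only: eq) simp
  next
    assume "\<forall>g\<in>carrier G. (t \<diamond> str X) \<diamond> inj (fst X) g = (str Y \<diamond> tT t) \<diamond> inj (fst X) g"
    then show "t \<diamond> str X = str Y \<diamond> tT t"
      by (intro inj_epi[of "t \<diamond> str X" "str Y \<diamond> tT t" "fst X"]) (use o X Y t in \<open>simp_all del: comp_assoc\<close>)
  qed
  also have "\<dots> \<longleftrightarrow> (\<forall>g\<in>carrier G. t \<diamond> act X g = act Y g \<diamond> fm (\<rho> g) t)"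
  proof (rule ball_cong[OF refl])
    fix g assume g: "g \<in> carrier G"
    have "(str Y \<diamond> tT t) \<diamond> inj (fst X) g = act Y g \<diamond> fm (\<rho> g) t"
      using o X Y t g tT_inj[OF t(1) g] by (simp add: act_def)
    then show "(t \<diamond> str X) \<diamond> inj (fst X) g = (str Y \<diamond> tT t) \<diamond> inj (fst X) g \<longleftrightarrow>
        t \<diamond> act X g = act Y g \<diamond> fm (\<rho> g) t"
      using o X t g by (simp add: act_def)
  qed
  finally show ?thesis .
qed

lemma Mod_Obj_act_iff:
  assumes X: "ok (str X)"
  shows "X \<in> Obj TMod \<longleftrightarrow>
    (\<forall>g\<in>carrier G. \<forall>h\<in>carrier G. act X g \<diamond> fm (\<rho> g) (act X h) = act X (g \<ast> h) \<diamond> r2 g h (fst X)) \<and>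
    act X E \<diamond> r0 (fst X) = one (fst X)"
proof -
  let ?M = "fst X"
  have M: "?M \<in> Obj C" using okD(2)[OF X] by simp
  have l: "(str X \<diamond> tT (str X)) \<diamond> inj (S ?M) g \<diamond> fm (\<rho> g) (inj ?M h) = act X g \<diamond> fm (\<rho> g) (act X h)"
    if "g \<in> carrier G" "h \<in> carrier G" for g h
    using tT_inj[OF X, of g] that X M comp_reduce[OF tT_inj[OF X, of g], of "fm (\<rho> g) (inj ?M h)"]
    by (simp add: act_def)
  have r: "(str X \<diamond> tmu ?M) \<diamond> inj (S ?M) g \<diamond> fm (\<rho> g) (inj ?M h) = act X (g \<ast> h) \<diamond> r2 g h ?M"
    if "g \<in> carrier G" "h \<in> carrier G" for g h
    using that X M by (simp add: act_def tmu_component)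
  have "str X \<diamond> tT (str X) = str X \<diamond> tmu ?M \<longleftrightarrow>
      (\<forall>g\<in>carrier G. \<forall>h\<in>carrier G. act X g \<diamond> fm (\<rho> g) (act X h) = act X (g \<ast> h) \<diamond> r2 g h ?M)"
  proof
    assume eq: "str X \<diamond> tT (str X) = str X \<diamond> tmu ?M"
    show "\<forall>g\<in>carrier G. \<forall>h\<in>carrier G. act X g \<diamond> fm (\<rho> g) (act X h) = act X (g \<ast> h) \<diamond> r2 g h ?M"
    proof (intro ballI)
      fix g h assume g: "g \<in> carrier G" "h \<in> carrier G"
      have "act X g \<diamond> fm (\<rho> g) (act X h) = (str X \<diamond> tT (str X)) \<diamond> inj (S ?M) g \<diamond> fm (\<rho> g) (inj ?M h)"
        by (rule l[OF g, symmetric])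
      also have "\<dots> = act X (g \<ast> h) \<diamond> r2 g h ?M"
        unfolding eq by (rule r[OF g])
      finally show "act X g \<diamond> fm (\<rho> g) (act X h) = act X (g \<ast> h) \<diamond> r2 g h ?M" .
    qed
  next
    assume "\<forall>g\<in>carrier G. \<forall>h\<in>carrier G. act X g \<diamond> fm (\<rho> g) (act X h) = act X (g \<ast> h) \<diamond> r2 g h ?M"
    then show "str X \<diamond> tT (str X) = str X \<diamond> tmu ?M"
      by (intro inj_inj_epi[of "str X \<diamond> tT (str X)" "str X \<diamond> tmu ?M" ?M])
         (use X M l r in \<open>simp_all del: comp_assoc\<close>)
  qed
  moreover have "str X \<diamond> teta ?M = act X E \<diamond> r0 ?M"
    using X M by (simp add: act_def teta_eq)
  ultimately show ?thesis
    using X by (simp add: Mod_Obj_iff)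
qed

lemma act_comp: "\<lbrakk>X \<in> Obj TMod; g \<in> carrier G; h \<in> carrier G\<rbrakk> \<Longrightarrow>
    act X g \<diamond> fm (\<rho> g) (act X h) = act X (g \<ast> h) \<diamond> r2 g h (fst X)"
  and act_one: "X \<in> Obj TMod \<Longrightarrow> act X E \<diamond> r0 (fst X) = one (fst X)"
  using Mod_Obj_act_iff[OF Mod_ok] by blast+

lemma module_of_action:
  assumes M: "M \<in> Obj C"
    and u: "\<And>g. g \<in> carrier G \<Longrightarrow> ok (u g) \<and> src (u g) = FO (\<rho> g) M \<and> tgt (u g) = M"
    and comp: "\<And>g h. \<lbrakk>g \<in> carrier G; h \<in> carrier G\<rbrakk> \<Longrightarrow> u g \<diamond> fm (\<rho> g) (u h) = u (g \<ast> h) \<diamond> r2 g h M"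
    and unit: "u E \<diamond> r0 M = one M"
  shows "(M, mor (copair M M u)) \<in> Obj TMod"
    and "g \<in> carrier G \<Longrightarrow> act (M, mor (copair M M u)) g = u g"
proof -
  note c = copair[OF M M u]
  have str: "str (M, mor (copair M M u)) = copair M M u"
    by (simp add: str_def copair_def)
  show act: "g \<in> carrier G \<Longrightarrow> act (M, mor (copair M M u)) g = u g" for g
    using c(2) by (simp add: act_def str)
  show "(M, mor (copair M M u)) \<in> Obj TMod"
    using c(1) comp unit by (subst Mod_Obj_act_iff) (simp_all add: str act)
qed

text \<open>The arrows of an action are invertible, as their composites with those of inverse group
  elements are.\<close>

lemma act_iso:
  assumes X: "X \<in> Obj TMod" and g: "g \<in> carrier G"
  shows "\<exists>v. inverse_pair (act X g) v"
proof -
  let ?M = "fst X" and ?h = "inv\<^bsub>G\<^esub> g"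
  have M: "?M \<in> Obj C" "?h \<in> carrier G" using X g by simp_all
  have "act X E = (act X E \<diamond> r0 ?M) \<diamond> r0' ?M"
    using X M by simp
  then have "act X E = r0' ?M"
    using X M by (simp add: act_one)
  then have E: "inverse_pair (act X E) (r0 ?M)"
    using inverse_pair_sym[OF inverse_r0[OF M(1)]] by simp
  have i: "inverse_pair (act X E \<diamond> r2 g ?h ?M) (r2' g ?h ?M \<diamond> r0 ?M)"
    using M g by (intro inverse_pair_comp inverse_r2 E) simp_all
  have "inverse_pair (act X E \<diamond> r2 ?h g ?M) (r2' ?h g ?M \<diamond> r0 ?M)"
    using M g by (intro inverse_pair_comp inverse_r2 E) simp_all
  then have j: "inverse_pair (fm (\<rho> g) (act X E \<diamond> r2 ?h g ?M)) (fm (\<rho> g) (r2' ?h g ?M \<diamond> r0 ?M))"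
    using g by (intro inverse_fm) simp_all
  show ?thesis
  proof (rule iso_of_composites[OF i j])
    show "act X g \<diamond> fm (\<rho> g) (act X ?h) = act X E \<diamond> r2 g ?h ?M"
      using act_comp[OF X g M(2)] g by simp
    have "fm (\<rho> g) (act X ?h \<diamond> fm (\<rho> ?h) (act X g)) = fm (\<rho> g) (act X E \<diamond> r2 ?h g ?M)"
      using act_comp[OF X M(2) g] g by simp
    then show "fm (\<rho> g) (act X ?h) \<diamond> fm (\<rho> g) (fm (\<rho> ?h) (act X g)) = fm (\<rho> g) (act X E \<diamond> r2 ?h g ?M)"
      using X M g by simp
  qed (use X M g in simp_all)
qed

lemma str_ten:
  assumes "ok (str X)" "ok (str Y)"
  shows "ok (str (TensO TMod X Y))" "fst (TensO TMod X Y) = fst X \<boxtimes> fst Y"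
    and "g \<in> carrier G \<Longrightarrow> act (TensO TMod X Y) g = (act X g \<parallel> act Y g) \<diamond> f2' (\<rho> g) (fst X) (fst Y)"
proof -
  have o: "fst X \<in> Obj C" "fst Y \<in> Obj C"
    using okD(2)[OF assms(1)] okD(2)[OF assms(2)] by simp_all
  have s: "str (TensO TMod X Y) = (str X \<parallel> str Y) \<diamond> tt2 (fst X) (fst Y)"
    by (simp add: str_def ten_def comp_def tt2_def)
  show "ok (str (TensO TMod X Y))" "fst (TensO TMod X Y) = fst X \<boxtimes> fst Y"
    unfolding s using assms o by simp_all
  show "act (TensO TMod X Y) g = (act X g \<parallel> act Y g) \<diamond> f2' (\<rho> g) (fst X) (fst Y)" if "g \<in> carrier G"
    using assms o that unfolding act_def s by (simp add: tt2_inj)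
qed

lemma str_Unit: "ok (str (Unit TMod))" "fst (Unit TMod) = Unit C"
  "g \<in> carrier G \<Longrightarrow> act (Unit TMod) g = f0' (\<rho> g)"
proof -
  have s: "str (Unit TMod) = tt0"
    by (simp add: str_def tt0_def)
  show "ok (str (Unit TMod))" "fst (Unit TMod) = Unit C"
    unfolding s by simp_all
  show "g \<in> carrier G \<Longrightarrow> act (Unit TMod) g = f0' (\<rho> g)"
    unfolding act_def s by (simp add: tt0_inj)
qed

lemma Unit_Mod: "Unit TMod \<in> Obj TMod"
proof -
  have s: "str (Unit TMod) = tt0"
    by (simp add: str_def tt0_def)
  show ?thesis
    unfolding Mod_Obj_iff s by (simp add: tt0_tmu tt0_teta)
qed

lemma free_module:
  assumes "X \<in> Obj C"
  shows "(S X, Mu T X) \<in> Obj TMod" "str (S X, Mu T X) = tmu X"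
proof -
  show s: "str (S X, Mu T X) = tmu X"
    by (simp add: str_def tmu_def)
  show "(S X, Mu T X) \<in> Obj TMod"
    unfolding Mod_Obj_iff s using assms by (simp add: tmu_assoc tmu_teta)
qed

subsection \<open>Comparison with the equivariantization\<close>

abbreviation "Equiv \<equiv> equivariantization C G \<rho> \<rho>2 \<rho>0"
abbreviation "Comp \<equiv> comparison C G S \<pi>"

lemma Comp_Obj: "FO Comp (X, u) = (X, mor (copair X X (\<lambda>g. Arrow (FO (\<rho> g) X) (u g) X)))"
  by (simp add: comparison_def copair_def)

lemma Equiv_Obj_iff: "(X, u) \<in> Obj Equiv \<longleftrightarrow> X \<in> Obj C \<and> u \<in> extensional (carrier G) \<and>
    (\<forall>g\<in>carrier G. ok (Arrow (FO (\<rho> g) X) (u g) X)) \<and>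
    (\<forall>g\<in>carrier G. \<forall>h\<in>carrier G. Arrow (FO (\<rho> g) X) (u g) X \<diamond> fm (\<rho> g) (Arrow (FO (\<rho> h) X) (u h) X) =
       Arrow (FO (\<rho> (g \<ast> h)) X) (u (g \<ast> h)) X \<diamond> r2 g h X) \<and>
    Arrow (FO (\<rho> E) X) (u E) X \<diamond> r0 X = one X"
  by (auto simp: equivariantization_def PiE_iff comp_def fm_def r2_def r0_def one_def)

lemma Equiv_Hom: "Hom Equiv (X, u) (Y, v) =
    {f \<in> Hom C X Y. \<forall>g\<in>carrier G. f \<cdot> u g = v g \<cdot> FM (\<rho> g) X Y f}"
  by (simp add: equivariantization_def)

lemma Comp_Mod:
  assumes "(X, u) \<in> Obj Equiv"
  shows "FO Comp (X, u) \<in> Obj TMod"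
    and "g \<in> carrier G \<Longrightarrow> act (FO Comp (X, u)) g = Arrow (FO (\<rho> g) X) (u g) X"
  unfolding Comp_Obj using assms unfolding Equiv_Obj_iff
  by (intro module_of_action; simp)+

lemma fst_Comp [simp]: "fst (FO Comp X) = fst X"
  by (cases X) (simp add: comparison_def)

lemma Comp_Hom:
  assumes X: "X \<in> Obj Equiv" and Y: "Y \<in> Obj Equiv"
  shows "Hom TMod (FO Comp X) (FO Comp Y) = Hom Equiv X Y"
proof -
  obtain M u N v where XY: "X = (M, u)" "Y = (N, v)" by (cases X, cases Y) auto
  have o: "M \<in> Obj C" "N \<in> Obj C" using X Y by (auto simp: XY Equiv_Obj_iff)
  have iff: "f \<in> Hom TMod (FO Comp X) (FO Comp Y) \<longleftrightarrow> f \<in> Hom Equiv X Y" if f: "f \<in> Hom C M N" for f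
  proof -
    have "f \<in> Hom TMod (FO Comp X) (FO Comp Y) \<longleftrightarrow>
        (\<forall>g\<in>carrier G. Arrow M f N \<diamond> act (FO Comp X) g = act (FO Comp Y) g \<diamond> fm (\<rho> g) (Arrow M f N))"
      using Mod_Hom_iff[of "FO Comp X" "FO Comp Y" "Arrow M f N"] Comp_Mod(1) X Y f o by (simp add: XY)
    also have "\<dots> \<longleftrightarrow> (\<forall>g\<in>carrier G. f \<cdot> u g = v g \<cdot> FM (\<rho> g) M N f)"
      using X Y Comp_Mod(2) by (simp add: XY comp_def fm_def)
    finally show ?thesis using f by (simp add: XY Equiv_Hom)
  qed
  then show ?thesis
    by (auto simp: Mod_Hom Equiv_Hom XY)
qed

definition uncomp :: "('o \<times> 'a, 'a, 'o \<times> ('g \<Rightarrow> 'a), 'a) func" where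
  "uncomp = \<lparr>FO = (\<lambda>X. (fst X, \<lambda>g\<in>carrier G. mor (act X g))), FM = (\<lambda>X Y f. f)\<rparr>"

lemma act_Arrow: "Arrow (FO (\<rho> g) (fst X)) (mor (act X g)) (fst X) = act X g"
  by (cases "act X g") (metis arrow.sel src_tgt_act(4,5))

lemma uncomp_Equiv:
  assumes X: "X \<in> Obj TMod"
  shows "FO uncomp X \<in> Obj Equiv" and "FO Comp (FO uncomp X) = X"
proof -
  have M: "fst X \<in> Obj C" using X by simp
  show E: "FO uncomp X \<in> Obj Equiv"
    unfolding uncomp_def using X act_comp[OF X] act_one[OF X]
    by (simp add: Equiv_Obj_iff act_Arrow)
  have "str (FO Comp (FO uncomp X)) = str X"
  proof (rule inj_epi[of _ _ "fst X"])
    fix g assume g: "g \<in> carrier G"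
    have "act (FO Comp (FO uncomp X)) g = act X g"
      using Comp_Mod(2)[of "fst X" "snd (FO uncomp X)" g] E g by (simp add: uncomp_def act_Arrow)
    then show "str (FO Comp (FO uncomp X)) \<diamond> inj (fst X) g = str X \<diamond> inj (fst X) g"
      by (simp add: act_def uncomp_def)
  qed (use X M Comp_Mod(1)[of "fst X" "snd (FO uncomp X)"] E in \<open>simp_all add: uncomp_def\<close>)
  then show "FO Comp (FO uncomp X) = X"
    by (cases X) (auto simp: str_def uncomp_def prod_eq_iff)
qed

lemma uncomp_Comp:
  assumes "X \<in> Obj Equiv"
  shows "FO uncomp (FO Comp X) = X"
proof -
  obtain M u where X: "X = (M, u)" by (cases X)
  have "(\<lambda>g\<in>carrier G. mor (act (FO Comp (M, u)) g)) = u"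
    using assms Comp_Mod(2)[of M u] by (auto simp: X Equiv_Obj_iff extensional_def fun_eq_iff)
  then show ?thesis
    using fst_Comp[of X] by (simp add: uncomp_def X)
qed

lemma Comp_iso: "category_isomorphism Equiv TMod Comp"
proof -
  have FM: "FM Comp X Y f = f" "FM uncomp X' Y' f = f" for X Y X' Y' f
    by (simp_all add: comparison_def uncomp_def)
  have Idn: "Idn Equiv X = Idn C (fst X)" "Cmp Equiv = Cmp C" for X
    by (simp_all add: equivariantization_def case_prod_unfold)
  have Comp: "is_functor Equiv TMod Comp"
    unfolding is_functor_def using Comp_Mod(1) Comp_Hom by (auto simp: FM Idn)
  have hom: "Hom Equiv (FO uncomp X) (FO uncomp Y) = Hom TMod X Y" if "X \<in> Obj TMod" "Y \<in> Obj TMod" for X Y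
    using Comp_Hom[OF uncomp_Equiv(1)[OF that(1)] uncomp_Equiv(1)[OF that(2)]] uncomp_Equiv(2) that by simp
  have uncomp: "is_functor TMod Equiv uncomp"
    unfolding is_functor_def using uncomp_Equiv(1) hom by (auto simp: FM Idn, simp add: uncomp_def)
  show ?thesis
    unfolding category_isomorphism_def
    using Comp uncomp uncomp_Equiv(2) uncomp_Comp by (auto simp: FM intro!: exI[of _ uncomp])
qed

lemma Comp_forgetful: "func_comp forgetful Comp = forgetful"
  by (auto simp: func_comp_def forgetful_def comparison_def fun_eq_iff)

subsection \<open>Duals of modules\<close>

text \<open>If evaluation is compatible with two families \<open>v\<close> and \<open>u\<close>, then the two sides of the axioms of an
  action for \<open>v\<close>, paired with those for \<open>u\<close>, have the same evaluation. So \<open>v\<close> is an action if \<open>u\<close> is,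
  by the cancellation property of evaluation.\<close>

lemma action_eval:
  assumes d: "dual_arrows Y M Ev K"
    and v': "\<forall>g\<in>carrier G. ok (v g) \<and> src (v g) = FO (\<rho> g) Y \<and> tgt (v g) = Y"
    and u': "\<forall>g\<in>carrier G. ok (u g) \<and> src (u g) = FO (\<rho> g) M \<and> tgt (u g) = M"
    and eval': "\<forall>g\<in>carrier G. Ev \<diamond> (v g \<parallel> u g) = f0' (\<rho> g) \<diamond> fm (\<rho> g) Ev \<diamond> f2 (\<rho> g) Y M"
  shows "\<lbrakk>g \<in> carrier G; h \<in> carrier G\<rbrakk> \<Longrightarrow>
      Ev \<diamond> ((v g \<diamond> fm (\<rho> g) (v h)) \<parallel> (u g \<diamond> fm (\<rho> g) (u h))) =
      Ev \<diamond> ((v (g \<ast> h) \<diamond> r2 g h Y) \<parallel> (u (g \<ast> h) \<diamond> r2 g h M))"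
    and "Ev \<diamond> ((v E \<diamond> r0 Y) \<parallel> (u E \<diamond> r0 M)) = Ev"
proof -
  note D = dual_arrowsD(1-8)[OF d]
  note v = bspec[OF v'] and u = bspec[OF u'] and eval = bspec[OF eval']
  let ?I = "Unit C"
  assume g: "g \<in> carrier G" "h \<in> carrier G"
  have gh: "g \<ast> h \<in> carrier G" using g by simp
  note typed = D v[OF g(1)] u[OF g(1)] v[OF g(2)] u[OF g(2)] v[OF gh] u[OF gh] g
  have n: "f2 (\<rho> g) Y M \<diamond> (fm (\<rho> g) (v h) \<parallel> fm (\<rho> g) (u h)) =
      fm (\<rho> g) (v h \<parallel> u h) \<diamond> f2 (\<rho> g) (FO (\<rho> h) Y) (FO (\<rho> h) M)"
    using f2_natural[of "\<rho> g" "v h" "u h"] typed by simp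
  have "Ev \<diamond> ((v g \<diamond> fm (\<rho> g) (v h)) \<parallel> (u g \<diamond> fm (\<rho> g) (u h))) =
      (Ev \<diamond> (v g \<parallel> u g)) \<diamond> (fm (\<rho> g) (v h) \<parallel> fm (\<rho> g) (u h))"
    using typed by simp
  also have "\<dots> = f0' (\<rho> g) \<diamond> fm (\<rho> g) (Ev \<diamond> (v h \<parallel> u h)) \<diamond> f2 (\<rho> g) (FO (\<rho> h) Y) (FO (\<rho> h) M)"
    unfolding eval[OF g(1)] using typed n by simp
  also have "\<dots> = (f0' (\<rho> g) \<diamond> fm (\<rho> g) (f0' (\<rho> h))) \<diamond> fm (\<rho> g) (fm (\<rho> h) Ev) \<diamond>
      fm (\<rho> g) (f2 (\<rho> h) Y M) \<diamond> f2 (\<rho> g) (FO (\<rho> h) Y) (FO (\<rho> h) M)"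
    unfolding eval[OF g(2)] using typed by simp
  also have "\<dots> = f0' (\<rho> (g \<ast> h)) \<diamond> (r2 g h ?I \<diamond> fm (\<rho> g) (fm (\<rho> h) Ev)) \<diamond>
      fm (\<rho> g) (f2 (\<rho> h) Y M) \<diamond> f2 (\<rho> g) (FO (\<rho> h) Y) (FO (\<rho> h) M)"
    unfolding f0'_r2[OF g, symmetric] using typed by simp
  also have "r2 g h ?I \<diamond> fm (\<rho> g) (fm (\<rho> h) Ev) = fm (\<rho> (g \<ast> h)) Ev \<diamond> r2 g h (Y \<boxtimes> M)"
    using r2_natural[of g h Ev] typed by simp
  also have "f0' (\<rho> (g \<ast> h)) \<diamond> (fm (\<rho> (g \<ast> h)) Ev \<diamond> r2 g h (Y \<boxtimes> M)) \<diamond>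
      fm (\<rho> g) (f2 (\<rho> h) Y M) \<diamond> f2 (\<rho> g) (FO (\<rho> h) Y) (FO (\<rho> h) M) =
      f0' (\<rho> (g \<ast> h)) \<diamond> fm (\<rho> (g \<ast> h)) Ev \<diamond> f2 (\<rho> (g \<ast> h)) Y M \<diamond> (r2 g h Y \<parallel> r2 g h M)"
    using typed by (simp add: r2_f2)
  also have "\<dots> = (Ev \<diamond> (v (g \<ast> h) \<parallel> u (g \<ast> h))) \<diamond> (r2 g h Y \<parallel> r2 g h M)"
    unfolding eval[OF gh] using typed by simp
  also have "\<dots> = Ev \<diamond> ((v (g \<ast> h) \<diamond> r2 g h Y) \<parallel> (u (g \<ast> h) \<diamond> r2 g h M))"
    using typed by simp
  finally show "Ev \<diamond> ((v g \<diamond> fm (\<rho> g) (v h)) \<parallel> (u g \<diamond> fm (\<rho> g) (u h))) =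
      Ev \<diamond> ((v (g \<ast> h) \<diamond> r2 g h Y) \<parallel> (u (g \<ast> h) \<diamond> r2 g h M))" .
next
  note D = dual_arrowsD(1-8)[OF d]
  note v = bspec[OF v'] and u = bspec[OF u'] and eval = bspec[OF eval']
  note typed = D v[OF one_closed] u[OF one_closed]
  have "Ev \<diamond> ((v E \<diamond> r0 Y) \<parallel> (u E \<diamond> r0 M)) = (Ev \<diamond> (v E \<parallel> u E)) \<diamond> (r0 Y \<parallel> r0 M)"
    using typed by simp
  also have "\<dots> = f0' (\<rho> E) \<diamond> fm (\<rho> E) Ev \<diamond> r0 (Y \<boxtimes> M)"
    unfolding eval[OF one_closed] using typed by (simp add: r0_f2)
  also have "\<dots> = f0' (\<rho> E) \<diamond> r0 (Unit C) \<diamond> Ev"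
    using r0_natural[of Ev] typed by simp
  also have "\<dots> = Ev"
    using typed by (simp add: r0_f0)
  finally show "Ev \<diamond> ((v E \<diamond> r0 Y) \<parallel> (u E \<diamond> r0 M)) = Ev" .
qed

text \<open>Since \<open>\<rho>\<^sup>g Y\<close> is a left dual of \<open>\<rho>\<^sup>g M\<close>, the invertible arrow \<open>\<rho>\<^sup>g M \<rightarrow> M\<close> has exactly one
  counterpart \<open>\<rho>\<^sup>g Y \<rightarrow> Y\<close> that is compatible with evaluation, and it is compatible with coevaluation
  as well.\<close>

lemma left_dual_module:
  assumes X: "X \<in> Obj TMod" and d: "dual_arrows Y (fst X) Ev K"
  shows "\<exists>Z\<in>Obj TMod. fst Z = Y \<and> (\<forall>g\<in>carrier G.
    Ev \<diamond> (act Z g \<parallel> act X g) = f0' (\<rho> g) \<diamond> fm (\<rho> g) Ev \<diamond> f2 (\<rho> g) Y (fst X) \<and>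
    (act X g \<parallel> act Z g) \<diamond> f2' (\<rho> g) (fst X) Y \<diamond> fm (\<rho> g) K \<diamond> f0 (\<rho> g) = K)"
proof -
  let ?M = "fst X"
  note D = dual_arrowsD(1-8)[OF d]
  have "\<exists>v. ok v \<and> src v = FO (\<rho> g) Y \<and> tgt v = Y \<and>
      Ev \<diamond> (v \<parallel> act X g) = f0' (\<rho> g) \<diamond> fm (\<rho> g) Ev \<diamond> f2 (\<rho> g) Y ?M \<and>
      (act X g \<parallel> v) \<diamond> f2' (\<rho> g) ?M Y \<diamond> fm (\<rho> g) K \<diamond> f0 (\<rho> g) = K" if g: "g \<in> carrier G" for g
    using act_iso[OF X g] dual_transport[OF d functor_dual_arrows[OF smf_\<rho>[OF g] d], of "act X g"] by auto
  then obtain v where v': "\<forall>g\<in>carrier G. ok (v g) \<and> src (v g) = FO (\<rho> g) Y \<and> tgt (v g) = Y"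
    and ev': "\<forall>g\<in>carrier G. Ev \<diamond> (v g \<parallel> act X g) = f0' (\<rho> g) \<diamond> fm (\<rho> g) Ev \<diamond> f2 (\<rho> g) Y ?M"
    and coev: "\<And>g. g \<in> carrier G \<Longrightarrow> (act X g \<parallel> v g) \<diamond> f2' (\<rho> g) ?M Y \<diamond> fm (\<rho> g) K \<diamond> f0 (\<rho> g) = K"
    by metis
  have u': "\<forall>g\<in>carrier G. ok (act X g) \<and> src (act X g) = FO (\<rho> g) ?M \<and> tgt (act X g) = ?M"
    using X by simp
  note v = bspec[OF v'] and ev = bspec[OF ev']
  note eval = action_eval[OF d v' u' ev']
  have comp: "v g \<diamond> fm (\<rho> g) (v h) = v (g \<ast> h) \<diamond> r2 g h Y" if g: "g \<in> carrier G" "h \<in> carrier G" for g h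
  proof -
    obtain w where w: "inverse_pair (act X (g \<ast> h)) w" using act_iso[OF X] g by blast
    then have "inverse_pair (act X (g \<ast> h) \<diamond> r2 g h ?M) (r2' g h ?M \<diamond> w)"
      using X g by (intro inverse_pair_comp inverse_r2) simp_all
    then show ?thesis
      by (rule eval_cancel[OF d])
        (use eval(1)[OF g] act_comp[OF X g] v[OF g(1)] v[OF g(2)] v[of "g \<ast> h"] g D X in simp_all)
  qed
  have unit: "v E \<diamond> r0 Y = one Y"
    by (rule eval_cancel[OF d, of "one ?M" "one ?M"])
      (use eval(2) act_one[OF X] v[of E] D X in \<open>simp_all add: inverse_pair_def\<close>)
  show ?thesis
    using module_of_action[OF D(2) v comp unit] ev coev
    by (intro bexI[of _ "(Y, mor (copair Y Y v))"]) simp_all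
qed

lemma right_dual_module:
  assumes X: "X \<in> Obj TMod" and d: "dual_arrows (fst X) M Ev K"
  shows "\<exists>Z\<in>Obj TMod. fst Z = M \<and> (\<forall>g\<in>carrier G.
    Ev \<diamond> (act X g \<parallel> act Z g) = f0' (\<rho> g) \<diamond> fm (\<rho> g) Ev \<diamond> f2 (\<rho> g) (fst X) M \<and>
    (act Z g \<parallel> act X g) \<diamond> f2' (\<rho> g) M (fst X) \<diamond> fm (\<rho> g) K \<diamond> f0 (\<rho> g) = K)"
proof -
  let ?Y = "fst X"
  note D = dual_arrowsD(1-8)[OF d]
  have "\<exists>v. ok v \<and> src v = FO (\<rho> g) M \<and> tgt v = M \<and>
      Ev \<diamond> (act X g \<parallel> v) = f0' (\<rho> g) \<diamond> fm (\<rho> g) Ev \<diamond> f2 (\<rho> g) ?Y M \<and>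
      (v \<parallel> act X g) \<diamond> f2' (\<rho> g) M ?Y \<diamond> fm (\<rho> g) K \<diamond> f0 (\<rho> g) = K" if g: "g \<in> carrier G" for g
    using act_iso[OF X g] dual_transport_right[OF d functor_dual_arrows[OF smf_\<rho>[OF g] d], of "act X g"] by auto
  then obtain v where v': "\<forall>g\<in>carrier G. ok (v g) \<and> src (v g) = FO (\<rho> g) M \<and> tgt (v g) = M"
    and ev': "\<forall>g\<in>carrier G. Ev \<diamond> (act X g \<parallel> v g) = f0' (\<rho> g) \<diamond> fm (\<rho> g) Ev \<diamond> f2 (\<rho> g) ?Y M"
    and coev: "\<And>g. g \<in> carrier G \<Longrightarrow> (v g \<parallel> act X g) \<diamond> f2' (\<rho> g) M ?Y \<diamond> fm (\<rho> g) K \<diamond> f0 (\<rho> g) = K"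
    by metis
  have u': "\<forall>g\<in>carrier G. ok (act X g) \<and> src (act X g) = FO (\<rho> g) ?Y \<and> tgt (act X g) = ?Y"
    using X by simp
  note v = bspec[OF v'] and ev = bspec[OF ev']
  note eval = action_eval[OF d u' v' ev']
  have comp: "v g \<diamond> fm (\<rho> g) (v h) = v (g \<ast> h) \<diamond> r2 g h M" if g: "g \<in> carrier G" "h \<in> carrier G" for g h
  proof -
    obtain w where w: "inverse_pair (act X (g \<ast> h)) w" using act_iso[OF X] g by blast
    then have "inverse_pair (act X (g \<ast> h) \<diamond> r2 g h ?Y) (r2' g h ?Y \<diamond> w)"
      using X g by (intro inverse_pair_comp inverse_r2) simp_all
    then show ?thesis
      by (rule eval_cancel_right[OF d])
        (use eval(1)[OF g] act_comp[OF X g] v[OF g(1)] v[OF g(2)] v[of "g \<ast> h"] g D X in simp_all)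
  qed
  have unit: "v E \<diamond> r0 M = one M"
    by (rule eval_cancel_right[OF d, of "one ?Y" "one ?Y"])
      (use eval(2) act_one[OF X] v[of E] D X in \<open>simp_all add: inverse_pair_def\<close>)
  show ?thesis
    using module_of_action[OF D(1) v comp unit] ev coev
    by (intro bexI[of _ "(M, mor (copair M M v))"]) simp_all
qed

text \<open>Duality in the category of modules refers to inverses formed in that category. They agree with
  the inverses in the underlying category, as the inverse of a module map is a module map.\<close>

lemma Assoc_Mod:
  assumes "X \<in> Obj TMod" "Y \<in> Obj TMod" "Z \<in> Obj TMod"
  shows "inv_arr TMod (TensO TMod (TensO TMod X Y) Z) (TensO TMod X (TensO TMod Y Z)) (Assoc C (fst X) (fst Y) (fst Z)) =
    mor (asc' (fst X) (fst Y) (fst Z))" (is "inv_arr TMod ?l ?r ?a = ?a'")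
proof -
  let ?x = "fst X" and ?y = "fst Y" and ?z = "fst Z"
  let ?L = "TensO TMod (TensO TMod X Y) Z" and ?R = "TensO TMod X (TensO TMod Y Z)"
  have ok: "ok (str X)" "ok (str Y)" "ok (str Z)" using assms by simp_all
  have o: "?x \<in> Obj C" "?y \<in> Obj C" "?z \<in> Obj C" using assms by simp_all
  note t = str_ten[OF str_ten(1)[OF ok(1,2)] ok(3)] str_ten[OF ok(1) str_ten(1)[OF ok(2,3)]]
    str_ten(2)[OF ok(1,2)] str_ten(2)[OF ok(2,3)]
  note a = str_ten(3)[OF ok(1,2)] str_ten(3)[OF ok(2,3)]
  have nat: "asc ?x ?y ?z \<diamond> act ?L g = act ?R g \<diamond> fm (\<rho> g) (asc ?x ?y ?z)" if g: "g \<in> carrier G" for g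
  proof -
    let ?F = "FO (\<rho> g)"
    have "asc ?x ?y ?z \<diamond> act ?L g = asc ?x ?y ?z \<diamond> (((act X g \<parallel> act Y g) \<diamond> f2' (\<rho> g) ?x ?y) \<parallel> act Z g) \<diamond> f2' (\<rho> g) (?x \<boxtimes> ?y) ?z"
      using t(3)[OF g] a(1)[OF g] by (simp del: Mod_simps(4) add: t)
    also have "\<dots> = (asc ?x ?y ?z \<diamond> ((act X g \<parallel> act Y g) \<parallel> act Z g)) \<diamond> (f2' (\<rho> g) ?x ?y \<parallel> one (?F ?z)) \<diamond> f2' (\<rho> g) (?x \<boxtimes> ?y) ?z"
      using o ok g by simp
    also have "asc ?x ?y ?z \<diamond> ((act X g \<parallel> act Y g) \<parallel> act Z g) = (act X g \<parallel> (act Y g \<parallel> act Z g)) \<diamond> asc (?F ?x) (?F ?y) (?F ?z)"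
      using asc_natural[of "act X g" "act Y g" "act Z g"] o ok g by simp
    also have "((act X g \<parallel> (act Y g \<parallel> act Z g)) \<diamond> asc (?F ?x) (?F ?y) (?F ?z)) \<diamond> (f2' (\<rho> g) ?x ?y \<parallel> one (?F ?z)) \<diamond> f2' (\<rho> g) (?x \<boxtimes> ?y) ?z
        = (act X g \<parallel> (act Y g \<parallel> act Z g)) \<diamond> (one (?F ?x) \<parallel> f2' (\<rho> g) ?y ?z) \<diamond> f2' (\<rho> g) ?x (?y \<boxtimes> ?z) \<diamond> fm (\<rho> g) (asc ?x ?y ?z)"
      using o ok g by (simp add: f2'_asc del: ten_comp ten_comp_assoc)
    also have "\<dots> = act ?R g \<diamond> fm (\<rho> g) (asc ?x ?y ?z)"
      using o ok g t(6)[OF g] a(2)[OF g] by (simp del: Mod_simps(4) add: t)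
    finally show ?thesis .
  qed
  have "asc' ?x ?y ?z \<diamond> act ?R g = act ?L g \<diamond> fm (\<rho> g) (asc' ?x ?y ?z)" if g: "g \<in> carrier G" for g
  proof -
    note i = inverse_pair_cancel(2)[OF inverse_fm[OF smf_\<rho>[OF g] inverse_structural(1)[OF o]]]
    have "asc' ?x ?y ?z \<diamond> act ?R g = asc' ?x ?y ?z \<diamond> act ?R g \<diamond> fm (\<rho> g) (asc ?x ?y ?z) \<diamond> fm (\<rho> g) (asc' ?x ?y ?z)"
      unfolding i using o g by (simp del: Mod_simps(4) add: t(1,2,4,5,7,8))
    also have "\<dots> = asc' ?x ?y ?z \<diamond> (act ?R g \<diamond> fm (\<rho> g) (asc ?x ?y ?z)) \<diamond> fm (\<rho> g) (asc' ?x ?y ?z)"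
      using o g by (simp del: Mod_simps(4) add: t(1,2,4,5,7,8))
    also have "\<dots> = act ?L g \<diamond> fm (\<rho> g) (asc' ?x ?y ?z)"
      unfolding nat[OF g, symmetric] using o g by (simp del: Mod_simps(4) add: t(1,2,4,5,7,8))
    finally show ?thesis .
  qed
  then have "mor (asc ?x ?y ?z) \<in> Hom TMod ?L ?R" "mor (asc' ?x ?y ?z) \<in> Hom TMod ?R ?L"
    using Mod_Hom_iff[OF t(1,4), of "asc ?x ?y ?z"] Mod_Hom_iff[OF t(4,1), of "asc' ?x ?y ?z"] nat o
    by (simp_all del: Mod_simps(4) add: t)
  then have inv: "inverse_arrows TMod ?L ?R ?a ?a'"
    using o inverse_inv_arr[OF _ _ Assoc_iso[OF o]]
    by (simp add: inverse_arrows_def mor_structural)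
  show ?thesis
    unfolding inv_arr_def
  proof (rule the_equality)
    show "inverse_arrows TMod ?L ?R ?a ?a'" by (rule inv)
    fix b assume "inverse_arrows TMod ?L ?R ?a b"
    then have "inverse_arrows C ((?x \<boxtimes> ?y) \<boxtimes> ?z) (?x \<boxtimes> (?y \<boxtimes> ?z)) ?a b"
      by (simp add: inverse_arrows_def Mod_Hom)
    moreover have "inverse_arrows C ((?x \<boxtimes> ?y) \<boxtimes> ?z) (?x \<boxtimes> (?y \<boxtimes> ?z)) ?a ?a'"
      using inv by (simp add: inverse_arrows_def Mod_Hom)
    ultimately show "b = ?a'"
      using o by (intro inverse_arrows_unique) simp_all
  qed
qed

lemma dual_pair_Mod:
  assumes X: "X \<in> Obj TMod" and Z: "Z \<in> Obj TMod" and d: "dual_arrows (fst Z) (fst X) Ev K"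
    and ev: "\<And>g. g \<in> carrier G \<Longrightarrow> Ev \<diamond> (act Z g \<parallel> act X g) = f0' (\<rho> g) \<diamond> fm (\<rho> g) Ev \<diamond> f2 (\<rho> g) (fst Z) (fst X)"
    and coev: "\<And>g. g \<in> carrier G \<Longrightarrow> (act X g \<parallel> act Z g) \<diamond> f2' (\<rho> g) (fst X) (fst Z) \<diamond> fm (\<rho> g) K \<diamond> f0 (\<rho> g) = K"
  shows "dual_pair TMod Z X (mor Ev) (mor K)"
proof -
  note D = dual_arrowsD(1-8)[OF d]
  have ok: "ok (str X)" "ok (str Z)" using X Z by simp_all
  have "Ev = Arrow (fst Z \<boxtimes> fst X) (mor Ev) (Unit C)" "K = Arrow (Unit C) (mor K) (fst X \<boxtimes> fst Z)"
    using D by (metis arrow.collapse)+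
  then have C: "dual_pair C (fst Z) (fst X) (mor Ev) (mor K)"
    using d dual_pair_iff by metis
  have "Ev \<diamond> act (TensO TMod Z X) g = act (Unit TMod) g \<diamond> fm (\<rho> g) Ev" if g: "g \<in> carrier G" for g
  proof -
    have "Ev \<diamond> act (TensO TMod Z X) g = (Ev \<diamond> (act Z g \<parallel> act X g)) \<diamond> f2' (\<rho> g) (fst Z) (fst X)"
      using str_ten(3)[OF ok(2,1) g] ok D g by (simp del: Mod_simps(4))
    then show ?thesis
      unfolding ev[OF g] using str_Unit(3)[OF g] D g by (simp del: Mod_simps)
  qed
  then have e: "mor Ev \<in> Hom TMod (TensO TMod Z X) (Unit TMod)"
    using Mod_Hom_iff[OF str_ten(1)[OF ok(2,1)] str_Unit(1), of Ev] D str_ten(2)[OF ok(2,1)] str_Unit(2)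
    by (simp del: Mod_simps)
  have "K \<diamond> act (Unit TMod) g = act (TensO TMod X Z) g \<diamond> fm (\<rho> g) K" if g: "g \<in> carrier G" for g
  proof -
    have "K \<diamond> f0' (\<rho> g) = ((act X g \<parallel> act Z g) \<diamond> f2' (\<rho> g) (fst X) (fst Z) \<diamond> fm (\<rho> g) K \<diamond> f0 (\<rho> g)) \<diamond> f0' (\<rho> g)"
      by (simp only: coev[OF g])
    also have "\<dots> = ((act X g \<parallel> act Z g) \<diamond> f2' (\<rho> g) (fst X) (fst Z)) \<diamond> fm (\<rho> g) K"
      using ok D g by simp
    finally show ?thesis
      using str_ten(3)[OF ok g] str_Unit(3)[OF g] by (simp del: Mod_simps comp_assoc)
  qed
  then have c: "mor K \<in> Hom TMod (Unit TMod) (TensO TMod X Z)"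
    using Mod_Hom_iff[OF str_Unit(1) str_ten(1)[OF ok], of K] D str_ten(2)[OF ok] str_Unit(2)
    by (simp del: Mod_simps)
  show ?thesis
    unfolding dual_pair_def Assoc_Mod[OF Z X Z, folded Mod_simps(6)]
    using X Z e c C by (simp add: dual_pair_def mor_structural)
qed

lemma rigid_Mod: "rigid TMod"
  unfolding rigid_def
proof (intro ballI conjI)
  fix X assume X: "X \<in> Obj TMod"
  obtain Y e c where "dual_pair C Y (fst X) e c"
    using rigid X unfolding rigid_def by (meson Mod_Obj)
  then have d: "dual_arrows Y (fst X) (Arrow (Y \<boxtimes> fst X) e (Unit C)) (Arrow (Unit C) c (fst X \<boxtimes> Y))"
    by (simp add: dual_pair_iff)
  obtain Z where "Z \<in> Obj TMod" "fst Z = Y"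
    "\<And>g. g \<in> carrier G \<Longrightarrow> Arrow (Y \<boxtimes> fst X) e (Unit C) \<diamond> (act Z g \<parallel> act X g) = f0' (\<rho> g) \<diamond> fm (\<rho> g) (Arrow (Y \<boxtimes> fst X) e (Unit C)) \<diamond> f2 (\<rho> g) Y (fst X)"
    "\<And>g. g \<in> carrier G \<Longrightarrow> (act X g \<parallel> act Z g) \<diamond> f2' (\<rho> g) (fst X) Y \<diamond> fm (\<rho> g) (Arrow (Unit C) c (fst X \<boxtimes> Y)) \<diamond> f0 (\<rho> g) = Arrow (Unit C) c (fst X \<boxtimes> Y)"
    using left_dual_module[OF X d] by auto
  then show "\<exists>Y e c. dual_pair TMod Y X e c"
    using dual_pair_Mod[OF X, of Z] d by blast
next
  fix X assume X: "X \<in> Obj TMod"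
  obtain M e c where "dual_pair C (fst X) M e c"
    using rigid X unfolding rigid_def by (meson Mod_Obj)
  then have d: "dual_arrows (fst X) M (Arrow (fst X \<boxtimes> M) e (Unit C)) (Arrow (Unit C) c (M \<boxtimes> fst X))"
    by (simp add: dual_pair_iff)
  obtain Z where "Z \<in> Obj TMod" "fst Z = M"
    "\<And>g. g \<in> carrier G \<Longrightarrow> Arrow (fst X \<boxtimes> M) e (Unit C) \<diamond> (act X g \<parallel> act Z g) = f0' (\<rho> g) \<diamond> fm (\<rho> g) (Arrow (fst X \<boxtimes> M) e (Unit C)) \<diamond> f2 (\<rho> g) (fst X) M"
    "\<And>g. g \<in> carrier G \<Longrightarrow> (act Z g \<parallel> act X g) \<diamond> f2' (\<rho> g) M (fst X) \<diamond> fm (\<rho> g) (Arrow (Unit C) c (M \<boxtimes> fst X)) \<diamond> f0 (\<rho> g) = Arrow (Unit C) c (M \<boxtimes> fst X)"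
    using right_dual_module[OF X d] by auto
  then show "\<exists>Y e c. dual_pair TMod X Y e c"
    using dual_pair_Mod[of Z X] X d by blast
qed

lemma cocommutative_T_monad: "cocommutative_hopf_monad C T" and normal_T: "normal_hopf_monad C T"
  and hopf_T: "hopf_monad C T"
proof -
  show hopf: "hopf_monad C T"
    using bimonad_T rigid_Mod by (simp add: hopf_monad_def)
  show normal: "normal_hopf_monad C T"
    using hopf linear_T right_exact_T trivial_T_Unit by (simp add: normal_hopf_monad_def)
  have "RUnit C (S X) \<cdot> (Idn C (S X) \<star> g) \<cdot> T2 T X (Unit C) \<cdot> FM T X (X \<boxtimes> Unit C) (inv_arr C (X \<boxtimes> Unit C) X (RUnit C X)) =
      LUnit C (S X) \<cdot> (g \<star> Idn C (S X)) \<cdot> T2 T (Unit C) X \<cdot> FM T X (Unit C \<boxtimes> X) (inv_arr C (Unit C \<boxtimes> X) X (LUnit C X))"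
    if g: "g \<in> Hom C (S (Unit C)) (Unit C)" and X: "X \<in> Obj C" for g X
  proof -
    define \<gamma> where "\<gamma> = Arrow (S (Unit C)) g (Unit C)"
    have \<gamma>: "ok \<gamma>" "src \<gamma> = S (Unit C)" "tgt \<gamma> = Unit C"
      using g by (simp_all add: \<gamma>_def)
    have "((ru (S X) \<diamond> (one (S X) \<parallel> \<gamma>)) \<diamond> tt2 X (Unit C)) \<diamond> tT (ru' X) =
        ((lu (S X) \<diamond> (\<gamma> \<parallel> one (S X))) \<diamond> tt2 (Unit C) X) \<diamond> tT (lu' X)"
      using cocommutative_T[OF \<gamma> X] \<gamma> X by simp
    from arg_cong[OF this, of mor] show ?thesis
      by (simp add: mor_monad mor_structural \<gamma>_def del: comp_assoc)
  qed
  then show "cocommutative_hopf_monad C T"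
    using normal by (simp add: cocommutative_hopf_monad_def)
qed

section \<open>Semisimplicity\<close>

lemma fm_scl:
  assumes "g \<in> carrier G" "ok t"
  shows "fm (\<rho> g) (scl c t) = scl c (fm (\<rho> g) t)"
proof -
  have "FM (\<rho> g) (src t) (tgt t) \<in> module_hom class_ring (HomSp C (src t) (tgt t))
      (HomSp C (FO (\<rho> g) (src t)) (FO (\<rho> g) (tgt t)))"
    using linear_\<rho>[OF assms(1)] okD[OF assms(2)] by (simp add: linear_functor_def)
  from module_homD(3)[OF this okD(3)[OF assms(2)], of c] show ?thesis
    by (simp add: scl_def fm_def)
qed

lemma comp_through_sum:
  assumes "ok t" "ok s" "src t = S X" "tgt s = S X" "X \<in> Obj C"
  shows "mor (t \<diamond> s) = finsum (HomSp C (src s) (tgt t))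
    (\<lambda>g. mor ((t \<diamond> inj X g) \<diamond> (prj X g \<diamond> s))) (carrier G)"
proof -
  note B = biproductD[OF direct_sums[OF assms(5)]]
  have T: "mor t \<in> Hom C (S X) (tgt t)" "mor s \<in> Hom C (src s) (S X)"
    using okD(3)[OF assms(1)] okD(3)[OF assms(2)] assms(3,4) by simp_all
  have h: "\<iota> X g \<cdot> \<pi> X g \<in> Hom C (S X) (S X)" if "g \<in> carrier G" for g
    using that B(2-5) by (intro Cmp_in_Hom[of "S X" "FO (\<rho> g) X" "S X"]) auto
  have h': "(\<iota> X g \<cdot> \<pi> X g) \<cdot> mor s \<in> Hom C (src s) (S X)" if "g \<in> carrier G" for g
    using h[OF that] T assms by (intro Cmp_in_Hom[of "src s" "S X" "S X"]) auto
  have "mor (t \<diamond> s) = mor t \<cdot> (finsum (HomSp C (S X) (S X)) (\<lambda>g. \<iota> X g \<cdot> \<pi> X g) (carrier G) \<cdot> mor s)"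
    using assms T Idn_left[of "src s" "S X" "mor s"] by (simp add: B(7))
  also have "\<dots> = mor t \<cdot> finsum (HomSp C (src s) (S X)) (\<lambda>g. (\<iota> X g \<cdot> \<pi> X g) \<cdot> mor s) (carrier G)"
    using assms T h by (subst comp_finsum_right) simp_all
  also have "\<dots> = finsum (HomSp C (src s) (tgt t)) (\<lambda>g. mor t \<cdot> ((\<iota> X g \<cdot> \<pi> X g) \<cdot> mor s)) (carrier G)"
    using assms T h' by (intro comp_finsum_left) simp_all
  also have "\<dots> = finsum (HomSp C (src s) (tgt t)) (\<lambda>g. mor ((t \<diamond> inj X g) \<diamond> (prj X g \<diamond> s))) (carrier G)"
  proof (rule finsum_Hom_cong)
    fix g assume g: "g \<in> carrier G"
    have "t \<diamond> ((inj X g \<diamond> prj X g) \<diamond> s) = (t \<diamond> inj X g) \<diamond> (prj X g \<diamond> s)"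
      using assms g by simp
    from arg_cong[OF this, of mor]
    show "mor t \<cdot> ((\<iota> X g \<cdot> \<pi> X g) \<cdot> mor s) = mor ((t \<diamond> inj X g) \<diamond> (prj X g \<diamond> s))"
      by (simp add: mor_action del: comp_assoc)
    show "mor ((t \<diamond> inj X g) \<diamond> (prj X g \<diamond> s)) \<in> Hom C (src s) (tgt t)"
      using okD(3)[of "(t \<diamond> inj X g) \<diamond> (prj X g \<diamond> s)"] assms g by (simp del: comp_assoc src_tgt_comp(3))
  qed (use assms in simp_all)
  finally show ?thesis .
qed

lemma finsum_scl_const:
  assumes "ok t"
  shows "finsum (HomSp C (src t) (tgt t)) (\<lambda>g. mor (scl c t)) (carrier G) = mor (scl (of_nat (card (carrier G)) * c) t)"
proof -
  interpret H: kspace "HomSp C (src t) (tgt t)" using assms by (intro HomSp_kspace) simp_all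
  have t: "mor t \<in> Hom C (src t) (tgt t)" by (rule okD(3)[OF assms])
  have "(\<lambda>c. c \<odot>\<^bsub>HomSp C (src t) (tgt t)\<^esub> mor t) \<in> module_hom class_ring ground_space (HomSp C (src t) (tgt t))"
    using t by (intro module_homI) (simp_all add: H.scale_add_left H.scale_scale)
  from module_hom_finsum[OF this ground_space_vectorspace H.vectorspace, of "carrier G" "\<lambda>_. c"]
  show ?thesis
    by (simp add: scl_def finsum_ground_space)
qed

text \<open>On a free module, \<open>g\<close> takes the component with index \<open>h\<close> to the one with index \<open>g h\<close>.\<close>

lemma prj_free_act:
  assumes X: "X \<in> Obj C" and g: "g \<in> carrier G" "h \<in> carrier G"
  shows "prj X (g \<ast> h) \<diamond> tmu X \<diamond> inj (S X) g = r2 g h X \<diamond> fm (\<rho> g) (prj X h)"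
proof (rule fm_inj_epi[of _ _ g X])
  fix k assume k: "k \<in> carrier G"
  have "(prj X (g \<ast> h) \<diamond> tmu X \<diamond> inj (S X) g) \<diamond> fm (\<rho> g) (inj X k) =
      (prj X (g \<ast> h) \<diamond> inj X (g \<ast> k)) \<diamond> r2 g k X"
    using X g k by (simp add: tmu_component)
  also have "\<dots> = r2 g h X \<diamond> fm (\<rho> g) (prj X h \<diamond> inj X k)"
  proof (cases "k = h")
    case True
    then show ?thesis using X g by (simp add: prj_inj del: fm_comp)
  next
    case False
    then have "g \<ast> k \<noteq> g \<ast> h" using g k by simp
    then show ?thesis using X g k False by (simp add: prj_inj fm_zero del: fm_comp)
  qed
  also have "\<dots> = (r2 g h X \<diamond> fm (\<rho> g) (prj X h)) \<diamond> fm (\<rho> g) (inj X k)"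
    using X g k by simp
  finally show "(prj X (g \<ast> h) \<diamond> tmu X \<diamond> inj (S X) g) \<diamond> fm (\<rho> g) (inj X k) =
      (r2 g h X \<diamond> fm (\<rho> g) (prj X h)) \<diamond> fm (\<rho> g) (inj X k)" .
qed (use X g in simp_all)

text \<open>Maschke's theorem: the arrow \<open>M \<rightarrow> T M\<close> with components \<open>|G|\<^sup>-\<^sup>1 (u\<^sup>g)\<^sup>-\<^sup>1\<close> is a module map, and
  composed with the action map \<open>T M \<rightarrow> M\<close> it becomes the mean of \<open>|G|\<close> identities.\<close>

lemma semisimple_if:
  assumes N: "of_nat (card (carrier G)) \<noteq> (0 :: 'k)"
  shows "semisimple_monad C T"
  unfolding semisimple_monad_def
proof (intro ballI)
  fix X assume X: "X \<in> Obj TMod"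
  let ?M = "fst X" and ?c = "inverse (of_nat (card (carrier G))) :: 'k"
  have M: "?M \<in> Obj C" using X by simp
  note free = free_module[OF M]
  have "\<exists>a. \<forall>g\<in>carrier G. inverse_pair (act X g) (a g)"
    using act_iso[OF X] by metis
  then obtain a where a: "\<And>g. g \<in> carrier G \<Longrightarrow> inverse_pair (act X g) (a g)" by blast
  have a': "ok (a g)" "src (a g) = ?M" "tgt (a g) = FO (\<rho> g) ?M" "act X g \<diamond> a g = one ?M" "a g \<diamond> act X g = one (FO (\<rho> g) ?M)"
    if "g \<in> carrier G" for g
    using a[OF that] by (auto simp: inverse_pair_def)
  obtain V where V: "ok V" "src V = ?M" "tgt V = S ?M" "\<And>g. g \<in> carrier G \<Longrightarrow> prj ?M g \<diamond> V = scl ?c (a g)"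
    using prj_pair[of ?M ?M "\<lambda>g. scl ?c (a g)"] M a' by auto
  have "V \<diamond> act X g = act (S ?M, Mu T ?M) g \<diamond> fm (\<rho> g) V" if g: "g \<in> carrier G" for g
  proof (rule prj_mono[of _ _ ?M])
    fix k assume k: "k \<in> carrier G"
    \<comment> \<open>Acting by \<open>g\<close> takes the component with index \<open>h = g\<inverse> k\<close> to the one with index \<open>k\<close>.\<close>
    define h where "h = inv\<^bsub>G\<^esub> g \<ast> k"
    have h: "h \<in> carrier G" "k = g \<ast> h"
      using g k by (simp_all add: h_def m_assoc[symmetric])
    have "act X k \<diamond> r2 g h ?M \<diamond> fm (\<rho> g) (a h) = (act X g \<diamond> fm (\<rho> g) (act X h)) \<diamond> fm (\<rho> g) (a h)"
      using act_comp[OF X g h(1)] X g h M a'(1-3)[OF h(1)] by simp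
    also have "\<dots> = act X g \<diamond> fm (\<rho> g) (act X h \<diamond> a h)"
      using X g h M a'(1-3)[OF h(1)] by simp
    also have "\<dots> = act X g"
      unfolding a'(4)[OF h(1)] using X g M by simp
    finally have 1: "act X k \<diamond> r2 g h ?M \<diamond> fm (\<rho> g) (a h) = act X g" .
    have 2: "a k \<diamond> act X g = r2 g h ?M \<diamond> fm (\<rho> g) (a h)"
      unfolding 1[symmetric] using inverse_pair_cancel(3)[OF a[OF k], of "r2 g h ?M \<diamond> fm (\<rho> g) (a h)"] X g h M a'[OF h(1)] by simp
    have "prj ?M k \<diamond> V \<diamond> act X g = (prj ?M k \<diamond> V) \<diamond> act X g"
      using X g k M V(1-3) by simp
    also have "\<dots> = scl ?c (a k \<diamond> act X g)"
      unfolding V(4)[OF k] using X g k a'[OF k] by simp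
    also have "\<dots> = r2 g h ?M \<diamond> fm (\<rho> g) (prj ?M h \<diamond> V)"
      unfolding 2 V(4)[OF h(1)] using X g h M a'[OF h(1)] by (simp add: fm_scl)
    also have "\<dots> = (r2 g h ?M \<diamond> fm (\<rho> g) (prj ?M h)) \<diamond> fm (\<rho> g) V"
      using X g h M V(1-3) by simp
    also have "\<dots> = prj ?M k \<diamond> act (S ?M, Mu T ?M) g \<diamond> fm (\<rho> g) V"
      unfolding prj_free_act[OF M g h(1), symmetric] using X g h M V(1-3) by (simp add: act_def free)
    finally show "prj ?M k \<diamond> V \<diamond> act X g = prj ?M k \<diamond> act (S ?M, Mu T ?M) g \<diamond> fm (\<rho> g) V" .
  qed (use X g M V(1-3) free in simp_all)
  then have i: "mor V \<in> Hom TMod X (S ?M, Mu T ?M)"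
    using Mod_Hom_iff[of X "(S ?M, Mu T ?M)" V] X V(1-3) free M by simp
  have "snd X \<cdot> Mu T ?M = snd X \<cdot> FM T (S ?M) ?M (snd X)"
  proof -
    have "str X \<diamond> tmu ?M = str X \<diamond> tT (str X)"
      using X by (simp add: Mod_Obj_iff)
    from arg_cong[OF this, of mor] show ?thesis
      using X by (simp add: mor_monad)
  qed
  then have p: "snd X \<in> Hom TMod (S ?M, Mu T ?M) X"
    using okD(3)[OF Mod_ok[OF X]] by (simp add: Mod_Hom)
  have "mor (str X \<diamond> V) = finsum (HomSp C ?M ?M) (\<lambda>g. mor ((str X \<diamond> inj ?M g) \<diamond> (prj ?M g \<diamond> V))) (carrier G)"
    using comp_through_sum[of "str X" V ?M] X M V(1-3) by simp
  also have "\<dots> = finsum (HomSp C ?M ?M) (\<lambda>g. mor (scl ?c (one ?M))) (carrier G)"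
  proof (rule finsum_Hom_cong[OF M M])
    fix g assume g: "g \<in> carrier G"
    have "(str X \<diamond> inj ?M g) \<diamond> (prj ?M g \<diamond> V) = act X g \<diamond> scl ?c (a g)"
      unfolding V(4)[OF g] by (simp only: act_def)
    also have "\<dots> = scl ?c (one ?M)"
      using X g a'[OF g] by simp
    finally show "mor ((str X \<diamond> inj ?M g) \<diamond> (prj ?M g \<diamond> V)) = mor (scl ?c (one ?M))" by simp
    show "mor (scl ?c (one ?M)) \<in> Hom C ?M ?M"
      using okD(3)[of "scl ?c (one ?M)"] M by simp
  qed
  also have "\<dots> = mor (scl 1 (one ?M))"
    using finsum_scl_const[of "one ?M" ?c] M N by simp
  also have "\<dots> = Idn C ?M"
  proof -
    interpret H: kspace "HomSp C ?M ?M" using M by (intro HomSp_kspace)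
    show ?thesis using M by (simp add: scl_def Idn_in_Hom)
  qed
  finally have "snd X \<cdot> mor V = Idn C ?M" by simp
  with i p M show "\<exists>Y\<in>Obj C. \<exists>i\<in>Hom TMod X (FO T Y, Mu T Y). \<exists>p\<in>Hom TMod (FO T Y, Mu T Y) X.
      p \<cdot>\<^bsub>TMod\<^esub> i = Idn TMod X"
    by (intro bexI[of _ ?M] bexI[of _ "mor V"] bexI[of _ "snd X"]) simp_all
qed

text \<open>If the unit module is a retract of a free module, the identity is a composite \<open>1 \<rightarrow> T X \<rightarrow> 1\<close> of
  module maps. Both maps are determined by their components at the neutral element, and by
  equivariance every component contributes the same scalar \<open>c\<close> to the composite. So \<open>1 = |G| c\<close>.\<close>

lemma semisimple_only_if:
  assumes ss: "semisimple_monad C T"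
  shows "of_nat (card (carrier G)) \<noteq> (0 :: 'k)"
proof -
  let ?I = "Unit C"
  obtain X i0 p0 where X: "X \<in> Obj C"
    and i0: "i0 \<in> Hom TMod (Unit TMod) (S X, Mu T X)" and p0: "p0 \<in> Hom TMod (S X, Mu T X) (Unit TMod)"
    and pi0: "p0 \<cdot> i0 = Idn C ?I"
    using ss Unit_Mod unfolding semisimple_monad_def by (auto simp del: Mod_simps(5)) (auto simp: str_Unit(2))
  define i p where "i = Arrow ?I i0 (S X)" and "p = Arrow (S X) p0 ?I"
  note free = free_module[OF X]
  have i: "ok i" "src i = ?I" "tgt i = S X" and p: "ok p" "src p = S X" "tgt p = ?I"
    using i0 p0 X by (simp_all add: i_def p_def Mod_Hom)
  have pi: "p \<diamond> i = one ?I"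
    by (simp add: i_def p_def comp_def one_def pi0)
  have eq_i: "i \<diamond> f0' (\<rho> g) = tmu X \<diamond> inj (S X) g \<diamond> fm (\<rho> g) i" if g: "g \<in> carrier G" for g
    using Mod_Hom_iff[of "Unit TMod" "(S X, Mu T X)" i] i0 i X free str_Unit g
    by (simp add: i_def act_def[of "(S X, Mu T X)"] del: Mod_simps(5))
  have eq_p: "p \<diamond> tmu X \<diamond> inj (S X) g = f0' (\<rho> g) \<diamond> fm (\<rho> g) p" if g: "g \<in> carrier G" for g
    using Mod_Hom_iff[of "(S X, Mu T X)" "Unit TMod" p] p0 p X free str_Unit g
    by (simp add: p_def act_def[of "(S X, Mu T X)"] del: Mod_simps(5))
  \<comment> \<open>The next facts express the components of \<open>p\<close> and \<open>i\<close> with index \<open>g\<close> by those with index \<open>1\<close>.\<close>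
  have r2E: "r2 g E X = fm (\<rho> g) (r0' X)" if g: "g \<in> carrier G" for g
  proof -
    have "r2 g E X = (r2 g E X \<diamond> fm (\<rho> g) (r0 X)) \<diamond> fm (\<rho> g) (r0' X)"
      using X g inverse_pair_cancel(2)[OF inverse_fm[OF smf_\<rho>[OF g] inverse_r0[OF X]]] by simp
    then show ?thesis
      using X g by (simp add: r2_r0)
  qed
  obtain c where c: "p \<diamond> inj X E \<diamond> prj X E \<diamond> i = scl c (one ?I)"
    using End_Unit_scl[of "p \<diamond> inj X E \<diamond> prj X E \<diamond> i"] i p X by auto
  have pg: "p \<diamond> inj X g = f0' (\<rho> g) \<diamond> fm (\<rho> g) (p \<diamond> inj X E) \<diamond> fm (\<rho> g) (r0 X)" if g: "g \<in> carrier G" for g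
  proof -
    have "p \<diamond> inj X g = p \<diamond> (inj X g \<diamond> r2 g E X) \<diamond> fm (\<rho> g) (r0 X)"
      using X g p by (simp add: r2_r0)
    also have "inj X g \<diamond> r2 g E X = tmu X \<diamond> inj (S X) g \<diamond> fm (\<rho> g) (inj X E)"
      using tmu_component(2)[OF X g one_closed] g by simp
    also have "p \<diamond> (tmu X \<diamond> inj (S X) g \<diamond> fm (\<rho> g) (inj X E)) \<diamond> fm (\<rho> g) (r0 X) =
        (p \<diamond> tmu X \<diamond> inj (S X) g) \<diamond> fm (\<rho> g) (inj X E) \<diamond> fm (\<rho> g) (r0 X)"
      using X g p by simp
    also have "\<dots> = f0' (\<rho> g) \<diamond> fm (\<rho> g) (p \<diamond> inj X E) \<diamond> fm (\<rho> g) (r0 X)"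
      unfolding eq_p[OF g] using X g p by simp
    finally show ?thesis .
  qed
  have ig: "prj X g \<diamond> i = fm (\<rho> g) (r0' X) \<diamond> fm (\<rho> g) (prj X E \<diamond> i) \<diamond> f0 (\<rho> g)" if g: "g \<in> carrier G" for g
  proof -
    have "prj X g \<diamond> i = prj X g \<diamond> (i \<diamond> f0' (\<rho> g)) \<diamond> f0 (\<rho> g)"
      using X g i by simp
    also have "\<dots> = (prj X (g \<ast> E) \<diamond> tmu X \<diamond> inj (S X) g) \<diamond> fm (\<rho> g) i \<diamond> f0 (\<rho> g)"
      unfolding eq_i[OF g] using X g i by simp
    also have "\<dots> = fm (\<rho> g) (r0' X) \<diamond> fm (\<rho> g) (prj X E \<diamond> i) \<diamond> f0 (\<rho> g)"
      unfolding prj_free_act[OF X g one_closed] r2E[OF g] using X g i by simp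
    finally show ?thesis .
  qed
  have summand: "(p \<diamond> inj X g) \<diamond> (prj X g \<diamond> i) = scl c (one ?I)" if g: "g \<in> carrier G" for g
  proof -
    have "(p \<diamond> inj X g) \<diamond> (prj X g \<diamond> i) =
        f0' (\<rho> g) \<diamond> fm (\<rho> g) ((p \<diamond> inj X E) \<diamond> (r0 X \<diamond> r0' X) \<diamond> (prj X E \<diamond> i)) \<diamond> f0 (\<rho> g)"
      unfolding pg[OF g] ig[OF g] using X g i p
        inverse_pair_cancel(4)[OF inverse_fm[OF smf_\<rho>[OF g] inverse_r0[OF X]]] by simp
    also have "(p \<diamond> inj X E) \<diamond> (r0 X \<diamond> r0' X) \<diamond> (prj X E \<diamond> i) = scl c (one ?I)"
      using c X i p by simp
    finally show ?thesis
      using g by (simp add: fm_scl)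
  qed
  have "Idn C ?I = finsum (HomSp C ?I ?I) (\<lambda>g. mor ((p \<diamond> inj X g) \<diamond> (prj X g \<diamond> i))) (carrier G)"
    using comp_through_sum[of p i X] i p X pi by (simp add: one_def del: src_tgt_comp(3) comp_assoc)
  also have "\<dots> = finsum (HomSp C ?I ?I) (\<lambda>g. mor (scl c (one ?I))) (carrier G)"
    using okD(3)[of "scl c (one ?I)"] by (intro finsum_Hom_cong) (simp_all add: summand del: src_tgt_comp(3) comp_assoc)
  also have "\<dots> = mor (scl (of_nat (card (carrier G)) * c) (one ?I))"
    using finsum_scl_const[of "one ?I" c] by simp
  finally have "1 \<odot>\<^bsub>HomSp C ?I ?I\<^esub> Idn C ?I = (of_nat (card (carrier G)) * c) \<odot>\<^bsub>HomSp C ?I ?I\<^esub> Idn C ?I"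
    using kspace.scale_one[OF HomSp_kspace[OF Unit_Obj Unit_Obj] Idn_in_Hom[OF Unit_Obj]] by (simp add: scl_def)
  then have "1 = of_nat (card (carrier G)) * c"
    using End_Unit unfolding bij_betw_def inj_on_def by blast
  then show ?thesis by auto
qed

lemma semisimple_iff: "semisimple_monad C T \<longleftrightarrow> \<not> CHAR('k) dvd Coset.order G"
  using semisimple_if semisimple_only_if of_nat_eq_0_iff_char_dvd[where ?'a = 'k, of "card (carrier G)"]
  unfolding Coset.order_def by blast

section \<open>The induced Hopf algebra\<close>

abbreviation "Ker \<equiv> Ker_U C T"
abbreviation "mcoeff \<equiv> matrix_coefficients C G \<rho> \<iota>"

definition pt :: "'o \<times> 'a \<Rightarrow> 'a \<Rightarrow> ('o, 'a) arrow" where "pt X x = Arrow (Unit C) x (fst X)"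

definition gact :: "'o \<times> 'a \<Rightarrow> 'g \<Rightarrow> 'a \<Rightarrow> 'a" where
  "gact X g x = mor (act X g \<diamond> fm (\<rho> g) (pt X x) \<diamond> f0 (\<rho> g))"

lemma pt_simps [simp]: "src (pt X x) = Unit C" "tgt (pt X x) = fst X" "mor (pt X x) = x"
  by (simp_all add: pt_def)

lemma ok_pt [simp]: "\<lbrakk>ok (str X); x \<in> carrier (fibre C X)\<rbrakk> \<Longrightarrow> ok (pt X x)"
  using okD(2)[of "str X"] by (simp add: pt_def fibre_def)

lemma mor_fibre:
  "\<lbrakk>ok t; src t = Unit C; tgt t = fst X\<rbrakk> \<Longrightarrow> mor t \<in> carrier (fibre C X)"
  using okD(3)[of t] by (simp add: fibre_def)

lemma fibre_pt: "ok (pt X x) \<Longrightarrow> x \<in> carrier (fibre C X)"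
  using mor_fibre[of "pt X x" X] by simp

lemma pt_mor: "\<lbrakk>src t = Unit C; tgt t = fst X\<rbrakk> \<Longrightarrow> pt X (mor t) = t"
  by (cases t) (simp add: pt_def)

lemma fibre_space: "ok (str X) \<Longrightarrow> vectorspace class_ring (fibre C X)"
  using okD(2)[of "str X"] by (simp add: fibre_def HomSp_vectorspace)

lemmas fibre_dual_space = dual_space_vectorspace[OF fibre_space]

lemma pt_gact:
  assumes "ok (str X)" "g \<in> carrier G" "x \<in> carrier (fibre C X)"
  shows "pt X (gact X g x) = act X g \<diamond> fm (\<rho> g) (pt X x) \<diamond> f0 (\<rho> g)"
  unfolding gact_def by (rule pt_mor) (use assms in simp_all)

lemma gact_closed:
  assumes "ok (str X)" "g \<in> carrier G" "x \<in> carrier (fibre C X)"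
  shows "gact X g x \<in> carrier (fibre C X)"
  unfolding gact_def by (rule mor_fibre) (use assms in simp_all)

lemma gact_hom:
  assumes X: "ok (str X)" and g: "g \<in> carrier G"
  shows "gact X g \<in> module_hom class_ring (fibre C X) (fibre C X)"
proof -
  have M: "fst X \<in> Obj C" using okD(2)[OF X] by simp
  let ?F = "FO (\<rho> g)"
  have F: "?F (Unit C) \<in> Obj C" "?F (fst X) \<in> Obj C"
    using g M okD(1)[of "fm (\<rho> g) (one (fst X))"] okD(1)[of "fm (\<rho> g) (one (Unit C))"] by simp_all
  have FM: "FM (\<rho> g) (Unit C) (fst X) \<in> module_hom class_ring (HomSp C (Unit C) (fst X))
      (HomSp C (?F (Unit C)) (?F (fst X)))"
    using linear_\<rho>[OF g] M by (simp add: linear_functor_def)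
  have f0: "mor (f0 (\<rho> g)) \<in> Hom C (Unit C) (?F (Unit C))"
    using okD(3)[of "f0 (\<rho> g)"] g by simp
  have a: "mor (act X g) \<in> Hom C (?F (fst X)) (fst X)"
    using okD(3)[of "act X g"] X g by simp
  have "(\<lambda>x. mor (act X g) \<cdot> (FM (\<rho> g) (Unit C) (fst X) x \<cdot> mor (f0 (\<rho> g)))) \<in>
      module_hom class_ring (HomSp C (Unit C) (fst X)) (HomSp C (Unit C) (fst X))"
    using module_hom_comp[OF module_hom_comp[OF FM Cmp_linear_left] Cmp_linear_right, OF _ F f0 _ F(2) M a] F M
    by simp
  then show ?thesis
    unfolding fibre_def gact_def[abs_def] by (simp add: comp_def fm_def pt_def)
qed

text \<open>This combines the axiom of a module with the naturality of \<open>\<rho>\<^sub>2\<close> and its compatibility with units.\<close>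

lemma gact_mult:
  assumes X: "X \<in> Obj TMod" and g: "g \<in> carrier G" "h \<in> carrier G" and x: "x \<in> carrier (fibre C X)"
  shows "gact X (g \<ast> h) x = gact X g (gact X h x)"
proof -
  let ?x = "pt X x"
  have M: "fst X \<in> Obj C" using X by simp
  have "act X g \<diamond> fm (\<rho> g) (pt X (gact X h x)) \<diamond> f0 (\<rho> g) =
      (act X g \<diamond> fm (\<rho> g) (act X h)) \<diamond> fm (\<rho> g) (fm (\<rho> h) ?x) \<diamond> fm (\<rho> g) (f0 (\<rho> h)) \<diamond> f0 (\<rho> g)"
    using X g x M by (simp add: pt_gact)
  also have "\<dots> = act X (g \<ast> h) \<diamond> (r2 g h (fst X) \<diamond> fm (\<rho> g) (fm (\<rho> h) ?x)) \<diamond> fm (\<rho> g) (f0 (\<rho> h)) \<diamond> f0 (\<rho> g)"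
    unfolding act_comp[OF X g] using X g x M by simp
  also have "r2 g h (fst X) \<diamond> fm (\<rho> g) (fm (\<rho> h) ?x) = fm (\<rho> (g \<ast> h)) ?x \<diamond> r2 g h (Unit C)"
    using r2_natural[OF g, of ?x] X x by simp
  also have "act X (g \<ast> h) \<diamond> (fm (\<rho> (g \<ast> h)) ?x \<diamond> r2 g h (Unit C)) \<diamond> fm (\<rho> g) (f0 (\<rho> h)) \<diamond> f0 (\<rho> g) =
      act X (g \<ast> h) \<diamond> fm (\<rho> (g \<ast> h)) ?x \<diamond> (r2 g h (Unit C) \<diamond> fm (\<rho> g) (f0 (\<rho> h)) \<diamond> f0 (\<rho> g))"
    using X g x M by simp
  also have "\<dots> = act X (g \<ast> h) \<diamond> fm (\<rho> (g \<ast> h)) ?x \<diamond> f0 (\<rho> (g \<ast> h))"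
    unfolding r2_f0[OF g] ..
  finally show ?thesis by (simp add: gact_def)
qed

lemma gact_one:
  assumes X: "X \<in> Obj TMod" and x: "x \<in> carrier (fibre C X)"
  shows "gact X E x = x"
proof -
  let ?x = "pt X x"
  have M: "fst X \<in> Obj C" using X by simp
  have "act X E \<diamond> fm (\<rho> E) ?x \<diamond> f0 (\<rho> E) = act X E \<diamond> (fm (\<rho> E) ?x \<diamond> r0 (Unit C))"
    by (simp add: r0_f0)
  also have "\<dots> = (act X E \<diamond> r0 (fst X)) \<diamond> ?x"
    using r0_natural[of ?x] X x M by simp
  also have "\<dots> = ?x"
    unfolding act_one[OF X] using X x by simp
  finally show ?thesis by (simp add: gact_def)
qed

lemma gact_map:
  assumes X: "X \<in> Obj TMod" and Y: "Y \<in> Obj TMod" and f: "f \<in> Hom TMod X Y"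
    and g: "g \<in> carrier G" and x: "x \<in> carrier (fibre C X)"
  shows "f \<cdot> x \<in> carrier (fibre C Y)" "gact Y g (f \<cdot> x) = f \<cdot> gact X g x"
proof -
  define t where "t = Arrow (fst X) f (fst Y)"
  have t: "ok t" "src t = fst X" "tgt t = fst Y" "mor t = f"
    using f X Y by (simp_all add: t_def Mod_Hom)
  have tx: "pt Y (f \<cdot> x) = t \<diamond> pt X x"
    by (simp add: t_def pt_def comp_def)
  show "f \<cdot> x \<in> carrier (fibre C Y)"
    by (rule fibre_pt) (use t X x in \<open>simp add: tx\<close>)
  have "t \<diamond> act X g = act Y g \<diamond> fm (\<rho> g) t"
    using Mod_Hom_iff[of X Y t] t f X Y g by simp
  then have "act Y g \<diamond> fm (\<rho> g) (t \<diamond> pt X x) \<diamond> f0 (\<rho> g) = (t \<diamond> act X g) \<diamond> fm (\<rho> g) (pt X x) \<diamond> f0 (\<rho> g)"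
    using t X Y g x by simp
  also have "\<dots> = t \<diamond> (act X g \<diamond> fm (\<rho> g) (pt X x) \<diamond> f0 (\<rho> g))"
    using t X Y g x by simp
  finally have "mor (act Y g \<diamond> fm (\<rho> g) (t \<diamond> pt X x) \<diamond> f0 (\<rho> g)) = mor (t \<diamond> (act X g \<diamond> fm (\<rho> g) (pt X x) \<diamond> f0 (\<rho> g)))"
    by (rule arg_cong)
  then show "gact Y g (f \<cdot> x) = f \<cdot> gact X g x"
    unfolding gact_def tx by (simp add: t(4) del: comp_assoc)
qed

text \<open>Up to the unit constraint of \<open>\<rho>\<^sup>g\<close>, this is the left unit axiom of a monoidal functor at the unit object.\<close>

lemma f0_lu':
  assumes "g \<in> carrier G"
  shows "f2' (\<rho> g) (Unit C) (Unit C) \<diamond> fm (\<rho> g) (lu' (Unit C)) \<diamond> f0 (\<rho> g) =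
    (f0 (\<rho> g) \<parallel> f0 (\<rho> g)) \<diamond> lu' (Unit C)" (is "?l = ?r")
proof -
  let ?I = "Unit C" and ?F = "\<rho> g"
  have i: "inverse_pair (fm ?F (lu ?I) \<diamond> f2 ?F ?I ?I) (f2' ?F ?I ?I \<diamond> fm ?F (lu' ?I))"
    using assms by (intro inverse_pair_comp inverse_f2 inverse_fm inverse_structural) simp_all
  have "(fm ?F (lu ?I) \<diamond> f2 ?F ?I ?I) \<diamond> ?r =
      (fm ?F (lu ?I) \<diamond> f2 ?F ?I ?I \<diamond> (f0 ?F \<parallel> one (FO ?F ?I))) \<diamond> (one ?I \<parallel> f0 ?F) \<diamond> lu' ?I"
    using assms by simp
  also have "\<dots> = (lu (FO ?F ?I) \<diamond> (one ?I \<parallel> f0 ?F)) \<diamond> lu' ?I"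
    unfolding f2_lu[OF smf_\<rho>[OF assms] Unit_Obj] using assms by simp
  also have "lu (FO ?F ?I) \<diamond> (one ?I \<parallel> f0 ?F) = f0 ?F \<diamond> lu ?I"
    using lu_natural[of "f0 ?F"] assms by simp
  also have "(f0 ?F \<diamond> lu ?I) \<diamond> lu' ?I = (fm ?F (lu ?I) \<diamond> f2 ?F ?I ?I) \<diamond> ?l"
    using inverse_pair_cancel(1)[OF i] assms
      inverse_pair_cancel(2,4)[OF inverse_fm[OF smf_\<rho>[OF assms] inverse_structural(2)[OF Unit_Obj]]] by simp
  finally have "(fm ?F (lu ?I) \<diamond> f2 ?F ?I ?I) \<diamond> ?l = (fm ?F (lu ?I) \<diamond> f2 ?F ?I ?I) \<diamond> ?r" ..
  then show ?thesis
    by (rule inverse_pair_left_eq[OF i, rotated -1]) (use assms in simp_all)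
qed

text \<open>The group acts on \<open>\<omega>(X \<otimes> Y) = \<omega>(X) \<otimes> \<omega>(Y)\<close> diagonally.\<close>

lemma gact_tensor:
  assumes X: "ok (str X)" and Y: "ok (str Y)" and g: "g \<in> carrier G"
    and x: "x \<in> carrier (fibre C X)" and y: "y \<in> carrier (fibre C Y)"
  shows "(x \<star> y) \<cdot> mor (lu' (Unit C)) \<in> carrier (fibre C (TensO TMod X Y))"
    and "gact (TensO TMod X Y) g ((x \<star> y) \<cdot> mor (lu' (Unit C))) = (gact X g x \<star> gact Y g y) \<cdot> mor (lu' (Unit C))"
proof -
  let ?I = "Unit C"
  let ?XY = "TensO TMod X Y"
  note st = str_ten[OF X Y]
  have o: "fst X \<in> Obj C" "fst Y \<in> Obj C" using okD(2)[OF X] okD(2)[OF Y] by simp_all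
  have p: "pt ?XY ((x \<star> y) \<cdot> mor (lu' ?I)) = (pt X x \<parallel> pt Y y) \<diamond> lu' ?I" for x y
    by (simp add: pt_def comp_def ten_def del: Mod_simps(4)) (simp add: lu'_def)
  show "(x \<star> y) \<cdot> mor (lu' ?I) \<in> carrier (fibre C ?XY)"
    by (rule fibre_pt) (use X Y x y in \<open>simp add: p del: Mod_simps(4)\<close>)
  have "act ?XY g \<diamond> fm (\<rho> g) ((pt X x \<parallel> pt Y y) \<diamond> lu' ?I) \<diamond> f0 (\<rho> g) =
      (act X g \<parallel> act Y g) \<diamond> (f2' (\<rho> g) (fst X) (fst Y) \<diamond> fm (\<rho> g) (pt X x \<parallel> pt Y y)) \<diamond> fm (\<rho> g) (lu' ?I) \<diamond> f0 (\<rho> g)"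
    unfolding st(3)[OF g] using X Y x y g o by simp
  also have "f2' (\<rho> g) (fst X) (fst Y) \<diamond> fm (\<rho> g) (pt X x \<parallel> pt Y y) =
      (fm (\<rho> g) (pt X x) \<parallel> fm (\<rho> g) (pt Y y)) \<diamond> f2' (\<rho> g) ?I ?I"
    using f2'_natural[of "\<rho> g" "pt X x" "pt Y y"] X Y x y g by simp
  also have "(act X g \<parallel> act Y g) \<diamond> ((fm (\<rho> g) (pt X x) \<parallel> fm (\<rho> g) (pt Y y)) \<diamond> f2' (\<rho> g) ?I ?I) \<diamond> fm (\<rho> g) (lu' ?I) \<diamond> f0 (\<rho> g)
      = (act X g \<parallel> act Y g) \<diamond> (fm (\<rho> g) (pt X x) \<parallel> fm (\<rho> g) (pt Y y)) \<diamond> (f2' (\<rho> g) ?I ?I \<diamond> fm (\<rho> g) (lu' ?I) \<diamond> f0 (\<rho> g))"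
    using X Y x y g o by (simp del: ten_comp ten_comp_assoc)
  also have "\<dots> = ((act X g \<diamond> fm (\<rho> g) (pt X x) \<diamond> f0 (\<rho> g)) \<parallel> (act Y g \<diamond> fm (\<rho> g) (pt Y y) \<diamond> f0 (\<rho> g))) \<diamond> lu' ?I"
    unfolding f0_lu'[OF g] using X Y x y g o by simp
  also have "\<dots> = (pt X (gact X g x) \<parallel> pt Y (gact Y g y)) \<diamond> lu' ?I"
    using X Y x y g by (simp add: pt_gact)
  finally have diagonal: "act ?XY g \<diamond> fm (\<rho> g) ((pt X x \<parallel> pt Y y) \<diamond> lu' ?I) \<diamond> f0 (\<rho> g) =
      (pt X (gact X g x) \<parallel> pt Y (gact Y g y)) \<diamond> lu' ?I" .
  have "mor ((pt X a \<parallel> pt Y b) \<diamond> lu' ?I) = (a \<star> b) \<cdot> mor (lu' ?I)" for a b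
    by (simp add: comp_def ten_def)
  then show "gact ?XY g ((x \<star> y) \<cdot> mor (lu' ?I)) = (gact X g x \<star> gact Y g y) \<cdot> mor (lu' ?I)"
    unfolding gact_def[of ?XY] p diagonal .
qed

lemma gact_Unit:
  assumes "g \<in> carrier G"
  shows "Idn C (Unit C) \<in> carrier (fibre C (Unit TMod))" "gact (Unit TMod) g (Idn C (Unit C)) = Idn C (Unit C)"
proof -
  have p: "pt (Unit TMod) (Idn C (Unit C)) = one (Unit C)"
    by (simp add: pt_def one_def)
  show "Idn C (Unit C) \<in> carrier (fibre C (Unit TMod))"
    by (simp add: fibre_def Idn_in_Hom)
  show "gact (Unit TMod) g (Idn C (Unit C)) = Idn C (Unit C)"
  proof -
    have "f0' (\<rho> g) \<diamond> fm (\<rho> g) (one (Unit C)) \<diamond> f0 (\<rho> g) = one (Unit C)"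
      using assms by simp
    then show ?thesis
      unfolding gact_def p str_Unit(3)[OF assms] by (simp add: one_def)
  qed
qed

subsection \<open>Matrix coefficients\<close>

lemma mcoeff:
  assumes X: "ok (str X)"
  shows "mcoeff X \<in> module_hom class_ring (tensor_space (fibre C X) (fibre_dual C X)) (function_hopf G)"
    and "\<lbrakk>x \<in> carrier (fibre C X); \<phi> \<in> carrier (fibre_dual C X)\<rbrakk> \<Longrightarrow>
      mcoeff X (fibre_tens C X x \<phi>) = (\<lambda>g\<in>carrier G. \<phi> (gact X g x))"
proof -
  let ?B = "\<lambda>x \<phi>. \<lambda>g\<in>carrier G. \<phi> (snd X \<cdot> \<iota> (fst X) g \<cdot> FM (\<rho> g) (Unit C) (fst X) x \<cdot> F0 (\<rho> g))"
  have M: "fst X \<in> Obj C" using okD(2)[OF X] by simp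
  have raw: "snd X \<cdot> \<iota> (fst X) g \<cdot> FM (\<rho> g) (Unit C) (fst X) x \<cdot> F0 (\<rho> g) = gact X g x"
    if g: "g \<in> carrier G" and x: "x \<in> carrier (fibre C X)" for g x
  proof -
    have "((str X \<diamond> inj (fst X) g) \<diamond> fm (\<rho> g) (pt X x)) \<diamond> f0 (\<rho> g) = act X g \<diamond> fm (\<rho> g) (pt X x) \<diamond> f0 (\<rho> g)"
      using X g x M by (simp add: act_def)
    from arg_cong[OF this, of mor] show ?thesis
      unfolding gact_def by (simp add: mor_action fm_def f0_def del: comp_assoc)
  qed
  have "bilinear (fibre C X) (fibre_dual C X) (function_algebra G) ?B"
  proof (rule bilinearI)
    interpret D: kspace "fibre C X" by (rule kspace.intro[OF fibre_space[OF X]])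
    fix x x' \<phi> \<phi>' and c :: 'k
    assume x: "x \<in> carrier (fibre C X)" "x' \<in> carrier (fibre C X)"
      and \<phi>: "\<phi> \<in> carrier (fibre_dual C X)" "\<phi>' \<in> carrier (fibre_dual C X)"
    note l = module_homD[OF gact_hom[OF X]] and d = dual_spaceD(3,4)[OF \<phi>(1)]
    show "?B x \<phi> \<in> carrier (function_algebra G)"
      by (simp add: function_algebra_simps)
    show "?B (x \<oplus>\<^bsub>fibre C X\<^esub> x') \<phi> = ?B x \<phi> \<oplus>\<^bsub>function_algebra G\<^esub> ?B x' \<phi>"
      "?B (c \<odot>\<^bsub>fibre C X\<^esub> x) \<phi> = c \<odot>\<^bsub>function_algebra G\<^esub> ?B x \<phi>"
      using x by (auto simp: function_algebra_simps raw l d restrict_def fun_eq_iff)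
    show "?B x (\<phi> \<oplus>\<^bsub>fibre_dual C X\<^esub> \<phi>') = ?B x \<phi> \<oplus>\<^bsub>function_algebra G\<^esub> ?B x \<phi>'"
      "?B x (c \<odot>\<^bsub>fibre_dual C X\<^esub> \<phi>) = c \<odot>\<^bsub>function_algebra G\<^esub> ?B x \<phi>"
      using x by (auto simp: function_algebra_simps raw l(1) dual_space_def restrict_def fun_eq_iff)
  qed
  note lift = tensor_lift[OF fibre_space[OF X] fibre_dual_space[OF X] function_algebra_vectorspace this]
  have eq: "mcoeff X = tensor_lift (fibre C X) (fibre_dual C X) (function_algebra G) ?B"
    by (cases X) (simp add: matrix_coefficients_def)
  show "mcoeff X \<in> module_hom class_ring (tensor_space (fibre C X) (fibre_dual C X)) (function_hopf G)"
    using lift(1) unfolding eq module_hom_function_algebra .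
  show "mcoeff X (fibre_tens C X x \<phi>) = (\<lambda>g\<in>carrier G. \<phi> (gact X g x))"
    if "x \<in> carrier (fibre C X)" "\<phi> \<in> carrier (fibre_dual C X)"
    unfolding eq lift(3)[OF that] using that by (auto simp: raw restrict_def fun_eq_iff)
qed

lemma Ker_simps [simp]:
  "Hom Ker X Y = Hom TMod X Y" "TensO Ker X Y = TensO TMod X Y" "Unit Ker = Unit TMod"
  by (simp_all add: Ker_U_def)

lemma Ker_Obj: "X \<in> Obj Ker \<longleftrightarrow> X \<in> Obj TMod \<and> trivial_object C (fst X)"
  by (simp add: Ker_U_def)

lemma pullback_dual:
  assumes X: "X \<in> Obj TMod" and Y: "Y \<in> Obj TMod" and f: "f \<in> Hom TMod X Y"
    and \<psi>: "\<psi> \<in> carrier (fibre_dual C Y)"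
  shows "(\<lambda>x\<in>carrier (fibre C X). \<psi> (f \<cdot> x)) \<in> carrier (fibre_dual C X)"
proof (rule dual_spaceI)
  interpret V: kspace "fibre C X" using X by (intro kspace.intro fibre_space) simp
  have "(\<lambda>x. f \<cdot> x) \<in> module_hom class_ring (fibre C X) (fibre C Y)"
    unfolding fibre_def using X Y f by (intro Cmp_linear_right) (simp_all add: Mod_Hom)
  note l = module_homD[OF this] and d = dual_spaceD(3,4)[OF \<psi>]
  fix x y c assume x: "x \<in> carrier (fibre C X)"
  show "(\<lambda>x\<in>carrier (fibre C X). \<psi> (f \<cdot> x)) (c \<odot>\<^bsub>fibre C X\<^esub> x) = c * (\<lambda>x\<in>carrier (fibre C X). \<psi> (f \<cdot> x)) x"
    using x by (simp add: l d)
  assume "y \<in> carrier (fibre C X)"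
  then show "(\<lambda>x\<in>carrier (fibre C X). \<psi> (f \<cdot> x)) (x \<oplus>\<^bsub>fibre C X\<^esub> y) =
      (\<lambda>x\<in>carrier (fibre C X). \<psi> (f \<cdot> x)) x + (\<lambda>x\<in>carrier (fibre C X). \<psi> (f \<cdot> x)) y"
    using x by (simp add: l d)
qed simp

lemma mcoeff_wedge: "coend_wedge C T (function_hopf G) mcoeff"
  unfolding coend_wedge_def
proof (intro conjI ballI)
  fix X assume "X \<in> Obj Ker"
  then show "mcoeff X \<in> module_hom class_ring (tensor_space (fibre C X) (fibre_dual C X)) (function_hopf G)"
    by (intro mcoeff) (simp add: Ker_Obj)
next
  fix X Y f x \<psi>
  assume X: "X \<in> Obj Ker" and Y: "Y \<in> Obj Ker" and f: "f \<in> Hom Ker X Y"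
    and x: "x \<in> carrier (fibre C X)" and \<psi>: "\<psi> \<in> carrier (fibre_dual C Y)"
  then have T: "X \<in> Obj TMod" "Y \<in> Obj TMod" "f \<in> Hom TMod X Y" by (simp_all add: Ker_Obj)
  note m = gact_map[OF T _ x]
  show "mcoeff Y (fibre_tens C Y (f \<cdot> x) \<psi>) = mcoeff X (fibre_tens C X x (\<lambda>x'\<in>carrier (fibre C X). \<psi> (f \<cdot> x')))"
    using T m(1)[OF one_closed] m(2) x \<psi> pullback_dual[OF T \<psi>]
    by (auto simp: mcoeff(2) gact_closed restrict_def fun_eq_iff)
qed

subsection \<open>The regular module\<close>

text \<open>The free module on the unit object, whose fibre is the regular representation of \<open>G\<close>.\<close>

definition reg where "reg = (S (Unit C), Mu T (Unit C))"
definition gen where "gen = Eta T (Unit C)"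

text \<open>The inverse of the isomorphism \<open>\<bbbk> \<rightarrow> End 1\<close>.\<close>

definition scalar :: "'a \<Rightarrow> 'k" where
  "scalar = inv_into UNIV (\<lambda>c. c \<odot>\<^bsub>HomSp C (Unit C) (Unit C)\<^esub> Idn C (Unit C))"

lemma scalar_scl: "scalar (mor (scl c (one (Unit C)))) = c"
  using inv_into_f_f[OF bij_betw_imp_inj_on[OF End_Unit], of c] by (simp add: scalar_def scl_def one_def)

lemma scalar_hom: "scalar \<in> module_hom class_ring (HomSp C (Unit C) (Unit C)) ground_space"
proof -
  let ?H = "HomSp C (Unit C) (Unit C)"
  interpret H: kspace ?H by (rule HomSp_kspace) simp_all
  have i: "Idn C (Unit C) \<in> carrier ?H" by (simp add: Idn_in_Hom)
  have s: "scalar (c \<odot>\<^bsub>?H\<^esub> Idn C (Unit C)) = c" for c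
    using scalar_scl[of c] by (simp add: scl_def one_def)
  have ex: "\<exists>c. x = c \<odot>\<^bsub>?H\<^esub> Idn C (Unit C)" if "x \<in> carrier ?H" for x
    using End_Unit that by (auto simp: bij_betw_def)
  show ?thesis
  proof (rule module_homI)
    fix x y c assume "x \<in> carrier ?H" 
    then obtain a where a: "x = a \<odot>\<^bsub>?H\<^esub> Idn C (Unit C)" using ex by blast
    show "scalar (c \<odot>\<^bsub>?H\<^esub> x) = c \<odot>\<^bsub>ground_space\<^esub> scalar x"
      unfolding a by (simp add: H.scale_scale i s)
    assume "y \<in> carrier ?H"
    then obtain b where b: "y = b \<odot>\<^bsub>?H\<^esub> Idn C (Unit C)" using ex by blast
    show "scalar (x \<oplus>\<^bsub>?H\<^esub> y) = scalar x \<oplus>\<^bsub>ground_space\<^esub> scalar y"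
      unfolding a b H.scale_add_left[OF i, symmetric] by (simp add: s)
  qed simp
qed

text \<open>The coefficient of the basis vector \<open>g e\<close> of the regular representation, where \<open>e = gen\<close>.\<close>

definition coord :: "'g \<Rightarrow> 'a \<Rightarrow> 'k" where
  "coord g x = scalar (mor (f0' (\<rho> g) \<diamond> prj (Unit C) g \<diamond> pt reg x))"

lemma reg: "reg \<in> Obj TMod" "ok (str reg)" "fst reg = S (Unit C)" "str reg = tmu (Unit C)"
  using free_module[of "Unit C"] by (simp_all add: reg_def)

lemma gen: "pt reg gen = teta (Unit C)" "gen \<in> carrier (fibre C reg)"
proof -
  show p: "pt reg gen = teta (Unit C)"
    by (simp add: pt_def teta_def reg gen_def)
  show "gen \<in> carrier (fibre C reg)"
    by (rule fibre_pt) (simp add: p)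
qed

lemma pt_gact_gen:
  assumes g: "g \<in> carrier G"
  shows "pt reg (gact reg g gen) = inj (Unit C) g \<diamond> f0 (\<rho> g)"
proof -
  let ?I = "Unit C"
  have "pt reg (gact reg g gen) = (tmu ?I \<diamond> inj (S ?I) g) \<diamond> fm (\<rho> g) (inj ?I E \<diamond> r0 ?I) \<diamond> f0 (\<rho> g)"
    using pt_gact[OF reg(2) g gen(2)] by (simp add: gen teta_eq act_def reg del: comp_assoc)
  also have "\<dots> = (tmu ?I \<diamond> inj (S ?I) g \<diamond> fm (\<rho> g) (inj ?I E)) \<diamond> fm (\<rho> g) (r0 ?I) \<diamond> f0 (\<rho> g)"
    using g by simp
  also have "\<dots> = inj ?I g \<diamond> (r2 g E ?I \<diamond> fm (\<rho> g) (r0 ?I)) \<diamond> f0 (\<rho> g)"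
    using g tmu_component(2)[OF Unit_Obj g one_closed] by simp
  also have "\<dots> = inj ?I g \<diamond> f0 (\<rho> g)"
    unfolding r2_r0(2)[OF g Unit_Obj] using g by simp
  finally show ?thesis .
qed

lemma coord_gen:
  assumes g: "g \<in> carrier G" and h: "h \<in> carrier G"
  shows "coord g (gact reg h gen) = (if h = g then 1 else 0)"
proof -
  let ?I = "Unit C"
  interpret H: kspace "HomSp C ?I ?I" by (rule HomSp_kspace) simp_all
  have "f0' (\<rho> g) \<diamond> prj ?I g \<diamond> pt reg (gact reg h gen) = f0' (\<rho> g) \<diamond> (prj ?I g \<diamond> inj ?I h) \<diamond> f0 (\<rho> h)"
    unfolding pt_gact_gen[OF h] using g h by simp
  also have "\<dots> = (if h = g then one ?I else zr ?I ?I)"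
    using g h by (simp add: prj_inj)
  also have "\<dots> = scl (if h = g then 1 else 0) (one ?I)"
    by (simp add: scl_def one_def Idn_in_Hom)
  finally show ?thesis
    unfolding coord_def by (simp only: scalar_scl)
qed

lemma coord_hom:
  assumes g: "g \<in> carrier G"
  shows "coord g \<in> module_hom class_ring (fibre C reg) ground_space"
proof -
  let ?p = "f0' (\<rho> g) \<diamond> prj (Unit C) g"
  have "mor ?p \<in> Hom C (S (Unit C)) (Unit C)"
    using okD(3)[of ?p] g by simp
  then have "(\<lambda>x. mor ?p \<cdot> x) \<in> module_hom class_ring (fibre C reg) (HomSp C (Unit C) (Unit C))"
    unfolding fibre_def reg by (intro Cmp_linear_right) simp_all
  from module_hom_comp[OF this scalar_hom] have "(\<lambda>x. scalar (mor ?p \<cdot> x)) \<in> module_hom class_ring (fibre C reg) ground_space" .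
  moreover have "scalar (mor ?p \<cdot> x) = coord g x" if "x \<in> carrier (fibre C reg)" for x
  proof -
    have "?p \<diamond> pt reg x = f0' (\<rho> g) \<diamond> prj (Unit C) g \<diamond> pt reg x"
      using g that reg by simp
    from arg_cong[OF this, of mor] show ?thesis
      by (simp add: coord_def del: comp_assoc)
  qed
  ultimately show ?thesis
    using module_hom_cong[OF fibre_space[OF reg(2)]] by (metis (no_types, lifting))
qed

lemma reg_expand:
  assumes x: "x \<in> carrier (fibre C reg)"
  shows "x = finsum (fibre C reg) (\<lambda>g. coord g x \<odot>\<^bsub>fibre C reg\<^esub> gact reg g gen) (carrier G)"
proof -
  let ?I = "Unit C" and ?x = "pt reg x"
  have ok: "ok ?x" using x reg by simp
  have "x = mor (one (S ?I) \<diamond> ?x)"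
    using ok by (simp add: reg)
  also have "\<dots> = finsum (HomSp C ?I (S ?I)) (\<lambda>g. mor ((one (S ?I) \<diamond> inj ?I g) \<diamond> (prj ?I g \<diamond> ?x))) (carrier G)"
    using comp_through_sum[of "one (S ?I)" ?x ?I] ok by (simp add: reg)
  also have "\<dots> = finsum (HomSp C ?I (S ?I)) (\<lambda>g. coord g x \<odot>\<^bsub>HomSp C ?I (S ?I)\<^esub> gact reg g gen) (carrier G)"
  proof (rule finsum_Hom_cong)
    fix g assume g: "g \<in> carrier G"
    obtain c where c: "f0' (\<rho> g) \<diamond> prj ?I g \<diamond> ?x = scl c (one ?I)"
      using End_Unit_scl[of "f0' (\<rho> g) \<diamond> prj ?I g \<diamond> ?x"] ok g reg by auto
    have "(one (S ?I) \<diamond> inj ?I g) \<diamond> (prj ?I g \<diamond> ?x) = (inj ?I g \<diamond> f0 (\<rho> g)) \<diamond> (f0' (\<rho> g) \<diamond> prj ?I g \<diamond> ?x)"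
      using ok g reg by simp
    also have "\<dots> = scl c (pt reg (gact reg g gen))"
      unfolding c pt_gact_gen[OF g] using g by simp
    finally show "mor ((one (S ?I) \<diamond> inj ?I g) \<diamond> (prj ?I g \<diamond> ?x)) = coord g x \<odot>\<^bsub>HomSp C ?I (S ?I)\<^esub> gact reg g gen"
      unfolding coord_def c scalar_scl by (simp add: scl_def reg)
    show "coord g x \<odot>\<^bsub>HomSp C ?I (S ?I)\<^esub> gact reg g gen \<in> Hom C ?I (S ?I)"
      using gact_closed[OF reg(2) g gen(2)] kspace.scale_closed[OF HomSp_kspace[of ?I "S ?I"]]
      by (simp add: fibre_def reg)
  qed simp_all
  finally show ?thesis
    unfolding fibre_def reg .
qed

text \<open>The functional with value \<open>f g\<close> at the basis vector \<open>g e\<close>; in this way the dual of the regular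
  representation is the space of functions on \<open>G\<close>.\<close>

definition functional :: "('g \<Rightarrow> 'k) \<Rightarrow> 'a \<Rightarrow> 'k" where
  "functional f = (\<lambda>x\<in>carrier (fibre C reg). \<Sum>g\<in>carrier G. f g * coord g x)"

lemma functional_dual: "functional f \<in> carrier (fibre_dual C reg)"
proof (rule dual_spaceI)
  interpret V: kspace "fibre C reg" by (rule kspace.intro[OF fibre_space[OF reg(2)]])
  note c = module_homD[OF coord_hom]
  fix x y c assume x: "x \<in> carrier (fibre C reg)"
  show "functional f (c \<odot>\<^bsub>fibre C reg\<^esub> x) = c * functional f x"
    using x by (simp add: functional_def c sum_distrib_left mult.left_commute)
  assume "y \<in> carrier (fibre C reg)"
  then show "functional f (x \<oplus>\<^bsub>fibre C reg\<^esub> y) = functional f x + functional f y"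
    using x by (simp add: functional_def c algebra_simps sum.distrib)
qed (simp add: functional_def)

lemma functional_gen:
  assumes "g \<in> carrier G"
  shows "functional f (gact reg g gen) = f g"
proof -
  have "functional f (gact reg g gen) = (\<Sum>h\<in>carrier G. f h * (if g = h then 1 else 0))"
    using assms gact_closed[OF reg(2) assms gen(2)] by (simp add: functional_def coord_gen)
  also have "\<dots> = f g"
    using finite_group assms by (simp add: if_distrib cong: if_cong)
  finally show ?thesis .
qed

lemma functional_of_values:
  assumes \<phi>: "\<phi> \<in> carrier (fibre_dual C reg)"
  shows "functional (\<lambda>g\<in>carrier G. \<phi> (gact reg g gen)) = \<phi>"
proof (rule extensionalityI[of _ "carrier (fibre C reg)"])
  show "functional (\<lambda>g\<in>carrier G. \<phi> (gact reg g gen)) \<in> extensional (carrier (fibre C reg))"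
    by (simp add: functional_def)
  show "\<phi> \<in> extensional (carrier (fibre C reg))" by (rule dual_spaceD(2)[OF \<phi>])
  interpret V: kspace "fibre C reg" by (rule kspace.intro[OF fibre_space[OF reg(2)]])
  fix x assume x: "x \<in> carrier (fibre C reg)"
  note cl = gact_closed[OF reg(2) _ gen(2)]
  have "\<phi> x = (\<Sum>g\<in>carrier G. \<phi> (coord g x \<odot>\<^bsub>fibre C reg\<^esub> gact reg g gen))"
    using arg_cong[OF reg_expand[OF x], of \<phi>]
      module_hom_finsum[OF dual_spaceD(1)[OF \<phi>] fibre_space[OF reg(2)] ground_space_vectorspace,
        of "carrier G" "\<lambda>g. coord g x \<odot>\<^bsub>fibre C reg\<^esub> gact reg g gen"] cl
    by (simp add: finsum_ground_space)
  then show "functional (\<lambda>g\<in>carrier G. \<phi> (gact reg g gen)) x = \<phi> x"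
    using x by (simp add: functional_def cl dual_spaceD(4)[OF \<phi>] mult.commute)
qed

lemma reg_Ker: "reg \<in> Obj Ker"
  using reg trivial_T_Unit by (simp add: Ker_Obj T_fields)

lemma mcoeff_reg:
  assumes "f \<in> carrier (function_hopf G)"
  shows "mcoeff reg (fibre_tens C reg gen (functional f)) = f"
  unfolding mcoeff(2)[OF reg(2) gen(2) functional_dual]
  using assms by (auto simp: functional_gen fun_eq_iff PiE_iff extensional_def)

text \<open>The free module on \<open>1\<close> represents \<open>\<omega>\<close>: the arrow \<open>x : 1 \<rightarrow> M\<close> extends to the module map
  \<open>T 1 \<rightarrow> T M \<rightarrow> M\<close>.\<close>

lemma regular_map:
  assumes X: "X \<in> Obj TMod" and x: "x \<in> carrier (fibre C X)"
  shows "\<exists>a\<in>Hom TMod reg X. a \<cdot> gen = x"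
proof -
  let ?a = "str X \<diamond> tT (pt X x)" and ?I = "Unit C"
  have M: "fst X \<in> Obj C" "ok (str X)" "ok (pt X x)" using X x by simp_all
  have assoc: "str X \<diamond> tT (str X) = str X \<diamond> tmu (fst X)"
    using X by (simp add: Mod_Obj_iff)
  have "?a \<diamond> tmu ?I = str X \<diamond> tmu (fst X) \<diamond> tT (tT (pt X x))"
    using M tmu_natural[OF M(3)] by simp
  also have "\<dots> = (str X \<diamond> tmu (fst X)) \<diamond> tT (tT (pt X x))"
    using M by simp
  also have "\<dots> = str X \<diamond> tT ?a"
    unfolding assoc[symmetric] using X M by (simp add: tT_comp)
  finally have "mor (?a \<diamond> tmu ?I) = mor (str X \<diamond> tT ?a)" by (rule arg_cong)
  then have module_map: "mor ?a \<in> Hom TMod reg X"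
    using okD(3)[of ?a] M by (simp add: Mod_Hom reg_def mor_monad del: comp_assoc)
  have unit: "str X \<diamond> teta (fst X) = one (fst X)"
    using X by (simp add: Mod_Obj_iff)
  have "?a \<diamond> teta ?I = (str X \<diamond> teta (fst X)) \<diamond> pt X x"
    using M teta_natural[OF M(3)] by simp
  also have "\<dots> = pt X x"
    unfolding unit using M by simp
  finally have "mor (?a \<diamond> teta ?I) = mor (pt X x)" by (rule arg_cong)
  moreover have "mor (teta ?I) = gen"
    by (simp add: gen_def teta_def)
  ultimately have "mor ?a \<cdot> gen = x"
    by (simp del: comp_assoc)
  with module_map show ?thesis by blast
qed

text \<open>A dinatural family \<open>i\<close> factors through the functions on \<open>G\<close> by \<open>h f = i (e \<otimes> \<phi>)\<close>, with \<open>\<phi>\<close> the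
  functional of \<open>f\<close>, and this is forced because \<open>f\<close> is the matrix coefficient of \<open>e \<otimes> \<phi>\<close>. It is a
  factorisation because dinaturality along the module map \<open>a : T 1 \<rightarrow> X\<close> with \<open>a e = x\<close> rewrites
  \<open>x \<otimes> \<phi>\<close> to \<open>e \<otimes> \<phi> a\<close>, and the functional \<open>\<phi> a\<close> takes \<open>g e\<close> to \<open>\<phi> (g x)\<close>.\<close>

lemma coend: "is_coend TYPE('d) C T (function_hopf G :: ('k, 'g \<Rightarrow> 'k) hopf) mcoeff"
  unfolding is_coend_def
proof (intro conjI allI impI)
  let ?L = "function_hopf G :: ('k, 'g \<Rightarrow> 'k) hopf"
  interpret L: kspace ?L by (rule kspace.intro[OF function_hopf_vectorspace])
  show "vectorspace class_ring ?L" by (rule function_hopf_vectorspace)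
  show "coend_wedge C T ?L mcoeff" by (rule mcoeff_wedge)
  fix D :: "('k, 'd) module" and i
  assume D: "vectorspace class_ring D" and i: "coend_wedge C T D i"
  let ?V = "fibre C reg" and ?W = "fibre_dual C reg"
  note VW = fibre_space[OF reg(2)] fibre_dual_space[OF reg(2)]
  have i1: "i X \<in> module_hom class_ring (tensor_space (fibre C X) (fibre_dual C X)) D" if "X \<in> Obj Ker" for X
    using i that unfolding coend_wedge_def by blast
  have i2: "i Y (fibre_tens C Y (f \<cdot> x) \<psi>) = i X (fibre_tens C X x (\<lambda>x'\<in>carrier (fibre C X). \<psi> (f \<cdot> x')))"
    if "X \<in> Obj Ker" "Y \<in> Obj Ker" "f \<in> Hom TMod X Y" "x \<in> carrier (fibre C X)" "\<psi> \<in> carrier (fibre_dual C Y)"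
    for X Y f x \<psi>
    using i that unfolding coend_wedge_def by simp
  let ?h = "\<lambda>f\<in>carrier ?L. i reg (fibre_tens C reg gen (functional f))"
  have "functional \<in> module_hom class_ring ?L ?W"
  proof (rule module_homI)
    show "functional (f \<oplus>\<^bsub>?L\<^esub> f') = functional f \<oplus>\<^bsub>?W\<^esub> functional f'" for f f'
      by (auto simp: functional_def dual_space_def restrict_def fun_eq_iff algebra_simps sum.distrib)
    show "functional (c \<odot>\<^bsub>?L\<^esub> f) = c \<odot>\<^bsub>?W\<^esub> functional f" for c f
      by (auto simp: functional_def dual_space_def restrict_def fun_eq_iff algebra_simps sum_distrib_left)
  qed (rule functional_dual)
  note lin = module_hom_comp[OF module_hom_comp[OF this bilinearD(1)[OF tens_bilinear[OF VW] gen(2)]] i1[OF reg_Ker]]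
  have h_hom: "?h \<in> module_hom class_ring ?L D"
    by (rule module_hom_cong[OF function_hopf_vectorspace, THEN iffD1, OF _ lin]) simp
  then have h: "?h \<in> lin_maps ?L D"
    by (simp add: lin_maps_def)
  have wedge_h: "?h (mcoeff X t) = i X t"
    if X: "X \<in> Obj Ker" and t: "t \<in> carrier (tensor_space (fibre C X) (fibre_dual C X))" for X t
  proof -
    have X': "X \<in> Obj TMod" "ok (str X)" using X by (simp_all add: Ker_Obj)
    note sp = fibre_space[OF X'(2)] fibre_dual_space[OF X'(2)]
    have "?h (mcoeff X (fibre_tens C X x \<phi>)) = i X (fibre_tens C X x \<phi>)"
      if x: "x \<in> carrier (fibre C X)" and \<phi>: "\<phi> \<in> carrier (fibre_dual C X)" for x \<phi>
    proof -
      obtain a where a: "a \<in> Hom TMod reg X" "a \<cdot> gen = x" using regular_map[OF X'(1) x] by blast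
      let ?\<psi> = "\<lambda>x'\<in>carrier ?V. \<phi> (a \<cdot> x')"
      have \<psi>: "?\<psi> \<in> carrier ?W" by (rule pullback_dual[OF reg(1) X'(1) a(1) \<phi>])
      have "mcoeff X (fibre_tens C X x \<phi>) = (\<lambda>g\<in>carrier G. ?\<psi> (gact reg g gen))"
        unfolding mcoeff(2)[OF X'(2) x \<phi>]
        using gact_map(2)[OF reg(1) X'(1) a(1) _ gen(2)] gact_closed[OF reg(2) _ gen(2)] a(2)
        by (auto simp: restrict_def fun_eq_iff)
      then have "functional (mcoeff X (fibre_tens C X x \<phi>)) = ?\<psi>"
        using functional_of_values[OF \<psi>] by simp
      moreover have "mcoeff X (fibre_tens C X x \<phi>) \<in> carrier ?L"
        unfolding mcoeff(2)[OF X'(2) x \<phi>] by simp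
      ultimately show ?thesis
        using i2[OF reg_Ker X a(1) gen(2) \<phi>] a(2) by simp
    qed
    note generators = this
    show ?thesis
      by (rule tensor_hom_eq[OF sp D module_hom_comp[OF mcoeff(1)[OF X'(2)] h_hom] i1[OF X] _ t])
         (rule generators)
  qed
  show "\<exists>!h. h \<in> lin_maps ?L D \<and>
      (\<forall>X\<in>Obj Ker. \<forall>t\<in>carrier (tensor_space (fibre C X) (fibre_dual C X)). h (mcoeff X t) = i X t)"
  proof (rule ex1I[of _ ?h])
    show "?h \<in> lin_maps ?L D \<and>
      (\<forall>X\<in>Obj Ker. \<forall>t\<in>carrier (tensor_space (fibre C X) (fibre_dual C X)). ?h (mcoeff X t) = i X t)"
      using h wedge_h by blast
    fix h' assume h': "h' \<in> lin_maps ?L D \<and>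
      (\<forall>X\<in>Obj Ker. \<forall>t\<in>carrier (tensor_space (fibre C X) (fibre_dual C X)). h' (mcoeff X t) = i X t)"
    show "h' = ?h"
    proof (rule extensionalityI[of _ "carrier ?L"])
      show "h' \<in> extensional (carrier ?L)" using h' by (simp add: lin_maps_def)
      show "?h \<in> extensional (carrier ?L)" by simp
      fix f assume f: "f \<in> carrier ?L"
      have "h' f = h' (mcoeff reg (fibre_tens C reg gen (functional f)))"
        unfolding mcoeff_reg[OF f] ..
      also have "\<dots> = i reg (fibre_tens C reg gen (functional f))"
        using h' reg_Ker tens_closed[OF VW gen(2) functional_dual] by blast
      finally show "h' f = ?h f" using f by simp
    qed
  qed
qed

text \<open>Evaluated at group elements, the formulas for comultiplication, counit, product and unit are the
  identities \<open>(g h) x = g (h x)\<close>, \<open>1 x = x\<close>, \<open>g (x \<otimes> y) = g x \<otimes> g y\<close> and \<open>g 1 = 1\<close>.\<close>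

lemma induced_hopf_algebra:
  "induced_hopf_algebra TYPE('d) C T (function_hopf G :: ('k, 'g \<Rightarrow> 'k) hopf) mcoeff"
  unfolding induced_hopf_algebra_def
proof (intro conjI)
  let ?L = "function_hopf G :: ('k, 'g \<Rightarrow> 'k) hopf"
  interpret H: function_hopf_algebra G ?L
    by unfold_locales (simp_all add: finite_group)
  interpret LL: kspace "tensor_space ?L ?L" by (rule kspace.intro[OF H.LL_space])
  show "hopf_algebra ?L" by (rule H.hopf_algebra_L)
  show "is_coend TYPE('d) C T ?L mcoeff" by (rule coend)
  have mL: "mcoeff X (fibre_tens C X x \<phi>) \<in> carrier ?L"
    if "ok (str X)" "x \<in> carrier (fibre C X)" "\<phi> \<in> carrier (fibre_dual C X)" for X x \<phi>
    using mcoeff(2)[OF that] by simp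
  show "\<forall>X\<in>Obj Ker. \<forall>(n::nat) e e'.
        (\<forall>i<n. e i \<in> carrier (fibre C X) \<and> e' i \<in> carrier (fibre_dual C X)) \<and>
        (\<forall>x\<in>carrier (fibre C X).
           finsum (fibre C X) (\<lambda>i. e' i x \<odot>\<^bsub>fibre C X\<^esub> e i) {..<n} = x) \<longrightarrow>
        (\<forall>x\<in>carrier (fibre C X). \<forall>\<phi>\<in>carrier (fibre_dual C X).
           comult ?L (mcoeff X (fibre_tens C X x \<phi>)) =
           finsum (tensor_space ?L ?L)
             (\<lambda>i. tens ?L ?L (mcoeff X (fibre_tens C X (e i) \<phi>)) (mcoeff X (fibre_tens C X x (e' i)))) {..<n})"
  proof (intro ballI allI impI, elim conjE)
    fix X n e e' x \<phi>
    assume X: "X \<in> Obj Ker" and e: "\<forall>i<(n::nat). e i \<in> carrier (fibre C X) \<and> e' i \<in> carrier (fibre_dual C X)"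
      and sum: "\<forall>x\<in>carrier (fibre C X). finsum (fibre C X) (\<lambda>i. e' i x \<odot>\<^bsub>fibre C X\<^esub> e i) {..<n} = x"
      and x: "x \<in> carrier (fibre C X)" and \<phi>: "\<phi> \<in> carrier (fibre_dual C X)"
    have X': "X \<in> Obj TMod" "ok (str X)" using X by (simp_all add: Ker_Obj)
    interpret V: kspace "fibre C X" by (rule kspace.intro[OF fibre_space[OF X'(2)]])
    let ?t = "\<lambda>i. tens ?L ?L (mcoeff X (fibre_tens C X (e i) \<phi>)) (mcoeff X (fibre_tens C X x (e' i)))"
    have t: "?t i \<in> carrier (tensor_space ?L ?L)" if "i < n" for i
      using that e x \<phi> X' by (intro tens_closed[OF H.L_space H.L_space] mL) simp_all
    show "comult ?L (mcoeff X (fibre_tens C X x \<phi>)) = finsum (tensor_space ?L ?L) ?t {..<n}"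
    proof (rule H.ev2_eqI[OF H.comult_carrier])
      show "finsum (tensor_space ?L ?L) ?t {..<n} \<in> carrier (tensor_space ?L ?L)"
        using t by (intro LL.finsum_closed) auto
      fix g h assume g: "g \<in> carrier G" and h: "h \<in> carrier G"
      let ?y = "gact X h x"
      have y: "?y \<in> carrier (fibre C X)" by (rule gact_closed[OF X'(2) h x])
      have "(\<lambda>x. \<phi> (gact X g x)) \<in> module_hom class_ring (fibre C X) ground_space"
        by (rule module_hom_comp[OF gact_hom[OF X'(2) g] dual_spaceD(1)[OF \<phi>]])
      note m = module_hom_finsum[OF this V.vectorspace ground_space_vectorspace,
          of "{..<n}" "\<lambda>i. e' i ?y \<odot>\<^bsub>fibre C X\<^esub> e i"] module_homD[OF this]
      have "H.ev2 g h (comult ?L (mcoeff X (fibre_tens C X x \<phi>))) = \<phi> (gact X g ?y)"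
        using g h x \<phi> X' by (simp add: H.ev2_comult mcoeff(2) gact_mult)
      also have "\<dots> = \<phi> (gact X g (finsum (fibre C X) (\<lambda>i. e' i ?y \<odot>\<^bsub>fibre C X\<^esub> e i) {..<n}))"
        using sum y by simp
      also have "\<dots> = (\<Sum>i<n. e' i ?y * \<phi> (gact X g (e i)))"
        using m(1) e by (simp add: finsum_ground_space m(4))
      also have "\<dots> = (\<Sum>i<n. H.ev2 g h (?t i))"
      proof (rule sum.cong[OF refl])
        fix i assume "i \<in> {..<n}"
        then have "e i \<in> carrier (fibre C X)" "e' i \<in> carrier (fibre_dual C X)" using e by simp_all
        note ei = mL[OF X'(2) this(1) \<phi>] mL[OF X'(2) x this(2)] mcoeff(2)[OF X'(2) this(1) \<phi>] mcoeff(2)[OF X'(2) x this(2)]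
        show "e' i ?y * \<phi> (gact X g (e i)) = H.ev2 g h (?t i)"
          unfolding H.ev2_tens[OF g h ei(1,2)] unfolding ei(3,4) using g h by simp
      qed
      also have "\<dots> = H.ev2 g h (finsum (tensor_space ?L ?L) ?t {..<n})"
        using module_hom_finsum[OF H.ev2_hom[OF g h] H.LL_space ground_space_vectorspace, of "{..<n}" ?t] t
        by (simp add: finsum_ground_space)
      finally show "H.ev2 g h (comult ?L (mcoeff X (fibre_tens C X x \<phi>))) = H.ev2 g h (finsum (tensor_space ?L ?L) ?t {..<n})" .
    qed
  qed
  show "\<forall>X\<in>Obj Ker. \<forall>x\<in>carrier (fibre C X). \<forall>\<phi>\<in>carrier (fibre_dual C X).
        counit ?L (mcoeff X (fibre_tens C X x \<phi>)) = \<phi> x"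
    by (simp add: Ker_Obj mcoeff(2) gact_one)
  show "\<forall>X\<in>Obj Ker. \<forall>Y\<in>Obj Ker.
      \<forall>x\<in>carrier (fibre C X). \<forall>\<phi>\<in>carrier (fibre_dual C X).
      \<forall>y\<in>carrier (fibre C Y). \<forall>\<psi>\<in>carrier (fibre_dual C Y).
      \<forall>\<chi>\<in>carrier (fibre_dual C (TensO Ker X Y)).
        let \<omega>2 = (\<lambda>x' y'. (x' \<star> y') \<cdot> inv_arr C (Unit C \<boxtimes> Unit C) (Unit C) (LUnit C (Unit C))) in
        (\<forall>x'\<in>carrier (fibre C X). \<forall>y'\<in>carrier (fibre C Y). \<chi> (\<omega>2 x' y') = \<phi> x' * \<psi> y') \<longrightarrow>
        mcoeff X (fibre_tens C X x \<phi>) \<otimes>\<^bsub>?L\<^esub> mcoeff Y (fibre_tens C Y y \<psi>) =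
        mcoeff (TensO Ker X Y) (fibre_tens C (TensO Ker X Y) (\<omega>2 x y) \<chi>)"
    unfolding Let_def Ker_simps
  proof (intro ballI impI)
    fix X Y x \<phi> y \<psi> \<chi>
    assume X: "X \<in> Obj Ker" and Y: "Y \<in> Obj Ker"
      and x: "x \<in> carrier (fibre C X)" and \<phi>: "\<phi> \<in> carrier (fibre_dual C X)"
      and y: "y \<in> carrier (fibre C Y)" and \<psi>: "\<psi> \<in> carrier (fibre_dual C Y)"
      and \<chi>: "\<chi> \<in> carrier (fibre_dual C (TensO TMod X Y))"
      and eq: "\<forall>x'\<in>carrier (fibre C X). \<forall>y'\<in>carrier (fibre C Y).
        \<chi> ((x' \<star> y') \<cdot> inv_arr C (Unit C \<boxtimes> Unit C) (Unit C) (LUnit C (Unit C))) = \<phi> x' * \<psi> y'"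
    have lu': "inv_arr C (Unit C \<boxtimes> Unit C) (Unit C) (LUnit C (Unit C)) = mor (lu' (Unit C))"
      by (simp add: lu'_def)
    have ok: "ok (str X)" "ok (str Y)" using X Y by (simp_all add: Ker_Obj)
    note t = gact_tensor[OF ok _ x y]
    show "mcoeff X (fibre_tens C X x \<phi>) \<otimes>\<^bsub>?L\<^esub> mcoeff Y (fibre_tens C Y y \<psi>) =
        mcoeff (TensO TMod X Y) (fibre_tens C (TensO TMod X Y)
          ((x \<star> y) \<cdot> inv_arr C (Unit C \<boxtimes> Unit C) (Unit C) (LUnit C (Unit C))) \<chi>)"
      unfolding lu' mcoeff(2)[OF ok(1) x \<phi>] mcoeff(2)[OF ok(2) y \<psi>]
        mcoeff(2)[OF str_ten(1)[OF ok] t(1)[OF one_closed] \<chi>]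
    proof (rule extensionalityI[of _ "carrier G"])
      fix g assume g: "g \<in> carrier G"
      have "\<chi> ((gact X g x \<star> gact Y g y) \<cdot> mor (lu' (Unit C))) = \<phi> (gact X g x) * \<psi> (gact Y g y)"
        using eq gact_closed[OF ok(1) g x] gact_closed[OF ok(2) g y] by (simp add: lu')
      then show "((\<lambda>g\<in>carrier G. \<phi> (gact X g x)) \<otimes>\<^bsub>?L\<^esub> (\<lambda>g\<in>carrier G. \<psi> (gact Y g y))) g =
          (\<lambda>g\<in>carrier G. \<chi> (gact (TensO TMod X Y) g ((x \<star> y) \<cdot> mor (lu' (Unit C))))) g"
        using g by (simp add: t(2) del: Mod_simps(4))
    qed simp_all
  qed
  show "\<forall>\<phi>\<in>carrier (fibre_dual C (Unit Ker)). \<phi> (Idn C (Unit C)) = 1 \<longrightarrow>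
      mcoeff (Unit Ker) (fibre_tens C (Unit Ker) (Idn C (Unit C)) \<phi>) = \<one>\<^bsub>?L\<^esub>"
    unfolding Ker_simps
  proof (intro ballI impI)
    fix \<phi> assume \<phi>: "\<phi> \<in> carrier (fibre_dual C (Unit TMod))" and one: "\<phi> (Idn C (Unit C)) = 1"
    show "mcoeff (Unit TMod) (fibre_tens C (Unit TMod) (Idn C (Unit C)) \<phi>) = \<one>\<^bsub>?L\<^esub>"
      unfolding mcoeff(2)[OF str_Unit(1) gact_Unit(1)[OF one_closed] \<phi>]
      by (auto simp: gact_Unit(2) one restrict_def fun_eq_iff simp del: Mod_simps(5))
  qed
qed

end

theorem theorem4p21:
  fixes C :: "('k::field, 'o, 'a) moncat"
    and G :: "('g, 'm) monoid_scheme"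
    and \<rho> :: "'g \<Rightarrow> ('o, 'a, 'o, 'a) monfunc"
    and \<rho>2 :: "'g \<Rightarrow> 'g \<Rightarrow> 'o \<Rightarrow> 'a"
    and \<rho>0 :: "'o \<Rightarrow> 'a"
    and S :: "'o \<Rightarrow> 'o"
    and \<iota> \<pi> :: "'o \<Rightarrow> 'g \<Rightarrow> 'a"
    and T :: "('o, 'a) bimonad"
  assumes "tensor_category C"
    and "group G" and "finite (carrier G)"
    and "tensor_action C G \<rho> \<rho>2 \<rho>0"
    and direct_sums: "\<And>X. X \<in> Obj C \<Longrightarrow>
      biproduct C (carrier G) (\<lambda>g. FO (\<rho> g) X) (S X) (\<iota> X) (\<pi> X)"
    and T_def: "T = action_monad C G \<rho> \<rho>2 \<rho>0 S \<iota> \<pi>"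
  shows
    "(linear_functor C C T \<and> exact_functor C C T \<and> hopf_monad C T)
   \<and> (category_isomorphism (equivariantization C G \<rho> \<rho>2 \<rho>0) (module_category C T)
        (comparison C G S \<pi>)
      \<and> func_comp forgetful (comparison C G S \<pi>) = forgetful)
   \<and> (faithful_functor C T \<and> normal_hopf_monad C T \<and> cocommutative_hopf_monad C T)
   \<and> (induced_hopf_algebra TYPE('d) C T (function_hopf G) (matrix_coefficients C G \<rho> \<iota>)
      \<and> (semisimple_monad C T \<longleftrightarrow> \<not> CHAR('k) dvd Coset.order G))"
proof -
  interpret action_sums C G \<rho> \<rho>2 \<rho>0 S \<iota> \<pi> T
    by (intro action_sums.intro action_sums_axioms.intro assms)
  show ?thesis
    by (intro conjI linear_T exact_T hopf_T Comp_iso Comp_forgetful faithful_T normal_T cocommutative_T_monad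
      induced_hopf_algebra semisimple_iff)
qed

end
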